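(* Let $M$ be a smooth manifold. The mapping $d_T:\Phi(\tau_M)\to\Phi(\tau_{TM})$ is a $v_T$-derivation of degree $0$, and $d_T(Y)=Y^c$ for every vector field $Y$ on $M$.
   Context: Everything is smooth. $\tau_M:TM\to M$, $\pi_M:T^*M\to M$ are the projections; $\Phi^r(\tau_M)$ is the space of $r$-vector fields on $M$ and $\Phi(\tau_M)=\bigoplus_r\Phi^r(\tau_M)$ is the graded exterior algebra of multivector fields ($\Phi^0$ = functions). Derivations: if $\rho:\Phi\to\Psi$ is a homomorphism of commutative graded algebras, a linear map $a:\Phi\to\Psi$ is a $\rho$-derivation of degree $s$ if $a(\Phi^q)\subset\Psi^{q+s}$ and $a(\mu\wedge\nu)=a(\mu)\wedge\rho(\nu)+(-1)^{qs}\rho(\mu)\wedge a(\nu)$ for $\mu\in\Phi^q$. Lifts of vector fields: for a vector field $Y=Y^i\partial/\partial x^i$ on $M$, the vertical lift $Y^v=Y^i(x)\,\partial/\partial\dot x^i$ is the generator of the flow $v\mapsto v+tY(\tau_M(v))$ on $TM$, and the complete lift $Y^c=Y^i(x)\,\partial/\partial x^i+\frac{\partial Y^i}{\partial x^k}(x)\dot x^k\,\partial/\partial\dot x^i$ is the generator of the (local) flow $T\varphi^t$, where $\varphi^t$ is the flow of $Y$. $v_T:\Phi(\tau_M)\to\Phi(\tau_{TM})$ is the unique homomorphism of graded algebras with $v_T(f)=f\circ\tau_M$ for functions and $v_T(Y)=Y^v$ for vector fields. The map $\varepsilon_M$: let $\kappa_M:TTM\to TTM$ be the canonical flip, $(x,\dot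 x,\delta x,\delta\dot x)\mapsto(x,\delta x,\dot x,\delta\dot x)$, and let $\langle\cdot,\cdot\rangle':TTM\times_{TM}TT^*M\to\mathbb R$ be the tangent map of the pairing $TM\times_MT^*M\to\mathbb R$ followed by projection onto the derivative component of $T\mathbb R$. $\alpha_M:TT^*M\to T^*TM$ is the isomorphism of vector bundles over $TM$ given by $\langle v,\alpha_M(w)\rangle=\langle\kappa_M(v),w\rangle'$, and $\varepsilon_M=\alpha_M^{-1}:T^*TM\to TT^*M$. In coordinates, $\alpha_M(x,p,\dot x,\dot p)=(x,\dot x,\pi=\dot p,\dot\pi=p)$, with $\pi,\dot\pi$ conjugate to $x,\dot x$. Tangent lift of multivector fields: for $f\in\Phi^0(\tau_M)$, $d_Tf$ is the function $v\mapsto\langle df,v\rangle$ on $TM$. For $X\in\Phi^r(\tau_M)$, $r\ge1$, let $\widetilde X^{\,r}:\bigwedge^rT^*M\to\mathbb R$ be the function $a\mapsto\langle X,a\rangle$. Then $d_TX\in\Phi^r(\tau_{TM})$ is the $r$-vector field defined by $$(d_TX)(a_1\wedge\dots\wedge a_r)=\big\langle d\widetilde X^{\,r},\ T\textstyle\bigwedge^r(\varepsilon_M(a_1),\dots,\varepsilon_M(a_r))\big\rangle$$ for $a_1,\dots,a_r$ in a common fibre of $T^*TM\to TM$, where $T\bigwedge^r$ is the tangent map of the wedge map $T^*M\times_M\cdots\times_MT^*M\to\bigwedge^rT^*M$. *)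

theory Defs
  imports "HOL-Analysis.Analysis"
begin

section \<open>Smooth functions on coordinate spaces\<close>

text \<open>
  The model spaces are \<open>\<real>\<^sup>I\<close> for a finite set \<open>I\<close> of coordinate labels, realised as the functions
  supported on \<open>I\<close>; for \<open>I = {..<n}\<close> this is the topological space \<^const>\<open>Euclidean_space\<close> \<open>n\<close> of
  the library.  Labels are kept abstract so that the coordinates of \<open>TM\<close>, \<open>TTM\<close>, \<open>T\<^sup>*M\<close> and the
  exterior powers of \<open>T\<^sup>*M\<close> can be labelled by sums and by sets of coordinate labels of \<open>M\<close>.
\<close>

definition coord_space :: "'i set \<Rightarrow> ('i \<Rightarrow> real) set" where
  "coord_space I = {u. \<forall>i. i \<notin> I \<longrightarrow> u i = 0}"

definition coord_open :: "'i set \<Rightarrow> ('i \<Rightarrow> real) set \<Rightarrow> bool" where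
  "coord_open I A \<longleftrightarrow> openin (top_of_set (coord_space I)) A"

definition pderiv_at :: "'i \<Rightarrow> (('i \<Rightarrow> real) \<Rightarrow> real) \<Rightarrow> ('i \<Rightarrow> real) \<Rightarrow> real" where
  "pderiv_at i f u = deriv (\<lambda>t. f (u(i := t))) (u i)"

primrec Ck_on :: "nat \<Rightarrow> 'i set \<Rightarrow> ('i \<Rightarrow> real) set \<Rightarrow> (('i \<Rightarrow> real) \<Rightarrow> real) \<Rightarrow> bool" where
  "Ck_on 0 I A f \<longleftrightarrow> continuous_on A f"
| "Ck_on (Suc k) I A f \<longleftrightarrow> continuous_on A f \<and>
     (\<forall>i\<in>I. (\<forall>u\<in>A. (\<lambda>t. f (u(i := t))) differentiable (at (u i))) \<and> Ck_on k I A (pderiv_at i f))"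

definition smooth_on :: "'i set \<Rightarrow> ('i \<Rightarrow> real) set \<Rightarrow> (('i \<Rightarrow> real) \<Rightarrow> real) \<Rightarrow> bool" where
  "smooth_on I A f \<longleftrightarrow> (\<forall>k. Ck_on k I A f)"

definition smooth_real_on :: "real set \<Rightarrow> (real \<Rightarrow> real) \<Rightarrow> bool" where
  "smooth_real_on S f \<longleftrightarrow> (\<forall>k. \<forall>t\<in>S. ((deriv ^^ k) f) differentiable (at t))"


section \<open>Smooth manifolds\<close>

text \<open>
  A chart is a pair of its domain \<open>U\<close> and its coordinate map; \<open>x p i\<close> is the value at \<open>p\<close> of
  the \<open>i\<close>-th coordinate function.  The coordinate map is only meaningful on \<open>U\<close>.
\<close>

type_synonym ('m, 'i) chart = "'m set \<times> ('m \<Rightarrow> 'i \<Rightarrow> real)"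

record ('m, 'i) manifold =
  pts :: "'m set"
  idx :: "'i set"
  atlas :: "('m, 'i) chart set"

definition chart_inv :: "('m, 'i) chart \<Rightarrow> ('i \<Rightarrow> real) \<Rightarrow> 'm" where
  "chart_inv c = inv_into (fst c) (snd c)"

definition charts_at :: "('m, 'i) manifold \<Rightarrow> 'm \<Rightarrow> ('m, 'i) chart set" where
  "charts_at M p = {c \<in> atlas M. p \<in> fst c}"

definition mtopology :: "('m, 'i) manifold \<Rightarrow> 'm topology" where
  "mtopology M = topology (\<lambda>W. W \<subseteq> pts M \<and>
     (\<forall>c\<in>atlas M. coord_open (idx M) (snd c ` (fst c \<inter> W))))"

definition smooth_manifold :: "('m, 'i) manifold \<Rightarrow> bool" where
  "smooth_manifold M \<longleftrightarrow>
     finite (idx M) \<and>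
     (\<Union>c\<in>atlas M. fst c) = pts M \<and>
     (\<forall>c\<in>atlas M. inj_on (snd c) (fst c) \<and> coord_open (idx M) (snd c ` fst c)) \<and>
     (\<forall>c\<in>atlas M. \<forall>d\<in>atlas M.
        coord_open (idx M) (snd c ` (fst c \<inter> fst d)) \<and>
        (\<forall>i\<in>idx M. smooth_on (idx M) (snd c ` (fst c \<inter> fst d)) (\<lambda>u. snd d (chart_inv c u) i))) \<and>
     Hausdorff_space (mtopology M) \<and> second_countable (mtopology M)"

definition smooth_fun_on :: "('m, 'i) manifold \<Rightarrow> 'm set \<Rightarrow> ('m \<Rightarrow> real) \<Rightarrow> bool" where
  "smooth_fun_on M W f \<longleftrightarrow> openin (mtopology M) W \<and>
     (\<forall>c\<in>atlas M. smooth_on (idx M) (snd c ` (fst c \<inter> W)) (\<lambda>u. f (chart_inv c u)))"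

definition smooth_at :: "('m, 'i) manifold \<Rightarrow> 'm \<Rightarrow> ('m \<Rightarrow> real) \<Rightarrow> bool" where
  "smooth_at M p f \<longleftrightarrow> (\<exists>W. p \<in> W \<and> smooth_fun_on M W f)"

text \<open>
  Curves are parametrised near \<open>0\<close>, which is all that matters for their velocity at \<open>0\<close>; a small
  enough piece of a curve lies in a single chart.
\<close>

definition smooth_curve :: "('m, 'i) manifold \<Rightarrow> (real \<Rightarrow> 'm) \<Rightarrow> bool" where
  "smooth_curve M \<gamma> \<longleftrightarrow> (\<exists>c\<in>atlas M. \<exists>e>0. \<gamma> ` {-e<..<e} \<subseteq> fst c \<and>
     (\<forall>i\<in>idx M. smooth_real_on {-e<..<e} (\<lambda>t. snd c (\<gamma> t) i)))"


section \<open>Tangent and cotangent bundles\<close>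

text \<open>
  A tangent vector at \<open>p\<close> is the velocity of a smooth curve through \<open>p\<close>.  The class of a curve
  (curves being equivalent if they are tangent at \<open>p\<close>) is represented by the directional derivative
  on the functions that are smooth near \<open>p\<close>, extended by \<open>0\<close> to all other functions.  In
  this way the vector space operations of \<open>T\<^sub>pM\<close> are the pointwise ones.
\<close>

type_synonym 'm tvec = "('m \<Rightarrow> real) \<Rightarrow> real"
type_synonym 'm covec = "'m tvec \<Rightarrow> real"

definition velocity :: "('m, 'i) manifold \<Rightarrow> (real \<Rightarrow> 'm) \<Rightarrow> 'm \<times> 'm tvec" where
  "velocity M \<gamma> =
     (\<gamma> 0, \<lambda>f. if smooth_at M (\<gamma> 0) f then deriv (\<lambda>t. f (\<gamma> t)) 0 else 0)"

definition tangent_space :: "('m, 'i) manifold \<Rightarrow> 'm \<Rightarrow> 'm tvec set" where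
  "tangent_space M p = {snd (velocity M \<gamma>) |\<gamma>. smooth_curve M \<gamma> \<and> \<gamma> 0 = p}"

definition cotangent_space :: "('m, 'i) manifold \<Rightarrow> 'm \<Rightarrow> 'm covec set" where
  "cotangent_space M p = {a.
     (\<forall>v\<in>tangent_space M p. \<forall>w\<in>tangent_space M p. \<forall>c d.
        a (\<lambda>f. c * v f + d * w f) = c * a v + d * a w) \<and>
     (\<forall>v. v \<notin> tangent_space M p \<longrightarrow> a v = 0)}"

text \<open>The coordinate vector \<open>\<partial>/\<partial>x\<^sup>i\<close> at \<open>p\<close> is the velocity of the \<open>i\<close>-th coordinate line.\<close>

definition coord_vec :: "('m, 'i) manifold \<Rightarrow> ('m, 'i) chart \<Rightarrow> 'm \<Rightarrow> 'i \<Rightarrow> 'm tvec" where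
  "coord_vec M c p i = snd (velocity M (\<lambda>t. chart_inv c ((snd c p)(i := snd c p i + t))))"

definition differential :: "('m, 'i) manifold \<Rightarrow> ('m \<Rightarrow> real) \<Rightarrow> 'm \<Rightarrow> 'm covec" where
  "differential M f p = (\<lambda>v. if v \<in> tangent_space M p then v f else 0)"

definition coord_covec :: "('m, 'i) manifold \<Rightarrow> ('m, 'i) chart \<Rightarrow> 'm \<Rightarrow> 'i \<Rightarrow> 'm covec" where
  "coord_covec M c p i = differential M (\<lambda>q. snd c q i) p"

text \<open>
  Natural charts: \<open>Inl i\<close> labels the base coordinate \<open>x\<^sup>i\<close> and \<open>Inr i\<close> the fibre coordinate, that is
  the component \<open>v x\<^sup>i\<close> of a tangent vector, respectively \<open>a (\<partial>/\<partial>x\<^sup>i)\<close> of a covector.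
\<close>

definition tangent_chart :: "('m, 'i) manifold \<Rightarrow> ('m, 'i) chart \<Rightarrow> ('m \<times> 'm tvec, 'i + 'i) chart" where
  "tangent_chart M c =
     (Sigma (fst c) (tangent_space M),
      \<lambda>(p, v). case_sum (snd c p) (\<lambda>i. if i \<in> idx M then v (\<lambda>q. snd c q i) else 0))"

definition tangent_bundle :: "('m, 'i) manifold \<Rightarrow> ('m \<times> 'm tvec, 'i + 'i) manifold" where
  "tangent_bundle M =
     \<lparr>pts = Sigma (pts M) (tangent_space M), idx = idx M <+> idx M, atlas = tangent_chart M ` atlas M\<rparr>"

definition cotangent_chart :: "('m, 'i) manifold \<Rightarrow> ('m, 'i) chart \<Rightarrow> ('m \<times> 'm covec, 'i + 'i) chart" where
  "cotangent_chart M c =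
     (Sigma (fst c) (cotangent_space M),
      \<lambda>(p, a). case_sum (snd c p) (\<lambda>i. if i \<in> idx M then a (coord_vec M c p i) else 0))"

definition cotangent_bundle :: "('m, 'i) manifold \<Rightarrow> ('m \<times> 'm covec, 'i + 'i) manifold" where
  "cotangent_bundle M =
     \<lparr>pts = Sigma (pts M) (cotangent_space M), idx = idx M <+> idx M, atlas = cotangent_chart M ` atlas M\<rparr>"

definition tangent_map ::
  "('m, 'i) manifold \<Rightarrow> ('n, 'j) manifold \<Rightarrow> ('m \<Rightarrow> 'n) \<Rightarrow> 'm \<times> 'm tvec \<Rightarrow> 'n \<times> 'n tvec" where
  "tangent_map M N F w =
     (F (fst w), \<lambda>g. if smooth_at N (F (fst w)) g then snd w (\<lambda>q. g (F q)) else 0)"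


section \<open>Exterior powers\<close>

text \<open>
  For a finite-dimensional vector space \<open>V\<close>, the \<open>r\<close>-th exterior power of its dual is realised as the
  space of alternating \<open>r\<close>-linear forms on \<open>V\<close>, forms being functions of lists of vectors that vanish
  unless the list has length \<open>r\<close> and its entries lie in \<open>V\<close>.  Used with \<open>V = T\<^sub>pM\<close> this is the
  \<open>r\<close>-th exterior power of \<open>T\<^sub>p\<^sup>*M\<close>, and with \<open>V = T\<^sub>p\<^sup>*M\<close> that of \<open>T\<^sub>pM\<close>.  An element of the
  whole exterior algebra is a function of lists of arbitrary length, whose component of
  degree \<open>r\<close> is its restriction to lists of length \<open>r\<close>.
\<close>

definition alt_forms :: "nat \<Rightarrow> ('a \<Rightarrow> real) set \<Rightarrow> (('a \<Rightarrow> real) list \<Rightarrow> real) set" where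
  "alt_forms r V = {\<omega>.
     (\<forall>vs. \<not> (length vs = r \<and> set vs \<subseteq> V) \<longrightarrow> \<omega> vs = 0) \<and>
     (\<forall>vs k v w c d. length vs = r \<and> set vs \<subseteq> V \<and> k < r \<and> v \<in> V \<and> w \<in> V \<longrightarrow>
        \<omega> (vs[k := (\<lambda>z. c * v z + d * w z)]) = c * \<omega> (vs[k := v]) + d * \<omega> (vs[k := w])) \<and>
     (\<forall>vs i j. length vs = r \<and> set vs \<subseteq> V \<and> i < j \<and> j < r \<and> vs ! i = vs ! j \<longrightarrow> \<omega> vs = 0)}"

text \<open>
  The exterior product as the signed sum over shuffles.  A shuffle is given by the set \<open>S\<close> of
  positions of the arguments of the first factor, and its sign counts the inversions.  With this
  normalisation \<open>(a\<^sub>1 \<and> \<dots> \<and> a\<^sub>r)(v\<^sub>1, \<dots>, v\<^sub>r) = det (a\<^sub>i(v\<^sub>j))\<close>.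
\<close>

definition shuffle_sign :: "nat \<Rightarrow> nat set \<Rightarrow> real" where
  "shuffle_sign r S = (- 1) ^ card {(i, j). i < j \<and> j < r \<and> i \<notin> S \<and> j \<in> S}"

definition wedge :: "('b list \<Rightarrow> real) \<Rightarrow> ('b list \<Rightarrow> real) \<Rightarrow> 'b list \<Rightarrow> real" where
  "wedge \<mu> \<nu> vs = (\<Sum>S\<in>Pow {..<length vs}.
     shuffle_sign (length vs) S * \<mu> (nths vs S) * \<nu> (nths vs (- S)))"

definition unit_form :: "'b list \<Rightarrow> real" where
  "unit_form vs = (if vs = [] then 1 else 0)"

definition one_form :: "('b \<Rightarrow> real) \<Rightarrow> 'b list \<Rightarrow> real" where
  "one_form a vs = (case vs of [v] \<Rightarrow> a v | _ \<Rightarrow> 0)"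

definition wedge_list :: "('b \<Rightarrow> real) list \<Rightarrow> 'b list \<Rightarrow> real" where
  "wedge_list as = foldr (\<lambda>a. wedge (one_form a)) as unit_form"

text \<open>
  The pairing \<open>\<langle>X, \<omega>\<rangle>\<close> of an \<open>r\<close>-vector \<open>X\<close> at \<open>p\<close> with an element \<open>\<omega>\<close> of the \<open>r\<close>-th exterior power
  of \<open>T\<^sub>p\<^sup>*M\<close>: it is linear in \<open>\<omega>\<close> and \<open>\<langle>X, a\<^sub>1 \<and> \<dots> \<and> a\<^sub>r\<rangle> = X(a\<^sub>1, \<dots>, a\<^sub>r)\<close>.
\<close>

definition ext_pairing ::
  "('m, 'i) manifold \<Rightarrow> 'm \<Rightarrow> nat \<Rightarrow> ('m covec list \<Rightarrow> real) \<Rightarrow> ('m tvec list \<Rightarrow> real) \<Rightarrow> real" where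
  "ext_pairing M p r X = (THE L.
     (\<forall>\<omega>\<in>alt_forms r (tangent_space M p). \<forall>\<eta>\<in>alt_forms r (tangent_space M p). \<forall>c d.
        L (\<lambda>vs. c * \<omega> vs + d * \<eta> vs) = c * L \<omega> + d * L \<eta>) \<and>
     (\<forall>as. length as = r \<and> set as \<subseteq> cotangent_space M p \<longrightarrow> L (wedge_list as) = X as) \<and>
     (\<forall>\<omega>. \<omega> \<notin> alt_forms r (tangent_space M p) \<longrightarrow> L \<omega> = 0))"

text \<open>
  The bundle of \<open>r\<close>-th exterior powers of \<open>T\<^sup>*M\<close>.  The fibre coordinates are the components
  \<open>\<omega>(\<partial>/\<partial>x\<^bsup>i\<^sub>1\<^esup>, \<dots>, \<partial>/\<partial>x\<^bsup>i\<^sub>r\<^esup>)\<close>, \<open>i\<^sub>1 < \<dots> < i\<^sub>r\<close>, labelled by the sets \<open>{i\<^sub>1, \<dots>, i\<^sub>r}\<close>.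
\<close>

definition ext_chart ::
  "('m, 'i::linorder) manifold \<Rightarrow> nat \<Rightarrow> ('m, 'i) chart \<Rightarrow> ('m \<times> ('m tvec list \<Rightarrow> real), 'i + 'i set) chart" where
  "ext_chart M r c =
     (Sigma (fst c) (\<lambda>p. alt_forms r (tangent_space M p)),
      \<lambda>(p, \<omega>). case_sum (snd c p)
        (\<lambda>S. if S \<subseteq> idx M \<and> card S = r then \<omega> (map (coord_vec M c p) (sorted_list_of_set S)) else 0))"

definition ext_bundle ::
  "('m, 'i::linorder) manifold \<Rightarrow> nat \<Rightarrow> ('m \<times> ('m tvec list \<Rightarrow> real), 'i + 'i set) manifold" where
  "ext_bundle M r =
     \<lparr>pts = Sigma (pts M) (\<lambda>p. alt_forms r (tangent_space M p)),
      idx = idx M <+> {S. S \<subseteq> idx M \<and> card S = r},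
      atlas = ext_chart M r ` atlas M\<rparr>"


section \<open>The exterior algebra of multivector fields\<close>

type_synonym 'm mvfield = "'m \<Rightarrow> 'm covec list \<Rightarrow> real"

text \<open>\<open>\<Phi>\<^sup>r\<close>; smoothness means smoothness of all components with respect to the charts.\<close>

definition mv_fields :: "('m, 'i) manifold \<Rightarrow> nat \<Rightarrow> 'm mvfield set" where
  "mv_fields M r = {X.
     (\<forall>p\<in>pts M. X p \<in> alt_forms r (cotangent_space M p)) \<and>
     (\<forall>p. p \<notin> pts M \<longrightarrow> X p = (\<lambda>_. 0)) \<and>
     (\<forall>c\<in>atlas M. \<forall>is. length is = r \<and> set is \<subseteq> idx M \<longrightarrow>
        smooth_fun_on M (fst c) (\<lambda>p. X p (map (coord_covec M c p) is)))}"

definition mv_part :: "nat \<Rightarrow> 'm mvfield \<Rightarrow> 'm mvfield" where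
  "mv_part r X = (\<lambda>p as. if length as = r then X p as else 0)"

text \<open>\<open>\<Phi>\<close>, the direct sum of the \<open>\<Phi>\<^sup>r\<close>.\<close>

definition mv_algebra :: "('m, 'i) manifold \<Rightarrow> 'm mvfield set" where
  "mv_algebra M = {X. (\<forall>r. mv_part r X \<in> mv_fields M r) \<and> finite {r. mv_part r X \<noteq> (\<lambda>_ _. 0)}}"

definition mv_comb :: "real \<Rightarrow> 'm mvfield \<Rightarrow> real \<Rightarrow> 'm mvfield \<Rightarrow> 'm mvfield" where
  "mv_comb c X d Y = (\<lambda>p as. c * X p as + d * Y p as)"

definition mv_wedge :: "'m mvfield \<Rightarrow> 'm mvfield \<Rightarrow> 'm mvfield" where
  "mv_wedge X Y = (\<lambda>p. wedge (X p) (Y p))"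

text \<open>Functions and vector fields as elements of \<open>\<Phi>\<^sup>0\<close> and \<open>\<Phi>\<^sup>1\<close>.\<close>

definition fun_field :: "('m, 'i) manifold \<Rightarrow> ('m \<Rightarrow> real) \<Rightarrow> 'm mvfield" where
  "fun_field M f = (\<lambda>p as. if p \<in> pts M \<and> as = [] then f p else 0)"

definition smooth_vector_field :: "('m, 'i) manifold \<Rightarrow> ('m \<Rightarrow> 'm tvec) \<Rightarrow> bool" where
  "smooth_vector_field M Y \<longleftrightarrow>
     (\<forall>p\<in>pts M. Y p \<in> tangent_space M p) \<and>
     (\<forall>c\<in>atlas M. \<forall>i\<in>idx M. smooth_fun_on M (fst c) (\<lambda>p. Y p (\<lambda>q. snd c q i)))"

definition vec_field :: "('m, 'i) manifold \<Rightarrow> ('m \<Rightarrow> 'm tvec) \<Rightarrow> 'm mvfield" where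
  "vec_field M Y = (\<lambda>p as. if p \<in> pts M then
     (case as of [a] \<Rightarrow> if a \<in> cotangent_space M p then a (Y p) else 0 | _ \<Rightarrow> 0) else 0)"

definition mv_linear :: "('m, 'i) manifold \<Rightarrow> ('n, 'j) manifold \<Rightarrow> ('m mvfield \<Rightarrow> 'n mvfield) \<Rightarrow> bool" where
  "mv_linear M N \<rho> \<longleftrightarrow> \<rho> ` mv_algebra M \<subseteq> mv_algebra N \<and>
     (\<forall>X\<in>mv_algebra M. \<forall>Y\<in>mv_algebra M. \<forall>c d.
        \<rho> (mv_comb c X d Y) = mv_comb c (\<rho> X) d (\<rho> Y))"

definition graded_hom :: "('m, 'i) manifold \<Rightarrow> ('n, 'j) manifold \<Rightarrow> ('m mvfield \<Rightarrow> 'n mvfield) \<Rightarrow> bool" where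
  "graded_hom M N \<rho> \<longleftrightarrow> mv_linear M N \<rho> \<and>
     (\<forall>r. \<rho> ` mv_fields M r \<subseteq> mv_fields N r) \<and>
     \<rho> (fun_field M (\<lambda>_. 1)) = fun_field N (\<lambda>_. 1) \<and>
     (\<forall>X\<in>mv_algebra M. \<forall>Y\<in>mv_algebra M. \<rho> (mv_wedge X Y) = mv_wedge (\<rho> X) (\<rho> Y))"

definition derivation_along ::
  "('m, 'i) manifold \<Rightarrow> ('n, 'j) manifold \<Rightarrow> ('m mvfield \<Rightarrow> 'n mvfield) \<Rightarrow> int \<Rightarrow>
   ('m mvfield \<Rightarrow> 'n mvfield) \<Rightarrow> bool" where
  "derivation_along M N \<rho> s a \<longleftrightarrow> graded_hom M N \<rho> \<and> mv_linear M N a \<and>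
     (\<forall>q. a ` mv_fields M q \<subseteq>
        (if int q + s \<ge> 0 then mv_fields N (nat (int q + s)) else {\<lambda>_ _. 0})) \<and>
     (\<forall>q. \<forall>\<mu>\<in>mv_fields M q. \<forall>\<nu>\<in>mv_algebra M.
        a (mv_wedge \<mu> \<nu>) =
          mv_comb 1 (mv_wedge (a \<mu>) (\<rho> \<nu>))
                  (if even (int q * s) then 1 else - 1) (mv_wedge (\<rho> \<mu>) (a \<nu>)))"


section \<open>Lifts of vector fields\<close>

text \<open>\<open>Y\<^sup>v\<close> at \<open>v\<close> is the velocity of \<open>t \<mapsto> v + t Y(\<tau>\<^sub>M v)\<close>.\<close>

definition vertical_lift ::
  "('m, 'i) manifold \<Rightarrow> ('m \<Rightarrow> 'm tvec) \<Rightarrow> 'm \<times> 'm tvec \<Rightarrow> ('m \<times> 'm tvec) tvec" where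
  "vertical_lift M Y u =
     snd (velocity (tangent_bundle M) (\<lambda>t. (fst u, \<lambda>f. snd u f + t * Y (fst u) f)))"

text \<open>
  \<open>Y\<^sup>c = Y\<^sup>i \<partial>/\<partial>x\<^sup>i + (\<partial>Y\<^sup>i/\<partial>x\<^sup>k) v\<^sup>k \<partial>/\<partial>v\<^sup>i\<close> in the natural coordinates \<open>(x, v)\<close> of \<open>TM\<close>, for every
  chart of \<open>M\<close>.
\<close>

definition complete_lift ::
  "('m, 'i) manifold \<Rightarrow> ('m \<Rightarrow> 'm tvec) \<Rightarrow> 'm \<times> 'm tvec \<Rightarrow> ('m \<times> 'm tvec) tvec" where
  "complete_lift M Y u = (THE \<xi>. \<forall>c\<in>charts_at M (fst u).
     \<xi> = (\<lambda>f.
       (\<Sum>i\<in>idx M. Y (fst u) (\<lambda>q. snd c q i) *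
          coord_vec (tangent_bundle M) (tangent_chart M c) u (Inl i) f) +
       (\<Sum>i\<in>idx M. (\<Sum>k\<in>idx M. coord_vec M c (fst u) k (\<lambda>p. Y p (\<lambda>q. snd c q i)) * snd u (\<lambda>q. snd c q k)) *
          coord_vec (tangent_bundle M) (tangent_chart M c) u (Inr i) f)))"

definition v_T :: "('m, 'i) manifold \<Rightarrow> 'm mvfield \<Rightarrow> ('m \<times> 'm tvec) mvfield" where
  "v_T M = (THE \<rho>.
     \<rho> \<in> mv_algebra M \<rightarrow>\<^sub>E mv_algebra (tangent_bundle M) \<and>
     graded_hom M (tangent_bundle M) \<rho> \<and>
     (\<forall>f. smooth_fun_on M (pts M) f \<longrightarrow>
        \<rho> (fun_field M f) = fun_field (tangent_bundle M) (\<lambda>u. f (fst u))) \<and>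
     (\<forall>Y. smooth_vector_field M Y \<longrightarrow>
        \<rho> (vec_field M Y) = vec_field (tangent_bundle M) (vertical_lift M Y)))"


section \<open>The isomorphism of \<open>TT\<^sup>*M\<close> with \<open>T\<^sup>*TM\<close>\<close>

definition swap_coords :: "(('i + 'i) + ('i + 'i) \<Rightarrow> real) \<Rightarrow> ('i + 'i) + ('i + 'i) \<Rightarrow> real" where
  "swap_coords u = case_sum
     (case_sum (\<lambda>i. u (Inl (Inl i))) (\<lambda>i. u (Inr (Inl i))))
     (case_sum (\<lambda>i. u (Inl (Inr i))) (\<lambda>i. u (Inr (Inr i))))"

text \<open>The canonical flip \<open>\<kappa>\<^sub>M\<close>.\<close>

definition flip ::
  "('m, 'i) manifold \<Rightarrow> ('m \<times> 'm tvec) \<times> ('m \<times> 'm tvec) tvec \<Rightarrow> ('m \<times> 'm tvec) \<times> ('m \<times> 'm tvec) tvec" where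
  "flip M z = (THE z'. \<forall>c\<in>charts_at M (fst (fst z)).
     z' \<in> fst (tangent_chart (tangent_bundle M) (tangent_chart M c)) \<and>
     snd (tangent_chart (tangent_bundle M) (tangent_chart M c)) z' =
       swap_coords (snd (tangent_chart (tangent_bundle M) (tangent_chart M c)) z))"

text \<open>
  \<open>\<langle>z, w\<rangle>'\<close>: the derivative component of the tangent map of the pairing \<open>TM \<times>\<^sub>M T\<^sup>*M \<rightarrow> \<real>\<close>.  The
  curves in the fibre product are the pairs of curves over the same curve of \<open>M\<close>; thus the tangent
  map of the pairing, applied to the velocity of such a pair, is the velocity of the paired curves.
\<close>

definition tangent_pairing ::
  "('m, 'i) manifold \<Rightarrow> ('m \<times> 'm tvec) \<times> ('m \<times> 'm tvec) tvec \<Rightarrow>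
   ('m \<times> 'm covec) \<times> ('m \<times> 'm covec) tvec \<Rightarrow> real" where
  "tangent_pairing M z w = (THE r. \<exists>\<xi> \<alpha>.
     smooth_curve (tangent_bundle M) \<xi> \<and> smooth_curve (cotangent_bundle M) \<alpha> \<and>
     (\<forall>\<^sub>F t in nhds 0. fst (\<xi> t) = fst (\<alpha> t)) \<and>
     velocity (tangent_bundle M) \<xi> = z \<and> velocity (cotangent_bundle M) \<alpha> = w \<and>
     r = deriv (\<lambda>t. snd (\<alpha> t) (snd (\<xi> t))) 0)"

definition alpha ::
  "('m, 'i) manifold \<Rightarrow> ('m \<times> 'm covec) \<times> ('m \<times> 'm covec) tvec \<Rightarrow> ('m \<times> 'm tvec) \<times> ('m \<times> 'm tvec) covec" where
  "alpha M w = (let u = tangent_map (cotangent_bundle M) M fst w in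
     (u, \<lambda>v. if v \<in> tangent_space (tangent_bundle M) u
              then tangent_pairing M (flip M (u, v)) w else 0))"

definition epsilon ::
  "('m, 'i) manifold \<Rightarrow> ('m \<times> 'm tvec) \<times> ('m \<times> 'm tvec) covec \<Rightarrow> ('m \<times> 'm covec) \<times> ('m \<times> 'm covec) tvec" where
  "epsilon M = inv_into (pts (tangent_bundle (cotangent_bundle M))) (alpha M)"


section \<open>The tangent lift of multivector fields\<close>

definition wedge_map :: "('m \<times> 'm covec) list \<Rightarrow> 'm \<times> ('m tvec list \<Rightarrow> real)" where
  "wedge_map as = (fst (hd as), wedge_list (map snd as))"

text \<open>
  The tangent map of the wedge map on the \<open>r\<close>-fold fibre product of \<open>T\<^sup>*M\<close>; as for the pairing,
  curves in the fibre product are families of curves over the same curve of \<open>M\<close>.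
\<close>

definition tangent_wedge ::
  "('m, 'i::linorder) manifold \<Rightarrow> nat \<Rightarrow> (('m \<times> 'm covec) \<times> ('m \<times> 'm covec) tvec) list \<Rightarrow>
   ('m \<times> ('m tvec list \<Rightarrow> real)) \<times> ('m \<times> ('m tvec list \<Rightarrow> real)) tvec" where
  "tangent_wedge M r ws = (THE W. \<exists>\<gamma>s. length \<gamma>s = r \<and>
     (\<forall>\<gamma>\<in>set \<gamma>s. smooth_curve (cotangent_bundle M) \<gamma>) \<and>
     (\<forall>\<^sub>F t in nhds 0. \<forall>\<gamma>\<in>set \<gamma>s. \<forall>\<delta>\<in>set \<gamma>s. fst (\<gamma> t) = fst (\<delta> t)) \<and>
     map (velocity (cotangent_bundle M)) \<gamma>s = ws \<and>
     W = velocity (ext_bundle M r) (\<lambda>t. wedge_map (map (\<lambda>\<gamma>. \<gamma> t) \<gamma>s)))"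

definition mv_function ::
  "('m, 'i) manifold \<Rightarrow> nat \<Rightarrow> 'm mvfield \<Rightarrow> 'm \<times> ('m tvec list \<Rightarrow> real) \<Rightarrow> real" where
  "mv_function M r X a = ext_pairing M (fst a) r (X (fst a)) (snd a)"

definition d_T_hom ::
  "('m, 'i::linorder) manifold \<Rightarrow> nat \<Rightarrow> 'm mvfield \<Rightarrow> ('m \<times> 'm tvec) mvfield" where
  "d_T_hom M r X u as =
     (if u \<in> pts (tangent_bundle M) \<and> length as = r \<and> set as \<subseteq> cotangent_space (tangent_bundle M) u
      then if r = 0 then differential M (\<lambda>p. X p []) (fst u) (snd u)
           else (let W = tangent_wedge M r (map (\<lambda>a. epsilon M (u, a)) as)
                 in differential (ext_bundle M r) (mv_function M r X) (fst W) (snd W))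
      else 0)"

definition d_T :: "('m, 'i::linorder) manifold \<Rightarrow> 'm mvfield \<Rightarrow> ('m \<times> 'm tvec) mvfield" where
  "d_T M X u as = d_T_hom M (length as) (mv_part (length as) X) u as"

end

theory Submission
  imports Defs "Jordan_Normal_Form.Determinant"
begin

text \<open>
  Let \<open>u = (p, v)\<close> be a point of \<open>TM\<close> and fix a chart at \<open>p\<close>.  For covectors \<open>A\<^sub>1, \<dots>, A\<^sub>r\<close> at \<open>u\<close> the
  vectors \<open>\<epsilon>\<^sub>M(A\<^sub>j)\<close> are the velocities of curves \<open>\<gamma>\<^sub>j\<close> in \<open>T\<^sup>*M\<close> that are affine in the natural coordinates
  and lie over one base curve \<open>b\<close> with velocity \<open>v\<close>, so that
  \<open>(d\<^sub>TX)(A\<^sub>1, \<dots>, A\<^sub>r)\<close> is the derivative at \<open>0\<close> of \<open>t \<mapsto> X(b(t))(\<gamma>\<^sub>1(t), \<dots>, \<gamma>\<^sub>r(t))\<close>.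
  Since \<open>\<gamma>\<^sub>j(0)\<close> is the composite of \<open>A\<^sub>j\<close> with the vertical lift, evaluating a multivector on the
  \<open>\<gamma>\<^sub>j(0)\<close> is evaluating its image under \<open>v\<^sub>T\<close> on the \<open>A\<^sub>j\<close>; the derivation property is therefore the
  Leibniz rule applied to the shuffle sum of an exterior product.  For a vector field the same derivative,
  computed in any chart, is the pairing with the coordinate expression of the complete lift; this also
  shows that the latter does not depend on the chart.
\<close>


section \<open>Calculus on coordinate spaces\<close>

text \<open>\<open>ext_pairing\<close>, \<open>v_T\<close>, \<open>flip\<close>,
  \<open>tangent_pairing\<close>, \<open>tangent_wedge\<close> and \<open>complete_lift\<close> are
  definite descriptions, so none of them can be computed with before exactly one value is known to
  fit. For the two tangent maps this holds because velocities are determined by chart components;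
  for the flip because second partial derivatives commute; for \<open>v_T\<close> because bump
  functions turn a chart expansion into a global identity, which is where the Hausdorff property
  enters. As \<open>Ck_on\<close> speaks of derivatives along coordinate lines only, the chain rule
  and Schwarz's theorem have to be derived from the continuity of the partial derivatives. The
  affine curves come from inverting \<alpha> in natural coordinates: \<epsilon>(A) has fibre
  position A(\<partial>/\<partial>v^i) and fibre velocity A(\<partial>/\<partial>x^i), where (x, v)
  are the coordinates of the tangent bundle. Such a curve depends linearly on A at every time t, not
  only at 0. Multilinearity and alternation of X at the points of the base curve therefore pass to
  the lift by differentiation, and on coordinate covectors the curve is explicit enough to read off
  smooth components.\<close>

definition coord_box :: "'i set \<Rightarrow> ('i \<Rightarrow> real) \<Rightarrow> real \<Rightarrow> ('i \<Rightarrow> real) set" where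
  "coord_box I u e = {w \<in> coord_space I. \<forall>i\<in>I. \<bar>w i - u i\<bar> < e}"

lemma coord_box_mono: "d \<le> e \<Longrightarrow> coord_box I u d \<subseteq> coord_box I u e"
  unfolding coord_box_def by auto

lemma open_box_preimage:
  fixes u :: "'i \<Rightarrow> real" assumes "finite I" shows "open {w. \<forall>i\<in>I. \<bar>w i - u i\<bar> < e}"
proof -
  have "{w. \<forall>i\<in>I. \<bar>w i - u i\<bar> < e} = (\<Inter>i\<in>I. (\<lambda>w. w i) -` ball (u i) e)"
    by (auto simp: dist_real_def abs_minus_commute)
  also have "open \<dots>"
    by (intro open_INT assms ballI open_vimage) (simp_all add: continuous_on_product_coordinates)
  finally show ?thesis .
qed

text \<open>On \<open>coord_space I\<close> the coordinates outside the finite set \<open>I\<close>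
  are all 0, so a basic open set of the product topology restricts only finitely many coordinates
  and contains a box with one common radius. Openness thereby becomes a statement about real
  inequalities.\<close>

lemma coord_open_iff:
  assumes fin: "finite I"
  shows "coord_open I A \<longleftrightarrow> A \<subseteq> coord_space I \<and> (\<forall>u\<in>A. \<exists>e>0. coord_box I u e \<subseteq> A)"
proof
  assume "coord_open I A"
  then obtain T where T: "open T" "A = coord_space I \<inter> T"
    by (auto simp: coord_open_def openin_open)
  show "A \<subseteq> coord_space I \<and> (\<forall>u\<in>A. \<exists>e>0. coord_box I u e \<subseteq> A)"
  proof (intro conjI ballI)
    fix u assume u: "u \<in> A"
    from T(1) u T(2) obtain U where U: "\<And>i. open (U i)" "u \<in> Pi\<^sub>E UNIV U" "Pi\<^sub>E UNIV U \<subseteq> T"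
      unfolding open_fun_def openin_product_topology_alt by (auto dest!: bspec)
    have "\<exists>e>0. ball (u i) e \<subseteq> U i" for i
      using U(1)[of i] U(2) unfolding open_contains_ball by (auto simp: PiE_def)
    then obtain e where e: "\<And>i. e i > 0" "\<And>i. ball (u i) (e i) \<subseteq> U i" by metis
    \<comment> \<open>The inserted 1 keeps the minimum defined and positive when \<open>I\<close> is
      empty.\<close>
    define d where "d = Min (insert 1 (e ` I))"
    have d: "d > 0" "\<And>i. i \<in> I \<Longrightarrow> d \<le> e i" using fin e(1) by (auto simp: d_def)
    have "coord_box I u d \<subseteq> A"
    proof
      fix w assume w: "w \<in> coord_box I u d"
      have "w i \<in> U i" for i
      proof (cases "i \<in> I")
        case True
        then have "\<bar>w i - u i\<bar> < e i" using w d(2)[OF True] by (fastforce simp: coord_box_def)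
        then show ?thesis using e(2)[of i] by (auto simp: dist_real_def abs_minus_commute)
      next
        case False
        then have "w i = u i" using w u T(2) by (auto simp: coord_box_def coord_space_def)
        then show ?thesis using U(2) by auto
      qed
      then have "w \<in> T" using U(3) by auto
      then show "w \<in> A" using w T(2) by (auto simp: coord_box_def)
    qed
    then show "\<exists>e>0. coord_box I u e \<subseteq> A" using d by blast
  qed (use T in auto)
next
  assume A: "A \<subseteq> coord_space I \<and> (\<forall>u\<in>A. \<exists>e>0. coord_box I u e \<subseteq> A)"
  then obtain e where e: "\<And>u. u \<in> A \<Longrightarrow> e u > 0 \<and> coord_box I u (e u) \<subseteq> A" by metis
  define T where "T = (\<Union>u\<in>A. {w. \<forall>i\<in>I. \<bar>w i - u i\<bar> < e u})"
  have "open T" unfolding T_def by (intro open_UN ballI open_box_preimage fin)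
  moreover have "A = coord_space I \<inter> T"
  proof (intro equalityI subsetI IntI)
    fix w assume w: "w \<in> A"
    then show "w \<in> coord_space I" using A by blast
    show "w \<in> T" unfolding T_def using e[OF w] w by (intro UN_I[of w]) auto
  next
    fix w assume w: "w \<in> coord_space I \<inter> T"
    then obtain u where "u \<in> A" "\<forall>i\<in>I. \<bar>w i - u i\<bar> < e u" unfolding T_def by blast
    then have "w \<in> coord_box I u (e u)" using w by (auto simp: coord_box_def)
    then show "w \<in> A" using e \<open>u \<in> A\<close> by blast
  qed
  ultimately show "coord_open I A" by (auto simp: coord_open_def openin_open)
qed

text \<open>The epsilon-delta form with boxes as neighbourhoods, in which total differentiability
  and Schwarz's theorem are proved.\<close>

lemma continuous_on_coord_iff:
  fixes f :: "('i \<Rightarrow> real) \<Rightarrow> real"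
  assumes fin: "finite I" and sub: "A \<subseteq> coord_space I"
  shows "continuous_on A f \<longleftrightarrow> (\<forall>u\<in>A. \<forall>e>0. \<exists>d>0. \<forall>w\<in>A \<inter> coord_box I u d. \<bar>f w - f u\<bar> < e)"
proof
  assume c: "continuous_on A f"
  show "\<forall>u\<in>A. \<forall>e>0. \<exists>d>0. \<forall>w\<in>A \<inter> coord_box I u d. \<bar>f w - f u\<bar> < e"
  proof (intro ballI allI impI)
    fix u e assume u: "u \<in> A" and e: "e > (0::real)"
    obtain T where T: "open T" "T \<inter> A = f -` ball (f u) e \<inter> A"
      using c unfolding continuous_on_open_invariant by blast
    have "coord_open I (coord_space I \<inter> T)" using T by (auto simp: coord_open_def openin_open)
    moreover have "u \<in> coord_space I \<inter> T" using T(2) u e sub by auto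
    ultimately obtain d where d: "d > 0" "coord_box I u d \<subseteq> coord_space I \<inter> T"
      using coord_open_iff[OF fin] by metis
    have "\<forall>w\<in>A \<inter> coord_box I u d. \<bar>f w - f u\<bar> < e"
    proof
      fix w assume "w \<in> A \<inter> coord_box I u d"
      then have "w \<in> T \<inter> A" using d by auto
      then have "f w \<in> ball (f u) e" using T(2) by blast
      then show "\<bar>f w - f u\<bar> < e" by (simp add: dist_real_def abs_minus_commute)
    qed
    then show "\<exists>d>0. \<forall>w\<in>A \<inter> coord_box I u d. \<bar>f w - f u\<bar> < e" using d by auto
  qed
next
  assume R: "\<forall>u\<in>A. \<forall>e>0. \<exists>d>0. \<forall>w\<in>A \<inter> coord_box I u d. \<bar>f w - f u\<bar> < e"
  show "continuous_on A f" unfolding continuous_on_topological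
  proof (intro ballI allI impI)
    fix u B assume u: "u \<in> A" and B: "open B" "f u \<in> B"
    obtain e where e: "e > 0" "ball (f u) e \<subseteq> B" using B unfolding open_contains_ball by auto
    obtain d where d: "d > 0" "\<forall>w\<in>A \<inter> coord_box I u d. \<bar>f w - f u\<bar> < e" using R u e by blast
    show "\<exists>T. open T \<and> u \<in> T \<and> (\<forall>y\<in>A. y \<in> T \<longrightarrow> f y \<in> B)"
    proof (intro exI conjI ballI impI)
      show "open {w. \<forall>i\<in>I. \<bar>w i - u i\<bar> < d}" by (rule open_box_preimage[OF fin])
      show "u \<in> {w. \<forall>i\<in>I. \<bar>w i - u i\<bar> < d}" using d by auto
      fix y assume "y \<in> A" "y \<in> {w. \<forall>i\<in>I. \<bar>w i - u i\<bar> < d}"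
      then have "y \<in> A \<inter> coord_box I u d" using sub by (auto simp: coord_box_def)
      then have "\<bar>f y - f u\<bar> < e" using d by auto
      then show "f y \<in> B" using e by (auto simp: dist_real_def abs_minus_commute subset_iff)
    qed
  qed
qed

section \<open>Closure properties of functions of class C^k\<close>

lemma coord_open_sub: "coord_open I A \<Longrightarrow> A \<subseteq> coord_space I"
  by (auto simp: coord_open_def openin_open)

lemma coord_open_Int: "coord_open I A \<Longrightarrow> coord_open I B \<Longrightarrow> coord_open I (A \<inter> B)"
  unfolding coord_open_def by (rule openin_Int)

text \<open>Guarantees that a derivative along a coordinate line, taken at a point of an open set,
  sees only values inside that set.\<close>

lemma eventually_upd_in:
  assumes "finite I" "coord_open I A" "u \<in> A" "i \<in> I"
  shows "\<forall>\<^sub>F t in nhds (u i). u(i := t) \<in> A"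
proof -
  obtain e where e: "e > 0" "coord_box I u e \<subseteq> A" using coord_open_iff assms by metis
  have "\<forall>\<^sub>F t in nhds (u i). dist t (u i) < e" using e(1) by (auto simp: eventually_nhds_metric)
  then show ?thesis
  proof eventually_elim
    case (elim t)
    have "u \<in> coord_space I" using assms coord_open_sub by blast
    then have "u(i := t) \<in> coord_box I u e" using elim assms(4) e(1) by (auto simp: coord_box_def dist_real_def coord_space_def)
    then show ?case using e by blast
  qed
qed

text \<open>\<open>pderiv_at\<close> is a derivative of \<open>f\<close> on the full coordinate
  line, not relative to \<open>A\<close>. Agreement on \<open>A\<close> is enough because
  \<open>A\<close> is open and the line stays in \<open>A\<close> for a while.\<close>

lemma Ck_cong:
  assumes "finite I" "coord_open I A" "\<And>u. u \<in> A \<Longrightarrow> f u = g u"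
  shows "Ck_on k I A f \<longleftrightarrow> Ck_on k I A g"
  using assms(3)
proof (induction k arbitrary: f g)
  case 0
  then show ?case using continuous_on_cong[of A A f g] by auto
next
  case (Suc k)
  have ev: "\<forall>\<^sub>F t in nhds (u i). f (u(i := t)) = g (u(i := t))" if "u \<in> A" "i \<in> I" for u i
    using eventually_upd_in[OF assms(1,2) that] by eventually_elim (use Suc in auto)
  have d: "(\<lambda>t. f (u(i := t))) differentiable (at (u i)) \<longleftrightarrow> (\<lambda>t. g (u(i := t))) differentiable (at (u i))"
    if "u \<in> A" "i \<in> I" for u i
    unfolding real_differentiable_def using DERIV_cong_ev[OF refl ev[OF that] refl] by auto
  have p: "pderiv_at i f u = pderiv_at i g u" if "u \<in> A" "i \<in> I" for u i
    unfolding pderiv_at_def using deriv_cong_ev[OF ev[OF that] refl] .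
  have "continuous_on A f \<longleftrightarrow> continuous_on A g" using Suc.prems continuous_on_cong[of A A f g] by auto
  moreover have "Ck_on k I A (pderiv_at i f) \<longleftrightarrow> Ck_on k I A (pderiv_at i g)" if "i \<in> I" for i
    by (rule Suc.IH) (use p that in auto)
  ultimately show ?case using d by auto
qed

text \<open>Allows the partial derivatives to be given by formulas \<open>g i\<close>, valid on
  \<open>A\<close> only; by \<open>Ck_cong\<close> the formulas may replace
  \<open>pderiv_at i f\<close> there.\<close>

lemma Ck_SucI:
  assumes "finite I" "coord_open I A" "continuous_on A f"
    "\<And>i u. i \<in> I \<Longrightarrow> u \<in> A \<Longrightarrow> ((\<lambda>t. f (u(i := t))) has_real_derivative g i u) (at (u i))"
    "\<And>i. i \<in> I \<Longrightarrow> Ck_on k I A (g i)"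
  shows "Ck_on (Suc k) I A f"
proof -
  have "Ck_on k I A (pderiv_at i f)" if "i \<in> I" for i
  proof -
    have "pderiv_at i f u = g i u" if "u \<in> A" for u
      unfolding pderiv_at_def using assms(4)[OF \<open>i \<in> I\<close> that] by (rule DERIV_imp_deriv)
    then show ?thesis using Ck_cong[OF assms(1,2), of "pderiv_at i f" "g i"] assms(5)[OF that] by auto
  qed
  then show ?thesis using assms(3,4) by (auto simp: real_differentiable_def)
qed

lemma Ck_SucD:
  assumes "Ck_on (Suc k) I A f" "i \<in> I"
  shows "u \<in> A \<Longrightarrow> ((\<lambda>t. f (u(i := t))) has_real_derivative pderiv_at i f u) (at (u i))"
    and "Ck_on k I A (pderiv_at i f)"
  using assms by (auto simp: pderiv_at_def differentiable_def DERIV_deriv_iff_real_differentiable)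

lemma Ck_cont: "Ck_on k I A f \<Longrightarrow> continuous_on A f"
  by (cases k) auto

lemma Ck_Suc_imp: "Ck_on (Suc k) I A f \<Longrightarrow> Ck_on k I A f"
  by (induction k arbitrary: f) auto

lemma Ck_subset: "Ck_on k I A f \<Longrightarrow> B \<subseteq> A \<Longrightarrow> Ck_on k I B f"
  by (induction k arbitrary: f) (auto intro: continuous_on_subset)

lemma Ck_const: "Ck_on k I A (\<lambda>_. c)"
  by (induction k arbitrary: c) (auto simp: pderiv_at_def[abs_def])

lemma Ck_coord:
  assumes "finite I" "coord_open I A" shows "Ck_on k I A (\<lambda>u. u j)"
proof (cases k)
  case 0
  then show ?thesis by (auto intro: continuous_on_subset[OF continuous_on_product_coordinates])
next
  case (Suc l)
  show ?thesis unfolding Suc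
  proof (rule Ck_SucI[OF assms, where g = "\<lambda>i _. if i = j then 1 else 0"])
    show "continuous_on A (\<lambda>u. u j)" by (auto intro: continuous_on_subset[OF continuous_on_product_coordinates])
  qed (auto intro!: Ck_const derivative_eq_intros)
qed

lemma Ck_add:
  assumes "finite I" "coord_open I A" "Ck_on k I A f" "Ck_on k I A g"
  shows "Ck_on k I A (\<lambda>u. f u + g u)"
  using assms(3,4)
proof (induction k arbitrary: f g)
  case 0 then show ?case by (auto intro: continuous_intros)
next
  case (Suc k)
  show ?case
  proof (rule Ck_SucI[OF assms(1,2), where g = "\<lambda>i u. pderiv_at i f u + pderiv_at i g u"])
    show "continuous_on A (\<lambda>u. f u + g u)" using Suc.prems by (auto intro!: continuous_intros)
    fix i assume i: "i \<in> I"
    show "((\<lambda>t. f (u(i := t)) + g (u(i := t))) has_real_derivative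
         pderiv_at i f u + pderiv_at i g u) (at (u i))" if "u \<in> A" for u
      by (rule DERIV_add[OF Ck_SucD(1)[OF Suc.prems(1) i that] Ck_SucD(1)[OF Suc.prems(2) i that]])
    show "Ck_on k I A (\<lambda>u. pderiv_at i f u + pderiv_at i g u)"
      by (intro Suc.IH Ck_SucD(2)[OF _ i] Suc.prems)
  qed
qed

lemma Ck_mult:
  assumes "finite I" "coord_open I A" "Ck_on k I A f" "Ck_on k I A g"
  shows "Ck_on k I A (\<lambda>u. f u * g u)"
  using assms(3,4)
proof (induction k arbitrary: f g)
  case 0 then show ?case by (auto intro: continuous_intros)
next
  case (Suc k)
  show ?case
  proof (rule Ck_SucI[OF assms(1,2), where g = "\<lambda>i u. pderiv_at i f u * g u + pderiv_at i g u * f u"])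
    show "continuous_on A (\<lambda>u. f u * g u)" using Suc.prems by (auto intro!: continuous_intros)
    fix i assume i: "i \<in> I"
    show "((\<lambda>t. f (u(i := t)) * g (u(i := t))) has_real_derivative
         pderiv_at i f u * g u + pderiv_at i g u * f u) (at (u i))" if "u \<in> A" for u
      using DERIV_mult[OF Ck_SucD(1)[OF Suc.prems(1) i that] Ck_SucD(1)[OF Suc.prems(2) i that]]
      unfolding fun_upd_triv .
    show "Ck_on k I A (\<lambda>u. pderiv_at i f u * g u + pderiv_at i g u * f u)"
      by (intro Ck_add[OF assms(1,2)] Suc.IH Ck_SucD(2)[OF _ i] Suc.prems Ck_Suc_imp)
  qed
qed

lemma Ck_sum:
  assumes "finite I" "coord_open I A" "\<And>j. j \<in> J \<Longrightarrow> Ck_on k I A (f j)"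
  shows "Ck_on k I A (\<lambda>u. \<Sum>j\<in>J. f j u)"
  using assms(3)
proof (induction J rule: infinite_finite_induct)
  case (insert j J)
  then show ?case using Ck_add[OF assms(1,2)] by simp
qed (auto intro: Ck_const)

text \<open>Partial derivatives at a point do not refer to the domain, so only the continuity of the
  iterated derivatives has to be patched together.\<close>

lemma Ck_local:
  assumes fin: "finite I" and sub: "A \<subseteq> coord_space I"
    and "\<And>u. u \<in> A \<Longrightarrow> \<exists>B. coord_open I B \<and> u \<in> B \<and> Ck_on k I B f"
  shows "Ck_on k I A f"
  using assms(3)
proof (induction k arbitrary: f)
  case 0
  show ?case unfolding Ck_on.simps continuous_on_coord_iff[OF fin sub]
  proof (intro ballI allI impI)
    fix u e assume u: "u \<in> A" and e: "e > (0::real)"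
    obtain B where B: "coord_open I B" "u \<in> B" "continuous_on B f" using 0 u by fastforce
    obtain d where d: "d > 0" "\<forall>w\<in>B \<inter> coord_box I u d. \<bar>f w - f u\<bar> < e"
      using B e continuous_on_coord_iff[OF fin coord_open_sub[OF B(1)]] by blast
    obtain d' where d': "d' > 0" "coord_box I u d' \<subseteq> B" using B coord_open_iff[OF fin] by blast
    have "coord_box I u (min d d') \<subseteq> B \<inter> coord_box I u d"
      using d' coord_box_mono[of "min d d'" d I u] coord_box_mono[of "min d d'" d' I u] by auto
    then show "\<exists>d>0. \<forall>w\<in>A \<inter> coord_box I u d. \<bar>f w - f u\<bar> < e"
      using d d' by (intro exI[of _ "min d d'"]) auto
  qed
next
  case (Suc k)
  have 1: "Ck_on k I A f" using Suc.IH Suc.prems Ck_Suc_imp by blast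
  have 2: "(\<lambda>t. f (u(i := t))) differentiable (at (u i))" if "u \<in> A" "i \<in> I" for u i
    using Suc.prems[OF that(1)] that(2) by auto
  have 3: "Ck_on k I A (pderiv_at i f)" if "i \<in> I" for i
    by (rule Suc.IH) (use Suc.prems that in \<open>force\<close>)
  show ?case using Ck_cont[OF 1] 2 3 by auto
qed

section \<open>Total differentiability, chain rule and composition\<close>

text \<open>Continuity of the partial derivatives gives a linear approximation: pass from
  \<open>u\<close> to \<open>w\<close> changing one coordinate at a time and apply the mean value
  bound to each change. The error is measured in the l^1 norm, so the contributions of the
  coordinates simply add.\<close>

lemma total_diff:
  assumes fin: "finite I" and op: "coord_open I A" and C: "Ck_on (Suc 0) I A f" and u: "u \<in> A" and e: "e > 0"
  shows "\<exists>d>0. \<forall>w\<in>coord_box I u d. w \<in> A \<and>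
    \<bar>f w - f u - (\<Sum>i\<in>I. pderiv_at i f u * (w i - u i))\<bar> \<le> e * (\<Sum>i\<in>I. \<bar>w i - u i\<bar>)"
proof -
  have sub: "A \<subseteq> coord_space I" using op coord_open_sub by blast
  obtain d0 where d0: "d0 > 0" "coord_box I u d0 \<subseteq> A" using op u coord_open_iff[OF fin] by blast
  have "\<exists>d>0. \<forall>w\<in>A \<inter> coord_box I u d. \<bar>pderiv_at i f w - pderiv_at i f u\<bar> < e" if "i \<in> I" for i
    using C that continuous_on_coord_iff[OF fin sub] u e by auto
  then obtain d where d: "\<And>i. i \<in> I \<Longrightarrow> d i > 0"
    "\<And>i w. i \<in> I \<Longrightarrow> w \<in> A \<inter> coord_box I u (d i) \<Longrightarrow> \<bar>pderiv_at i f w - pderiv_at i f u\<bar> < e" by metis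
  define D where "D = Min (insert d0 (d ` I))"
  have D: "D > 0" "D \<le> d0" "\<And>i. i \<in> I \<Longrightarrow> D \<le> d i" using fin d d0 by (auto simp: D_def)
  have DA: "coord_box I u D \<subseteq> A" using d0 coord_box_mono[OF D(2)] by blast
  have De: "\<bar>pderiv_at i f w - pderiv_at i f u\<bar> < e" if "i \<in> I" "w \<in> coord_box I u D" for i w
    by (rule d(2)[OF that(1)]) (use DA that(2) subsetD[OF coord_box_mono[OF D(3)[OF that(1)]]] in auto)
  \<comment> \<open>Induction over the set \<open>J\<close> of coordinates in which \<open>w\<close>
    may differ from \<open>u\<close>; each step resets one coordinate \<open>j\<close> to
    \<open>u j\<close>.\<close>
  have key: "\<forall>w\<in>coord_box I u D. (\<forall>i\<in>I - J. w i = u i) \<longrightarrow>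
     \<bar>f w - f u - (\<Sum>i\<in>J. pderiv_at i f u * (w i - u i))\<bar> \<le> e * (\<Sum>i\<in>J. \<bar>w i - u i\<bar>)" if "finite J" "J \<subseteq> I" for J
    using that
  proof (induction J)
    case empty
    have "w = u" if "w \<in> coord_box I u D" "\<forall>i\<in>I. w i = u i" for w
    proof
      fix i
      show "w i = u i" using that u sub by (cases "i \<in> I") (auto simp: coord_box_def coord_space_def)
    qed
    then show ?case by auto
  next
    case (insert j J)
    show ?case
    proof (intro ballI impI)
      fix w assume w: "w \<in> coord_box I u D" "\<forall>i\<in>I - insert j J. w i = u i"
      define w' where "w' = w(j := u j)"
      have j: "j \<in> I" using insert by auto
      have coord_box: "w(j := s) \<in> coord_box I u D" if "s \<in> closed_segment (u j) (w j)" for s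
      proof -
        have "\<bar>s - u j\<bar> \<le> \<bar>w j - u j\<bar>" using that by (auto simp: closed_segment_eq_real_ivl split: if_splits)
        then show ?thesis using w j by (auto simp: coord_box_def coord_space_def)
      qed
      have w'b: "w' \<in> coord_box I u D" unfolding w'_def by (rule coord_box) (auto)
      have IH: "\<bar>f w' - f u - (\<Sum>i\<in>J. pderiv_at i f u * (w' i - u i))\<bar> \<le> e * (\<Sum>i\<in>J. \<bar>w' i - u i\<bar>)"
        using insert w'b w by (auto simp: w'_def)
      have J: "w' i = w i" if "i \<in> J" for i using that insert by (auto simp: w'_def)
      \<comment> \<open>Subtracting the linear term leaves a function of the \<open>j\<close>-th
        coordinate whose derivative is bounded by \<open>e\<close> on the segment, all of which lies
        in the box of radius \<open>D\<close>.\<close>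
      have "norm ((f (w(j := w j)) - pderiv_at j f u * w j) - (f (w(j := u j)) - pderiv_at j f u * u j))
         \<le> e * norm (w j - u j)"
      proof (rule field_differentiable_bound[where S = "closed_segment (u j) (w j)" and
            f' = "\<lambda>s. pderiv_at j f (w(j := s)) - pderiv_at j f u" and f = "\<lambda>s. f (w(j := s)) - pderiv_at j f u * s"])
        fix s assume s: "s \<in> closed_segment (u j) (w j)"
        have "((\<lambda>t. f ((w(j := s))(j := t))) has_real_derivative pderiv_at j f (w(j := s))) (at ((w(j := s)) j))"
          by (rule Ck_SucD(1)[OF C j]) (use coord_box[OF s] DA in blast)
        then have "((\<lambda>t. f (w(j := t))) has_real_derivative pderiv_at j f (w(j := s))) (at s)" by simp
        then show "((\<lambda>s. f (w(j := s)) - pderiv_at j f u * s) has_real_derivative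
             pderiv_at j f (w(j := s)) - pderiv_at j f u) (at s within closed_segment (u j) (w j))"
          by (auto intro!: derivative_eq_intros intro: DERIV_subset)
        show "norm (pderiv_at j f (w(j := s)) - pderiv_at j f u) \<le> e"
          using De[OF j coord_box[OF s]] by simp
      qed auto
      then have 2: "\<bar>f w - f w' - pderiv_at j f u * (w j - u j)\<bar> \<le> e * \<bar>w j - u j\<bar>"
        by (simp add: w'_def algebra_simps)
      have S: "(\<Sum>i\<in>J. pderiv_at i f u * (w' i - u i)) = (\<Sum>i\<in>J. pderiv_at i f u * (w i - u i))"
        "(\<Sum>i\<in>J. \<bar>w' i - u i\<bar>) = (\<Sum>i\<in>J. \<bar>w i - u i\<bar>)"
        using J by auto
      show "\<bar>f w - f u - (\<Sum>i\<in>insert j J. pderiv_at i f u * (w i - u i))\<bar> \<le> e * (\<Sum>i\<in>insert j J. \<bar>w i - u i\<bar>)"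
        using IH 2 insert(1,2) unfolding S by (simp add: algebra_simps)
    qed
  qed
  show ?thesis
    by (rule exI[of _ D]) (use key[OF fin order_refl] D DA in auto)
qed

text \<open>The curve is only assumed differentiable at \<open>t0\<close>. The difference quotient
  of the composite is the linear combination of the quotients \<open>q i\<close> plus a remainder
  \<open>R\<close>, and \<open>total_diff\<close> forces \<open>R\<close> to 0.\<close>

lemma chain_rule:
  assumes fin: "finite I" and op: "coord_open I A" and C: "Ck_on (Suc 0) I A f" and u: "g t0 \<in> A"
    and ev: "\<forall>\<^sub>F t in nhds t0. g t \<in> coord_space I"
    and der: "\<And>i. i \<in> I \<Longrightarrow> ((\<lambda>t. g t i) has_real_derivative g' i) (at t0)"
  shows "((\<lambda>t. f (g t)) has_real_derivative (\<Sum>i\<in>I. pderiv_at i f (g t0) * g' i)) (at t0)"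
proof -
  define q where "q i t = (g t i - g t0 i) / (t - t0)" for i t
  define p where "p i = pderiv_at i f (g t0)" for i
  have q: "(q i \<longlongrightarrow> g' i) (at t0)" if "i \<in> I" for i
    using der[OF that] unfolding has_field_derivative_iff q_def .
  define R where "R t = (f (g t) - f (g t0)) / (t - t0) - (\<Sum>i\<in>I. p i * q i t)" for t
  have inbox: "\<forall>\<^sub>F t in at t0. g t \<in> coord_box I (g t0) d" if "d > 0" for d
  proof -
    have "\<forall>i\<in>I. \<forall>\<^sub>F t in at t0. dist (g t i) (g t0 i) < d"
      using der that DERIV_isCont unfolding isCont_def tendsto_iff by blast
    then have "\<forall>\<^sub>F t in at t0. \<forall>i\<in>I. dist (g t i) (g t0 i) < d" using fin by (simp add: eventually_ball_finite)
    moreover have "\<forall>\<^sub>F t in at t0. g t \<in> coord_space I"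
      using ev by (simp add: eventually_nhds_conv_at)
    ultimately show ?thesis by eventually_elim (auto simp: coord_box_def dist_real_def)
  qed
  have "(R \<longlongrightarrow> 0) (at t0)"
  proof (rule tendstoI)
    fix e :: real assume e: "e > 0"
    \<comment> \<open>The sum of the moduli of the difference quotients tends to
      \<open>K - 1\<close> and is thus eventually below \<open>K\<close>; using
      \<open>total_diff\<close> with tolerance \<open>e / K\<close> then bounds the remainder by
      \<open>e\<close>.\<close>
    define K where "K = (\<Sum>i\<in>I. \<bar>g' i\<bar>) + 1"
    have K: "K > 0" unfolding K_def by (simp add: sum_nonneg add_nonneg_pos)
    have "((\<lambda>t. \<Sum>i\<in>I. \<bar>q i t\<bar>) \<longlongrightarrow> (\<Sum>i\<in>I. \<bar>g' i\<bar>)) (at t0)"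
      by (intro tendsto_sum tendsto_rabs q)
    then have 1: "\<forall>\<^sub>F t in at t0. (\<Sum>i\<in>I. \<bar>q i t\<bar>) < K"
      by (rule order_tendstoD) (simp add: K_def)
    obtain d where d: "d > 0" "\<forall>w\<in>coord_box I (g t0) d. w \<in> A \<and>
      \<bar>f w - f (g t0) - (\<Sum>i\<in>I. pderiv_at i f (g t0) * (w i - g t0 i))\<bar> \<le> e / K * (\<Sum>i\<in>I. \<bar>w i - g t0 i\<bar>)"
      using total_diff[OF fin op C u, of "e / K"] e K by auto
    show "\<forall>\<^sub>F t in at t0. dist (R t) 0 < e"
      using 1 inbox[OF d(1)] eventually_neq_at_within[of t0]
    proof eventually_elim
      case (elim t)
      have nz: "t - t0 \<noteq> 0" using elim by simp
      have "\<bar>f (g t) - f (g t0) - (\<Sum>i\<in>I. p i * (g t i - g t0 i))\<bar> \<le> e / K * (\<Sum>i\<in>I. \<bar>g t i - g t0 i\<bar>)"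
        using d(2) elim unfolding p_def by blast
      moreover have "R t = (f (g t) - f (g t0) - (\<Sum>i\<in>I. p i * (g t i - g t0 i))) / (t - t0)"
        unfolding R_def q_def by (simp add: diff_divide_distrib[of _ "sum _ _"] diff_divide_distrib[of "f _"] sum_divide_distrib)
      moreover have "(\<Sum>i\<in>I. \<bar>g t i - g t0 i\<bar>) = \<bar>t - t0\<bar> * (\<Sum>i\<in>I. \<bar>q i t\<bar>)"
        unfolding q_def sum_distrib_left using nz by (intro sum.cong) (auto simp: abs_divide)
      ultimately have "\<bar>R t\<bar> \<le> e / K * (\<bar>t - t0\<bar> * (\<Sum>i\<in>I. \<bar>q i t\<bar>)) / \<bar>t - t0\<bar>"
        by (simp only: abs_divide divide_right_mono abs_ge_zero)
      then have "\<bar>R t\<bar> \<le> e / K * (\<Sum>i\<in>I. \<bar>q i t\<bar>)" using nz by simp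
      also have "\<dots> < e / K * K" using elim e K by (intro mult_strict_left_mono) auto
      finally show ?case using K by (simp add: dist_real_def)
    qed
  qed
  moreover have "((\<lambda>t. \<Sum>i\<in>I. p i * q i t) \<longlongrightarrow> (\<Sum>i\<in>I. p i * g' i)) (at t0)"
    by (intro tendsto_sum tendsto_mult_left q)
  ultimately have "((\<lambda>t. R t + (\<Sum>i\<in>I. p i * q i t)) \<longlongrightarrow> 0 + (\<Sum>i\<in>I. p i * g' i)) (at t0)"
    by (rule tendsto_add)
  then show ?thesis unfolding has_field_derivative_iff R_def p_def by simp
qed

text \<open>Induction on \<open>k\<close>: by the chain rule the partial derivatives of the
  composite are sums of products of functions that the induction hypothesis already places in class
  C^k.\<close>

lemma Ck_compose:
  assumes fI: "finite I" and oA: "coord_open I A" and fJ: "finite J" and oB: "coord_open J B"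
    and g: "Ck_on k J B g" and sub: "\<phi> ` A \<subseteq> B" and \<phi>: "\<And>j. j \<in> J \<Longrightarrow> Ck_on k I A (\<lambda>u. \<phi> u j)"
  shows "Ck_on k I A (\<lambda>u. g (\<phi> u))"
  using g \<phi>
proof (induction k arbitrary: g)
  case 0
  have cs: "\<phi> u \<in> coord_space J" if "u \<in> A" for u using that sub coord_open_sub[OF oB] by blast
  \<comment> \<open>Continuity into the product topology concerns all coordinates; those outside
    \<open>J\<close> vanish because the values of \<phi> lie in \<open>B\<close>.\<close>
  have "continuous_on A \<phi>"
  proof (rule continuous_on_coordinatewise_then_product)
    fix j
    show "continuous_on A (\<lambda>u. \<phi> u j)"
    proof (cases "j \<in> J")
      case False
      have "continuous_on A (\<lambda>u. \<phi> u j) \<longleftrightarrow> continuous_on A (\<lambda>_. 0::real)"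
        by (rule continuous_on_cong) (use cs False in \<open>auto simp: coord_space_def\<close>)
      then show ?thesis by simp
    qed (use 0 in auto)
  qed
  then show ?case using continuous_on_compose2[OF _ _ sub, of g] 0(1) by simp
next
  case (Suc k)
  have cs: "\<phi> u \<in> coord_space J" if "u \<in> A" for u using that sub coord_open_sub[OF oB] by blast
  have \<phi>': "Ck_on k I A (\<lambda>u. \<phi> u j)" if "j \<in> J" for j using Suc.prems(2)[OF that] Ck_Suc_imp by blast
  show ?case
  proof (rule Ck_SucI[OF fI oA, where g = "\<lambda>i u. \<Sum>j\<in>J. pderiv_at j g (\<phi> u) * pderiv_at i (\<lambda>u. \<phi> u j) u"])
    show "continuous_on A (\<lambda>u. g (\<phi> u))"
      using Suc.IH[OF Ck_Suc_imp[OF Suc.prems(1)] \<phi>'] Ck_cont by blast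
    fix i assume i: "i \<in> I"
    show "Ck_on k I A (\<lambda>u. \<Sum>j\<in>J. pderiv_at j g (\<phi> u) * pderiv_at i (\<lambda>u. \<phi> u j) u)"
    proof (rule Ck_sum[OF fI oA], rule Ck_mult[OF fI oA])
      fix j assume j: "j \<in> J"
      show "Ck_on k I A (\<lambda>u. pderiv_at j g (\<phi> u))"
        by (rule Suc.IH[OF Ck_SucD(2)[OF Suc.prems(1) j] \<phi>'])
      show "Ck_on k I A (pderiv_at i (\<lambda>u. \<phi> u j))" using Ck_SucD(2)[OF Suc.prems(2)[OF j] i] .
    qed
    fix u assume u: "u \<in> A"
    have u': "u(i := u i) = u" by simp
    have "((\<lambda>t. g (\<phi> (u(i := t)))) has_real_derivative 
        (\<Sum>j\<in>J. pderiv_at j g (\<phi> (u(i := u i))) * pderiv_at i (\<lambda>u. \<phi> u j) u)) (at (u i))"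
    proof (rule chain_rule[OF fJ oB])
      show "Ck_on (Suc 0) J B g" using Suc.prems(1) by (auto intro: Ck_cont)
      show "\<phi> (u(i := u i)) \<in> B" using u sub by auto
      show "\<forall>\<^sub>F t in nhds (u i). \<phi> (u(i := t)) \<in> coord_space J"
        using eventually_upd_in[OF fI oA u i] by eventually_elim (use cs in auto)
      show "((\<lambda>t. \<phi> (u(i := t)) j) has_real_derivative pderiv_at i (\<lambda>u. \<phi> u j) u) (at (u i))" if "j \<in> J" for j
        using Ck_SucD(1)[OF Suc.prems(2)[OF that] i u] .
    qed
    then show "((\<lambda>t. g (\<phi> (u(i := t)))) has_real_derivative 
        (\<Sum>j\<in>J. pderiv_at j g (\<phi> u) * pderiv_at i (\<lambda>u. \<phi> u j) u)) (at (u i))" by simp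
  qed
qed

section \<open>Symmetry of second derivatives\<close>

text \<open>The mean value theorem is applied twice, first in direction \<open>i\<close> to the
  increment \<open>F\<close> in direction \<open>j\<close>, then in direction \<open>j\<close> to
  \<open>pderiv_at i f\<close>. The second difference itself is symmetric in \<open>i\<close> and
  \<open>j\<close>, the derivative that it produces is not.\<close>

lemma mixed_difference:
  assumes op: "coord_open I A" and C: "Ck_on (Suc (Suc 0)) I A f" and ij: "i \<in> I" "j \<in> I" "i \<noteq> j"
    and k: "0 < k" "k < d" and inA: "coord_box I u d \<subseteq> A" and u: "u \<in> A"
  shows "\<exists>w\<in>coord_box I u d. f (u(i := u i + k, j := u j + k)) - f (u(i := u i + k)) - f (u(j := u j + k)) + f u
    = k * k * pderiv_at j (pderiv_at i f) w"
proof -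
  have uc: "u \<in> coord_space I" using u op coord_open_sub by blast
  have inb: "u(i := u i + s, j := u j + t) \<in> coord_box I u d" if "0 \<le> s" "s \<le> k" "0 \<le> t" "t \<le> k" for s t
    using that uc ij k by (auto simp: coord_box_def coord_space_def)
  have ji: "w(i := a, j := b) = w(j := b, i := a)" for w :: "_ \<Rightarrow> real" and a b using ij(3) by (rule fun_upd_twist)
  have d1: "((\<lambda>s. f (u(i := u i + s, j := u j + t))) has_real_derivative 
      pderiv_at i f (u(i := u i + s, j := u j + t))) (at s)" if "0 \<le> s" "s \<le> k" "0 \<le> t" "t \<le> k" for s t
  proof -
    have "((\<lambda>x. f ((u(i := u i + s, j := u j + t))(i := x))) has_real_derivative 
        pderiv_at i f (u(i := u i + s, j := u j + t))) (at ((u(i := u i + s, j := u j + t)) i))"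
      by (rule Ck_SucD(1)[OF C ij(1)]) (use inb[OF that] inA in blast)
    then have "((\<lambda>x. f ((u(i := x, j := u j + t)))) has_real_derivative 
        pderiv_at i f (u(i := u i + s, j := u j + t))) (at (u i + s))" using ij by (simp add: fun_upd_twist)
    moreover have "((\<lambda>s. u i + s) has_real_derivative 1) (at s)" by (auto intro!: derivative_eq_intros)
    ultimately show ?thesis using DERIV_chain2[where g = "\<lambda>s. u i + s" and f = "\<lambda>x. f ((u(i := x, j := u j + t)))" and s = UNIV] by fastforce
  qed
  have d2: "((\<lambda>t. pderiv_at i f (u(i := u i + s, j := u j + t))) has_real_derivative 
      pderiv_at j (pderiv_at i f) (u(i := u i + s, j := u j + t))) (at t)" if "0 \<le> s" "s \<le> k" "0 \<le> t" "t \<le> k" for s t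
  proof -
    have "((\<lambda>x. pderiv_at i f ((u(i := u i + s, j := u j + t))(j := x))) has_real_derivative 
        pderiv_at j (pderiv_at i f) (u(i := u i + s, j := u j + t))) (at ((u(i := u i + s, j := u j + t)) j))"
      by (rule Ck_SucD(1)[OF Ck_SucD(2)[OF C ij(1)] ij(2)]) (use inb[OF that] inA in blast)
    then have "((\<lambda>x. pderiv_at i f ((u(i := u i + s, j := x)))) has_real_derivative 
        pderiv_at j (pderiv_at i f) (u(i := u i + s, j := u j + t))) (at (u j + t))" by simp
    moreover have "((\<lambda>t. u j + t) has_real_derivative 1) (at t)" by (auto intro!: derivative_eq_intros)
    ultimately show ?thesis using DERIV_chain2[where g = "\<lambda>t. u j + t" and f = "\<lambda>x. pderiv_at i f ((u(i := u i + s, j := x)))" and s = UNIV] by fastforce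
  qed
  define F where "F s = f (u(i := u i + s, j := u j + k)) - f (u(i := u i + s, j := u j + 0))" for s
  have "\<exists>z>0. z < k \<and> F k - F 0 = (k - 0) * (pderiv_at i f (u(i := u i + z, j := u j + k)) - pderiv_at i f (u(i := u i + z, j := u j + 0)))"
    unfolding F_def by (rule MVT2[OF k(1)]) (rule DERIV_diff[OF d1 d1], use k in auto)
  then obtain z where z: "0 < z" "z < k" 
    "F k - F 0 = (k - 0) * (pderiv_at i f (u(i := u i + z, j := u j + k)) - pderiv_at i f (u(i := u i + z, j := u j + 0)))"
    by blast
  have "\<exists>y>0. y < k \<and> pderiv_at i f (u(i := u i + z, j := u j + k)) - pderiv_at i f (u(i := u i + z, j := u j + 0))
     = (k - 0) * pderiv_at j (pderiv_at i f) (u(i := u i + z, j := u j + y))"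
    by (rule MVT2[OF k(1)]) (rule d2, use k z in auto)
  then obtain y where y: "0 < y" "y < k" "pderiv_at i f (u(i := u i + z, j := u j + k)) - pderiv_at i f (u(i := u i + z, j := u j + 0))
     = (k - 0) * pderiv_at j (pderiv_at i f) (u(i := u i + z, j := u j + y))" by blast
  have F: "F k - F 0 = f (u(i := u i + k, j := u j + k)) - f (u(i := u i + k)) - f (u(j := u j + k)) + f u"
    using ij unfolding F_def by (simp add: fun_upd_idem)
  show ?thesis
    by (rule bexI[of _ "u(i := u i + z, j := u j + y)"]) (use z y F inb in \<open>auto simp: mult.assoc\<close>)
qed

text \<open>Schwarz's theorem. If the mixed derivatives differed at \<open>u\<close>, continuity
  would keep them apart on a small box; but the second difference with step \<open>d/2\<close>
  equals \<open>d/2 * (d/2)\<close> times a value of either of them in that box.\<close>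

lemma pderiv_commute:
  assumes fin: "finite I" and op: "coord_open I A" and C: "Ck_on (Suc (Suc 0)) I A f" and ij: "i \<in> I" "j \<in> I" and u: "u \<in> A"
  shows "pderiv_at i (pderiv_at j f) u = pderiv_at j (pderiv_at i f) u"
proof (cases "i = j")
  case False
  have uc: "A \<subseteq> coord_space I" using op coord_open_sub by blast
  show ?thesis
  proof (rule ccontr)
    assume ne: "\<not> ?thesis"
    \<comment> \<open>Half the distance of the two values, so that their neighbourhoods of radius
      \<open>e\<close> are disjoint.\<close>
    define e where "e = \<bar>pderiv_at i (pderiv_at j f) u - pderiv_at j (pderiv_at i f) u\<bar> / 2"
    have e: "e > 0" using ne by (simp add: e_def)
    obtain d0 where d0: "d0 > 0" "coord_box I u d0 \<subseteq> A" using op u coord_open_iff[OF fin] by blast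
    have "continuous_on A (pderiv_at a (pderiv_at b f))" if "a \<in> I" "b \<in> I" for a b
      using Ck_SucD(2)[OF Ck_SucD(2)[OF C that(2)] that(1)] by (rule Ck_cont)
    note c = this[unfolded continuous_on_coord_iff[OF fin uc], rule_format, OF _ _ u e]
    obtain d1 where d1: "d1 > 0" "\<forall>w\<in>A \<inter> coord_box I u d1. \<bar>pderiv_at i (pderiv_at j f) w - pderiv_at i (pderiv_at j f) u\<bar> < e"
      using c[OF ij] by blast
    obtain d2 where d2: "d2 > 0" "\<forall>w\<in>A \<inter> coord_box I u d2. \<bar>pderiv_at j (pderiv_at i f) w - pderiv_at j (pderiv_at i f) u\<bar> < e"
      using c[OF ij(2,1)] by blast
    define d where "d = min d0 (min d1 d2)"
    have d: "d > 0" "coord_box I u d \<subseteq> A" "coord_box I u d \<subseteq> A \<inter> coord_box I u d1" "coord_box I u d \<subseteq> A \<inter> coord_box I u d2"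
      using d0 d1 d2 coord_box_mono[of d d0 I u] coord_box_mono[of d d1 I u] coord_box_mono[of d d2 I u] by (auto simp: d_def)
    obtain w where w: "w \<in> coord_box I u d" "f (u(i := u i + d/2, j := u j + d/2)) - f (u(i := u i + d/2)) - f (u(j := u j + d/2)) + f u
      = d/2 * (d/2) * pderiv_at j (pderiv_at i f) w"
      using mixed_difference[OF op C ij False _ _ d(2) u, of "d/2"] d by auto
    obtain w' where w': "w' \<in> coord_box I u d" "f (u(j := u j + d/2, i := u i + d/2)) - f (u(j := u j + d/2)) - f (u(i := u i + d/2)) + f u
      = d/2 * (d/2) * pderiv_at i (pderiv_at j f) w'"
      using mixed_difference[OF op C ij(2,1) False[symmetric] _ _ d(2) u, of "d/2"] d by auto
    have "d/2 * (d/2) * pderiv_at j (pderiv_at i f) w = d/2 * (d/2) * pderiv_at i (pderiv_at j f) w'"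
      using w(2) w'(2) unfolding fun_upd_twist[OF False, of u "u i + d/2" "u j + d/2"] by linarith
    then have "pderiv_at j (pderiv_at i f) w = pderiv_at i (pderiv_at j f) w'" using d by simp
    moreover have "\<bar>pderiv_at j (pderiv_at i f) w - pderiv_at j (pderiv_at i f) u\<bar> < e" using d2 d w by blast
    moreover have "\<bar>pderiv_at i (pderiv_at j f) w' - pderiv_at i (pderiv_at j f) u\<bar> < e" using d1 d w' by blast
    moreover have "\<bar>pderiv_at i (pderiv_at j f) u - pderiv_at j (pderiv_at i f) u\<bar> = 2 * e" by (simp add: e_def)
    ultimately show False by linarith
  qed
qed simp

text \<open>Up to linear combinations, the derivatives of \<open>exp (- 1 / t)\<close>, extended by \<open>0\<close> to \<open>t \<le> 0\<close>.\<close>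

definition flat :: "nat \<Rightarrow> real \<Rightarrow> real" where
  "flat m t = (if t > 0 then exp (- inverse t) * inverse t ^ m else 0)"

text \<open>The family is closed under differentiation up to linear combinations, which is why the
  exponent \<open>m\<close> is carried along. At 0 the right-hand difference quotient is x^(m+1) /
  exp x with x = 1/h, and the left-hand one is 0.\<close>

lemma flat_deriv: "(flat m has_real_derivative flat (m + 2) t - m * flat (m + 1) t) (at t)"
proof -
  consider "t > 0" | "t < 0" | "t = 0" by linarith
  then show ?thesis
  proof cases
    case 1
    have ev: "\<forall>\<^sub>F s in nhds t. flat m s = exp (- inverse s) * inverse s ^ m"
      using eventually_nhds_in_open[of "{0<..}" t] 1 by (auto simp: flat_def elim: eventually_mono)
    have D: "((\<lambda>s. exp (- inverse s) * inverse s ^ m) has_real_derivative flat (m + 2) t - m * flat (m + 1) t) (at t)"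
    proof -
      have "((\<lambda>s. exp (- inverse s) * inverse s ^ m) has_real_derivative
         exp (- inverse t) * inverse t ^ 2 * inverse t ^ m - exp (- inverse t) * (real m * inverse t ^ (m - 1) * inverse t ^ 2)) (at t)"
        using 1 by (auto intro!: derivative_eq_intros simp: power2_eq_square)
      moreover have "exp (- inverse t) * inverse t ^ 2 * inverse t ^ m - exp (- inverse t) * (real m * inverse t ^ (m - 1) * inverse t ^ 2)
         = flat (m + 2) t - m * flat (m + 1) t"
        using 1 by (cases m) (auto simp: flat_def power_add power2_eq_square)
      ultimately show ?thesis by simp
    qed
    show ?thesis using D DERIV_cong_ev[OF refl ev refl] by blast
  next
    case 2
    have ev: "\<forall>\<^sub>F s in nhds t. flat m s = 0"
      using eventually_nhds_in_open[of "{..<0}" t] 2 by (auto simp: flat_def elim: eventually_mono)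
    have D: "((\<lambda>s. 0) has_real_derivative flat (m + 2) t - m * flat (m + 1) t) (at t)"
      using 2 by (auto simp: flat_def)
    show ?thesis using D DERIV_cong_ev[OF refl ev refl] by blast
  next
    case 3
    have "((\<lambda>h. flat m h / h) \<longlongrightarrow> 0) (at 0)"
    proof (rule filterlim_split_at)
      have "\<forall>\<^sub>F h in at_left (0::real). flat m h / h = 0"
        by (auto simp: flat_def eventually_at_filter)
      then show "((\<lambda>h. flat m h / h) \<longlongrightarrow> 0) (at_left 0)" by (rule tendsto_eventually)
      have "((\<lambda>x. x ^ (Suc m) / exp x) \<longlongrightarrow> (0::real)) at_top" by (rule tendsto_power_div_exp_0)
      moreover have "\<forall>\<^sub>F x in at_top. x ^ (Suc m) / exp x = flat m (inverse x) / inverse x"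
        using eventually_gt_at_top[of "0::real"] by eventually_elim (auto simp: flat_def exp_minus field_simps)
      ultimately have "((\<lambda>x. flat m (inverse x) / inverse x) \<longlongrightarrow> 0) at_top"
        by (rule Lim_transform_eventually)
      then show "((\<lambda>h. flat m h / h) \<longlongrightarrow> 0) (at_right 0)" unfolding filterlim_at_right_to_top .
    qed
    then show ?thesis using 3 by (simp add: has_field_derivative_iff flat_def)
  qed
qed

lemma Ck_flat:
  assumes "finite I" "coord_open I A" "Ck_on k I A g"
  shows "Ck_on k I A (\<lambda>u. flat m (g u))"
  using assms(3)
proof (induction k arbitrary: m)
  case 0
  have "continuous_on UNIV (flat m)"
    unfolding continuous_on_eq_continuous_at[OF open_UNIV] using DERIV_isCont[OF flat_deriv] by blast
  then show ?case using 0 by (auto intro: continuous_on_compose2)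
next
  case (Suc k)
  show ?case
  proof (rule Ck_SucI[OF assms(1,2), where g = "\<lambda>i u. (flat (m + 2) (g u) + (- real m) * flat (m + 1) (g u)) * pderiv_at i g u"])
    have "continuous_on UNIV (flat m)"
      unfolding continuous_on_eq_continuous_at[OF open_UNIV] using DERIV_isCont[OF flat_deriv] by blast
    then show "continuous_on A (\<lambda>u. flat m (g u))" using Suc.prems by (auto intro: continuous_on_compose2)
    fix i assume i: "i \<in> I"
    show "Ck_on k I A (\<lambda>u. (flat (m + 2) (g u) + - real m * flat (m + 1) (g u)) * pderiv_at i g u)"
      by (intro Ck_mult[OF assms(1,2)] Ck_add[OF assms(1,2)] Suc.IH Ck_Suc_imp[OF Suc.prems] Ck_const Ck_SucD(2)[OF Suc.prems i])
    fix u assume u: "u \<in> A"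
    have "((\<lambda>t. g (u(i := t))) has_real_derivative pderiv_at i g u) (at (u i))" using Ck_SucD(1)[OF Suc.prems i u] .
    from DERIV_chain2[OF flat_deriv this] 
    show "((\<lambda>t. flat m (g (u(i := t)))) has_real_derivative (flat (m + 2) (g u) + - real m * flat (m + 1) (g u)) * pderiv_at i g u) (at (u i))"
      by simp
  qed
qed

section \<open>The same closure properties for smooth functions\<close>

lemma smooth_on_cong:
  "finite I \<Longrightarrow> coord_open I A \<Longrightarrow> (\<And>u. u \<in> A \<Longrightarrow> f u = g u) \<Longrightarrow> smooth_on I A f \<longleftrightarrow> smooth_on I A g"
  unfolding smooth_on_def using Ck_cong by blast

lemma smooth_on_subset: "smooth_on I A f \<Longrightarrow> B \<subseteq> A \<Longrightarrow> smooth_on I B f"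
  unfolding smooth_on_def using Ck_subset by blast

lemma smooth_on_const: "smooth_on I A (\<lambda>_. c)"
  unfolding smooth_on_def by (intro allI Ck_const)

lemma smooth_on_coord: "finite I \<Longrightarrow> coord_open I A \<Longrightarrow> smooth_on I A (\<lambda>u. u j)"
  unfolding smooth_on_def by (intro allI Ck_coord) auto

lemma smooth_on_add:
  "finite I \<Longrightarrow> coord_open I A \<Longrightarrow> smooth_on I A f \<Longrightarrow> smooth_on I A g \<Longrightarrow> smooth_on I A (\<lambda>u. f u + g u)"
  unfolding smooth_on_def by (intro allI Ck_add) auto

lemma smooth_on_mult:
  "finite I \<Longrightarrow> coord_open I A \<Longrightarrow> smooth_on I A f \<Longrightarrow> smooth_on I A g \<Longrightarrow> smooth_on I A (\<lambda>u. f u * g u)"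
  unfolding smooth_on_def by (intro allI Ck_mult) auto

lemma smooth_on_sum:
  "finite I \<Longrightarrow> coord_open I A \<Longrightarrow> (\<And>j. j \<in> J \<Longrightarrow> smooth_on I A (f j)) \<Longrightarrow> smooth_on I A (\<lambda>u. \<Sum>j\<in>J. f j u)"
  unfolding smooth_on_def by (intro allI Ck_sum) auto

lemma smooth_on_prod:
  assumes "finite I" "coord_open I A" "\<And>j. j \<in> J \<Longrightarrow> smooth_on I A (f j)"
  shows "smooth_on I A (\<lambda>u. \<Prod>j\<in>J. f j u)"
  using assms(3)
proof (induction J rule: infinite_finite_induct)
  case (insert j J)
  then show ?case using smooth_on_mult[OF assms(1,2)] by simp
qed (auto intro: smooth_on_const)

lemma smooth_on_pderiv: "smooth_on I A f \<Longrightarrow> i \<in> I \<Longrightarrow> smooth_on I A (pderiv_at i f)"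
  unfolding smooth_on_def using Ck_SucD(2)[of _ I A f i] by simp

lemma smooth_on_compose:
  assumes "finite I" "coord_open I A" "finite J" "coord_open J B" "smooth_on J B g" "\<phi> ` A \<subseteq> B"
   "\<And>j. j \<in> J \<Longrightarrow> smooth_on I A (\<lambda>u. \<phi> u j)"
  shows "smooth_on I A (\<lambda>u. g (\<phi> u))"
  unfolding smooth_on_def
proof
  fix k
  show "Ck_on k I A (\<lambda>u. g (\<phi> u))"
    by (rule Ck_compose[OF assms(1-4) _ assms(6)]) (use assms(5,7) in \<open>simp_all add: smooth_on_def\<close>)
qed

lemma smooth_on_local:
  assumes "finite I" "A \<subseteq> coord_space I" "\<And>u. u \<in> A \<Longrightarrow> \<exists>B. coord_open I B \<and> u \<in> B \<and> smooth_on I B f"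
  shows "smooth_on I A f"
  unfolding smooth_on_def
proof
  fix k
  show "Ck_on k I A f"
    by (rule Ck_local[OF assms(1,2)]) (use assms(3) in \<open>unfold smooth_on_def, blast\<close>)
qed

lemma smooth_on_flat:
  "finite I \<Longrightarrow> coord_open I A \<Longrightarrow> smooth_on I A g \<Longrightarrow> smooth_on I A (\<lambda>u. flat m (g u))"
  unfolding smooth_on_def by (intro allI Ck_flat) auto

lemma smooth_on_imp_Ck: "smooth_on I A f \<Longrightarrow> Ck_on k I A f"
  unfolding smooth_on_def by blast


section \<open>Alternating forms\<close>

text \<open>Linear subspaces of a space of real functions with pointwise operations; tangent spaces,
  cotangent spaces and spaces of forms are all of this kind.\<close>

definition lin_closed :: "('a \<Rightarrow> real) set \<Rightarrow> bool" where
  "lin_closed V \<longleftrightarrow> (\<lambda>_. 0) \<in> V \<and> (\<forall>v\<in>V. \<forall>w\<in>V. \<forall>c d. (\<lambda>z. c * v z + d * w z) \<in> V)"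

lemma lin_closed_comb: "lin_closed V \<Longrightarrow> v \<in> V \<Longrightarrow> w \<in> V \<Longrightarrow> (\<lambda>z. c * v z + d * w z) \<in> V"
  by (auto simp: lin_closed_def)

lemma lin_closed_sum:
  assumes "lin_closed V" "finite J" "\<And>j. j \<in> J \<Longrightarrow> e j \<in> V"
  shows "(\<lambda>z. \<Sum>j\<in>J. c j * e j z) \<in> V"
  using assms(2,3)
proof (induction J)
  case empty then show ?case using assms(1) by (simp add: lin_closed_def)
next
  case (insert j J)
  then show ?case using lin_closed_comb[OF assms(1), of "e j" "\<lambda>z. \<Sum>j\<in>J. c j * e j z" "c j" 1] by simp
qed

definition multilinear_at :: "nat \<Rightarrow> ('a \<Rightarrow> real) set \<Rightarrow> (('a \<Rightarrow> real) list \<Rightarrow> real) \<Rightarrow> bool" where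
  "multilinear_at r V \<omega> \<longleftrightarrow> (\<forall>vs k v w c d. length vs = r \<and> set vs \<subseteq> V \<and> k < r \<and> v \<in> V \<and> w \<in> V \<longrightarrow>
        \<omega> (vs[k := (\<lambda>z. c * v z + d * w z)]) = c * \<omega> (vs[k := v]) + d * \<omega> (vs[k := w]))"

lemma multilinear_atD:
  "multilinear_at r V \<omega> \<Longrightarrow> length vs = r \<Longrightarrow> set vs \<subseteq> V \<Longrightarrow> k < r \<Longrightarrow> v \<in> V \<Longrightarrow> w \<in> V \<Longrightarrow>
   \<omega> (vs[k := (\<lambda>z. c * v z + d * w z)]) = c * \<omega> (vs[k := v]) + d * \<omega> (vs[k := w])"
  unfolding multilinear_at_def by simp

lemma alt_formsI:
  assumes "\<And>vs. \<not> (length vs = r \<and> set vs \<subseteq> V) \<Longrightarrow> \<omega> vs = 0" "multilinear_at r V \<omega>"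
    "\<And>vs i j. length vs = r \<Longrightarrow> set vs \<subseteq> V \<Longrightarrow> i < j \<Longrightarrow> j < r \<Longrightarrow> vs ! i = vs ! j \<Longrightarrow> \<omega> vs = 0"
  shows "\<omega> \<in> alt_forms r V"
  unfolding alt_forms_def using assms(1,3) assms(2)[unfolded multilinear_at_def] by auto

lemma alt_forms_zero: "\<omega> \<in> alt_forms r V \<Longrightarrow> \<not> (length vs = r \<and> set vs \<subseteq> V) \<Longrightarrow> \<omega> vs = 0"
  unfolding alt_forms_def by blast

lemma alt_forms_lin: "\<omega> \<in> alt_forms r V \<Longrightarrow> multilinear_at r V \<omega>"
  unfolding alt_forms_def multilinear_at_def by blast

lemma alt_forms_alt: 
  assumes "\<omega> \<in> alt_forms r V" "length vs = r" "i \<noteq> j" "i < r" "j < r" "vs ! i = vs ! j" shows "\<omega> vs = 0"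
proof (cases "set vs \<subseteq> V")
  case True
  have "\<forall>vs i j. length vs = r \<and> set vs \<subseteq> V \<and> i < j \<and> j < r \<and> vs ! i = vs ! j \<longrightarrow> \<omega> vs = 0"
    using assms(1) unfolding alt_forms_def by blast
  then have *: "\<And>i j. i < j \<Longrightarrow> j < r \<Longrightarrow> vs ! i = vs ! j \<Longrightarrow> \<omega> vs = 0"
    using assms(2) True by blast
  then show ?thesis using assms by (metis nat_neq_iff)
qed (use alt_forms_zero assms in blast)

lemma alt_forms_comb:
  assumes "\<omega> \<in> alt_forms r V" "\<eta> \<in> alt_forms r V"
  shows "(\<lambda>vs. c * \<omega> vs + d * \<eta> vs) \<in> alt_forms r V"
proof (rule alt_formsI)
  show "multilinear_at r V (\<lambda>vs. c * \<omega> vs + d * \<eta> vs)"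
    using assms[THEN alt_forms_lin] unfolding multilinear_at_def by (simp add: algebra_simps)
next
  fix vs :: "('a \<Rightarrow> real) list" and i j
  assume "length vs = r" "i < j" "j < r" "vs ! i = vs ! j"
  then show "c * \<omega> vs + d * \<eta> vs = 0"
    using alt_forms_alt[OF assms(1), of vs i j] alt_forms_alt[OF assms(2), of vs i j] by simp
qed (simp add: alt_forms_zero[OF assms(1)] alt_forms_zero[OF assms(2)])

lemma alt_forms_zero_mem: "(\<lambda>_. 0) \<in> alt_forms r V"
  by (rule alt_formsI) (auto simp: multilinear_at_def)

lemma lin_closed_alt_forms: "lin_closed (alt_forms r V)"
  by (simp add: lin_closed_def alt_forms_zero_mem alt_forms_comb)

lemma multilinear_sum:
  assumes lin: "multilinear_at r V \<omega>" and V: "lin_closed V" and vs: "length vs = r" "set vs \<subseteq> V" "k < r"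
    and J: "finite J" "\<And>j. j \<in> J \<Longrightarrow> e j \<in> V"
  shows "\<omega> (vs[k := (\<lambda>z. \<Sum>j\<in>J. c j * e j z)]) = (\<Sum>j\<in>J. c j * \<omega> (vs[k := e j]))"
  using J
proof (induction J)
  case empty
  have z: "(\<lambda>_. 0) \<in> V" using V by (simp add: lin_closed_def)
  show ?case using multilinear_atD[OF lin vs z z, of 0 0] by simp
next
  case (insert j J)
  have "(\<lambda>z. \<Sum>j\<in>J. c j * e j z) \<in> V" using lin_closed_sum[OF V] insert by auto
  then show ?case using multilinear_atD[OF lin vs, of "e j" "\<lambda>z. \<Sum>j\<in>J. c j * e j z" "c j" 1] insert by simp
qed

text \<open>Expand \<omega> with the sum of the two arguments in both slots. Vanishing is assumed
  only for the slots \<open>i\<close> and \<open>j\<close> of this one list, so that the rule can be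
  used before alternation is known in general.\<close>

lemma swap_neg:
  assumes lin: "multilinear_at r V \<omega>" and V: "lin_closed V" and vs: "length vs = r" "set vs \<subseteq> V"
    and ij: "i < r" "j < r" "i \<noteq> j" and alt: "\<And>x. x \<in> V \<Longrightarrow> \<omega> (vs[i := x, j := x]) = 0"
  shows "\<omega> (vs[i := vs ! j, j := vs ! i]) = - \<omega> vs"
proof -
  define a b where "a = vs ! i" and "b = vs ! j"
  define s where "s = (\<lambda>z. 1 * a z + 1 * b z)"
  have ab: "a \<in> V" "b \<in> V" using vs ij by (auto simp: a_def b_def)
  have s: "s \<in> V" unfolding s_def by (rule lin_closed_comb[OF V ab])
  have up: "length (vs[k := x]) = r" "x \<in> V \<Longrightarrow> set (vs[k := x]) \<subseteq> V" for k x
    using vs set_update_subset_insert[of vs k x] by auto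
  have 1: "\<omega> (vs[i := x, j := s]) = \<omega> (vs[i := x, j := a]) + \<omega> (vs[i := x, j := b])" if "x \<in> V" for x
    using multilinear_atD[OF lin up(1) up(2)[OF that] ij(2) ab, of i 1 1] by (simp add: s_def)
  have 2: "\<omega> (vs[i := s, j := x]) = \<omega> (vs[i := a, j := x]) + \<omega> (vs[i := b, j := x])" if "x \<in> V" for x
    using multilinear_atD[OF lin up(1) up(2)[OF that] ij(1) ab, of j 1 1]
    unfolding s_def list_update_swap[OF ij(3)] by simp
  have "0 = \<omega> (vs[i := s, j := s])" using alt[OF s] by simp
  also have "\<dots> = \<omega> (vs[i := a, j := b]) + \<omega> (vs[i := b, j := a])"
    using 1[OF s] 2[OF ab(1)] 2[OF ab(2)] alt[OF ab(1)] alt[OF ab(2)] by simp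
  also have "vs[i := a, j := b] = vs" using ij vs by (simp add: a_def b_def)
  finally show ?thesis by (simp add: a_def b_def)
qed

lemma alt_forms_swap:
  assumes "\<omega> \<in> alt_forms r V" "lin_closed V" "length vs = r" "set vs \<subseteq> V" "i < r" "j < r" "i \<noteq> j"
  shows "\<omega> (vs[i := vs ! j, j := vs ! i]) = - \<omega> vs"
  by (rule swap_neg[OF alt_forms_lin[OF assms(1)] assms(2-7)])
     (use assms in \<open>auto intro!: alt_forms_alt[OF assms(1), of _ i j]\<close>)

text \<open>Adjacent transpositions suffice, because they move the later of two equal arguments next to the earlier one.\<close>

lemma alt_forms_adjacentI:
  assumes V: "lin_closed V" and zero: "\<And>vs. \<not> (length vs = r \<and> set vs \<subseteq> V) \<Longrightarrow> \<omega> vs = 0" and lin: "multilinear_at r V \<omega>"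
    and adj: "\<And>vs k. length vs = r \<Longrightarrow> set vs \<subseteq> V \<Longrightarrow> Suc k < r \<Longrightarrow> vs ! k = vs ! Suc k \<Longrightarrow> \<omega> vs = 0"
  shows "\<omega> \<in> alt_forms r V"
proof (rule alt_formsI[OF zero lin])
  have *: "\<omega> vs = 0" if "length vs = r" "set vs \<subseteq> V" "i + Suc m < r" "vs ! i = vs ! (i + Suc m)" for vs i m
    using that
  proof (induction m arbitrary: vs)
    case 0 then show ?case using adj[of vs i] by simp
  next
    case (Suc m)
    let ?j = "i + Suc (Suc m)" and ?k = "i + Suc m"
    have "\<omega> (vs[?k := vs ! ?j, ?j := vs ! ?k]) = - \<omega> vs"
    proof (rule swap_neg[OF lin V])
      fix x assume "x \<in> V"
      then have "set (vs[?k := x, ?j := x]) \<subseteq> V" 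
        using Suc.prems(2) by (meson set_update_subsetI)
      then show "\<omega> (vs[?k := x, ?j := x]) = 0" 
        by (intro adj[of _ ?k]) (use Suc.prems in auto)
    qed (use Suc.prems in auto)
    moreover have "\<omega> (vs[?k := vs ! ?j, ?j := vs ! ?k]) = 0"
    proof (rule Suc.IH)
      show "set (vs[?k := vs ! ?j, ?j := vs ! ?k]) \<subseteq> V"
        by (intro set_update_subsetI) (use Suc.prems in auto)
    qed (use Suc.prems in auto)
    ultimately show ?case by simp
  qed
  fix vs i j assume vs: "length vs = r" "set vs \<subseteq> V" "i < (j::nat)" "j < r" "vs ! i = vs ! j"
  then obtain m where "j = i + Suc m" by (metis less_iff_Suc_add add_Suc_right)
  then show "\<omega> vs = 0" using *[of vs i m] vs by simp
qed

text \<open>The absolute values discard the sign of the permutation: the lemma serves to transport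
  vanishing from the sorted list of a set of labels to its rearrangements.\<close>

lemma alt_forms_permute:
  assumes \<omega>: "\<omega> \<in> alt_forms r V" and V: "lin_closed V" and p: "p permutes {..<r}"
    and vs: "length vs = r" "set vs \<subseteq> V"
  shows "\<bar>\<omega> (permute_list p vs)\<bar> = \<bar>\<omega> vs\<bar>"
proof -
  have "\<forall>vs. length vs = r \<longrightarrow> set vs \<subseteq> V \<longrightarrow> \<bar>\<omega> (permute_list p vs)\<bar> = \<bar>\<omega> vs\<bar>"
    using p finite_lessThan
  proof (induction p rule: permutes_induct)
    case (swap a b p)
    show ?case
    proof (intro allI impI)
      fix vs :: "('a \<Rightarrow> real) list" assume vs: "length vs = r" "set vs \<subseteq> V"
      let ?t = "Transposition.transpose a b"
      have tp: "?t permutes {..<length vs}" using swap vs by (intro permutes_swap_id) auto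
      have "permute_list (?t \<circ> p) vs = permute_list p (permute_list ?t vs)"
        using swap vs by (intro permute_list_compose) auto
      also have "\<bar>\<omega> \<dots>\<bar> = \<bar>\<omega> (permute_list ?t vs)\<bar>" 
        using swap vs set_permute_list[OF tp] by simp
      also have "permute_list ?t vs = vs[a := vs ! b, b := vs ! a]"
        using swap vs by (intro nth_equalityI) (auto simp: permute_list_nth[OF tp] nth_list_update Transposition.transpose_def)
      also have "\<omega> \<dots> = - \<omega> vs" by (rule alt_forms_swap[OF \<omega> V vs]) (use swap in auto)
      finally show "\<bar>\<omega> (permute_list (?t \<circ> p) vs)\<bar> = \<bar>\<omega> vs\<bar>" by (simp add: o_def)
    qed
  qed auto
  then show ?thesis using vs by blast
qed

text \<open>A finite spanning family. Independence enters separately, through a dual family.\<close>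

definition spans :: "'i set \<Rightarrow> ('i \<Rightarrow> 'a \<Rightarrow> real) \<Rightarrow> ('a \<Rightarrow> real) set \<Rightarrow> bool" where
  "spans I e V \<longleftrightarrow> finite I \<and> lin_closed V \<and> e ` I \<subseteq> V \<and> (\<forall>v\<in>V. \<exists>c. v = (\<lambda>z. \<Sum>i\<in>I. c i * e i z))"

text \<open>On lists from the spanning family, a repeated label gives 0 by alternation and distinct
  labels are a rearrangement of a sorted list. Other arguments are expanded by
  multilinearity.\<close>

lemma alt_forms_vanish:
  fixes e :: "'i::linorder \<Rightarrow> 'a \<Rightarrow> real"
  assumes \<omega>: "\<omega> \<in> alt_forms r V" and sp: "spans I e V"
    and basis: "\<And>S. S \<subseteq> I \<Longrightarrow> card S = r \<Longrightarrow> \<omega> (map e (sorted_list_of_set S)) = 0"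
  shows "\<omega> vs = 0"
proof -
  have V: "lin_closed V" and fin: "finite I" and eV: "e ` I \<subseteq> V" using sp by (auto simp: spans_def)
  have 1: "\<omega> (map e xs) = 0" if xs: "length xs = r" "set xs \<subseteq> I" for xs
  proof (cases "distinct xs")
    case False
    then obtain i j where "i \<noteq> j" "i < length xs" "j < length xs" "xs ! i = xs ! j" by (auto simp: distinct_conv_nth)
    then show ?thesis using xs by (intro alt_forms_alt[OF \<omega>, of _ i j]) auto
  next
    case True
    let ?ys = "sorted_list_of_set (set xs)"
    have "mset xs = mset ?ys" using set_eq_iff_mset_eq_distinct[of xs ?ys] True by simp
    then obtain p where p: "p permutes {..<length ?ys}" "permute_list p ?ys = xs"
      by (rule mset_eq_permutation)
    have ln: "length ?ys = r" using True xs by (simp add: distinct_card)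
    have "map e xs = permute_list p (map e ?ys)" using p by (metis permute_list_map)
    then have "\<bar>\<omega> (map e xs)\<bar> = \<bar>\<omega> (map e ?ys)\<bar>"
      using alt_forms_permute[OF \<omega> V, of p "map e ?ys"] p(1) ln xs eV by auto
    also have "\<omega> (map e ?ys) = 0" by (rule basis) (use xs True distinct_card in auto)
    finally show ?thesis by simp
  qed
  \<comment> \<open>Induction on the number \<open>k\<close> of leading arguments that may still be
    arbitrary; the last of these is expanded in the spanning family.\<close>
  have 2: "\<omega> vs = 0" if "length vs = r" "set vs \<subseteq> V" "k \<le> r" "\<And>j. k \<le> j \<Longrightarrow> j < r \<Longrightarrow> vs ! j \<in> e ` I" for k vs
    using that
  proof (induction k arbitrary: vs)
    case 0
    then have "set vs \<subseteq> e ` I" by (auto simp: in_set_conv_nth)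
    then have "vs \<in> lists (e ` I)" by auto
    then have "vs \<in> map e ` lists I" by (simp add: lists_image)
    then obtain xs where "vs = map e xs" "set xs \<subseteq> I" by auto
    then show ?case using 1 0 by auto
  next
    case (Suc k)
    have "vs ! k \<in> V" using Suc.prems by (auto simp: subset_iff)
    then obtain c where c: "vs ! k = (\<lambda>z. \<Sum>i\<in>I. c i * e i z)" using sp by (auto simp: spans_def)
    have "\<omega> vs = \<omega> (vs[k := (\<lambda>z. \<Sum>i\<in>I. c i * e i z)])" using c by (metis list_update_id)
    also have "\<dots> = (\<Sum>i\<in>I. c i * \<omega> (vs[k := e i]))"
      by (rule multilinear_sum[OF alt_forms_lin[OF \<omega>] V Suc.prems(1,2) _ fin]) (use Suc.prems eV in auto)
    also have "\<dots> = (\<Sum>i\<in>I. c i * 0)"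
    proof (rule sum.cong[OF refl])
      fix i assume i: "i \<in> I"
      have "\<omega> (vs[k := e i]) = 0"
      proof (rule Suc.IH)
        show "set (vs[k := e i]) \<subseteq> V" using Suc.prems(2) eV i by (intro set_update_subsetI) auto
        fix j assume "k \<le> j" "j < r"
        then show "vs[k := e i] ! j \<in> e ` I" using i Suc.prems by (cases "j = k") auto
      qed (use Suc.prems in auto)
      then show "c i * \<omega> (vs[k := e i]) = c i * 0" by simp
    qed
    finally show ?case by simp
  qed
  show ?thesis
  proof (cases "length vs = r \<and> set vs \<subseteq> V")
    case True then show ?thesis using 2[of vs r] by auto
  qed (use alt_forms_zero[OF \<omega>] in blast)
qed

lemma alt_forms_eqI:
  fixes e :: "'i::linorder \<Rightarrow> 'a \<Rightarrow> real"
  assumes "\<omega> \<in> alt_forms r V" "\<eta> \<in> alt_forms r V" and sp: "spans I e V"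
    and basis: "\<And>S. S \<subseteq> I \<Longrightarrow> card S = r \<Longrightarrow> \<omega> (map e (sorted_list_of_set S)) = \<eta> (map e (sorted_list_of_set S))"
  shows "\<omega> = \<eta>"
proof
  fix vs
  have "1 * \<omega> vs + (-1) * \<eta> vs = 0"
    by (rule alt_forms_vanish[OF alt_forms_comb[OF assms(1,2)] sp]) (use basis in auto)
  then show "\<omega> vs = \<eta> vs" by simp
qed

section \<open>Exterior products of covectors as determinants\<close>

lemma shuffle_sign_singleton: "k < r \<Longrightarrow> shuffle_sign r {k} = (- 1) ^ k"
proof -
  assume "k < r"
  then have "{(i, j). i < j \<and> j < r \<and> i \<notin> {k} \<and> j \<in> {k}} = (\<lambda>i. (i, k)) ` {..<k}" by auto
  then show ?thesis unfolding shuffle_sign_def by (simp add: card_image inj_on_def)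
qed

lemma nths_single_index: "k < length vs \<Longrightarrow> nths vs {k} = [vs ! k]"
  by (induction vs arbitrary: k) (auto simp: nths_Cons nth_Cons split: nat.split)

lemma nths_omit: "nths vs (- {k}) = take k vs @ drop (Suc k) vs"
proof (induction vs arbitrary: k)
  case (Cons a vs)
  show ?case
  proof (cases k)
    case 0
    have "{j. Suc j \<in> - {0}} = UNIV" by auto
    then show ?thesis using 0 by (simp add: nths_Cons nths_all)
  next
    case (Suc l)
    have "{j. Suc j \<in> - {Suc l}} = - {l}" by auto
    then show ?thesis using Suc Cons by (simp add: nths_Cons)
  qed
qed simp

text \<open>A 1-form kills every list whose length is not 1, so only the shuffles \<open>{k}\<close>
  survive and the sum becomes a Laplace expansion.\<close>

lemma wedge_one_form:
  "wedge (one_form a) \<nu> vs = (\<Sum>k<length vs. (- 1) ^ k * a (vs ! k) * \<nu> (take k vs @ drop (Suc k) vs))"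
proof -
  let ?n = "length vs"
  let ?t = "\<lambda>S. shuffle_sign ?n S * one_form a (nths vs S) * \<nu> (nths vs (- S))"
  have z: "?t S = 0" if "S \<in> Pow {..<?n} - (\<lambda>k. {k}) ` {..<?n}" for S
  proof -
    have "{i. i < ?n \<and> i \<in> S} = S" using that by auto
    then have "length (nths vs S) = card S" by (simp add: length_nths)
    moreover have "card S \<noteq> 1" using that by (auto simp: card_1_singleton_iff)
    ultimately have "one_form a (nths vs S) = 0" unfolding one_form_def by (auto split: list.split)
    then show ?thesis by simp
  qed
  have "wedge (one_form a) \<nu> vs = sum ?t ((\<lambda>k. {k}) ` {..<?n})"
    unfolding wedge_def by (rule sum.mono_neutral_right) (use z in auto)
  also have "\<dots> = (\<Sum>k<?n. ?t {k})" by (subst sum.reindex) (auto simp: inj_on_def)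
  also have "\<dots> = (\<Sum>k<?n. (- 1) ^ k * a (vs ! k) * \<nu> (take k vs @ drop (Suc k) vs))"
    by (rule sum.cong[OF refl]) (auto simp: shuffle_sign_singleton nths_single_index nths_omit one_form_def)
  finally show ?thesis .
qed

definition pair_mat :: "('b \<Rightarrow> real) list \<Rightarrow> 'b list \<Rightarrow> real mat" where
  "pair_mat as vs = mat (length as) (length as) (\<lambda>(i, j). (as ! i) (vs ! j))"

lemma pair_mat_carrier: "pair_mat as vs \<in> carrier_mat (length as) (length as)"
  by (simp add: pair_mat_def)

text \<open>\<open>wedge_one_form\<close> is the Laplace expansion along the first row, and deleting
  row 0 and column \<open>k\<close> of \<open>pair_mat\<close> leaves the matrix of the shortened
  lists.\<close>

lemma wedge_list_det:
  "wedge_list as vs = (if length vs = length as then Determinant.det (pair_mat as vs) else 0)"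
proof (induction as arbitrary: vs)
  case Nil
  show ?case by (simp add: wedge_list_def unit_form_def pair_mat_def det_dim_zero)
next
  case (Cons a as)
  let ?n = "length as"
  let ?del = "\<lambda>k. take k vs @ drop (Suc k) vs"
  have W: "wedge_list (a # as) vs = (\<Sum>k<length vs. (- 1) ^ k * a (vs ! k) * wedge_list as (?del k))"
    using wedge_one_form[of a "wedge_list as" vs] by (simp add: wedge_list_def)
  show ?case
  proof (cases "length vs = Suc ?n")
    case False
    have "wedge_list as (?del k) = 0" if "k < length vs" for k
      using Cons[of "?del k"] False that by simp
    then show ?thesis using W False by simp
  next
    case True
    have "Determinant.det (pair_mat (a # as) vs) = (\<Sum>j<Suc ?n. pair_mat (a # as) vs $$ (0, j) * cofactor (pair_mat (a # as) vs) 0 j)"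
      by (rule laplace_expansion_row) (use pair_mat_carrier[of "a # as" vs] in auto)
    also have "\<dots> = (\<Sum>k<Suc ?n. (- 1) ^ k * a (vs ! k) * wedge_list as (?del k))"
    proof (rule sum.cong[OF refl])
      fix k assume k: "k \<in> {..<Suc ?n}"
      have "mat_delete (pair_mat (a # as) vs) 0 k = pair_mat as (?del k)"
        using k True by (intro eq_matI) (auto simp: mat_delete_def pair_mat_def nth_append)
      then show "pair_mat (a # as) vs $$ (0, k) * cofactor (pair_mat (a # as) vs) 0 k
         = (- 1) ^ k * a (vs ! k) * wedge_list as (?del k)"
        using k True Cons[of "?del k"] by (simp add: cofactor_def pair_mat_def)
    qed
    finally show ?thesis using W True by simp
  qed
qed

text \<open>Expand along row \<open>k\<close>, whose cofactors do not involve that row. This treats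
  the exterior product as a function of the covectors, the view needed for multivectors, which are
  forms on covectors.\<close>

lemma wedge_list_rows_lin:
  assumes "k < length as"
  shows "wedge_list (as[k := (\<lambda>z. c * a z + d * b z)]) vs = c * wedge_list (as[k := a]) vs + d * wedge_list (as[k := b]) vs"
proof (cases "length vs = length as")
  case True
  let ?n = "length as"
  let ?M = "\<lambda>x. pair_mat (as[k := x]) vs"
  have L: "Determinant.det (?M x) = (\<Sum>j<?n. x (vs ! j) * cofactor (?M x) k j)" for x
    using laplace_expansion_row[of "?M x" ?n k] pair_mat_carrier[of "as[k := x]" vs] assms
    by (simp add: pair_mat_def)
  have "mat_delete (?M x) k j = mat_delete (?M y) k j" for x y j
    by (intro eq_matI) (auto simp: mat_delete_def pair_mat_def)
  then have C: "cofactor (?M x) k j = cofactor (?M a) k j" for x j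
    unfolding cofactor_def by metis
  show ?thesis
    using True unfolding wedge_list_det L C[of b] C[of "\<lambda>z. c * a z + d * b z"]
    by (simp add: sum_distrib_left sum.distrib[symmetric] algebra_simps)
qed (simp add: wedge_list_det)

lemma wedge_list_rows_alt:
  assumes "i < length as" "j < length as" "i \<noteq> j" "as ! i = as ! j"
  shows "wedge_list as vs = 0"
proof -
  have "row (pair_mat as vs) i = row (pair_mat as vs) j"
    using assms by (auto simp: pair_mat_def row_def)
  then have "Determinant.det (pair_mat as vs) = 0"
    by (rule det_identical_rows[OF pair_mat_carrier assms(3,1,2)])
  then show ?thesis by (simp add: wedge_list_det)
qed

text \<open>The value 0 outside \<open>V\<close> matches the convention of
  \<open>cotangent_space\<close>; it makes forms that agree on \<open>V\<close> equal as
  functions.\<close>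

definition linear_form :: "('a \<Rightarrow> real) set \<Rightarrow> (('a \<Rightarrow> real) \<Rightarrow> real) \<Rightarrow> bool" where
  "linear_form V a \<longleftrightarrow> (\<forall>v\<in>V. \<forall>w\<in>V. \<forall>c d. a (\<lambda>z. c * v z + d * w z) = c * a v + d * a w) \<and> (\<forall>v. v \<notin> V \<longrightarrow> a v = 0)"

text \<open>Columns of the matrix correspond to vectors: linearity and the vanishing outside
  \<open>V\<close> follow from expansion along a column, alternation from equal columns.\<close>

lemma wedge_list_alt:
  assumes as: "\<And>a. a \<in> set as \<Longrightarrow> linear_form V a"
  shows "wedge_list as \<in> alt_forms (length as) V"
proof (rule alt_formsI)
  let ?n = "length as"
  have L: "Determinant.det (pair_mat as vs) = (\<Sum>i<?n. (as ! i) (vs ! k) * cofactor (pair_mat as vs) i k)" if "k < ?n" for vs k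
    using laplace_expansion_column[OF pair_mat_carrier that, of vs] that by (simp add: pair_mat_def)
  have asi: "linear_form V (as ! i)" if "i < ?n" for i using as that by auto
  fix vs assume vs: "\<not> (length vs = ?n \<and> set vs \<subseteq> V)"
  show "wedge_list as vs = 0"
  proof (cases "length vs = ?n")
    case True
    then obtain k where k: "k < ?n" "vs ! k \<notin> V" using vs by (auto simp: subset_iff in_set_conv_nth)
    then have "(as ! i) (vs ! k) = 0" if "i < ?n" for i using asi[OF that] unfolding linear_form_def by blast
    then show ?thesis using L[OF k(1), of vs] by (simp add: wedge_list_det)
  qed (simp add: wedge_list_det)
next
  let ?n = "length as"
  have L: "Determinant.det (pair_mat as vs) = (\<Sum>i<?n. (as ! i) (vs ! k) * cofactor (pair_mat as vs) i k)" if "k < ?n" for vs k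
    using laplace_expansion_column[OF pair_mat_carrier that, of vs] that by (simp add: pair_mat_def)
  have asi: "linear_form V (as ! i)" if "i < ?n" for i using as that by auto
  show "multilinear_at ?n V (wedge_list as)" unfolding multilinear_at_def
  proof (intro allI impI)
    fix vs :: "('a \<Rightarrow> real) list" and k v w and c d :: real
    assume H: "length vs = ?n \<and> set vs \<subseteq> V \<and> k < ?n \<and> v \<in> V \<and> w \<in> V"
    let ?M = "\<lambda>x. pair_mat as (vs[k := x])"
    have "mat_delete (?M x) i k = mat_delete (?M y) i k" if "i < ?n" for x y i
      using H that by (intro eq_matI) (auto simp: mat_delete_def pair_mat_def)
    then have C: "cofactor (?M x) i k = cofactor (?M v) i k" if "i < ?n" for x i
      unfolding cofactor_def using that by metis
    have L': "Determinant.det (?M x) = (\<Sum>i<?n. (as ! i) x * cofactor (?M v) i k)" for x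
    proof -
      have "Determinant.det (?M x) = (\<Sum>i<?n. (as ! i) x * cofactor (?M x) i k)"
        using L[of k "vs[k := x]"] H by simp
      also have "\<dots> = (\<Sum>i<?n. (as ! i) x * cofactor (?M v) i k)"
        by (rule sum.cong[OF refl], rule arg_cong2[where f = "(*)", OF refl], rule C) simp
      finally show ?thesis .
    qed
    have lin: "(as ! i) (\<lambda>z. c * v z + d * w z) = c * (as ! i) v + d * (as ! i) w" if "i < ?n" for i
      using asi[OF that] H unfolding linear_form_def by simp
    show "wedge_list as (vs[k := \<lambda>z. c * v z + d * w z]) = c * wedge_list as (vs[k := v]) + d * wedge_list as (vs[k := w])"
      using H lin unfolding wedge_list_det L' by (simp add: sum_distrib_left sum.distrib[symmetric] algebra_simps)
  qed
next
  fix vs :: "('a \<Rightarrow> real) list" and i j 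
  assume H: "length vs = length as" "i < j" "j < length as" "vs ! i = vs ! j"
  have "col (pair_mat as vs) i = col (pair_mat as vs) j"
    using H by (auto simp: pair_mat_def col_def)
  then have "Determinant.det (pair_mat as vs) = 0"
    by (intro det_identical_columns[OF pair_mat_carrier, of i j]) (use H in auto)
  then show "wedge_list as vs = 0" by (simp add: wedge_list_det)
qed

text \<open>For \<open>S = T\<close> the matrix of pairings is the identity. Otherwise, the
  cardinalities being equal, \<open>S\<close> has an element outside \<open>T\<close>, and its row
  is zero.\<close>

lemma wedge_list_dual:
  fixes d :: "'i::linorder \<Rightarrow> 'b \<Rightarrow> real"
  assumes dual: "\<And>i j. i \<in> I \<Longrightarrow> j \<in> I \<Longrightarrow> d i (e j) = (if i = j then 1 else 0)"
    and S: "finite I" "S \<subseteq> I" "T \<subseteq> I" "card S = card T"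
  shows "wedge_list (map d (sorted_list_of_set S)) (map e (sorted_list_of_set T)) = (if S = T then 1 else 0)"
proof -
  let ?s = "sorted_list_of_set S" and ?t = "sorted_list_of_set T"
  let ?n = "card S"
  have fin: "finite S" "finite T" using S by (auto intro: finite_subset)
  have ln: "length ?s = ?n" "length ?t = ?n" using S by auto
  have mem: "?s ! i \<in> S" "?t ! i \<in> T" if "i < ?n" for i
    using nth_mem[of i ?s] nth_mem[of i ?t] that ln fin by auto
  let ?M = "pair_mat (map d ?s) (map e ?t)"
  have M: "?M $$ (i, j) = (if ?s ! i = ?t ! j then 1 else 0)" if "i < ?n" "j < ?n" for i j
  proof -
    have "?s ! i \<in> I" "?t ! j \<in> I" using mem that S by blast+
    then show ?thesis using that ln dual[of "?s ! i" "?t ! j"] S by (simp add: pair_mat_def)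
  qed
  have car: "?M \<in> carrier_mat ?n ?n" using pair_mat_carrier[of "map d ?s" "map e ?t"] ln by simp
  have W: "wedge_list (map d ?s) (map e ?t) = Determinant.det ?M" using ln S by (simp add: wedge_list_det)
  show ?thesis
  proof (cases "S = T")
    case True
    have "?M = 1\<^sub>m ?n"
    proof (rule eq_matI)
      fix i j assume "i < dim_row (1\<^sub>m ?n :: real mat)" "j < dim_col (1\<^sub>m ?n :: real mat)"
      then show "?M $$ (i, j) = 1\<^sub>m ?n $$ (i, j)"
        using M[of i j] True ln nth_eq_iff_index_eq[of ?s i j] by auto
    qed (use car in auto)
    then show ?thesis using W True by simp
  next
    case False
    then have "\<not> S \<subseteq> T" using S fin card_subset_eq[of T S] by auto
    then obtain i where i: "i < ?n" "?s ! i \<notin> T" using fin ln by (metis subsetI in_set_conv_nth set_sorted_list_of_set)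
    have "Determinant.det ?M = (\<Sum>j<?n. ?M $$ (i, j) * cofactor ?M i j)" by (rule laplace_expansion_row[OF car i(1)])
    also have "\<dots> = 0" 
    proof (rule sum.neutral, rule ballI)
      fix j assume "j \<in> {..<?n}"
      then have j: "j < ?n" by simp
      have "?s ! i \<noteq> ?t ! j" using mem(2)[OF j] i(2) by metis
      then show "?M $$ (i, j) * cofactor ?M i j = 0" using M[OF i(1) j] by simp
    qed
    finally show ?thesis using W False by simp
  qed
qed

definition subsets_of_card :: "'i set \<Rightarrow> nat \<Rightarrow> 'i set set" where
  "subsets_of_card I r = {S. S \<subseteq> I \<and> card S = r}"

lemma finite_subsets_of_card: "finite I \<Longrightarrow> finite (subsets_of_card I r)"
  unfolding subsets_of_card_def by (rule finite_subset[of _ "Pow I"]) auto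

text \<open>Any values on the sorted basis lists are attained; this gives surjectivity of the fibre
  coordinates of \<open>ext_bundle\<close>.\<close>

lemma alt_form_from_coeffs:
  fixes d :: "'i::linorder \<Rightarrow> ('a \<Rightarrow> real) \<Rightarrow> real" and c :: "'i set \<Rightarrow> real" and r :: nat
  assumes "finite I" and d: "\<And>i. i \<in> I \<Longrightarrow> linear_form V (d i)"
    and dual: "\<And>i j. i \<in> I \<Longrightarrow> j \<in> I \<Longrightarrow> d i (e j) = (if i = j then 1 else 0)"
  defines "\<omega> \<equiv> \<lambda>vs. \<Sum>S\<in>subsets_of_card I r. c S * wedge_list (map d (sorted_list_of_set S)) vs"
  shows "\<omega> \<in> alt_forms r V"
    and "T \<in> subsets_of_card I r \<Longrightarrow> \<omega> (map e (sorted_list_of_set T)) = c T"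
proof -
  have "wedge_list (map d (sorted_list_of_set S)) \<in> alt_forms r V" if "S \<in> subsets_of_card I r" for S
  proof -
    have "finite S" using that assms(1) by (auto simp: subsets_of_card_def intro: finite_subset)
    then show ?thesis
      using wedge_list_alt[of "map d (sorted_list_of_set S)" V] d that by (auto simp: subsets_of_card_def)
  qed
  then show "\<omega> \<in> alt_forms r V" unfolding \<omega>_def
    by (intro lin_closed_sum[OF lin_closed_alt_forms] finite_subsets_of_card assms(1))
  assume T: "T \<in> subsets_of_card I r"
  have "\<omega> (map e (sorted_list_of_set T)) = (\<Sum>S\<in>subsets_of_card I r. c S * (if S = T then 1 else 0))"
    unfolding \<omega>_def
    by (rule sum.cong[OF refl]) (use wedge_list_dual[where d = d and e = e, OF dual assms(1), of _ T] T in \<open>auto simp: subsets_of_card_def\<close>)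
  also have "\<dots> = (\<Sum>S\<in>subsets_of_card I r. if S = T then c S else 0)" by (rule sum.cong) auto
  also have "\<dots> = c T" using T finite_subsets_of_card[OF assms(1)] by (simp add: sum.delta)
  finally show "\<omega> (map e (sorted_list_of_set T)) = c T" .
qed

lemma alt_form_expansion:
  fixes d :: "'i::linorder \<Rightarrow> ('a \<Rightarrow> real) \<Rightarrow> real"
  assumes sp: "spans I e V" and d: "\<And>i. i \<in> I \<Longrightarrow> linear_form V (d i)"
    and dual: "\<And>i j. i \<in> I \<Longrightarrow> j \<in> I \<Longrightarrow> d i (e j) = (if i = j then 1 else 0)"
    and \<omega>: "\<omega> \<in> alt_forms r V"
  shows "\<omega> = (\<lambda>vs. \<Sum>S\<in>subsets_of_card I r. \<omega> (map e (sorted_list_of_set S)) * wedge_list (map d (sorted_list_of_set S)) vs)"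
proof (rule alt_forms_eqI[OF \<omega> _ sp])
  have fin: "finite I" using sp by (simp add: spans_def)
  note * = alt_form_from_coeffs[OF fin d dual, where c = "\<lambda>S. \<omega> (map e (sorted_list_of_set S))" and r = r]
  show "(\<lambda>vs. \<Sum>S\<in>subsets_of_card I r. \<omega> (map e (sorted_list_of_set S)) * wedge_list (map d (sorted_list_of_set S)) vs) \<in> alt_forms r V"
    using *(1) .
  show "\<omega> (map e (sorted_list_of_set T)) = (\<Sum>S\<in>subsets_of_card I r. \<omega> (map e (sorted_list_of_set S)) * wedge_list (map d (sorted_list_of_set S)) (map e (sorted_list_of_set T)))"
    if "T \<subseteq> I" "card T = r" for T
    using *(2)[of T] that by (simp add: subsets_of_card_def)
qed

text \<open>The expansion of a form on covectors. Its basis forms evaluate the exterior product of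
  the arguments on the sorted lists of the \<open>e i\<close>, which here are mere points where the
  members of \<open>W\<close> can be evaluated.\<close>

lemma alt_form_expansion_dual:
  fixes d :: "'i::linorder \<Rightarrow> 'b \<Rightarrow> real"
  assumes sp: "spans I d W" and dual: "\<And>i j. i \<in> I \<Longrightarrow> j \<in> I \<Longrightarrow> d i (e j) = (if i = j then 1 else 0)"
    and X: "X \<in> alt_forms r W" and as: "length as = r" "set as \<subseteq> W"
  shows "X as = (\<Sum>S\<in>subsets_of_card I r. X (map d (sorted_list_of_set S)) * wedge_list as (map e (sorted_list_of_set S)))"
proof -
  have fin: "finite I" using sp by (simp add: spans_def)
  \<comment> \<open>Cut off outside lists of length \<open>r\<close> in \<open>W\<close>, so that it
    meets the support condition of \<open>alt_forms\<close>.\<close>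
  define R where "R S = (\<lambda>as. if length as = r \<and> set as \<subseteq> W then wedge_list as (map e (sorted_list_of_set S)) else 0)" for S
  have upd: "set (as[k := x]) \<subseteq> W" if "set as \<subseteq> W" "x \<in> W" for as :: "('b \<Rightarrow> real) list" and k x
    using that by (rule set_update_subsetI)
  have W: "lin_closed W" using sp by (simp add: spans_def)
  have "R S \<in> alt_forms r W" for S
  proof (rule alt_formsI)
    show "multilinear_at r W (R S)" unfolding multilinear_at_def R_def
      using lin_closed_comb[OF W] by (auto simp: upd wedge_list_rows_lin)
  next
    fix as :: "('b \<Rightarrow> real) list" and i j assume "length as = r" "i < j" "j < r" "as ! i = as ! j"
    then show "R S as = 0" using wedge_list_rows_alt[of i as j] by (simp add: R_def)
  qed (auto simp: R_def)
  then have *: "(\<lambda>as. \<Sum>S\<in>subsets_of_card I r. X (map d (sorted_list_of_set S)) * R S as) \<in> alt_forms r W"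
    by (intro lin_closed_sum[OF lin_closed_alt_forms] finite_subsets_of_card fin)
  have "X = (\<lambda>as. \<Sum>S\<in>subsets_of_card I r. X (map d (sorted_list_of_set S)) * R S as)"
  proof (rule alt_forms_eqI[OF X * sp])
    fix T assume T: "T \<subseteq> I" "card T = r"
    have "finite T" using T fin finite_subset by blast
    then have "R S (map d (sorted_list_of_set T)) = (if S = T then 1 else 0)" if "S \<in> subsets_of_card I r" for S
      unfolding R_def using wedge_list_dual[where d = d and e = e, OF dual fin, of T S] T that sp by (auto simp: subsets_of_card_def spans_def)
    then have "(\<Sum>S\<in>subsets_of_card I r. X (map d (sorted_list_of_set S)) * R S (map d (sorted_list_of_set T)))
      = (\<Sum>S\<in>subsets_of_card I r. if S = T then X (map d (sorted_list_of_set S)) else 0)"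
      by (intro sum.cong) auto
    also have "\<dots> = X (map d (sorted_list_of_set T))" 
      using T finite_subsets_of_card[OF fin, of r] by (simp add: sum.delta subsets_of_card_def)
    finally show "X (map d (sorted_list_of_set T)) = (\<Sum>S\<in>subsets_of_card I r. X (map d (sorted_list_of_set S)) * R S (map d (sorted_list_of_set T)))" by simp
  qed
  then have "X as = (\<Sum>S\<in>subsets_of_card I r. X (map d (sorted_list_of_set S)) * R S as)" by metis
  then show ?thesis using as by (simp add: R_def)
qed

section \<open>The derivative of an exterior product\<close>

definition det_deriv :: "nat \<Rightarrow> (nat \<Rightarrow> nat \<Rightarrow> real) \<Rightarrow> (nat \<Rightarrow> nat \<Rightarrow> real) \<Rightarrow> real" where
  "det_deriv r A E = (\<Sum>p | p permutes {0..<r}. signof p * (\<Sum>i=0..<r. E i (p i) * (\<Prod>j\<in>{0..<r} - {i}. A j (p j))))"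

text \<open>Product rule in the Leibniz formula for determinants. The result depends only on the
  entries \<open>A\<close> at \<open>t0\<close> and their derivatives \<open>E\<close>; this is what
  makes the velocity of a wedge of curves a function of the velocities of its factors.\<close>

lemma wedge_list_has_deriv:
  assumes len: "\<And>t. length (as t) = r" "\<And>t. length (vs t) = r"
    and der: "\<And>i j. i < r \<Longrightarrow> j < r \<Longrightarrow> ((\<lambda>t. (as t ! i) (vs t ! j)) has_real_derivative E i j) (at t0)"
    and A: "\<And>i j. i < r \<Longrightarrow> j < r \<Longrightarrow> (as t0 ! i) (vs t0 ! j) = A i j"
  shows "((\<lambda>t. wedge_list (as t) (vs t)) has_real_derivative det_deriv r A E) (at t0)"
proof -
  have W: "wedge_list (as t) (vs t) = (\<Sum>p | p permutes {0..<r}. signof p * (\<Prod>i=0..<r. (as t ! i) (vs t ! p i)))" for t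
  proof -
    have "wedge_list (as t) (vs t) = Determinant.det (pair_mat (as t) (vs t))" using len by (simp add: wedge_list_det)
    also have "\<dots> = (\<Sum>p | p permutes {0..<r}. signof p * (\<Prod>i=0..<r. pair_mat (as t) (vs t) $$ (i, p i)))"
      using det_def'[of "pair_mat (as t) (vs t)" r] pair_mat_carrier[of "as t" "vs t"] len by simp
    also have "\<dots> = (\<Sum>p | p permutes {0..<r}. signof p * (\<Prod>i=0..<r. (as t ! i) (vs t ! p i)))"
    proof (rule sum.cong[OF refl])
      fix p assume "p \<in> {p. p permutes {0..<r}}"
      then have "p i < r" if "i < r" for i using permutes_in_image[of p "{0..<r}" i] that by simp
      then have "(\<Prod>i=0..<r. pair_mat (as t) (vs t) $$ (i, p i)) = (\<Prod>i=0..<r. (as t ! i) (vs t ! p i))"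
        using len by (intro prod.cong) (auto simp: pair_mat_def)
      then show "signof p * (\<Prod>i=0..<r. pair_mat (as t) (vs t) $$ (i, p i)) = signof p * (\<Prod>i=0..<r. (as t ! i) (vs t ! p i))" by simp
    qed
    finally show ?thesis .
  qed
  show ?thesis unfolding W det_deriv_def
  proof (rule DERIV_sum, rule DERIV_cmult)
    fix p assume "p \<in> {p. p permutes {0..<r}}"
    then have p: "p i < r" if "i < r" for i using permutes_in_image[of p "{0..<r}" i] that by simp
    have "((\<lambda>t. \<Prod>i=0..<r. (as t ! i) (vs t ! p i)) has_real_derivative 
       (\<Sum>i\<in>{0..<r}. E i (p i) * (\<Prod>j\<in>{0..<r} - {i}. (as t0 ! j) (vs t0 ! p j)))) (at t0)"
      by (rule has_field_derivative_prod) (use der p in auto)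
    moreover have "(\<Sum>i\<in>{0..<r}. E i (p i) * (\<Prod>j\<in>{0..<r} - {i}. (as t0 ! j) (vs t0 ! p j)))
      = (\<Sum>i=0..<r. E i (p i) * (\<Prod>j\<in>{0..<r} - {i}. A j (p j)))"
      using A p by (intro sum.cong prod.cong arg_cong2[where f = "(*)"] refl) auto
    ultimately show "((\<lambda>t. \<Prod>i=0..<r. (as t ! i) (vs t ! p i)) has_real_derivative 
       (\<Sum>i=0..<r. E i (p i) * (\<Prod>j\<in>{0..<r} - {i}. A j (p j)))) (at t0)" by simp
  qed
qed

section \<open>Exterior products of alternating forms\<close>

lemma nths_update_mem:
  assumes "k < length vs" "k \<in> S"
  shows "\<exists>m<length (nths vs S). \<forall>v. nths (vs[k := v]) S = (nths vs S)[m := v]"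
  using assms
proof (induction vs arbitrary: k S)
  case (Cons a vs)
  show ?case
  proof (cases k)
    case 0
    then show ?thesis using Cons.prems by (intro exI[of _ 0]) (auto simp: nths_Cons)
  next
    case (Suc l)
    obtain m where m: "m < length (nths vs {j. Suc j \<in> S})" "\<forall>v. nths (vs[l := v]) {j. Suc j \<in> S} = (nths vs {j. Suc j \<in> S})[m := v]"
      using Cons.IH[of l "{j. Suc j \<in> S}"] Cons.prems Suc by auto
    show ?thesis
      by (rule exI[of _ "if 0 \<in> S then Suc m else m"]) (use m Suc in \<open>auto simp: nths_Cons\<close>)
  qed
qed simp

lemma nths_update_notin: "k \<notin> S \<Longrightarrow> nths (vs[k := v]) S = nths vs S"
proof (induction vs arbitrary: k S)
  case (Cons a vs)
  then show ?case by (cases k) (auto simp: nths_Cons)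
qed simp

lemma nths_cong: "(\<And>i. i < length vs \<Longrightarrow> i \<in> S \<longleftrightarrow> i \<in> T) \<Longrightarrow> nths vs S = nths vs T"
  unfolding nths_def by (rule arg_cong[where f = "map fst"], rule filter_cong[OF refl]) (auto simp: set_zip)

lemma length_nths_compl: "length (nths vs S) + length (nths vs (- S)) = length vs"
proof -
  have "{..<length vs} = {i. i < length vs \<and> i \<in> S} \<union> {i. i < length vs \<and> i \<in> - S}" by auto
  then have "length vs = card ({i. i < length vs \<and> i \<in> S} \<union> {i. i < length vs \<and> i \<in> - S})" 
    by (metis card_lessThan)
  also have "\<dots> = card {i. i < length vs \<and> i \<in> S} + card {i. i < length vs \<and> i \<in> - S}"
    by (rule card_Un_disjoint) auto
  finally show ?thesis by (simp add: length_nths)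
qed

text \<open>Moving the element \<open>k\<close> of \<open>S\<close> to \<open>k + 1\<close> creates
  the single new inversion \<open>(k, k + 1)\<close>; the transposition carries the old inversions
  bijectively to the remaining ones.\<close>

lemma shuffle_sign_swap:
  assumes k: "Suc k < n" and S: "k \<in> S" "Suc k \<notin> S"
  shows "shuffle_sign n (Transposition.transpose k (Suc k) ` S) = - shuffle_sign n S"
proof -
  let ?t = "Transposition.transpose k (Suc k)"
  let ?I = "\<lambda>S. {(i, j). i < j \<and> j < n \<and> i \<notin> S \<and> j \<in> S}"
  have mem: "x \<in> ?t ` S \<longleftrightarrow> ?t x \<in> S" for x
    by (metis image_eqI transpose_involutory imageE)
  have fin: "finite (?I S)" by (rule finite_subset[of _ "{..<n} \<times> {..<n}"]) auto
  have eq: "?I (?t ` S) = insert (k, Suc k) (map_prod ?t ?t ` ?I S)"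
  proof (intro equalityI subsetI)
    fix p assume "p \<in> ?I (?t ` S)"
    then obtain i j where p: "p = (i, j)" "i < j" "j < n" "?t i \<notin> S" "?t j \<in> S" using mem by auto
    show "p \<in> insert (k, Suc k) (map_prod ?t ?t ` ?I S)"
    proof (cases "i = k \<and> j = Suc k")
      case False
      then have "?t i < ?t j" "?t j < n" using p(2,3) k by (auto simp: Transposition.transpose_def)
      then have "(?t i, ?t j) \<in> ?I S" using p by auto
      then have "map_prod ?t ?t (?t i, ?t j) \<in> map_prod ?t ?t ` ?I S" by (rule imageI)
      then show ?thesis using p by simp
    qed (use p in auto)
  next
    fix p assume "p \<in> insert (k, Suc k) (map_prod ?t ?t ` ?I S)"
    then consider "p = (k, Suc k)" | i j where "p = (?t i, ?t j)" "i < j" "j < n" "i \<notin> S" "j \<in> S" by auto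
    then show "p \<in> ?I (?t ` S)"
    proof cases
      case 1 then show ?thesis using mem S k by auto
    next
      case 2
      then have "\<not> (i = k \<and> j = Suc k)" using S by auto
      then have "?t i < ?t j" "?t j < n" using 2 k by (auto simp: Transposition.transpose_def)
      then show ?thesis using 2 mem by auto
    qed
  qed
  have inj: "inj (map_prod ?t ?t)" by (intro prod.inj_map) auto
  have "(k, Suc k) \<notin> map_prod ?t ?t ` ?I S"
    using k by (auto simp: Transposition.transpose_def split: if_splits)
  then have "card (?I (?t ` S)) = Suc (card (?I S))"
    unfolding eq using fin card_image[OF inj_on_subset[OF inj subset_UNIV], of "?I S"] by simp
  then show ?thesis by (simp add: shuffle_sign_def)
qed

text \<open>If the arguments at \<open>k\<close> and \<open>k + 1\<close> agree, the shuffles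
  \<open>S\<close> containing exactly one of the two positions cancel against their images under the
  transposition, and all others put two equal arguments into the same factor.\<close>

lemma wedge_alt_forms:
  assumes V: "lin_closed V" and \<mu>: "\<mu> \<in> alt_forms p V" and \<nu>: "\<nu> \<in> alt_forms q V"
  shows "wedge \<mu> \<nu> \<in> alt_forms (p + q) V"
proof (rule alt_forms_adjacentI[OF V])
  fix vs :: "('a \<Rightarrow> real) list" assume vs: "\<not> (length vs = p + q \<and> set vs \<subseteq> V)"
  have "\<mu> (nths vs S) * \<nu> (nths vs (- S)) = 0" for S
  proof (rule ccontr)
    assume "\<not> ?thesis"
    then have "length (nths vs S) = p" "set (nths vs S) \<subseteq> V" "length (nths vs (- S)) = q" "set (nths vs (- S)) \<subseteq> V"
      using alt_forms_zero[OF \<mu>, of "nths vs S"] alt_forms_zero[OF \<nu>, of "nths vs (- S)"] by auto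
    then have "length vs = p + q" "set vs \<subseteq> V"
      using length_nths_compl[of vs S] by (auto simp: set_nths in_set_conv_nth) blast
    then show False using vs by simp
  qed
  then show "wedge \<mu> \<nu> vs = 0" unfolding wedge_def by (intro sum.neutral) (simp only: mult.assoc mult_zero_right, simp)
next
  show "multilinear_at (p + q) V (wedge \<mu> \<nu>)" unfolding multilinear_at_def
  proof (intro allI impI)
    fix vs :: "('a \<Rightarrow> real) list" and k v w and c d :: real
    assume H: "length vs = p + q \<and> set vs \<subseteq> V \<and> k < p + q \<and> v \<in> V \<and> w \<in> V"
    let ?u = "\<lambda>z. c * v z + d * w z"
    have uV: "?u \<in> V" using H lin_closed_comb[OF V] by blast
    have lin: "\<omega> ((nths vs S)[m := ?u]) = c * \<omega> ((nths vs S)[m := v]) + d * \<omega> ((nths vs S)[m := w])"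
      if "\<omega> \<in> alt_forms r V" "m < length (nths vs S)" for \<omega> r m S
    proof (cases "length (nths vs S) = r")
      case True
      then show ?thesis
        using multilinear_atD[OF alt_forms_lin[OF that(1)]] that H set_nths_subset[of vs S] by blast
    next
      case False
      then show ?thesis using alt_forms_zero[OF that(1)] by simp
    qed
    have "\<mu> (nths (vs[k := ?u]) S) * \<nu> (nths (vs[k := ?u]) (- S))
      = c * (\<mu> (nths (vs[k := v]) S) * \<nu> (nths (vs[k := v]) (- S))) + d * (\<mu> (nths (vs[k := w]) S) * \<nu> (nths (vs[k := w]) (- S)))" for S
    proof (cases "k \<in> S")
      case True
      \<comment> \<open>The slot \<open>m\<close> of the sublist does not depend on the inserted
        vector, so linearity in slot \<open>k\<close> is linearity of \<mu> in slot
        \<open>m\<close>.\<close>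
      obtain m where m: "m < length (nths vs S)" "\<forall>v. nths (vs[k := v]) S = (nths vs S)[m := v]"
        using nths_update_mem[of k vs S] H True by auto
      show ?thesis using lin[OF \<mu> m(1)] True by (simp add: m(2) nths_update_notin algebra_simps)
    next
      case False
      obtain m where m: "m < length (nths vs (- S))" "\<forall>v. nths (vs[k := v]) (- S) = (nths vs (- S))[m := v]"
        using nths_update_mem[of k vs "- S"] H False by auto
      show ?thesis using lin[OF \<nu> m(1)] False by (simp add: m(2) nths_update_notin algebra_simps)
    qed
    then show "wedge \<mu> \<nu> (vs[k := ?u]) = c * wedge \<mu> \<nu> (vs[k := v]) + d * wedge \<mu> \<nu> (vs[k := w])"
      unfolding wedge_def by (simp add: mult.assoc sum_distrib_left sum.distrib[symmetric] algebra_simps)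
  qed
next
  fix vs :: "('a \<Rightarrow> real) list" and k
  assume vs: "length vs = p + q" "set vs \<subseteq> V" "Suc k < p + q" "vs ! k = vs ! Suc k"
  let ?n = "length vs" and ?t = "Transposition.transpose k (Suc k)"
  let ?f = "\<lambda>S. shuffle_sign ?n S * \<mu> (nths vs S) * \<nu> (nths vs (- S))"
  define xs x ys where "xs = take k vs" and "x = vs ! k" and "ys = drop (Suc (Suc k)) vs"
  have kn: "Suc k < ?n" using vs by simp
  have dec: "vs = xs @ [x, x] @ ys" and lx: "length xs = k"
    using kn vs(4) id_take_nth_drop[of k vs] Cons_nth_drop_Suc[of "Suc k" vs]
    by (simp_all add: xs_def x_def ys_def)
  \<comment> \<open>The sublist split at the two equal entries: its middle part only records how
    many of the positions \<open>k\<close> and \<open>k + 1\<close> belong to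
    \<open>S\<close>.\<close>
  have nd: "nths vs S = nths xs S @ (if k \<in> S then [x] else []) @ (if Suc k \<in> S then [x] else []) @ nths ys {j. j + Suc (Suc k) \<in> S}" for S
    unfolding dec nths_append nths_Cons by (simp add: lx add.commute)
  have mem: "i \<in> ?t ` S \<longleftrightarrow> ?t i \<in> S" for i S
    by (metis image_eqI transpose_involutory imageE)
  have dup: "\<omega> (nths vs S) = 0" if "\<omega> \<in> alt_forms r V" "k \<in> S" "Suc k \<in> S" for \<omega> r S
  proof (cases "length (nths vs S) = r")
    case True
    let ?l = "length (nths xs S)"
    have "?l \<noteq> Suc ?l" "?l < r" "Suc ?l < r" "nths vs S ! ?l = nths vs S ! Suc ?l"
      using True that unfolding nd by (auto simp: nth_append)
    then show ?thesis using alt_forms_alt[OF that(1) True] by blast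
  next
    case False then show ?thesis using alt_forms_zero[OF that(1)] by blast
  qed
  have one: "?f (?t ` S) = - ?f S" if S: "k \<in> S" "Suc k \<notin> S" for S
  proof -
    have xsS: "nths xs (?t ` S) = nths xs S" "nths xs (- (?t ` S)) = nths xs (- S)"
      by (intro nths_cong; use lx mem in \<open>auto simp: Transposition.transpose_def\<close>)+
    have ysS: "{j. j + Suc (Suc k) \<in> ?t ` S} = {j. j + Suc (Suc k) \<in> S}" "{j. j + Suc (Suc k) \<in> - (?t ` S)} = {j. j + Suc (Suc k) \<in> - S}"
      by (auto simp: mem Transposition.transpose_def)
    have "nths vs (?t ` S) = nths vs S" "nths vs (- (?t ` S)) = nths vs (- S)"
      unfolding nd[of "?t ` S"] nd[of S] nd[of "- (?t ` S)"] nd[of "- S"] xsS ysS using S mem by auto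
    then show ?thesis using shuffle_sign_swap[OF kn S] by simp
  qed
  have inv: "?t ` ?t ` S = S" for S by (auto simp: image_image)
  \<comment> \<open>The second case reduces to the first because the transposition is an involution;
    in the last two cases both sides are 0. Reindexing by the involution then makes the whole sum
    equal to its negative.\<close>
  have neg: "?f (?t ` S) = - ?f S" for S
  proof -
    consider "k \<in> S" "Suc k \<notin> S" | "k \<notin> S" "Suc k \<in> S" | "k \<in> S" "Suc k \<in> S" | "k \<notin> S" "Suc k \<notin> S" by blast
    then show ?thesis
    proof cases
      case 1 then show ?thesis by (rule one)
    next
      case 2
      then have "?f (?t ` ?t ` S) = - ?f (?t ` S)" using mem by (intro one) auto
      then show ?thesis unfolding inv by simp
    next
      case 3
      then show ?thesis using dup[OF \<mu>, of S] dup[OF \<mu>, of "?t ` S"] mem by simp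
    next
      case 4
      then show ?thesis using dup[OF \<nu>, of "- S"] dup[OF \<nu>, of "- (?t ` S)"] mem by simp
    qed
  qed
  have "bij_betw ((`) ?t) (Pow {..<?n}) (Pow {..<?n})"
  proof (rule bij_betwI[where g = "(`) ?t"])
    show "(`) ?t \<in> Pow {..<?n} \<rightarrow> Pow {..<?n}" using kn by (auto simp: Transposition.transpose_def)
    then show "(`) ?t \<in> Pow {..<?n} \<rightarrow> Pow {..<?n}" .
  qed (use inv in auto)
  then have "sum ?f (Pow {..<?n}) = (\<Sum>S\<in>Pow {..<?n}. ?f (?t ` S))"
    by (rule sum.reindex_bij_betw[symmetric])
  also have "\<dots> = - sum ?f (Pow {..<?n})" unfolding neg by (simp add: sum_negf)
  finally show "wedge \<mu> \<nu> vs = 0" unfolding wedge_def by simp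
qed


section \<open>Tangent and cotangent spaces in charts\<close>

lemma linear_formD:
  "linear_form V a \<Longrightarrow> v \<in> V \<Longrightarrow> w \<in> V \<Longrightarrow> a (\<lambda>z. c * v z + d * w z) = c * a v + d * a w"
  unfolding linear_form_def by simp

lemma linear_form_outside: "linear_form V a \<Longrightarrow> v \<notin> V \<Longrightarrow> a v = 0"
  unfolding linear_form_def by blast

lemma linear_form_sum:
  assumes V: "lin_closed V" and a: "linear_form V a" and J: "finite J" "\<And>j. j \<in> J \<Longrightarrow> e j \<in> V"
  shows "a (\<lambda>z. \<Sum>j\<in>J. b j * e j z) = (\<Sum>j\<in>J. b j * a (e j))"
  using J
proof (induction J)
  case empty
  have z: "(\<lambda>_. 0) \<in> V" using V by (simp add: lin_closed_def)
  then show ?case using linear_formD[OF a z z, of 0 0] by simp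
next
  case (insert j J)
  have m: "(\<lambda>z. \<Sum>j\<in>J. b j * e j z) \<in> V" using lin_closed_sum[OF V] insert by auto
  have ej: "e j \<in> V" using insert by simp
  show ?case using linear_formD[OF a ej m, of "b j" 1] insert by simp
qed

text \<open>What holds before any smoothness of coordinate changes: topology, velocities and the
  chain rule in a single chart. The exterior bundle is handled at this level.\<close>

locale wcharted =
  fixes M :: "('m, 'i) manifold"
  assumes finite_idx: "finite (idx M)"
    and cover: "(\<Union>c\<in>atlas M. fst c) = pts M"
    and chart_inj: "\<And>c. c \<in> atlas M \<Longrightarrow> inj_on (snd c) (fst c)"
    and chart_img: "\<And>c. c \<in> atlas M \<Longrightarrow> coord_open (idx M) (snd c ` fst c)"
begin

lemma istopology_mtopology:
  "istopology (\<lambda>W. W \<subseteq> pts M \<and> (\<forall>c\<in>atlas M. coord_open (idx M) (snd c ` (fst c \<inter> W))))"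
  unfolding istopology_def
proof (intro conjI allI impI)
  fix S T assume S: "S \<subseteq> pts M \<and> (\<forall>c\<in>atlas M. coord_open (idx M) (snd c ` (fst c \<inter> S)))"
    and T: "T \<subseteq> pts M \<and> (\<forall>c\<in>atlas M. coord_open (idx M) (snd c ` (fst c \<inter> T)))"
  show "S \<inter> T \<subseteq> pts M" using S by blast
  show "\<forall>c\<in>atlas M. coord_open (idx M) (snd c ` (fst c \<inter> (S \<inter> T)))"
  proof
    fix c assume c: "c \<in> atlas M"
    have "snd c ` (fst c \<inter> (S \<inter> T)) = snd c ` (fst c \<inter> S) \<inter> snd c ` (fst c \<inter> T)"
      using inj_on_image_Int[OF chart_inj[OF c], of "fst c \<inter> S" "fst c \<inter> T"] by (simp add: Int_ac)
    then show "coord_open (idx M) (snd c ` (fst c \<inter> (S \<inter> T)))" using S T c coord_open_Int by metis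
  qed
next
  fix K assume K: "\<forall>S\<in>K. S \<subseteq> pts M \<and> (\<forall>c\<in>atlas M. coord_open (idx M) (snd c ` (fst c \<inter> S)))"
  then show "\<Union> K \<subseteq> pts M" by blast
  show "\<forall>c\<in>atlas M. coord_open (idx M) (snd c ` (fst c \<inter> \<Union> K))"
  proof
    fix c assume c: "c \<in> atlas M"
    have "snd c ` (fst c \<inter> \<Union> K) = \<Union> ((\<lambda>S. snd c ` (fst c \<inter> S)) ` K)" by auto
    then show "coord_open (idx M) (snd c ` (fst c \<inter> \<Union> K))"
      using K c unfolding coord_open_def by (auto intro!: openin_Union)
  qed
qed

lemma openin_mtopology:
  "openin (mtopology M) W \<longleftrightarrow> W \<subseteq> pts M \<and> (\<forall>c\<in>atlas M. coord_open (idx M) (snd c ` (fst c \<inter> W)))"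
  unfolding mtopology_def topology_inverse'[OF istopology_mtopology] ..

lemma chart_sub: "c \<in> atlas M \<Longrightarrow> fst c \<subseteq> pts M"
  using cover by blast

lemma openin_pts: "openin (mtopology M) (pts M)"
  unfolding openin_mtopology using chart_img chart_sub by (auto simp: Int_absorb2)

lemma chart_at_exists: "p \<in> pts M \<Longrightarrow> \<exists>c\<in>atlas M. p \<in> fst c"
  using cover by blast

lemma chart_inv_left: "c \<in> atlas M \<Longrightarrow> p \<in> fst c \<Longrightarrow> chart_inv c (snd c p) = p"
  unfolding chart_inv_def using chart_inj by simp

lemma chart_inv_right:
  assumes "u \<in> snd c ` fst c" shows "snd c (chart_inv c u) = u" "chart_inv c u \<in> fst c"
  using assms by (simp_all add: chart_inv_def f_inv_into_f inv_into_into)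

lemma coords_in: "c \<in> atlas M \<Longrightarrow> p \<in> fst c \<Longrightarrow> snd c p \<in> coord_space (idx M)"
  using coord_open_sub[OF chart_img] by blast

lemma smooth_atD:
  assumes "smooth_at M p f" "c \<in> atlas M" "p \<in> fst c"
  obtains A where "coord_open (idx M) A" "A \<subseteq> snd c ` fst c" "snd c p \<in> A" "smooth_on (idx M) A (\<lambda>u. f (chart_inv c u))"
proof -
  obtain W where W: "p \<in> W" "smooth_fun_on M W f" using assms by (auto simp: smooth_at_def)
  show thesis
    by (rule that[of "snd c ` (fst c \<inter> W)"]) (use W assms in \<open>auto simp: smooth_fun_on_def openin_mtopology\<close>)
qed

text \<open>Mere differentiability at 0 of the chart components, with \<open>a\<close> the vector of
  derivatives. A wedge of curves can so be treated without establishing that it is a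
  \<open>smooth_curve\<close>.\<close>

definition curve_at :: "('m, 'i) chart \<Rightarrow> (real \<Rightarrow> 'm) \<Rightarrow> ('i \<Rightarrow> real) \<Rightarrow> bool" where
  "curve_at c \<gamma> a \<longleftrightarrow> (\<forall>\<^sub>F t in nhds 0. \<gamma> t \<in> fst c) \<and>
     (\<forall>i\<in>idx M. ((\<lambda>t. snd c (\<gamma> t) i) has_real_derivative a i) (at 0))"

lemma curve_at_mem: "curve_at c \<gamma> a \<Longrightarrow> \<gamma> 0 \<in> fst c"
  unfolding curve_at_def by (auto dest: eventually_nhds_x_imp_x)

lemma curve_at_deriv:
  assumes c: "c \<in> atlas M" and cu: "curve_at c \<gamma> a" and f: "smooth_at M (\<gamma> 0) f"
  shows "((\<lambda>t. f (\<gamma> t)) has_real_derivative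
    (\<Sum>i\<in>idx M. pderiv_at i (\<lambda>u. f (chart_inv c u)) (snd c (\<gamma> 0)) * a i)) (at 0)"
proof -
  have p: "\<gamma> 0 \<in> fst c" using cu by (rule curve_at_mem)
  obtain A where A: "coord_open (idx M) A" "A \<subseteq> snd c ` fst c" "snd c (\<gamma> 0) \<in> A" "smooth_on (idx M) A (\<lambda>u. f (chart_inv c u))"
    by (rule smooth_atD[OF f c p])
  have ev: "\<forall>\<^sub>F t in nhds 0. \<gamma> t \<in> fst c" using cu by (simp add: curve_at_def)
  have D: "((\<lambda>t. f (chart_inv c (snd c (\<gamma> t)))) has_real_derivative
    (\<Sum>i\<in>idx M. pderiv_at i (\<lambda>u. f (chart_inv c u)) (snd c (\<gamma> 0)) * a i)) (at 0)"
  proof (rule chain_rule[OF finite_idx A(1), where f = "\<lambda>u. f (chart_inv c u)" and g = "\<lambda>t. snd c (\<gamma> t)" and ?t0.0 = "0"])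
    show "snd c (\<gamma> 0) \<in> A" by (rule A(3))
    show "Ck_on (Suc 0) (idx M) A (\<lambda>u. f (chart_inv c u))" using A(4) by (rule smooth_on_imp_Ck)
    show "\<forall>\<^sub>F t in nhds 0. snd c (\<gamma> t) \<in> coord_space (idx M)"
      using ev by eventually_elim (rule coords_in[OF c])
    show "((\<lambda>t. snd c (\<gamma> t) i) has_real_derivative a i) (at 0)" if "i \<in> idx M" for i
      using cu that by (simp add: curve_at_def)
  qed
  have ev2: "\<forall>\<^sub>F t in nhds 0. f (chart_inv c (snd c (\<gamma> t))) = f (\<gamma> t)"
    using ev by eventually_elim (simp add: chart_inv_left[OF c])
  show ?thesis using D DERIV_cong_ev[OF refl ev2 refl] by blast
qed

lemma curve_at_tendsto_coords:
  assumes "curve_at c \<gamma> a" "d > 0" "c \<in> atlas M"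
  shows "\<forall>\<^sub>F t in nhds 0. \<gamma> t \<in> fst c \<and> snd c (\<gamma> t) \<in> coord_box (idx M) (snd c (\<gamma> 0)) d"
proof -
  have ev: "\<forall>\<^sub>F t in nhds 0. \<gamma> t \<in> fst c" using assms by (simp add: curve_at_def)
  have "\<forall>i\<in>idx M. \<forall>\<^sub>F t in nhds 0. dist (snd c (\<gamma> t) i) (snd c (\<gamma> 0) i) < d"
  proof
    fix i assume "i \<in> idx M"
    then have "isCont (\<lambda>t. snd c (\<gamma> t) i) 0" using assms(1) DERIV_isCont unfolding curve_at_def by blast
    then have "((\<lambda>t. snd c (\<gamma> t) i) \<longlongrightarrow> snd c (\<gamma> 0) i) (nhds 0)"
      using tendsto_at_iff_tendsto_nhds[of "\<lambda>t. snd c (\<gamma> t) i" 0] by (simp add: isCont_def)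
    then show "\<forall>\<^sub>F t in nhds 0. dist (snd c (\<gamma> t) i) (snd c (\<gamma> 0) i) < d" using assms(2) by (rule tendstoD)
  qed
  then have "\<forall>\<^sub>F t in nhds 0. \<forall>i\<in>idx M. dist (snd c (\<gamma> t) i) (snd c (\<gamma> 0) i) < d"
    using finite_idx by (simp add: eventually_ball_finite)
  then show ?thesis using ev
  proof eventually_elim
    case (elim t)
    then show ?case using coords_in[OF assms(3)] by (simp add: coord_box_def dist_real_def)
  qed
qed

lemma curve_at_eventually_in:
  assumes c: "c \<in> atlas M" and cu: "curve_at c \<gamma> a" and W: "openin (mtopology M) W" "\<gamma> 0 \<in> W"
  shows "\<forall>\<^sub>F t in nhds 0. \<gamma> t \<in> W"
proof -
  have p: "\<gamma> 0 \<in> fst c" using cu by (rule curve_at_mem)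
  have "coord_open (idx M) (snd c ` (fst c \<inter> W))" using W c by (simp add: openin_mtopology)
  moreover have "snd c (\<gamma> 0) \<in> snd c ` (fst c \<inter> W)" using p W by blast
  ultimately obtain d where d: "d > 0" "coord_box (idx M) (snd c (\<gamma> 0)) d \<subseteq> snd c ` (fst c \<inter> W)"
    using coord_open_iff[OF finite_idx] by metis
  show ?thesis using curve_at_tendsto_coords[OF cu d(1) c]
  proof eventually_elim
    case (elim t)
    then obtain q where "q \<in> fst c" "q \<in> W" "snd c (\<gamma> t) = snd c q" using d by blast
    then show ?case using inj_onD[OF chart_inj[OF c]] elim by metis
  qed
qed

text \<open>Meaningful for small \<open>t\<close> only, as long as the affine line stays in the
  image of the chart.\<close>

definition chart_line :: "('m, 'i) chart \<Rightarrow> 'm \<Rightarrow> ('i \<Rightarrow> real) \<Rightarrow> real \<Rightarrow> 'm" where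
  "chart_line c p a t = chart_inv c (\<lambda>i. snd c p i + t * a i)"

lemma chart_line_near:
  assumes c: "c \<in> atlas M" and p: "p \<in> fst c" and a: "a \<in> coord_space (idx M)"
  shows "\<exists>e>0. \<forall>t\<in>{-e<..<e}. chart_line c p a t \<in> fst c \<and> snd c (chart_line c p a t) = (\<lambda>i. snd c p i + t * a i)"
proof -
  have "snd c p \<in> snd c ` fst c" using p by blast
  then obtain d where d: "d > 0" "coord_box (idx M) (snd c p) d \<subseteq> snd c ` fst c"
    using coord_open_iff[OF finite_idx] chart_img[OF c] by metis
  \<comment> \<open>A strict bound for all \<open>\<bar>a i\<bar>\<close>, positive even for an
    empty index set; for \<open>\<bar>t\<bar> < d / K\<close> the line stays in the box of radius
    \<open>d\<close>.\<close>
  define K where "K = (\<Sum>i\<in>idx M. \<bar>a i\<bar>) + 1"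
  have K: "K > 0" "\<And>i. i \<in> idx M \<Longrightarrow> \<bar>a i\<bar> < K"
  proof -
    show "K > 0" unfolding K_def by (simp add: sum_nonneg add_nonneg_pos)
    fix i assume "i \<in> idx M"
    then have "\<bar>a i\<bar> \<le> (\<Sum>i\<in>idx M. \<bar>a i\<bar>)" by (intro member_le_sum finite_idx) auto
    then show "\<bar>a i\<bar> < K" by (simp add: K_def)
  qed
  show ?thesis
  proof (intro exI[of _ "d / K"] conjI ballI)
    show "d / K > 0" using d K by simp
    fix t assume t: "t \<in> {- (d / K)<..<d / K}"
    have "\<bar>t * a i\<bar> < d" if "i \<in> idx M" for i
    proof -
      have "\<bar>t * a i\<bar> \<le> \<bar>t\<bar> * K" unfolding abs_mult using K(2)[OF that] by (intro mult_left_mono) auto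
      also have "\<dots> < d / K * K" using t K(1) by (intro mult_strict_right_mono) auto
      finally show ?thesis using K(1) by simp
    qed
    then have "(\<lambda>i. snd c p i + t * a i) \<in> coord_box (idx M) (snd c p) d"
      using coords_in[OF c p] a by (auto simp: coord_box_def coord_space_def)
    then have "(\<lambda>i. snd c p i + t * a i) \<in> snd c ` fst c" using d by blast
    then show "chart_line c p a t \<in> fst c" "snd c (chart_line c p a t) = (\<lambda>i. snd c p i + t * a i)"
      unfolding chart_line_def by (simp_all add: chart_inv_right)
  qed
qed

lemma eventually_nhds_0_interval: "e > 0 \<Longrightarrow> (\<And>t. t \<in> {-e<..<e} \<Longrightarrow> P t) \<Longrightarrow> \<forall>\<^sub>F t in nhds (0::real). P t"
  using eventually_nhds_in_open[of "{-e<..<e}" 0] by (auto elim!: eventually_mono)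

lemma chart_line_eventually:
  assumes c: "c \<in> atlas M" and p: "p \<in> fst c" and a: "a \<in> coord_space (idx M)"
  shows "\<forall>\<^sub>F t in nhds 0. chart_line c p a t \<in> fst c \<and> snd c (chart_line c p a t) = (\<lambda>i. snd c p i + t * a i)"
proof -
  obtain e where "e > 0" "\<forall>t\<in>{-e<..<e}. chart_line c p a t \<in> fst c \<and> snd c (chart_line c p a t) = (\<lambda>i. snd c p i + t * a i)"
    using chart_line_near[OF assms] by blast
  then show ?thesis by (intro eventually_nhds_0_interval) auto
qed

lemma chart_line_0: "c \<in> atlas M \<Longrightarrow> p \<in> fst c \<Longrightarrow> chart_line c p a 0 = p"
  by (simp add: chart_line_def chart_inv_left)

lemma chart_line_curve_at:
  assumes "c \<in> atlas M" "p \<in> fst c" "a \<in> coord_space (idx M)"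
  shows "curve_at c (chart_line c p a) a"
  unfolding curve_at_def
proof (intro conjI ballI)
  note ev = chart_line_eventually[OF assms]
  show "\<forall>\<^sub>F t in nhds 0. chart_line c p a t \<in> fst c" using ev by eventually_elim auto
  fix i assume "i \<in> idx M"
  have ev2: "\<forall>\<^sub>F t in nhds 0. snd c (chart_line c p a t) i = snd c p i + t * a i"
    using ev by eventually_elim auto
  have "((\<lambda>t. snd c p i + t * a i) has_real_derivative a i) (at 0)" by (auto intro!: derivative_eq_intros)
  then show "((\<lambda>t. snd c (chart_line c p a t) i) has_real_derivative a i) (at 0)"
    using DERIV_cong_ev[OF refl ev2 refl] by blast
qed

text \<open>Smoothness is stated by iterated \<open>deriv\<close>, and \<open>f\<close> is affine
  only on the interval. Every iterated derivative is again affine there, which is the invariant of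
  the induction.\<close>

lemma smooth_real_affine:
  assumes e: "\<And>t. t \<in> {-e<..<e} \<Longrightarrow> f t = x + t * (a::real)"
  shows "smooth_real_on {-e<..<e} f"
proof -
  have D: "\<exists>y b. \<forall>t\<in>{-e<..<e}. ((deriv ^^ k) f) t = y + t * b" for k
  proof (induction k)
    case 0
    have "\<forall>t\<in>{-e<..<e}. ((deriv ^^ 0) f) t = x + t * a" using e by simp
    then show ?case by blast
  next
    case (Suc k)
    then obtain y b where yb: "\<forall>t\<in>{-e<..<e}. ((deriv ^^ k) f) t = y + t * b" by blast
    have "((deriv ^^ Suc k) f) t = b + t * 0" if t: "t \<in> {-e<..<e}" for t
    proof -
      have ev: "\<forall>\<^sub>F s in nhds t. ((deriv ^^ k) f) s = y + s * b"
        using eventually_nhds_in_open[OF _ t] yb by (auto elim!: eventually_mono)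
      have "((\<lambda>s. y + s * b) has_real_derivative b) (at t)" by (auto intro!: derivative_eq_intros)
      then have "((deriv ^^ k) f has_real_derivative b) (at t)"
        using DERIV_cong_ev[OF refl ev refl] by blast
      then show ?thesis by (simp add: DERIV_imp_deriv)
    qed
    then show ?case by blast
  qed
  show ?thesis unfolding smooth_real_on_def
  proof (intro allI ballI)
    fix k t assume t: "t \<in> {-e<..<e}"
    obtain y b where yb: "\<forall>t\<in>{-e<..<e}. ((deriv ^^ k) f) t = y + t * b" using D by blast
    have ev: "\<forall>\<^sub>F s in nhds t. ((deriv ^^ k) f) s = y + s * b"
      using eventually_nhds_in_open[OF _ t] yb by (auto elim!: eventually_mono)
    have "((\<lambda>s. y + s * b) has_real_derivative b) (at t)" by (auto intro!: derivative_eq_intros)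
    then have "((deriv ^^ k) f has_real_derivative b) (at t)"
      using DERIV_cong_ev[OF refl ev refl] by blast
    then show "(deriv ^^ k) f differentiable at t" unfolding real_differentiable_def by blast
  qed
qed

lemma chart_line_smooth:
  assumes "c \<in> atlas M" "p \<in> fst c" "a \<in> coord_space (idx M)"
  shows "smooth_curve M (chart_line c p a)"
proof -
  obtain e where e: "e > 0" "\<forall>t\<in>{-e<..<e}. chart_line c p a t \<in> fst c \<and> snd c (chart_line c p a t) = (\<lambda>i. snd c p i + t * a i)"
    using chart_line_near[OF assms] by blast
  show ?thesis unfolding smooth_curve_def
  proof (intro bexI[OF _ assms(1)] exI[of _ e] conjI ballI)
    fix i assume "i \<in> idx M"
    show "smooth_real_on {-e<..<e} (\<lambda>t. snd c (chart_line c p a t) i)"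
      by (rule smooth_real_affine[of _ _ "snd c p i" "a i"]) (use e in auto)
  qed (use e in auto)
qed

lemma coord_vec_pderiv:
  assumes c: "c \<in> atlas M" and p: "p \<in> fst c" and i: "i \<in> idx M"
  shows "coord_vec M c p i f = (if smooth_at M p f then pderiv_at i (\<lambda>u. f (chart_inv c u)) (snd c p) else 0)"
proof -
  let ?F = "\<lambda>u. f (chart_inv c u)"
  have "deriv (\<lambda>t. ?F ((snd c p)(i := snd c p i + t))) 0 = pderiv_at i ?F (snd c p)" if f: "smooth_at M p f"
  proof -
    obtain A where A: "coord_open (idx M) A" "A \<subseteq> snd c ` fst c" "snd c p \<in> A" "smooth_on (idx M) A ?F"
      by (rule smooth_atD[OF f c p])
    have "((\<lambda>t. ?F ((snd c p)(i := t))) has_real_derivative pderiv_at i ?F (snd c p)) (at (snd c p i + 0))"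
      using Ck_SucD(1)[OF smooth_on_imp_Ck[OF A(4), of "Suc 0"] i A(3)] by simp
    moreover have "((\<lambda>t. snd c p i + t) has_real_derivative 1) (at 0)" by (auto intro!: derivative_eq_intros)
    ultimately have "((\<lambda>t. ?F ((snd c p)(i := snd c p i + t))) has_real_derivative pderiv_at i ?F (snd c p) * 1) (at 0)"
      by (rule DERIV_chain2[where g = "\<lambda>t. snd c p i + t" and f = "\<lambda>t. ?F ((snd c p)(i := t))"])
    then show ?thesis by (simp add: DERIV_imp_deriv)
  qed
  then show ?thesis by (simp add: coord_vec_def velocity_def chart_inv_left[OF c p])
qed

text \<open>The velocity is determined by the point and the chart components of the derivative. The
  uniqueness proofs for velocities of curves rest on this.\<close>

lemma velocity_curve_at:
  assumes c: "c \<in> atlas M" and cu: "curve_at c \<gamma> a"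
  shows "velocity M \<gamma> = (\<gamma> 0, \<lambda>f. \<Sum>i\<in>idx M. a i * coord_vec M c (\<gamma> 0) i f)"
proof -
  have p: "\<gamma> 0 \<in> fst c" using cu by (rule curve_at_mem)
  have "(if smooth_at M (\<gamma> 0) f then deriv (\<lambda>t. f (\<gamma> t)) 0 else 0) = (\<Sum>i\<in>idx M. a i * coord_vec M c (\<gamma> 0) i f)" for f
  proof (cases "smooth_at M (\<gamma> 0) f")
    case True
    have "deriv (\<lambda>t. f (\<gamma> t)) 0 = (\<Sum>i\<in>idx M. pderiv_at i (\<lambda>u. f (chart_inv c u)) (snd c (\<gamma> 0)) * a i)"
      by (rule DERIV_imp_deriv[OF curve_at_deriv[OF c cu True]])
    also have "\<dots> = (\<Sum>i\<in>idx M. a i * coord_vec M c (\<gamma> 0) i f)"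
      by (rule sum.cong[OF refl]) (simp add: coord_vec_pderiv[OF c p] True)
    finally show ?thesis using True by simp
  qed (simp add: coord_vec_pderiv[OF c p])
  then show ?thesis by (simp add: velocity_def)
qed

lemma curve_at_deriv_velocity:
  assumes "c \<in> atlas M" "curve_at c \<gamma> a" "smooth_at M (\<gamma> 0) f"
  shows "((\<lambda>t. f (\<gamma> t)) has_real_derivative snd (velocity M \<gamma>) f) (at 0)"
  using curve_at_deriv[OF assms] assms(3) by (simp add: velocity_def DERIV_imp_deriv)

text \<open>Each component vector is realised by an affine line of the chart. As tangent vectors are
  defined by curves, this is the source of the linear structure of
  \<open>tangent_space\<close>.\<close>

lemma tangent_comb:
  assumes c: "c \<in> atlas M" and p: "p \<in> fst c"
  shows "(\<lambda>f. \<Sum>i\<in>idx M. a i * coord_vec M c p i f) \<in> tangent_space M p"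
proof -
  let ?a = "\<lambda>i. if i \<in> idx M then a i else 0"
  have a: "?a \<in> coord_space (idx M)" by (simp add: coord_space_def)
  have "snd (velocity M (chart_line c p ?a)) = (\<lambda>f. \<Sum>i\<in>idx M. a i * coord_vec M c p i f)"
    using velocity_curve_at[OF c chart_line_curve_at[OF c p a]] by (simp add: chart_line_0[OF c p])
  then have "\<exists>\<gamma>. (\<lambda>f. \<Sum>i\<in>idx M. a i * coord_vec M c p i f) = snd (velocity M \<gamma>) \<and> smooth_curve M \<gamma> \<and> \<gamma> 0 = p"
    using chart_line_smooth[OF c p a] chart_line_0[OF c p] by (intro exI[of _ "chart_line c p ?a"]) simp
  then show ?thesis unfolding tangent_space_def by simp
qed

end

text \<open>The part of \<open>smooth_manifold\<close> that passes from the base to the tangent and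
  cotangent bundles by inspecting charts. The Hausdorff property is added as a separate hypothesis
  where bump functions require it.\<close>

locale charted = wcharted M for M :: "('m, 'i) manifold" +
  assumes overlap_open: "\<And>c d. c \<in> atlas M \<Longrightarrow> d \<in> atlas M \<Longrightarrow> coord_open (idx M) (snd c ` (fst c \<inter> fst d))"
    and overlap_smooth: "\<And>c d i. c \<in> atlas M \<Longrightarrow> d \<in> atlas M \<Longrightarrow> i \<in> idx M \<Longrightarrow>
      smooth_on (idx M) (snd c ` (fst c \<inter> fst d)) (\<lambda>u. snd d (chart_inv c u) i)"
begin

lemma openin_chart: "c \<in> atlas M \<Longrightarrow> openin (mtopology M) (fst c)"
  unfolding openin_mtopology using overlap_open chart_sub by simp

lemma smooth_on_change_chart:
  assumes c: "c \<in> atlas M" and d: "d \<in> atlas M"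
    and f: "smooth_on (idx M) (snd c ` (fst c \<inter> W)) (\<lambda>u. f (chart_inv c u))" and W: "openin (mtopology M) W"
  shows "smooth_on (idx M) (snd d ` (fst d \<inter> fst c \<inter> W)) (\<lambda>u. f (chart_inv d u))"
proof -
  let ?A = "snd d ` (fst d \<inter> fst c \<inter> W)"
  have "openin (mtopology M) (fst c \<inter> W)" using openin_chart[OF c] W by (rule openin_Int)
  then have oA: "coord_open (idx M) ?A" using d by (simp add: openin_mtopology Int_assoc)
  have B: "coord_open (idx M) (snd c ` (fst c \<inter> W))" using W c by (simp add: openin_mtopology)
  have inv: "chart_inv d u \<in> fst d" "chart_inv d u \<in> fst c" "chart_inv d u \<in> W" if "u \<in> ?A" for u
    using that chart_inv_left[OF d] by auto
  have "smooth_on (idx M) ?A (\<lambda>u. f (chart_inv c (snd c (chart_inv d u))))"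
  proof (rule smooth_on_compose[OF finite_idx oA finite_idx B, where g = "\<lambda>u. f (chart_inv c u)" and \<phi> = "\<lambda>u. snd c (chart_inv d u)"])
    show "smooth_on (idx M) (snd c ` (fst c \<inter> W)) (\<lambda>u. f (chart_inv c u))" by (rule f)
    show "(\<lambda>u. snd c (chart_inv d u)) ` ?A \<subseteq> snd c ` (fst c \<inter> W)" using inv by blast
    show "smooth_on (idx M) ?A (\<lambda>u. snd c (chart_inv d u) j)" if "j \<in> idx M" for j
      by (rule smooth_on_subset[OF overlap_smooth[OF d c that]]) auto
  qed
  moreover have "f (chart_inv c (snd c (chart_inv d u))) = f (chart_inv d u)" if "u \<in> ?A" for u
    using chart_inv_left[OF c inv(2)[OF that]] by simp
  ultimately show ?thesis using smooth_on_cong[OF finite_idx oA] by (metis (no_types, lifting))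
qed

text \<open>One chart suffices, as every other chart is reached by a smooth change of
  coordinates.\<close>

lemma smooth_fun_on_chartI:
  assumes c: "c \<in> atlas M" and f: "smooth_on (idx M) (snd c ` fst c) (\<lambda>u. f (chart_inv c u))"
  shows "smooth_fun_on M (fst c) f"
  unfolding smooth_fun_on_def
proof (intro conjI ballI openin_chart[OF c])
  fix d assume d: "d \<in> atlas M"
  have "fst d \<inter> fst c \<inter> fst c = fst d \<inter> fst c" by blast
  then show "smooth_on (idx M) (snd d ` (fst d \<inter> fst c)) (\<lambda>u. f (chart_inv d u))"
    using smooth_on_change_chart[OF c d _ openin_chart[OF c], of f] f by simp
qed

lemma smooth_coord: 
  assumes c: "c \<in> atlas M" shows "smooth_fun_on M (fst c) (\<lambda>q. snd c q i)"
proof (rule smooth_fun_on_chartI[OF c])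
  have "smooth_on (idx M) (snd c ` fst c) (\<lambda>u. u i)" by (rule smooth_on_coord[OF finite_idx chart_img[OF c]])
  then show "smooth_on (idx M) (snd c ` fst c) (\<lambda>u. snd c (chart_inv c u) i)"
    using smooth_on_cong[OF finite_idx chart_img[OF c], of "\<lambda>u. u i" "\<lambda>u. snd c (chart_inv c u) i"] chart_inv_right
    by (metis (no_types, lifting))
qed

lemma smooth_at_coord: "c \<in> atlas M \<Longrightarrow> p \<in> fst c \<Longrightarrow> smooth_at M p (\<lambda>q. snd c q i)"
  using smooth_coord smooth_at_def by fast

lemma coord_vec_coord:
  assumes c: "c \<in> atlas M" and p: "p \<in> fst c" and i: "i \<in> idx M"
  shows "coord_vec M c p i (\<lambda>q. snd c q j) = (if i = j then 1 else 0)"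
proof -
  have x: "snd c p \<in> snd c ` fst c" using p by blast
  have ev: "\<forall>\<^sub>F t in nhds (snd c p i). snd c (chart_inv c ((snd c p)(i := t))) j = ((snd c p)(i := t)) j"
    using eventually_upd_in[OF finite_idx chart_img[OF c] x i] by eventually_elim (simp add: chart_inv_right)
  have "((\<lambda>t. ((snd c p)(i := t)) j) has_real_derivative (if i = j then 1 else 0)) (at (snd c p i))"
    by (cases "i = j") auto
  then have "((\<lambda>t. snd c (chart_inv c ((snd c p)(i := t))) j) has_real_derivative (if i = j then 1 else 0)) (at (snd c p i))"
    using DERIV_cong_ev[OF refl ev refl] by blast
  then have "pderiv_at i (\<lambda>u. snd c (chart_inv c u) j) (snd c p) = (if i = j then 1 else 0)"
    unfolding pderiv_at_def by (rule DERIV_imp_deriv)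
  then show ?thesis by (simp add: coord_vec_pderiv[OF c p i] smooth_at_coord[OF c p])
qed

lemma curve_at_change:
  assumes c: "c \<in> atlas M" and d: "d \<in> atlas M" and cu: "curve_at d \<gamma> b" and p: "\<gamma> 0 \<in> fst c"
  shows "curve_at c \<gamma> (\<lambda>i. snd (velocity M \<gamma>) (\<lambda>q. snd c q i))"
  unfolding curve_at_def
proof (intro conjI ballI)
  show "\<forall>\<^sub>F t in nhds 0. \<gamma> t \<in> fst c" by (rule curve_at_eventually_in[OF d cu openin_chart[OF c] p])
  fix i
  show "((\<lambda>t. snd c (\<gamma> t) i) has_real_derivative snd (velocity M \<gamma>) (\<lambda>q. snd c q i)) (at 0)"
    by (rule curve_at_deriv_velocity[OF d cu smooth_at_coord[OF c p]])
qed

lemma smooth_curve_curve_at: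
  assumes c: "c \<in> atlas M" and \<gamma>: "smooth_curve M \<gamma>" and p: "\<gamma> 0 \<in> fst c"
  shows "curve_at c \<gamma> (\<lambda>i. snd (velocity M \<gamma>) (\<lambda>q. snd c q i))"
proof -
  obtain d e where d: "d \<in> atlas M" "e > 0" "\<gamma> ` {-e<..<e} \<subseteq> fst d"
     "\<And>i. i \<in> idx M \<Longrightarrow> smooth_real_on {-e<..<e} (\<lambda>t. snd d (\<gamma> t) i)"
    using \<gamma> by (auto simp: smooth_curve_def)
  have "(\<lambda>t. snd d (\<gamma> t) i) differentiable (at 0)" if "i \<in> idx M" for i
    using d(4)[OF that] d(2) unfolding smooth_real_on_def by (metis funpow_0 greaterThanLessThan_iff neg_less_0_iff_less)
  then have "curve_at d \<gamma> (\<lambda>i. deriv (\<lambda>t. snd d (\<gamma> t) i) 0)"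
    unfolding curve_at_def using d(2,3)
    by (auto simp: DERIV_deriv_iff_real_differentiable intro!: eventually_nhds_0_interval[of e])
  from curve_at_change[OF c d(1) this p] show ?thesis .
qed

lemma tangent_expand:
  assumes c: "c \<in> atlas M" and p: "p \<in> fst c" and v: "v \<in> tangent_space M p"
  shows "v = (\<lambda>f. \<Sum>i\<in>idx M. v (\<lambda>q. snd c q i) * coord_vec M c p i f)"
proof -
  obtain \<gamma> where \<gamma>: "smooth_curve M \<gamma>" "\<gamma> 0 = p" "v = snd (velocity M \<gamma>)"
    using v by (auto simp: tangent_space_def)
  have "curve_at c \<gamma> (\<lambda>i. v (\<lambda>q. snd c q i))" using smooth_curve_curve_at[OF c \<gamma>(1)] \<gamma> p by simp
  from velocity_curve_at[OF c this] have "snd (velocity M \<gamma>) = (\<lambda>f. \<Sum>i\<in>idx M. v (\<lambda>q. snd c q i) * coord_vec M c p i f)"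
    using \<gamma>(2) by simp
  then show ?thesis using \<gamma>(3) by simp
qed

lemma tangent_coord_comb:
  assumes c: "c \<in> atlas M" and p: "p \<in> fst c" and j: "j \<in> idx M"
  shows "(\<Sum>i\<in>idx M. a i * coord_vec M c p i (\<lambda>q. snd c q j)) = a j"
proof -
  have "(\<Sum>i\<in>idx M. a i * coord_vec M c p i (\<lambda>q. snd c q j)) = (\<Sum>i\<in>idx M. if i = j then a i else 0)"
    by (rule sum.cong[OF refl]) (simp add: coord_vec_coord[OF c p])
  then show ?thesis using finite_idx j by (simp add: sum.delta)
qed

lemma coord_vec_tangent:
  assumes c: "c \<in> atlas M" and p: "p \<in> fst c" and i: "i \<in> idx M"
  shows "coord_vec M c p i \<in> tangent_space M p"
proof -
  have "(\<lambda>f. \<Sum>j\<in>idx M. (if j = i then 1 else 0) * coord_vec M c p j f) = coord_vec M c p i"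
  proof
    fix f
    have "(\<Sum>j\<in>idx M. (if j = i then 1 else 0) * coord_vec M c p j f) = (\<Sum>j\<in>idx M. if j = i then coord_vec M c p j f else 0)"
      by (rule sum.cong) auto
    then show "(\<Sum>j\<in>idx M. (if j = i then 1 else 0) * coord_vec M c p j f) = coord_vec M c p i f"
      using finite_idx i by (simp add: sum.delta)
  qed
  then show ?thesis using tangent_comb[OF c p, of "\<lambda>j. if j = i then 1 else 0"] by simp
qed

lemma tangent_eqI:
  assumes c: "c \<in> atlas M" and p: "p \<in> fst c" and v: "v \<in> tangent_space M p" "w \<in> tangent_space M p"
    and eq: "\<And>i. i \<in> idx M \<Longrightarrow> v (\<lambda>q. snd c q i) = w (\<lambda>q. snd c q i)"
  shows "v = w"
proof -
  have "v = (\<lambda>f. \<Sum>i\<in>idx M. v (\<lambda>q. snd c q i) * coord_vec M c p i f)" by (rule tangent_expand[OF c p v(1)])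
  also have "\<dots> = (\<lambda>f. \<Sum>i\<in>idx M. w (\<lambda>q. snd c q i) * coord_vec M c p i f)" using eq by simp
  also have "\<dots> = w" by (rule tangent_expand[OF c p v(2), symmetric])
  finally show ?thesis .
qed

lemma tangent_lin_closed:
  assumes p: "p \<in> pts M" shows "lin_closed (tangent_space M p)"
  unfolding lin_closed_def
proof (intro conjI ballI allI)
  obtain c where c: "c \<in> atlas M" "p \<in> fst c" using chart_at_exists[OF p] by blast
  show "(\<lambda>_. 0) \<in> tangent_space M p" using tangent_comb[OF c, of "\<lambda>_. 0"] by simp
  fix v w and a b :: real assume v: "v \<in> tangent_space M p" and w: "w \<in> tangent_space M p"
  have "(\<lambda>f. a * v f + b * w f) = (\<lambda>f. \<Sum>i\<in>idx M. (a * v (\<lambda>q. snd c q i) + b * w (\<lambda>q. snd c q i)) * coord_vec M c p i f)"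
  proof
    fix f
    show "a * v f + b * w f = (\<Sum>i\<in>idx M. (a * v (\<lambda>q. snd c q i) + b * w (\<lambda>q. snd c q i)) * coord_vec M c p i f)"
      by (subst tangent_expand[OF c v], subst tangent_expand[OF c w])
         (simp add: sum_distrib_left sum.distrib[symmetric] algebra_simps)
  qed
  then show "(\<lambda>z. a * v z + b * w z) \<in> tangent_space M p" using tangent_comb[OF c] by simp
qed

lemma spans_tangent:
  assumes c: "c \<in> atlas M" and p: "p \<in> fst c"
  shows "spans (idx M) (coord_vec M c p) (tangent_space M p)"
proof -
  have "p \<in> pts M" using c p chart_sub by blast
  moreover have "\<forall>v\<in>tangent_space M p. \<exists>a. v = (\<lambda>z. \<Sum>i\<in>idx M. a i * coord_vec M c p i z)"
  proof
    fix v assume "v \<in> tangent_space M p"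
    from tangent_expand[OF c p this] show "\<exists>a. v = (\<lambda>z. \<Sum>i\<in>idx M. a i * coord_vec M c p i z)"
      by (rule exI[of _ "\<lambda>i. v (\<lambda>q. snd c q i)"])
  qed
  ultimately show ?thesis unfolding spans_def
    using finite_idx tangent_lin_closed coord_vec_tangent[OF c p] by blast
qed

section \<open>Covectors and their components\<close>

lemma cotangent_iff: "a \<in> cotangent_space M p \<longleftrightarrow> linear_form (tangent_space M p) a"
  by (simp add: cotangent_space_def linear_form_def)

lemma cotangent_comb_eval:
  assumes p: "p \<in> pts M" and a: "a \<in> cotangent_space M p" and J: "finite J" "\<And>j. j \<in> J \<Longrightarrow> e j \<in> tangent_space M p"
  shows "a (\<lambda>f. \<Sum>j\<in>J. b j * e j f) = (\<Sum>j\<in>J. b j * a (e j))"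
  by (rule linear_form_sum[OF tangent_lin_closed[OF p] _ J]) (use a in \<open>simp_all add: cotangent_iff\<close>)

lemma cotangent_eval:
  assumes c: "c \<in> atlas M" and p: "p \<in> fst c" and a: "a \<in> cotangent_space M p" and v: "v \<in> tangent_space M p"
  shows "a v = (\<Sum>i\<in>idx M. v (\<lambda>q. snd c q i) * a (coord_vec M c p i))"
proof -
  have pp: "p \<in> pts M" using c p chart_sub by blast
  have "a v = a (\<lambda>f. \<Sum>i\<in>idx M. v (\<lambda>q. snd c q i) * coord_vec M c p i f)" using tangent_expand[OF c p v] by metis
  also have "\<dots> = (\<Sum>i\<in>idx M. v (\<lambda>q. snd c q i) * a (coord_vec M c p i))"
    by (rule cotangent_comb_eval[OF pp a finite_idx coord_vec_tangent[OF c p]])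
  finally show ?thesis .
qed

lemma differential_cotangent: 
  assumes p: "p \<in> pts M"
  shows "differential M f p \<in> cotangent_space M p"
  unfolding cotangent_iff linear_form_def differential_def
  using lin_closed_comb[OF tangent_lin_closed[OF p]] by auto

lemma coord_covec_cotangent: "p \<in> pts M \<Longrightarrow> coord_covec M c p i \<in> cotangent_space M p"
  unfolding coord_covec_def by (rule differential_cotangent)

lemma coord_covec_eval: "v \<in> tangent_space M p \<Longrightarrow> coord_covec M c p i v = v (\<lambda>q. snd c q i)"
  by (simp add: coord_covec_def differential_def)

lemma coord_covec_dual:
  assumes c: "c \<in> atlas M" and p: "p \<in> fst c" and i: "i \<in> idx M"
  shows "coord_covec M c p j (coord_vec M c p i) = (if j = i then 1 else 0)"
  using coord_covec_eval[OF coord_vec_tangent[OF assms]] coord_vec_coord[OF assms] by auto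

lemma cotangent_expand:
  assumes c: "c \<in> atlas M" and p: "p \<in> fst c" and a: "a \<in> cotangent_space M p"
  shows "a = (\<lambda>v. \<Sum>i\<in>idx M. a (coord_vec M c p i) * coord_covec M c p i v)"
proof
  fix v
  show "a v = (\<Sum>i\<in>idx M. a (coord_vec M c p i) * coord_covec M c p i v)"
  proof (cases "v \<in> tangent_space M p")
    case True
    then show ?thesis using cotangent_eval[OF c p a True] by (simp add: coord_covec_eval mult.commute)
  next
    case False
    then show ?thesis using a by (simp add: cotangent_space_def coord_covec_def differential_def)
  qed
qed

lemma cotangent_eqI:
  assumes c: "c \<in> atlas M" and p: "p \<in> fst c" and a: "a \<in> cotangent_space M p" "b \<in> cotangent_space M p"
    and eq: "\<And>i. i \<in> idx M \<Longrightarrow> a (coord_vec M c p i) = b (coord_vec M c p i)"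
  shows "a = b"
proof -
  have "a = (\<lambda>v. \<Sum>i\<in>idx M. a (coord_vec M c p i) * coord_covec M c p i v)" by (rule cotangent_expand[OF c p a(1)])
  also have "\<dots> = (\<lambda>v. \<Sum>i\<in>idx M. b (coord_vec M c p i) * coord_covec M c p i v)" using eq by simp
  also have "\<dots> = b" by (rule cotangent_expand[OF c p a(2), symmetric])
  finally show ?thesis .
qed

lemma cotangent_lin_closed: 
  assumes p: "p \<in> pts M" shows "lin_closed (cotangent_space M p)"
  unfolding lin_closed_def cotangent_iff
proof (intro conjI ballI allI)
  show "linear_form (tangent_space M p) (\<lambda>_. 0)" by (simp add: linear_form_def)
  fix a b c d assume "a \<in> cotangent_space M p" "b \<in> cotangent_space M p"
  then have ab: "linear_form (tangent_space M p) a" "linear_form (tangent_space M p) b" by (simp_all add: cotangent_iff)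
  show "linear_form (tangent_space M p) (\<lambda>z. c * a z + d * b z)" unfolding linear_form_def
    by (auto simp: linear_formD[OF ab(1)] linear_formD[OF ab(2)] linear_form_outside[OF ab(1)] linear_form_outside[OF ab(2)] algebra_simps)
qed

lemma spans_cotangent:
  assumes c: "c \<in> atlas M" and p: "p \<in> fst c"
  shows "spans (idx M) (coord_covec M c p) (cotangent_space M p)"
proof -
  have "p \<in> pts M" using c p chart_sub by blast
  moreover have "\<forall>a\<in>cotangent_space M p. \<exists>b. a = (\<lambda>z. \<Sum>i\<in>idx M. b i * coord_covec M c p i z)"
  proof
    fix a assume "a \<in> cotangent_space M p"
    from cotangent_expand[OF c p this] show "\<exists>b. a = (\<lambda>z. \<Sum>i\<in>idx M. b i * coord_covec M c p i z)"
      by (rule exI[of _ "\<lambda>i. a (coord_vec M c p i)"])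
  qed
  ultimately show ?thesis unfolding spans_def
    using finite_idx cotangent_lin_closed coord_covec_cotangent by blast
qed

end

lemma smooth_manifold_charted: "smooth_manifold M \<Longrightarrow> charted M"
  unfolding smooth_manifold_def by unfold_locales auto


section \<open>Tangent, cotangent and exterior bundles\<close>

lemma coord_open_Inl:
  assumes fin: "finite I" "finite J" and B: "coord_open I B"
  shows "coord_open (I <+> J) {w \<in> coord_space (I <+> J). (\<lambda>i. w (Inl i)) \<in> B}"
  unfolding coord_open_iff[OF finite_Plus[OF fin]]
proof (intro conjI ballI)
  fix w assume w: "w \<in> {w \<in> coord_space (I <+> J). (\<lambda>i. w (Inl i)) \<in> B}"
  then obtain e where e: "e > 0" "coord_box I (\<lambda>i. w (Inl i)) e \<subseteq> B" using B coord_open_iff[OF fin(1)] by blast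
  have "coord_box (I <+> J) w e \<subseteq> {w \<in> coord_space (I <+> J). (\<lambda>i. w (Inl i)) \<in> B}"
  proof
    fix z assume z: "z \<in> coord_box (I <+> J) w e"
    then have "(\<lambda>i. z (Inl i)) \<in> coord_box I (\<lambda>i. w (Inl i)) e"
      by (auto simp: coord_box_def coord_space_def)
    then show "z \<in> {w \<in> coord_space (I <+> J). (\<lambda>i. w (Inl i)) \<in> B}" using e z by (auto simp: coord_box_def)
  qed
  then show "\<exists>e>0. coord_box (I <+> J) w e \<subseteq> {w \<in> coord_space (I <+> J). (\<lambda>i. w (Inl i)) \<in> B}" using e by blast
qed auto

lemma smooth_on_Inl:
  assumes fin: "finite I" "finite J" and B: "coord_open I B" and g: "smooth_on I B g"
  shows "smooth_on (I <+> J) {w \<in> coord_space (I <+> J). (\<lambda>i. w (Inl i)) \<in> B} (\<lambda>w. g (\<lambda>i. w (Inl i)))"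
proof (rule smooth_on_compose[OF finite_Plus[OF fin] coord_open_Inl[OF fin B] fin(1) B g, where \<phi> = "\<lambda>w i. w (Inl i)"])
  show "smooth_on (I <+> J) {w \<in> coord_space (I <+> J). (\<lambda>i. w (Inl i)) \<in> B} (\<lambda>w. w (Inl j))" for j
    by (rule smooth_on_coord[OF finite_Plus[OF fin] coord_open_Inl[OF fin B]])
qed auto

text \<open>A common model of the tangent, cotangent and exterior bundles. Since the fibre
  coordinates are bijective onto \<open>coord_space J\<close>, the image of a bundle chart is the
  full cylinder over the image of the base chart.\<close>

locale fibre_bundle = wcharted M for M :: "('m, 'i) manifold" +
  fixes E :: "'m \<Rightarrow> 'e set" and J :: "'j set" and \<phi> :: "('m, 'i) chart \<Rightarrow> 'm \<Rightarrow> 'e \<Rightarrow> 'j \<Rightarrow> real"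
  assumes finite_J: "finite J"
    and fibre_bij: "\<And>c p. c \<in> atlas M \<Longrightarrow> p \<in> fst c \<Longrightarrow> bij_betw (\<phi> c p) (E p) (coord_space J)"
begin

definition bchart :: "('m, 'i) chart \<Rightarrow> ('m \<times> 'e, 'i + 'j) chart" where
  "bchart c = (Sigma (fst c) E, \<lambda>(p, v). case_sum (snd c p) (\<phi> c p v))"

definition total :: "('m \<times> 'e, 'i + 'j) manifold" where
  "total = \<lparr>pts = Sigma (pts M) E, idx = idx M <+> J, atlas = bchart ` atlas M\<rparr>"

lemma case_sum_coord_space:
  "x \<in> coord_space I \<Longrightarrow> y \<in> coord_space J \<Longrightarrow> case_sum x y \<in> coord_space (I <+> J)"
  unfolding coord_space_def by (auto split: sum.split)

lemma bchart_image:
  assumes c: "c \<in> atlas M" and W: "W \<subseteq> fst c"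
  shows "snd (bchart c) ` (Sigma W E) = {w \<in> coord_space (idx M <+> J). (\<lambda>i. w (Inl i)) \<in> snd c ` W}"
proof (intro equalityI subsetI)
  fix w assume "w \<in> snd (bchart c) ` (Sigma W E)"
  then obtain p v where pv: "p \<in> W" "v \<in> E p" "w = case_sum (snd c p) (\<phi> c p v)" by (auto simp: bchart_def)
  have p: "p \<in> fst c" using pv W by blast
  have "\<phi> c p v \<in> coord_space J" using fibre_bij[OF c p] pv(2) by (auto simp: bij_betw_def)
  then show "w \<in> {w \<in> coord_space (idx M <+> J). (\<lambda>i. w (Inl i)) \<in> snd c ` W}"
    using case_sum_coord_space[OF coords_in[OF c p]] pv by auto
next
  fix w assume w: "w \<in> {w \<in> coord_space (idx M <+> J). (\<lambda>i. w (Inl i)) \<in> snd c ` W}"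
  then obtain p where p: "p \<in> W" "(\<lambda>i. w (Inl i)) = snd c p" by auto
  have "(\<lambda>j. w (Inr j)) \<in> coord_space J" using w by (auto simp: coord_space_def)
  then obtain v where v: "v \<in> E p" "\<phi> c p v = (\<lambda>j. w (Inr j))"
    using fibre_bij[OF c, of p] p W unfolding bij_betw_def by (metis imageE subsetD)
  have "w = case_sum (snd c p) (\<phi> c p v)"
    unfolding v(2) p(2)[symmetric] by (auto split: sum.split)
  then show "w \<in> snd (bchart c) ` (Sigma W E)" using p v
    by (intro image_eqI[of _ _ "(p, v)"]) (auto simp: bchart_def)
qed

lemma bchart_inj:
  assumes c: "c \<in> atlas M" shows "inj_on (snd (bchart c)) (fst (bchart c))"
proof (rule inj_onI)
  fix x y assume x: "x \<in> fst (bchart c)" and y: "y \<in> fst (bchart c)" and eq: "snd (bchart c) x = snd (bchart c) y"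
  obtain p v q w where xy: "x = (p, v)" "y = (q, w)" by (cases x, cases y) auto
  have 1: "p \<in> fst c" "q \<in> fst c" "v \<in> E p" "w \<in> E q" using x y xy by (auto simp: bchart_def)
  have eq': "case_sum (snd c p) (\<phi> c p v) = case_sum (snd c q) (\<phi> c q w)" using eq xy by (simp add: bchart_def)
  have "snd c p = snd c q" using fun_cong[OF eq', of "Inl _"] by (intro ext) simp
  then have pq: "p = q" using inj_onD[OF chart_inj[OF c]] 1 by blast
  have "\<phi> c p v = \<phi> c p w" using fun_cong[OF eq', of "Inr _"] pq by (intro ext) simp
  then have "v = w" using fibre_bij[OF c 1(1)] 1 pq by (auto simp: bij_betw_def inj_on_def)
  then show "x = y" using xy pq by simp
qed

lemma fst_bchart: "fst (bchart c) = Sigma (fst c) E"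
  by (simp add: bchart_def)

lemma wcharted_total: "wcharted total"
proof
  show "finite (idx total)" using finite_idx finite_J by (simp add: total_def)
  show "(\<Union>c\<in>atlas total. fst c) = pts total" using cover by (auto simp: total_def bchart_def)
  fix C assume "C \<in> atlas total"
  then obtain c where c: "c \<in> atlas M" "C = bchart c" by (auto simp: total_def)
  show "inj_on (snd C) (fst C)" using bchart_inj c by simp
  show "coord_open (idx total) (snd C ` fst C)"
    unfolding c(2) fst_bchart bchart_image[OF c(1) order_refl]
    using coord_open_Inl[OF finite_idx finite_J chart_img[OF c(1)]] by (simp add: total_def)
qed

text \<open>\<open>A c d\<close> is the matrix of the fibre coordinate change from the chart \<open>c\<close> to the chart \<open>d\<close>.\<close>

lemma charted_total:
  fixes A :: "('m, 'i) chart \<Rightarrow> ('m, 'i) chart \<Rightarrow> 'j \<Rightarrow> 'j \<Rightarrow> 'm \<Rightarrow> real"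
  assumes "charted M"
    and A: "\<And>c d j k. c \<in> atlas M \<Longrightarrow> d \<in> atlas M \<Longrightarrow> j \<in> J \<Longrightarrow> k \<in> J \<Longrightarrow>
       smooth_on (idx M) (snd c ` (fst c \<inter> fst d)) (\<lambda>u. A c d j k (chart_inv c u))"
    and \<phi>: "\<And>c d j p v. c \<in> atlas M \<Longrightarrow> d \<in> atlas M \<Longrightarrow> j \<in> J \<Longrightarrow> p \<in> fst c \<Longrightarrow> p \<in> fst d \<Longrightarrow> v \<in> E p \<Longrightarrow>
       \<phi> d p v j = (\<Sum>k\<in>J. A c d j k p * \<phi> c p v k)"
  shows "charted total"
proof -
  interpret charted M by fact
  interpret t: wcharted total by (rule wcharted_total)
  show ?thesis
  proof
    fix C D assume "C \<in> atlas total" "D \<in> atlas total"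
    then obtain c d where c: "c \<in> atlas M" "C = bchart c" and d: "d \<in> atlas M" "D = bchart d" by (auto simp: total_def)
    have CD: "fst C \<inter> fst D = Sigma (fst c \<inter> fst d) E" unfolding c d fst_bchart by auto
    let ?B = "snd c ` (fst c \<inter> fst d)"
    have img: "snd C ` (fst C \<inter> fst D) = {w \<in> coord_space (idx M <+> J). (\<lambda>i. w (Inl i)) \<in> ?B}" (is "_ = ?W")
      unfolding CD unfolding c(2) by (rule bchart_image[OF c(1)]) auto
    have oB: "coord_open (idx M) ?B" by (rule overlap_open[OF c(1) d(1)])
    have oW: "coord_open (idx M <+> J) ?W" by (rule coord_open_Inl[OF finite_idx finite_J oB])
    show "coord_open (idx total) (snd C ` (fst C \<inter> fst D))" using oW by (simp add: img total_def)
    fix i assume i: "i \<in> idx total"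
    have inv: "\<exists>p v. chart_inv C w = (p, v) \<and> p \<in> fst c \<and> p \<in> fst d \<and> v \<in> E p \<and> p = chart_inv c (\<lambda>i. w (Inl i)) \<and> \<phi> c p v = (\<lambda>j. w (Inr j))"
      if w: "w \<in> ?W" for w
    proof -
      obtain x where x: "x \<in> fst C \<inter> fst D" "w = snd C x" using w img by blast
      obtain p v where pv: "x = (p, v)" by (cases x)
      have px: "p \<in> fst c" "p \<in> fst d" "v \<in> E p" using x CD pv by auto
      have 1: "chart_inv C w = (p, v)" unfolding pv[symmetric] using x t.chart_inv_left \<open>C \<in> atlas total\<close> by blast
      have w': "w = case_sum (snd c p) (\<phi> c p v)" using x pv c by (simp add: bchart_def)
      have 2: "p = chart_inv c (\<lambda>i. w (Inl i))" using w' chart_inv_left[OF c(1) px(1)] by simp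
      have "\<phi> c p v = (\<lambda>j. w (Inr j))" using w' by simp
      with 1 2 px show ?thesis by blast
    qed
    have "smooth_on (idx M <+> J) ?W (\<lambda>w. snd D (chart_inv C w) i)"
    proof (cases i)
      case (Inl k)
      have k: "k \<in> idx M" using i Inl by (auto simp: total_def)
      have "smooth_on (idx M <+> J) ?W (\<lambda>w. snd d (chart_inv c (\<lambda>i. w (Inl i))) k)"
        by (rule smooth_on_Inl[OF finite_idx finite_J oB overlap_smooth[OF c(1) d(1) k]])
      moreover have "snd d (chart_inv c (\<lambda>i. w (Inl i))) k = snd D (chart_inv C w) i" if "w \<in> ?W" for w
        using inv[OF that] Inl d by (auto simp: bchart_def)
      ultimately show ?thesis using smooth_on_cong[OF finite_Plus[OF finite_idx finite_J] oW] by (metis (no_types, lifting))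
    next
      case (Inr j)
      have j: "j \<in> J" using i Inr by (auto simp: total_def)
      \<comment> \<open>The new fibre coordinates are linear in the old ones, with coefficients that
        are smooth functions of the base coordinates.\<close>
      have "smooth_on (idx M <+> J) ?W (\<lambda>w. \<Sum>k\<in>J. A c d j k (chart_inv c (\<lambda>i. w (Inl i))) * w (Inr k))"
      proof (rule smooth_on_sum[OF finite_Plus[OF finite_idx finite_J] oW])
        fix k assume k: "k \<in> J"
        show "smooth_on (idx M <+> J) ?W (\<lambda>w. A c d j k (chart_inv c (\<lambda>i. w (Inl i))) * w (Inr k))"
          by (rule smooth_on_mult[OF finite_Plus[OF finite_idx finite_J] oW])
             (rule smooth_on_Inl[OF finite_idx finite_J oB A[OF c(1) d(1) j k]],
              rule smooth_on_coord[OF finite_Plus[OF finite_idx finite_J] oW])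
      qed
      moreover have "(\<Sum>k\<in>J. A c d j k (chart_inv c (\<lambda>i. w (Inl i))) * w (Inr k)) = snd D (chart_inv C w) i" if "w \<in> ?W" for w
      proof -
        obtain p v where pv: "chart_inv C w = (p, v)" "p \<in> fst c" "p \<in> fst d" "v \<in> E p" "p = chart_inv c (\<lambda>i. w (Inl i))"
          "\<phi> c p v = (\<lambda>j. w (Inr j))" using inv[OF \<open>w \<in> ?W\<close>] by blast
        have "snd D (chart_inv C w) i = \<phi> d p v j" using pv(1) Inr d by (simp add: bchart_def)
        also have "\<dots> = (\<Sum>k\<in>J. A c d j k p * \<phi> c p v k)" by (rule \<phi>[OF c(1) d(1) j pv(2-4)])
        finally show ?thesis using pv(5,6) by simp
      qed
      ultimately show ?thesis using smooth_on_cong[OF finite_Plus[OF finite_idx finite_J] oW] by (metis (no_types, lifting))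
    qed
    then show "smooth_on (idx total) (snd C ` (fst C \<inter> fst D)) (\<lambda>u. snd D (chart_inv C u) i)"
      unfolding img by (simp add: total_def)
  qed
qed

end

section \<open>The three bundles as instances\<close>

context charted
begin

lemma smooth_coord_vec:
  assumes c: "c \<in> atlas M" and k: "k \<in> idx M" and W: "openin (mtopology M) W" "W \<subseteq> fst c"
    and f: "smooth_on (idx M) (snd c ` W) (\<lambda>u. f (chart_inv c u))"
    and sm: "\<And>p. p \<in> W \<Longrightarrow> smooth_at M p f"
  shows "smooth_on (idx M) (snd c ` W) (\<lambda>u. coord_vec M c (chart_inv c u) k f)"
proof -
  have "fst c \<inter> W = W" using W by blast
  then have o: "coord_open (idx M) (snd c ` W)" using W c openin_mtopology by (metis)
  have "smooth_on (idx M) (snd c ` W) (pderiv_at k (\<lambda>u. f (chart_inv c u)))"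
    by (rule smooth_on_pderiv[OF f k])
  moreover have "pderiv_at k (\<lambda>u. f (chart_inv c u)) u = coord_vec M c (chart_inv c u) k f" if "u \<in> snd c ` W" for u
  proof -
    obtain p where p: "p \<in> W" "u = snd c p" using \<open>u \<in> snd c ` W\<close> by (rule imageE) blast
    then show ?thesis using coord_vec_pderiv[OF c _ k, of p f] sm[OF p(1)] W chart_inv_left[OF c, of p] by auto
  qed
  ultimately show ?thesis using smooth_on_cong[OF finite_idx o] by (metis (no_types, lifting))
qed

lemma smooth_jacobian:
  assumes c: "c \<in> atlas M" and d: "d \<in> atlas M" and jk: "j \<in> idx M" "k \<in> idx M"
  shows "smooth_on (idx M) (snd c ` (fst c \<inter> fst d)) (\<lambda>u. coord_vec M c (chart_inv c u) k (\<lambda>q. snd d q j))"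
  by (rule smooth_coord_vec[OF c jk(2)])
     (use openin_chart[OF c] openin_chart[OF d] overlap_smooth[OF c d jk(1)] smooth_at_coord[OF d] in auto)

abbreviation tangent_fibre :: "('m, 'i) chart \<Rightarrow> 'm \<Rightarrow> 'm tvec \<Rightarrow> 'i \<Rightarrow> real" where
  "tangent_fibre c p v \<equiv> \<lambda>i. if i \<in> idx M then v (\<lambda>q. snd c q i) else 0"

abbreviation cotangent_fibre :: "('m, 'i) chart \<Rightarrow> 'm \<Rightarrow> 'm covec \<Rightarrow> 'i \<Rightarrow> real" where
  "cotangent_fibre c p a \<equiv> \<lambda>i. if i \<in> idx M then a (coord_vec M c p i) else 0"

lemma tangent_fibre_bij:
  assumes c: "c \<in> atlas M" and p: "p \<in> fst c"
  shows "bij_betw (tangent_fibre c p) (tangent_space M p) (coord_space (idx M))"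
  unfolding bij_betw_def
proof
  show "inj_on (tangent_fibre c p) (tangent_space M p)"
    by (rule inj_onI, rule tangent_eqI[OF c p]) (auto dest: fun_cong, metis)
  show "tangent_fibre c p ` tangent_space M p = coord_space (idx M)"
  proof (intro equalityI subsetI)
    fix a assume a: "a \<in> coord_space (idx M)"
    let ?v = "\<lambda>f. \<Sum>i\<in>idx M. a i * coord_vec M c p i f"
    have "tangent_fibre c p ?v = a" using a tangent_coord_comb[OF c p] by (auto simp: coord_space_def)
    then show "a \<in> tangent_fibre c p ` tangent_space M p" using tangent_comb[OF c p, of a]
      by (intro image_eqI[of _ _ ?v]) (simp_all only:)
  qed (auto simp: coord_space_def)
qed

lemma cotangent_comb:
  assumes c: "c \<in> atlas M" and p: "p \<in> fst c"
  shows "(\<lambda>v. \<Sum>i\<in>idx M. a i * coord_covec M c p i v) \<in> cotangent_space M p"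
proof -
  have "p \<in> pts M" using c p chart_sub by blast
  then show ?thesis by (intro lin_closed_sum[OF cotangent_lin_closed] finite_idx coord_covec_cotangent)
qed

lemma cotangent_coord_comb:
  assumes c: "c \<in> atlas M" and p: "p \<in> fst c" and j: "j \<in> idx M"
  shows "(\<Sum>i\<in>idx M. a i * coord_covec M c p i (coord_vec M c p j)) = a j"
proof -
  have "(\<Sum>i\<in>idx M. a i * coord_covec M c p i (coord_vec M c p j)) = (\<Sum>i\<in>idx M. if i = j then a i else 0)"
    by (rule sum.cong[OF refl]) (simp add: coord_covec_dual[OF c p j])
  then show ?thesis using finite_idx j by (simp add: sum.delta)
qed

lemma cotangent_fibre_bij:
  assumes c: "c \<in> atlas M" and p: "p \<in> fst c"
  shows "bij_betw (cotangent_fibre c p) (cotangent_space M p) (coord_space (idx M))"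
  unfolding bij_betw_def
proof
  show "inj_on (cotangent_fibre c p) (cotangent_space M p)"
    by (rule inj_onI, rule cotangent_eqI[OF c p]) (auto dest: fun_cong, metis)
  show "cotangent_fibre c p ` cotangent_space M p = coord_space (idx M)"
  proof (intro equalityI subsetI)
    fix a assume a: "a \<in> coord_space (idx M)"
    let ?v = "\<lambda>v. \<Sum>i\<in>idx M. a i * coord_covec M c p i v"
    have "cotangent_fibre c p ?v = a" using a cotangent_coord_comb[OF c p] by (auto simp: coord_space_def)
    then show "a \<in> cotangent_fibre c p ` cotangent_space M p" using cotangent_comb[OF c p, of a]
      by (intro image_eqI[of _ _ ?v]) (simp_all only:)
  qed (auto simp: coord_space_def)
qed

text \<open>The transition matrix is the Jacobian of the coordinate change.\<close>

lemma charted_tangent_bundle: "charted (tangent_bundle M)"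
proof -
  interpret b: fibre_bundle M "tangent_space M" "idx M" tangent_fibre
    by unfold_locales (use finite_idx tangent_fibre_bij in auto)
  have "b.bchart = tangent_chart M" by (intro ext) (simp add: b.bchart_def tangent_chart_def)
  then have "b.total = tangent_bundle M" by (simp add: b.total_def tangent_bundle_def)
  moreover have "charted b.total"
  proof (rule b.charted_total[where A = "\<lambda>c d j k p. coord_vec M c p k (\<lambda>q. snd d q j)"])
    show "charted M" by unfold_locales
    fix c d j p v assume c: "c \<in> atlas M" and d: "d \<in> atlas M" and j: "j \<in> idx M" and p: "p \<in> fst c" and v: "v \<in> tangent_space M p"
    show "tangent_fibre d p v j = (\<Sum>k\<in>idx M. coord_vec M c p k (\<lambda>q. snd d q j) * tangent_fibre c p v k)"
      using j fun_cong[OF tangent_expand[OF c p v], of "\<lambda>q. snd d q j"] by (simp add: mult.commute)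
  qed (rule smooth_jacobian)
  ultimately show ?thesis by simp
qed

text \<open>The transition matrix consists of derivatives taken in the target chart
  \<open>d\<close>. They are smooth in the coordinates of \<open>d\<close> at first and are carried
  over to \<open>c\<close> by \<open>smooth_on_change_chart\<close>.\<close>

lemma charted_cotangent_bundle: "charted (cotangent_bundle M)"
proof -
  interpret b: fibre_bundle M "cotangent_space M" "idx M" cotangent_fibre
    by unfold_locales (use finite_idx cotangent_fibre_bij in auto)
  have "b.bchart = cotangent_chart M" by (intro ext) (simp add: b.bchart_def cotangent_chart_def)
  then have "b.total = cotangent_bundle M" by (simp add: b.total_def cotangent_bundle_def)
  moreover have "charted b.total"
  proof (rule b.charted_total[where A = "\<lambda>c d j k p. coord_vec M d p j (\<lambda>q. snd c q k)"])
    show "charted M" by unfold_locales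
    fix c d j k assume cd: "c \<in> atlas M" "d \<in> atlas M" "j \<in> idx M" "k \<in> idx M"
    have "fst c \<inter> fst d \<inter> fst c = fst c \<inter> fst d" by blast
    then show "smooth_on (idx M) (snd c ` (fst c \<inter> fst d)) (\<lambda>u. coord_vec M d (chart_inv c u) j (\<lambda>q. snd c q k))"
      using smooth_on_change_chart[OF cd(2,1) smooth_jacobian[OF cd(2,1,4,3)] openin_chart[OF cd(1)]] by simp
  next
    fix c d j p a assume c: "c \<in> atlas M" and d: "d \<in> atlas M" and j: "j \<in> idx M" and p: "p \<in> fst c" "p \<in> fst d" and a: "a \<in> cotangent_space M p"
    show "cotangent_fibre d p a j = (\<Sum>k\<in>idx M. coord_vec M d p j (\<lambda>q. snd c q k) * cotangent_fibre c p a k)"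
      using j cotangent_eval[OF c p(1) a coord_vec_tangent[OF d p(2) j]] by simp
  qed
  ultimately show ?thesis by simp
qed

lemma mv_fields_altD: "X \<in> mv_fields M r \<Longrightarrow> p \<in> pts M \<Longrightarrow> X p \<in> alt_forms r (cotangent_space M p)"
  by (simp add: mv_fields_def)

lemma mv_fields_smoothD: "X \<in> mv_fields M r \<Longrightarrow> c \<in> atlas M \<Longrightarrow> length js = r \<Longrightarrow> set js \<subseteq> idx M \<Longrightarrow>
  smooth_fun_on M (fst c) (\<lambda>p. X p (map (coord_covec M c p) js))"
  by (simp add: mv_fields_def)

lemma coord_covec_linear_form:
  "c \<in> atlas M \<Longrightarrow> p \<in> fst c \<Longrightarrow> linear_form (tangent_space M p) (coord_covec M c p i)"
  using coord_covec_cotangent[of p c i] chart_sub[of c] by (auto simp: cotangent_iff)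

end

abbreviation ext_fibre :: "('m, 'i::linorder) manifold \<Rightarrow> nat \<Rightarrow> ('m, 'i) chart \<Rightarrow> 'm \<Rightarrow> ('m tvec list \<Rightarrow> real) \<Rightarrow> 'i set \<Rightarrow> real" where
  "ext_fibre M r c p \<omega> \<equiv> \<lambda>S. if S \<subseteq> idx M \<and> card S = r then \<omega> (map (coord_vec M c p) (sorted_list_of_set S)) else 0"

text \<open>Injective because a form is determined by its values on sorted basis lists, surjective
  by wedges of the dual coordinate covectors.\<close>

lemma ext_fibre_bij:
  fixes M :: "('m, 'i::linorder) manifold"
  assumes M: "charted M" and c: "c \<in> atlas M" and p: "p \<in> fst c"
  shows "bij_betw (ext_fibre M r c p) (alt_forms r (tangent_space M p)) (coord_space {S. S \<subseteq> idx M \<and> card S = r})"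
  unfolding bij_betw_def
proof
  interpret charted M by fact
  show "inj_on (ext_fibre M r c p) (alt_forms r (tangent_space M p))"
    by (rule inj_onI, rule alt_forms_eqI[OF _ _ spans_tangent[OF c p]]) (auto dest: fun_cong, metis)
  show "ext_fibre M r c p ` alt_forms r (tangent_space M p) = coord_space {S. S \<subseteq> idx M \<and> card S = r}"
  proof (intro equalityI subsetI)
    fix a assume a: "a \<in> coord_space {S. S \<subseteq> idx M \<and> card S = r}"
    have dual: "coord_covec M c p i (coord_vec M c p j) = (if i = j then 1 else 0)" if "i \<in> idx M" "j \<in> idx M" for i j
      using coord_covec_dual[OF c p that(2), of i] by simp
    have lf: "linear_form (tangent_space M p) (coord_covec M c p i)" if "i \<in> idx M" for i
      by (rule coord_covec_linear_form[OF c p])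
    note * = alt_form_from_coeffs[where d = "coord_covec M c p" and e = "coord_vec M c p" and c = a and r = r,
        OF finite_idx lf dual, unfolded subsets_of_card_def]
    let ?w = "\<lambda>vs. \<Sum>S\<in>{S. S \<subseteq> idx M \<and> card S = r}. a S * wedge_list (map (coord_covec M c p) (sorted_list_of_set S)) vs"
    have "ext_fibre M r c p ?w = a" 
    proof
      fix S show "ext_fibre M r c p ?w S = a S"
        using a *(2)[of S] by (auto simp: coord_space_def)
    qed
    then show "a \<in> ext_fibre M r c p ` alt_forms r (tangent_space M p)" using *(1)
      by (intro image_eqI[of _ _ ?w]) (simp_all only:)
  qed (auto simp: coord_space_def split: if_splits)
qed

lemma wcharted_ext_bundle:
  fixes M :: "('m, 'i::linorder) manifold"
  assumes M: "charted M"
  shows "wcharted (ext_bundle M r)"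
proof -
  interpret charted M by fact
  interpret b: fibre_bundle M "\<lambda>p. alt_forms r (tangent_space M p)" "{S. S \<subseteq> idx M \<and> card S = r}" "ext_fibre M r"
    using ext_fibre_bij[OF M] finite_subsets_of_card[OF finite_idx, unfolded subsets_of_card_def] by unfold_locales auto
  have "b.bchart = ext_chart M r" by (intro ext) (simp add: b.bchart_def ext_chart_def)
  then have "b.total = ext_bundle M r" by (simp add: b.total_def ext_bundle_def)
  then show ?thesis using b.wcharted_total by simp
qed

lemma ext_chart_image:
  fixes M :: "('m, 'i::linorder) manifold"
  assumes M: "charted M" and c: "c \<in> atlas M"
  shows "snd (ext_chart M r c) ` fst (ext_chart M r c) =
    {w \<in> coord_space (idx M <+> {S. S \<subseteq> idx M \<and> card S = r}). (\<lambda>i. w (Inl i)) \<in> snd c ` fst c}"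
proof -
  interpret charted M by fact
  interpret b: fibre_bundle M "\<lambda>p. alt_forms r (tangent_space M p)" "{S. S \<subseteq> idx M \<and> card S = r}" "ext_fibre M r"
    using ext_fibre_bij[OF M] finite_subsets_of_card[OF finite_idx, unfolded subsets_of_card_def] by unfold_locales auto
  have "b.bchart c = ext_chart M r c" by (simp add: b.bchart_def ext_chart_def)
  then show ?thesis using b.bchart_image[OF c order_refl] b.fst_bchart[of c] by simp
qed


section \<open>The tangent map of the wedge map\<close>

lemma smooth_on_congI:
  assumes "finite I" "coord_open I A" "smooth_on I A g" "\<And>u. u \<in> A \<Longrightarrow> f u = g u"
  shows "smooth_on I A f"
  using smooth_on_cong[OF assms(1,2), of f g] assms(3,4) by simp

locale charted_ord = charted M for M :: "('m, 'i::linorder) manifold"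
begin

lemma charted_M: "charted M" ..

sublocale T: charted "tangent_bundle M" by (rule charted_tangent_bundle)

sublocale K: charted "cotangent_bundle M" by (rule charted_cotangent_bundle)

lemma cotangent_chart_atlas: "c \<in> atlas M \<Longrightarrow> cotangent_chart M c \<in> atlas (cotangent_bundle M)"
  by (simp add: cotangent_bundle_def)

lemma tangent_chart_atlas: "c \<in> atlas M \<Longrightarrow> tangent_chart M c \<in> atlas (tangent_bundle M)"
  by (simp add: tangent_bundle_def)

lemma ext_chart_atlas: "c \<in> atlas M \<Longrightarrow> ext_chart M r c \<in> atlas (ext_bundle M r)"
  by (simp add: ext_bundle_def)

lemma coord_dual:
  "c \<in> atlas M \<Longrightarrow> p \<in> fst c \<Longrightarrow> i \<in> idx M \<Longrightarrow> j \<in> idx M \<Longrightarrow> coord_covec M c p i (coord_vec M c p j) = (if i = j then 1 else 0)"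
  using coord_covec_dual[of c p j i] by simp

lemma wedge_list_cotangent:
  "set as \<subseteq> cotangent_space M p \<Longrightarrow> wedge_list as \<in> alt_forms (length as) (tangent_space M p)"
  by (rule wedge_list_alt) (auto simp: cotangent_iff)

abbreviation basis_vecs :: "('m, 'i) chart \<Rightarrow> 'm \<Rightarrow> 'i set \<Rightarrow> 'm tvec list" where
  "basis_vecs c p S \<equiv> map (coord_vec M c p) (sorted_list_of_set S)"

abbreviation basis_covecs :: "('m, 'i) chart \<Rightarrow> 'm \<Rightarrow> 'i set \<Rightarrow> 'm covec list" where
  "basis_covecs c p S \<equiv> map (coord_covec M c p) (sorted_list_of_set S)"

lemma basis_covecs_cotangent:
  assumes "p \<in> pts M" shows "set (basis_covecs c p S) \<subseteq> cotangent_space M p"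
  using coord_covec_cotangent[OF assms, of c] by auto

text \<open>Existence and uniqueness of the pairing. The coordinate formula reproduces
  \<open>X\<close> on wedges by \<open>alt_form_expansion_dual\<close>; any other candidate agrees
  with it, because each form is a combination of wedges of coordinate covectors.\<close>

lemma ext_pairing_coords:
  assumes c: "c \<in> atlas M" and p: "p \<in> fst c" and X: "X \<in> alt_forms r (cotangent_space M p)"
  shows "ext_pairing M p r X = (\<lambda>\<omega>. if \<omega> \<in> alt_forms r (tangent_space M p)
     then \<Sum>S\<in>subsets_of_card (idx M) r. \<omega> (basis_vecs c p S) * X (basis_covecs c p S) else 0)"
    (is "_ = ?L")
  unfolding ext_pairing_def
proof (rule the_equality)
  let ?A = "alt_forms r (tangent_space M p)"
  have pp: "p \<in> pts M" using c p chart_sub by blast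
  show "(\<forall>\<omega>\<in>?A. \<forall>\<eta>\<in>?A. \<forall>c d. ?L (\<lambda>vs. c * \<omega> vs + d * \<eta> vs) = c * ?L \<omega> + d * ?L \<eta>) \<and>
    (\<forall>as. length as = r \<and> set as \<subseteq> cotangent_space M p \<longrightarrow> ?L (wedge_list as) = X as) \<and>
    (\<forall>\<omega>. \<omega> \<notin> ?A \<longrightarrow> ?L \<omega> = 0)"
  proof (intro conjI ballI allI impI)
    fix \<omega> \<eta> a b assume "\<omega> \<in> ?A" "\<eta> \<in> ?A"
    then show "?L (\<lambda>vs. a * \<omega> vs + b * \<eta> vs) = a * ?L \<omega> + b * ?L \<eta>"
      by (simp add: alt_forms_comb sum_distrib_left sum.distrib[symmetric] algebra_simps)
  next
    fix as assume as: "length as = r \<and> set as \<subseteq> cotangent_space M p"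
    have "wedge_list as \<in> ?A" using wedge_list_cotangent[of as p] as by simp
    moreover have "X as = (\<Sum>S\<in>subsets_of_card (idx M) r. X (basis_covecs c p S) * wedge_list as (basis_vecs c p S))"
      by (rule alt_form_expansion_dual[where d = "coord_covec M c p" and e = "coord_vec M c p", OF spans_cotangent[OF c p] coord_dual[OF c p] X]) (use as in auto)
    ultimately show "?L (wedge_list as) = X as" by (simp add: mult.commute)
  qed auto
  fix L assume L: "(\<forall>\<omega>\<in>?A. \<forall>\<eta>\<in>?A. \<forall>c d. L (\<lambda>vs. c * \<omega> vs + d * \<eta> vs) = c * L \<omega> + d * L \<eta>) \<and>
    (\<forall>as. length as = r \<and> set as \<subseteq> cotangent_space M p \<longrightarrow> L (wedge_list as) = X as) \<and>
    (\<forall>\<omega>. \<omega> \<notin> ?A \<longrightarrow> L \<omega> = 0)"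
  have lin: "linear_form ?A L" using L unfolding linear_form_def by blast
  have LX: "L (wedge_list as) = X as" if "length as = r" "set as \<subseteq> cotangent_space M p" for as using L that by blast
  show "L = ?L"
  proof
    fix \<omega>
    show "L \<omega> = ?L \<omega>"
    proof (cases "\<omega> \<in> ?A")
      case False then show ?thesis using linear_form_outside[OF lin] by simp
    next
      case True
      have fin: "finite (subsets_of_card (idx M) r)" by (rule finite_subsets_of_card[OF finite_idx])
      have len: "length (basis_covecs c p S) = r" if "S \<in> subsets_of_card (idx M) r" for S
        using that by (auto simp: subsets_of_card_def)
      have wl: "wedge_list (basis_covecs c p S) \<in> ?A" if "S \<in> subsets_of_card (idx M) r" for S
        using wedge_list_cotangent[OF basis_covecs_cotangent[OF pp], of c S] len[OF that] by simp
      have "\<omega> = (\<lambda>vs. \<Sum>S\<in>subsets_of_card (idx M) r. \<omega> (basis_vecs c p S) * wedge_list (basis_covecs c p S) vs)"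
        by (rule alt_form_expansion[where d = "coord_covec M c p" and e = "coord_vec M c p", OF spans_tangent[OF c p] coord_covec_linear_form[OF c p] coord_dual[OF c p] True])
      then have "L \<omega> = L (\<lambda>vs. \<Sum>S\<in>subsets_of_card (idx M) r. \<omega> (basis_vecs c p S) * wedge_list (basis_covecs c p S) vs)"
        by (rule arg_cong)
      also have "\<dots> = (\<Sum>S\<in>subsets_of_card (idx M) r. \<omega> (basis_vecs c p S) * L (wedge_list (basis_covecs c p S)))"
        by (rule linear_form_sum[OF lin_closed_alt_forms lin fin wl])
      also have "\<dots> = ?L \<omega>" using True LX[OF len basis_covecs_cotangent[OF pp]] by simp
      finally show ?thesis .
    qed
  qed
qed

lemma ext_pairing_wedge:
  assumes p: "p \<in> pts M" and X: "X \<in> alt_forms r (cotangent_space M p)" and as: "length as = r" "set as \<subseteq> cotangent_space M p"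
  shows "ext_pairing M p r X (wedge_list as) = X as"
proof -
  obtain c where c: "c \<in> atlas M" "p \<in> fst c" using chart_at_exists[OF p] by blast
  have "wedge_list as \<in> alt_forms r (tangent_space M p)" using wedge_list_cotangent[OF as(2)] as(1) by simp
  moreover have "X as = (\<Sum>S\<in>subsets_of_card (idx M) r. X (basis_covecs c p S) * wedge_list as (basis_vecs c p S))"
    by (rule alt_form_expansion_dual[where d = "coord_covec M c p" and e = "coord_vec M c p", OF spans_cotangent[OF c] coord_dual[OF c] X as])
  ultimately show ?thesis unfolding ext_pairing_coords[OF c X] by (simp add: mult.commute)
qed

lemma smooth_fun_on_chartD:
  "smooth_fun_on M (fst c) f \<Longrightarrow> c \<in> atlas M \<Longrightarrow> smooth_on (idx M) (snd c ` fst c) (\<lambda>u. f (chart_inv c u))"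
  unfolding smooth_fun_on_def by (metis Int_absorb)

text \<open>In natural coordinates the function is a sum of fibre coordinates times components of
  \<open>X\<close>, and the latter are smooth on the base.\<close>

lemma smooth_mv_function:
  assumes X: "X \<in> mv_fields M r" and a: "a \<in> pts (ext_bundle M r)"
  shows "smooth_at (ext_bundle M r) a (mv_function M r X)"
proof -
  interpret B: wcharted "ext_bundle M r" by (rule wcharted_ext_bundle[OF charted_M])
  let ?F = "{S. S \<subseteq> idx M \<and> card S = r}"
  have finF: "finite ?F" using finite_subsets_of_card[OF finite_idx, of r] by (simp add: subsets_of_card_def)
  have "smooth_fun_on (ext_bundle M r) (pts (ext_bundle M r)) (mv_function M r X)"
    unfolding smooth_fun_on_def
  proof (intro conjI ballI B.openin_pts)
    fix C assume C: "C \<in> atlas (ext_bundle M r)"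
    then obtain c where c: "c \<in> atlas M" "C = ext_chart M r c" by (auto simp: ext_bundle_def)
    let ?W = "{w \<in> coord_space (idx M <+> ?F). (\<lambda>i. w (Inl i)) \<in> snd c ` fst c}"
    have img: "snd C ` fst C = ?W" using ext_chart_image[OF charted_M c(1)] c(2) by simp
    have fin: "finite (idx M <+> ?F)" using finite_idx finF by simp
    have oW: "coord_open (idx M <+> ?F) ?W" by (rule coord_open_Inl[OF finite_idx finF chart_img[OF c(1)]])
    have eq: "mv_function M r X (chart_inv C w) = (\<Sum>S\<in>subsets_of_card (idx M) r. w (Inr S) * X (chart_inv c (\<lambda>i. w (Inl i))) (basis_covecs c (chart_inv c (\<lambda>i. w (Inl i))) S))"
      if w: "w \<in> ?W" for w
    proof -
      obtain p \<omega> where p: "p \<in> fst c" "\<omega> \<in> alt_forms r (tangent_space M p)" "w = snd C (p, \<omega>)"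
        using w unfolding img[symmetric] c(2) by (auto simp: ext_chart_def)
      have pp: "p \<in> pts M" using c p chart_sub by blast
      have inv: "chart_inv C w = (p, \<omega>)" unfolding p(3) using p c(2) by (intro B.chart_inv_left[OF C]) (simp add: ext_chart_def)
      have b: "chart_inv c (\<lambda>i. w (Inl i)) = p" unfolding p(3) c(2) using chart_inv_left[OF c(1) p(1)] by (simp add: ext_chart_def)
      have co: "w (Inr S) = \<omega> (basis_vecs c p S)" if "S \<in> subsets_of_card (idx M) r" for S
        unfolding p(3) c(2) using that by (simp add: ext_chart_def subsets_of_card_def)
      show ?thesis unfolding mv_function_def inv b fst_conv snd_conv ext_pairing_coords[OF c(1) p(1) mv_fields_altD[OF X pp]]
        using p(2) co by simp
    qed
    have "smooth_on (idx M <+> ?F) ?W (\<lambda>w. \<Sum>S\<in>subsets_of_card (idx M) r. w (Inr S) * X (chart_inv c (\<lambda>i. w (Inl i))) (basis_covecs c (chart_inv c (\<lambda>i. w (Inl i))) S))"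
    proof (rule smooth_on_sum[OF fin oW])
      fix S assume S: "S \<in> subsets_of_card (idx M) r"
      have "finite S" using S finite_idx by (auto simp: subsets_of_card_def intro: finite_subset)
      then have "smooth_fun_on M (fst c) (\<lambda>p. X p (basis_covecs c p S))"
        using S by (intro mv_fields_smoothD[OF X c(1)]) (auto simp: subsets_of_card_def)
      then have sm: "smooth_on (idx M) (snd c ` fst c) (\<lambda>u. X (chart_inv c u) (basis_covecs c (chart_inv c u) S))"
        using smooth_fun_on_chartD[OF _ c(1)] by blast
      show "smooth_on (idx M <+> ?F) ?W (\<lambda>w. w (Inr S) * X (chart_inv c (\<lambda>i. w (Inl i))) (basis_covecs c (chart_inv c (\<lambda>i. w (Inl i))) S))"
        by (rule smooth_on_mult[OF fin oW smooth_on_coord[OF fin oW] smooth_on_Inl[OF finite_idx finF chart_img[OF c(1)] sm]])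
    qed
    then have "smooth_on (idx M <+> ?F) ?W (\<lambda>w. mv_function M r X (chart_inv C w))"
      by (rule smooth_on_congI[OF fin oW]) (rule eq)
    moreover have "fst C \<inter> pts (ext_bundle M r) = fst C" using B.chart_sub[OF C] by blast
    ultimately show "smooth_on (idx (ext_bundle M r)) (snd C ` (fst C \<inter> pts (ext_bundle M r))) (\<lambda>u. mv_function M r X (chart_inv C u))"
      using img by (simp add: ext_bundle_def)
  qed
  then show ?thesis using a unfolding smooth_at_def by blast
qed

text \<open>The chart components of the velocity of a wedge curve, written in terms of the
  velocities \<open>ws\<close> alone. The base part is read off the first factor; the fibre part
  differentiates the determinants of the components.\<close>

definition wedge_velocity :: "('m, 'i) chart \<Rightarrow> (('m \<times> 'm covec) \<times> ('m \<times> 'm covec) tvec) list \<Rightarrow> 'i + 'i set \<Rightarrow> real" where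
  "wedge_velocity c ws = case_sum
     (\<lambda>i. snd (hd ws) (\<lambda>q. snd (cotangent_chart M c) q (Inl i)))
     (\<lambda>S. det_deriv (length ws)
        (\<lambda>i j. snd (fst (ws ! i)) (coord_vec M c (fst (fst (ws ! i))) (sorted_list_of_set S ! j)))
        (\<lambda>i j. snd (ws ! i) (\<lambda>q. snd (cotangent_chart M c) q (Inr (sorted_list_of_set S ! j)))))"

text \<open>The list is nonempty because \<open>wedge_map\<close> takes the base point from its
  head.\<close>

definition covec_curves :: "'m \<Rightarrow> (real \<Rightarrow> 'm \<times> 'm covec) list \<Rightarrow> bool" where
  "covec_curves p \<gamma>s \<longleftrightarrow> \<gamma>s \<noteq> [] \<and> (\<forall>\<gamma>\<in>set \<gamma>s. smooth_curve (cotangent_bundle M) \<gamma> \<and> fst (\<gamma> 0) = p) \<and>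
     (\<forall>\<^sub>F t in nhds 0. \<forall>\<gamma>\<in>set \<gamma>s. \<forall>\<delta>\<in>set \<gamma>s. fst (\<gamma> t) = fst (\<delta> t))"

lemma smooth_curve_mem: 
  assumes "smooth_curve (cotangent_bundle M) \<gamma>" shows "\<gamma> 0 \<in> pts (cotangent_bundle M)"
proof -
  obtain C e where "C \<in> atlas (cotangent_bundle M)" "e > 0" "\<gamma> ` {-e<..<e} \<subseteq> fst C"
    using assms by (auto simp: smooth_curve_def)
  moreover from this have "\<gamma> 0 \<in> fst C" by auto
  ultimately show ?thesis using K.chart_sub by blast
qed

lemma covec_curve_at:
  assumes c: "c \<in> atlas M" and \<gamma>: "smooth_curve (cotangent_bundle M) \<gamma>" and p: "fst (\<gamma> 0) \<in> fst c"
  shows "K.curve_at (cotangent_chart M c) \<gamma> (\<lambda>i. snd (velocity (cotangent_bundle M) \<gamma>) (\<lambda>q. snd (cotangent_chart M c) q i))"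
proof (rule K.smooth_curve_curve_at[OF cotangent_chart_atlas[OF c] \<gamma>])
  show "\<gamma> 0 \<in> fst (cotangent_chart M c)" using smooth_curve_mem[OF \<gamma>] p
    by (cases "\<gamma> 0") (auto simp: cotangent_bundle_def cotangent_chart_def)
qed

lemma wedge_curve_at:
  assumes c: "c \<in> atlas M" and p: "p \<in> fst c" and \<gamma>s: "covec_curves p \<gamma>s" and r: "length \<gamma>s = r"
  shows "wcharted.curve_at (ext_bundle M r) (ext_chart M r c) (\<lambda>t. wedge_map (map (\<lambda>\<gamma>. \<gamma> t) \<gamma>s))
     (wedge_velocity c (map (velocity (cotangent_bundle M)) \<gamma>s))"
proof -
  interpret B: wcharted "ext_bundle M r" by (rule wcharted_ext_bundle[OF charted_M])
  let ?K = "cotangent_chart M c" and ?V = "velocity (cotangent_bundle M)"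
  have ne: "\<gamma>s \<noteq> []" and ev: "\<forall>\<^sub>F t in nhds 0. \<forall>\<gamma>\<in>set \<gamma>s. \<forall>\<delta>\<in>set \<gamma>s. fst (\<gamma> t) = fst (\<delta> t)"
    using \<gamma>s by (auto simp: covec_curves_def)
  have cu: "K.curve_at ?K \<gamma> (\<lambda>i. snd (?V \<gamma>) (\<lambda>q. snd ?K q i))" and sm: "fst (\<gamma> 0) = p" if "\<gamma> \<in> set \<gamma>s" for \<gamma>
  proof -
    show "fst (\<gamma> 0) = p" using \<gamma>s that by (simp add: covec_curves_def)
    show "K.curve_at ?K \<gamma> (\<lambda>i. snd (?V \<gamma>) (\<lambda>q. snd ?K q i))"
      by (rule covec_curve_at[OF c]) (use \<gamma>s that p in \<open>auto simp: covec_curves_def\<close>)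
  qed
  have mem: "\<forall>\<^sub>F t in nhds 0. \<forall>\<gamma>\<in>set \<gamma>s. \<gamma> t \<in> fst ?K"
    using cu unfolding K.curve_at_def by (intro eventually_ball_finite) auto
  \<comment> \<open>For small times all factors lie in the chart and over the base point of the
    first one, so their wedge is an element of a single fibre.\<close>
  have good: "\<forall>\<^sub>F t in nhds 0. fst (hd \<gamma>s t) \<in> fst c \<and> (\<forall>\<gamma>\<in>set \<gamma>s. fst (\<gamma> t) = fst (hd \<gamma>s t) \<and> snd (\<gamma> t) \<in> cotangent_space M (fst (hd \<gamma>s t)))"
    using mem ev
  proof eventually_elim
    case (elim t)
    have h: "hd \<gamma>s \<in> set \<gamma>s" using ne by simp
    have 1: "fst (\<gamma> t) = fst (hd \<gamma>s t)" if "\<gamma> \<in> set \<gamma>s" for \<gamma> using elim(2) that h by blast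
    have 2: "fst (\<gamma> t) \<in> fst c" "snd (\<gamma> t) \<in> cotangent_space M (fst (\<gamma> t))" if "\<gamma> \<in> set \<gamma>s" for \<gamma>
      using elim(1) that by (auto simp: cotangent_chart_def)
    show ?case
    proof (intro conjI ballI)
      show "fst (hd \<gamma>s t) \<in> fst c" by (rule 2(1)[OF h])
      fix \<gamma> assume g: "\<gamma> \<in> set \<gamma>s"
      show "fst (\<gamma> t) = fst (hd \<gamma>s t)" by (rule 1[OF g])
      show "snd (\<gamma> t) \<in> cotangent_space M (fst (hd \<gamma>s t))" using 2(2)[OF g] unfolding 1[OF g] .
    qed
  qed
  have der: "((\<lambda>t. snd ?K (\<gamma> t) i) has_real_derivative snd (?V \<gamma>) (\<lambda>q. snd ?K q i)) (at 0)"
    if "\<gamma> \<in> set \<gamma>s" "i \<in> idx M <+> idx M" for \<gamma> i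
    using cu[OF that(1)] that(2) unfolding K.curve_at_def by (auto simp: cotangent_bundle_def)
  show ?thesis unfolding B.curve_at_def
  proof (intro conjI ballI)
    show "\<forall>\<^sub>F t in nhds 0. wedge_map (map (\<lambda>\<gamma>. \<gamma> t) \<gamma>s) \<in> fst (ext_chart M r c)"
      using good
    proof eventually_elim
      case (elim t)
      have "set (map snd (map (\<lambda>\<gamma>. \<gamma> t) \<gamma>s)) \<subseteq> cotangent_space M (fst (hd \<gamma>s t))" using elim by auto
      from wedge_list_cotangent[OF this]
      have "wedge_list (map snd (map (\<lambda>\<gamma>. \<gamma> t) \<gamma>s)) \<in> alt_forms r (tangent_space M (fst (hd \<gamma>s t)))" using r by simp
      moreover have "fst (hd \<gamma>s t) \<in> fst c" using elim by blast
      ultimately show ?case using ne by (simp add: wedge_map_def ext_chart_def hd_map)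
    qed
    fix i assume i: "i \<in> idx (ext_bundle M r)"
    show "((\<lambda>t. snd (ext_chart M r c) (wedge_map (map (\<lambda>\<gamma>. \<gamma> t) \<gamma>s)) i) has_real_derivative
         wedge_velocity c (map ?V \<gamma>s) i) (at 0)"
    proof (cases i)
      case (Inl k)
      have "snd (ext_chart M r c) (wedge_map (map (\<lambda>\<gamma>. \<gamma> t) \<gamma>s)) i = snd ?K (hd \<gamma>s t) (Inl k)" for t
        using Inl ne by (simp add: wedge_map_def ext_chart_def cotangent_chart_def hd_map split: prod.split)
      then show ?thesis using der[of "hd \<gamma>s" "Inl k"] Inl i ne by (auto simp: wedge_velocity_def hd_map ext_bundle_def)
    next
      case (Inr S)
      have S: "S \<subseteq> idx M" "card S = r" using i Inr by (auto simp: ext_bundle_def)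
      have finS: "finite S" using S finite_idx finite_subset by blast
      let ?s = "sorted_list_of_set S"
      have ls: "length ?s = r" using S by simp
      have mS: "?s ! j \<in> idx M" if "j < r" for j
        using nth_mem[of j ?s] that ls S(1) finS by auto
      let ?as = "\<lambda>t. map snd (map (\<lambda>\<gamma>. \<gamma> t) \<gamma>s)" and ?vs = "\<lambda>t. map (coord_vec M c (fst (hd \<gamma>s t))) ?s"
      have co: "snd (ext_chart M r c) (wedge_map (map (\<lambda>\<gamma>. \<gamma> t) \<gamma>s)) i = wedge_list (?as t) (?vs t)" for t
        using Inr S ne by (simp add: wedge_map_def ext_chart_def hd_map)
      have "((\<lambda>t. wedge_list (?as t) (?vs t)) has_real_derivative
        det_deriv r (\<lambda>i j. snd (fst ((map ?V \<gamma>s) ! i)) (coord_vec M c (fst (fst ((map ?V \<gamma>s) ! i))) (?s ! j)))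
          (\<lambda>i j. snd ((map ?V \<gamma>s) ! i) (\<lambda>q. snd ?K q (Inr (?s ! j))))) (at 0)"
      proof (rule wedge_list_has_deriv)
        show "length (?as t) = r" "length (?vs t) = r" for t using r ls by auto
        fix k j assume kj: "k < r" "j < r"
        have gk: "\<gamma>s ! k \<in> set \<gamma>s" using kj r by simp
        \<comment> \<open>The matrix entry is a natural fibre coordinate of the \<open>k\<close>-th
          curve, once its base point is replaced by that of the first curve.\<close>
        have ev2: "\<forall>\<^sub>F t in nhds 0. snd ?K ((\<gamma>s ! k) t) (Inr (?s ! j)) = (?as t ! k) (?vs t ! j)"
          using good
        proof eventually_elim
          case (elim t)
          then have "fst ((\<gamma>s ! k) t) = fst (hd \<gamma>s t)" using gk by blast
          then show ?case using kj r ls mS by (auto simp: cotangent_chart_def split: prod.split)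
        qed
        have "((\<lambda>t. snd ?K ((\<gamma>s ! k) t) (Inr (?s ! j))) has_real_derivative snd (?V (\<gamma>s ! k)) (\<lambda>q. snd ?K q (Inr (?s ! j)))) (at 0)"
          by (rule der[OF gk]) (use mS[OF kj(2)] in auto)
        then have "((\<lambda>t. (?as t ! k) (?vs t ! j)) has_real_derivative snd (?V (\<gamma>s ! k)) (\<lambda>q. snd ?K q (Inr (?s ! j)))) (at 0)"
          using DERIV_cong_ev[OF refl ev2 refl] by blast
        then show "((\<lambda>t. (?as t ! k) (?vs t ! j)) has_real_derivative snd ((map ?V \<gamma>s) ! k) (\<lambda>q. snd ?K q (Inr (?s ! j)))) (at 0)"
          using kj r by simp
        have "fst (hd \<gamma>s 0) = p" using sm ne by simp
        then show "(?as 0 ! k) (?vs 0 ! j) = snd (fst ((map ?V \<gamma>s) ! k)) (coord_vec M c (fst (fst ((map ?V \<gamma>s) ! k))) (?s ! j))"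
          using kj r ls sm[OF gk] by (simp add: velocity_def)
      qed
      then show ?thesis unfolding co using Inr r by (simp add: wedge_velocity_def)
    qed
  qed
qed

text \<open>Two families with the same velocities have the same initial points and the same
  \<open>wedge_velocity\<close>, hence the same velocity of their wedge; the description thus has
  one value.\<close>

lemma tangent_wedge_eq:
  assumes p: "p \<in> pts M" and \<gamma>s: "covec_curves p \<gamma>s" and r: "length \<gamma>s = r"
  shows "tangent_wedge M r (map (velocity (cotangent_bundle M)) \<gamma>s) = velocity (ext_bundle M r) (\<lambda>t. wedge_map (map (\<lambda>\<gamma>. \<gamma> t) \<gamma>s))"
  unfolding tangent_wedge_def
proof (rule the_equality)
  interpret B: wcharted "ext_bundle M r" by (rule wcharted_ext_bundle[OF charted_M])
  let ?V = "velocity (cotangent_bundle M)"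
  show "\<exists>\<delta>s. length \<delta>s = r \<and> (\<forall>\<gamma>\<in>set \<delta>s. smooth_curve (cotangent_bundle M) \<gamma>) \<and>
      (\<forall>\<^sub>F t in nhds 0. \<forall>\<gamma>\<in>set \<delta>s. \<forall>\<delta>\<in>set \<delta>s. fst (\<gamma> t) = fst (\<delta> t)) \<and>
      map ?V \<delta>s = map ?V \<gamma>s \<and>
      velocity (ext_bundle M r) (\<lambda>t. wedge_map (map (\<lambda>\<gamma>. \<gamma> t) \<gamma>s)) = velocity (ext_bundle M r) (\<lambda>t. wedge_map (map (\<lambda>\<gamma>. \<gamma> t) \<delta>s))"
    using \<gamma>s r by (intro exI[of _ \<gamma>s]) (simp add: covec_curves_def)
  fix W
  assume "\<exists>\<delta>s. length \<delta>s = r \<and> (\<forall>\<gamma>\<in>set \<delta>s. smooth_curve (cotangent_bundle M) \<gamma>) \<and>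
      (\<forall>\<^sub>F t in nhds 0. \<forall>\<gamma>\<in>set \<delta>s. \<forall>\<delta>\<in>set \<delta>s. fst (\<gamma> t) = fst (\<delta> t)) \<and>
      map ?V \<delta>s = map ?V \<gamma>s \<and> W = velocity (ext_bundle M r) (\<lambda>t. wedge_map (map (\<lambda>\<gamma>. \<gamma> t) \<delta>s))"
  then obtain \<delta>s where \<delta>s: "length \<delta>s = r" "\<forall>\<gamma>\<in>set \<delta>s. smooth_curve (cotangent_bundle M) \<gamma>"
      "\<forall>\<^sub>F t in nhds 0. \<forall>\<gamma>\<in>set \<delta>s. \<forall>\<delta>\<in>set \<delta>s. fst (\<gamma> t) = fst (\<delta> t)"
      "map ?V \<delta>s = map ?V \<gamma>s" "W = velocity (ext_bundle M r) (\<lambda>t. wedge_map (map (\<lambda>\<gamma>. \<gamma> t) \<delta>s))" by blast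
  have fstV: "fst (?V \<gamma>) = \<gamma> 0" for \<gamma> by (simp add: velocity_def)
  have at0: "map (\<lambda>\<gamma>. \<gamma> 0) \<delta>s = map (\<lambda>\<gamma>. \<gamma> 0) \<gamma>s"
    using arg_cong[OF \<delta>s(4), of "map fst"] by (simp add: fstV o_def)
  have "fst (\<delta> 0) = p" if "\<delta> \<in> set \<delta>s" for \<delta>
  proof -
    have "\<delta> 0 \<in> set (map (\<lambda>\<gamma>. \<gamma> 0) \<gamma>s)" unfolding at0[symmetric] using that by auto
    then show ?thesis using \<gamma>s by (auto simp: covec_curves_def)
  qed
  moreover have "\<delta>s \<noteq> []" using \<gamma>s \<delta>s(1) r by (auto simp: covec_curves_def)
  ultimately have cd: "covec_curves p \<delta>s" using \<delta>s by (simp add: covec_curves_def)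
  obtain c where c: "c \<in> atlas M" "p \<in> fst c" using chart_at_exists[OF p] by blast
  show "W = velocity (ext_bundle M r) (\<lambda>t. wedge_map (map (\<lambda>\<gamma>. \<gamma> t) \<gamma>s))"
    unfolding \<delta>s(5)
      B.velocity_curve_at[OF ext_chart_atlas[OF c(1)] wedge_curve_at[OF c cd \<delta>s(1)]]
      B.velocity_curve_at[OF ext_chart_atlas[OF c(1)] wedge_curve_at[OF c \<gamma>s r]] \<delta>s(4) at0 ..
qed

text \<open>Along the wedge curve the function of \<open>X\<close> is \<open>X\<close> evaluated on
  the covectors, by \<open>ext_pairing_wedge\<close>. This replaces the exterior bundle by the
  derivative of a real function.\<close>

lemma tangent_wedge_differential:
  assumes p: "p \<in> pts M" and \<gamma>s: "covec_curves p \<gamma>s" and r: "length \<gamma>s = r" and X: "X \<in> mv_fields M r"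
  defines "W \<equiv> tangent_wedge M r (map (velocity (cotangent_bundle M)) \<gamma>s)"
  shows "((\<lambda>t. X (fst (hd \<gamma>s t)) (map (\<lambda>\<gamma>. snd (\<gamma> t)) \<gamma>s)) has_real_derivative
    differential (ext_bundle M r) (mv_function M r X) (fst W) (snd W)) (at 0)"
proof -
  interpret B: wcharted "ext_bundle M r" by (rule wcharted_ext_bundle[OF charted_M])
  let ?\<Gamma> = "\<lambda>t. wedge_map (map (\<lambda>\<gamma>. \<gamma> t) \<gamma>s)"
  have W: "W = velocity (ext_bundle M r) ?\<Gamma>" unfolding W_def by (rule tangent_wedge_eq[OF p \<gamma>s r])
  obtain c where c: "c \<in> atlas M" "p \<in> fst c" using chart_at_exists[OF p] by blast
  note E = ext_chart_atlas[OF c(1), of r]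
  note cu = wedge_curve_at[OF c \<gamma>s r]
  have mem0: "?\<Gamma> 0 \<in> fst (ext_chart M r c)" using cu by (rule B.curve_at_mem)
  have "smooth_at (ext_bundle M r) (?\<Gamma> 0) (mv_function M r X)"
    by (rule smooth_mv_function[OF X]) (use mem0 B.chart_sub[OF E] in blast)
  from B.curve_at_deriv_velocity[OF E cu this]
  have D: "((\<lambda>t. mv_function M r X (?\<Gamma> t)) has_real_derivative snd W (mv_function M r X)) (at 0)" unfolding W .
  have fW: "fst W = ?\<Gamma> 0" unfolding W by (simp add: velocity_def)
  have "snd W \<in> tangent_space (ext_bundle M r) (fst W)"
    unfolding W B.velocity_curve_at[OF E cu] fst_conv snd_conv by (rule B.tangent_comb[OF E mem0])
  then have dW: "differential (ext_bundle M r) (mv_function M r X) (fst W) (snd W) = snd W (mv_function M r X)"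
    by (simp add: differential_def)
  have ne: "\<gamma>s \<noteq> []" using \<gamma>s by (simp add: covec_curves_def)
  have memk: "\<forall>\<^sub>F t in nhds 0. \<forall>\<gamma>\<in>set \<gamma>s. \<gamma> t \<in> fst (cotangent_chart M c)"
  proof (intro eventually_ball_finite ballI)
    fix \<gamma> assume "\<gamma> \<in> set \<gamma>s"
    then have "K.curve_at (cotangent_chart M c) \<gamma> (\<lambda>i. snd (velocity (cotangent_bundle M) \<gamma>) (\<lambda>q. snd (cotangent_chart M c) q i))"
      using \<gamma>s c by (intro covec_curve_at[OF c(1)]) (auto simp: covec_curves_def)
    then show "\<forall>\<^sub>F t in nhds 0. \<gamma> t \<in> fst (cotangent_chart M c)" by (simp add: K.curve_at_def)
  qed simp
  have ev: "\<forall>\<^sub>F t in nhds 0. \<forall>\<gamma>\<in>set \<gamma>s. \<forall>\<delta>\<in>set \<gamma>s. fst (\<gamma> t) = fst (\<delta> t)"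
    using \<gamma>s by (simp add: covec_curves_def)
  have "\<forall>\<^sub>F t in nhds 0. mv_function M r X (?\<Gamma> t) = X (fst (hd \<gamma>s t)) (map (\<lambda>\<gamma>. snd (\<gamma> t)) \<gamma>s)"
    using memk ev
  proof eventually_elim
    case (elim t)
    have h: "hd \<gamma>s \<in> set \<gamma>s" using ne by simp
    have 1: "fst (\<gamma> t) = fst (hd \<gamma>s t)" if "\<gamma> \<in> set \<gamma>s" for \<gamma> using elim(2) that h by blast
    have 2: "fst (\<gamma> t) \<in> fst c" "snd (\<gamma> t) \<in> cotangent_space M (fst (\<gamma> t))" if "\<gamma> \<in> set \<gamma>s" for \<gamma>
      using elim(1) that by (auto simp: cotangent_chart_def)
    have q: "fst (hd \<gamma>s t) \<in> pts M" using 2(1)[OF h] chart_sub[OF c(1)] by blast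
    have "set (map (\<lambda>\<gamma>. snd (\<gamma> t)) \<gamma>s) \<subseteq> cotangent_space M (fst (hd \<gamma>s t))" using 1 2(2) by fastforce
    then show ?case
      using ext_pairing_wedge[OF q mv_fields_altD[OF X q], of "map (\<lambda>\<gamma>. snd (\<gamma> t)) \<gamma>s"] r ne
      by (simp add: mv_function_def wedge_map_def hd_map o_def)
  qed
  from DERIV_cong_ev[OF refl this refl] D show ?thesis unfolding dW by blast
qed

end


section \<open>The canonical flip\<close>

lemma Inl_in_Plus [simp]: "Inl i \<in> A <+> B \<longleftrightarrow> i \<in> A"
  and Inr_in_Plus [simp]: "Inr j \<in> A <+> B \<longleftrightarrow> j \<in> B"
  by auto

lemma (in fibre_bundle) smooth_fun_on_pullback:
  assumes f: "smooth_fun_on M W f"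
  shows "smooth_fun_on total (Sigma W E) (\<lambda>q. f (fst q))"
proof -
  interpret t: wcharted total by (rule wcharted_total)
  have W: "openin (mtopology M) W" using f by (simp add: smooth_fun_on_def)
  have img: "snd (bchart c) ` (fst (bchart c) \<inter> Sigma W E) = {w \<in> coord_space (idx M <+> J). (\<lambda>i. w (Inl i)) \<in> snd c ` (fst c \<inter> W)}"
    if "c \<in> atlas M" for c
  proof -
    have "fst (bchart c) \<inter> Sigma W E = Sigma (fst c \<inter> W) E" unfolding fst_bchart by auto
    then show ?thesis using bchart_image[OF that, of "fst c \<inter> W"] by auto
  qed
  have oB: "coord_open (idx M) (snd c ` (fst c \<inter> W))" if "c \<in> atlas M" for c
    using W that by (simp add: openin_mtopology)
  show ?thesis unfolding smooth_fun_on_def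
  proof (intro conjI ballI)
    show "openin (mtopology total) (Sigma W E)" unfolding t.openin_mtopology
    proof (intro conjI ballI)
      show "Sigma W E \<subseteq> pts total" using W by (auto simp: openin_mtopology total_def)
      fix C assume "C \<in> atlas total"
      then obtain c where c: "c \<in> atlas M" "C = bchart c" by (auto simp: total_def)
      show "coord_open (idx total) (snd C ` (fst C \<inter> Sigma W E))"
        unfolding c(2) img[OF c(1)] using coord_open_Inl[OF finite_idx finite_J oB[OF c(1)]] by (simp add: total_def)
    qed
    fix C assume C: "C \<in> atlas total"
    then obtain c where c: "c \<in> atlas M" "C = bchart c" by (auto simp: total_def)
    let ?W = "{w \<in> coord_space (idx M <+> J). (\<lambda>i. w (Inl i)) \<in> snd c ` (fst c \<inter> W)}"
    have "smooth_on (idx M) (snd c ` (fst c \<inter> W)) (\<lambda>u. f (chart_inv c u))" using f c by (simp add: smooth_fun_on_def)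
    note S = smooth_on_Inl[OF finite_idx finite_J oB[OF c(1)] this]
    have "smooth_on (idx M <+> J) ?W (\<lambda>w. f (fst (chart_inv C w)))"
    proof (rule smooth_on_congI[OF finite_Plus[OF finite_idx finite_J] coord_open_Inl[OF finite_idx finite_J oB[OF c(1)]] S])
      fix w assume "w \<in> ?W"
      then obtain x where x: "x \<in> fst C" "x \<in> Sigma W E" "w = snd C x" using img[OF c(1)] c(2) by blast
      have "chart_inv C w = x" using t.chart_inv_left[OF C x(1)] x(3) by simp
      moreover have "(\<lambda>i. w (Inl i)) = snd c (fst x)" unfolding x(3) c(2) by (cases x) (simp add: bchart_def)
      moreover have "fst x \<in> fst c" using x(1) c(2) by (auto simp: bchart_def)
      ultimately show "f (fst (chart_inv C w)) = f (chart_inv c (\<lambda>i. w (Inl i)))" using chart_inv_left[OF c(1)] by simp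
    qed
    then show "smooth_on (idx total) (snd C ` (fst C \<inter> Sigma W E)) (\<lambda>u. f (fst (chart_inv C u)))"
      unfolding c(2) img[OF c(1)] by (simp add: total_def)
  qed
qed

context charted
begin

lemma smooth_fun_on_tangent_pullback:
  assumes f: "smooth_fun_on M W f"
  shows "smooth_fun_on (tangent_bundle M) (Sigma W (tangent_space M)) (\<lambda>q. f (fst q))"
proof -
  interpret b: fibre_bundle M "tangent_space M" "idx M" tangent_fibre
    by unfold_locales (use finite_idx tangent_fibre_bij in auto)
  have "b.bchart = tangent_chart M" by (intro ext) (simp add: b.bchart_def tangent_chart_def)
  then have "b.total = tangent_bundle M" by (simp add: b.total_def tangent_bundle_def)
  then show ?thesis using b.smooth_fun_on_pullback[OF f] by simp
qed

lemma smooth_fun_on_cotangent_pullback: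
  assumes f: "smooth_fun_on M W f"
  shows "smooth_fun_on (cotangent_bundle M) (Sigma W (cotangent_space M)) (\<lambda>q. f (fst q))"
proof -
  interpret b: fibre_bundle M "cotangent_space M" "idx M" cotangent_fibre
    by unfold_locales (use finite_idx cotangent_fibre_bij in auto)
  have "b.bchart = cotangent_chart M" by (intro ext) (simp add: b.bchart_def cotangent_chart_def)
  then have "b.total = cotangent_bundle M" by (simp add: b.total_def cotangent_bundle_def)
  then show ?thesis using b.smooth_fun_on_pullback[OF f] by simp
qed

end

context charted_ord
begin

sublocale TT: charted "tangent_bundle (tangent_bundle M)" by (rule T.charted_tangent_bundle)

sublocale TK: charted "tangent_bundle (cotangent_bundle M)" by (rule K.charted_tangent_bundle)

abbreviation tc :: "('m, 'i) chart \<Rightarrow> ('m \<times> 'm tvec, 'i + 'i) chart" where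
  "tc c \<equiv> tangent_chart M c"

abbreviation kc :: "('m, 'i) chart \<Rightarrow> ('m \<times> 'm covec, 'i + 'i) chart" where
  "kc c \<equiv> cotangent_chart M c"

abbreviation tx :: "('m, 'i) chart \<Rightarrow> 'i + 'i \<Rightarrow> 'm \<times> 'm tvec \<Rightarrow> real" where
  "tx c j \<equiv> \<lambda>q. snd (tangent_chart M c) q j"

abbreviation kx :: "('m, 'i) chart \<Rightarrow> 'i + 'i \<Rightarrow> 'm \<times> 'm covec \<Rightarrow> real" where
  "kx c j \<equiv> \<lambda>q. snd (cotangent_chart M c) q j"

lemma idx_tangent_bundle: "idx (tangent_bundle N) = idx N <+> idx N"
  by (simp add: tangent_bundle_def)

lemma idx_cotangent_bundle: "idx (cotangent_bundle N) = idx N <+> idx N"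
  by (simp add: cotangent_bundle_def)

lemma tc_mem: "q \<in> fst (tc c) \<longleftrightarrow> fst q \<in> fst c \<and> snd q \<in> tangent_space M (fst q)"
  by (cases q) (simp add: tangent_chart_def)

lemma kc_mem: "q \<in> fst (kc c) \<longleftrightarrow> fst q \<in> fst c \<and> snd q \<in> cotangent_space M (fst q)"
  by (cases q) (simp add: cotangent_chart_def)

lemma tx_Inl: "tx c (Inl i) q = snd c (fst q) i"
  by (cases q) (simp add: tangent_chart_def)

lemma tx_Inr: "i \<in> idx M \<Longrightarrow> tx c (Inr i) q = snd q (\<lambda>q. snd c q i)"
  by (cases q) (simp add: tangent_chart_def)

lemma kx_Inl: "kx c (Inl i) q = snd c (fst q) i"
  by (cases q) (simp add: cotangent_chart_def)

lemma kx_Inr: "i \<in> idx M \<Longrightarrow> kx c (Inr i) q = snd q (coord_vec M c (fst q) i)"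
  by (cases q) (simp add: cotangent_chart_def)

lemma sum_idx_T: "sum f (idx (tangent_bundle M)) = (\<Sum>i\<in>idx M. f (Inl i)) + (\<Sum>i\<in>idx M. f (Inr i))"
  unfolding idx_tangent_bundle using finite_idx by (simp add: sum.Plus)

definition jac :: "('m, 'i) chart \<Rightarrow> ('m, 'i) chart \<Rightarrow> 'm \<Rightarrow> 'i \<Rightarrow> 'i \<Rightarrow> real" where
  "jac c d p i j = pderiv_at i (\<lambda>u. snd d (chart_inv c u) j) (snd c p)"

definition hess :: "('m, 'i) chart \<Rightarrow> ('m, 'i) chart \<Rightarrow> 'm \<Rightarrow> 'i \<Rightarrow> 'i \<Rightarrow> 'i \<Rightarrow> real" where
  "hess c d p i k j = pderiv_at i (pderiv_at k (\<lambda>u. snd d (chart_inv c u) j)) (snd c p)"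

lemma jac_coord_vec:
  "c \<in> atlas M \<Longrightarrow> d \<in> atlas M \<Longrightarrow> p \<in> fst c \<Longrightarrow> p \<in> fst d \<Longrightarrow> i \<in> idx M \<Longrightarrow>
   coord_vec M c p i (\<lambda>q. snd d q j) = jac c d p i j"
  by (simp add: coord_vec_pderiv smooth_at_coord jac_def)

lemma hess_commute:
  assumes c: "c \<in> atlas M" and d: "d \<in> atlas M" and p: "p \<in> fst c" "p \<in> fst d" and i: "i \<in> idx M" "k \<in> idx M" "j \<in> idx M"
  shows "hess c d p i k j = hess c d p k i j"
  unfolding hess_def
  by (rule pderiv_commute[OF finite_idx overlap_open[OF c d] smooth_on_imp_Ck[OF overlap_smooth[OF c d i(3)]] i(1,2)])
     (use p in auto)

lemma tangent_change:
  assumes c: "c \<in> atlas M" and d: "d \<in> atlas M" and p: "p \<in> fst c" "p \<in> fst d" and v: "v \<in> tangent_space M p"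
  shows "v (\<lambda>q. snd d q j) = (\<Sum>i\<in>idx M. v (\<lambda>q. snd c q i) * jac c d p i j)"
proof -
  have "v (\<lambda>q. snd d q j) = (\<Sum>i\<in>idx M. v (\<lambda>q. snd c q i) * coord_vec M c p i (\<lambda>q. snd d q j))"
    by (subst tangent_expand[OF c p(1) v]) (rule refl)
  then show ?thesis using jac_coord_vec[OF c d p] by simp
qed

text \<open>Differentiate the coordinate change of the tangent bundle along a curve. The product
  rule for v^k \<partial>y^j/\<partial>x^k yields the Jacobian acting on the derivative of v and a
  Hessian term, bilinear in v and the base velocity.\<close>

lemma second_tangent_change:
  assumes c: "c \<in> atlas M" and d: "d \<in> atlas M" and u: "fst u \<in> fst c" "fst u \<in> fst d" "snd u \<in> tangent_space M (fst u)"
    and \<zeta>: "\<zeta> \<in> tangent_space (tangent_bundle M) u" and j: "j \<in> idx M"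
  shows "\<zeta> (tx d (Inl j)) = (\<Sum>i\<in>idx M. \<zeta> (tx c (Inl i)) * jac c d (fst u) i j)"
    and "\<zeta> (tx d (Inr j)) = (\<Sum>k\<in>idx M. \<zeta> (tx c (Inr k)) * jac c d (fst u) k j) +
      (\<Sum>k\<in>idx M. \<Sum>i\<in>idx M. snd u (\<lambda>q. snd c q k) * \<zeta> (tx c (Inl i)) * hess c d (fst u) i k j)"
proof -
  let ?V = "velocity (tangent_bundle M)"
  obtain \<xi> where \<xi>: "smooth_curve (tangent_bundle M) \<xi>" "\<xi> 0 = u" "\<zeta> = snd (?V \<xi>)"
    using \<zeta> by (auto simp: tangent_space_def)
  have mem: "\<xi> 0 \<in> fst (tc c)" "\<xi> 0 \<in> fst (tc d)" using u \<xi>(2) by (simp_all add: tc_mem)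
  note C = tangent_chart_atlas[OF c] and D = tangent_chart_atlas[OF d]
  have cu: "T.curve_at (tc c) \<xi> (\<lambda>i. \<zeta> (tx c i))" and cu': "T.curve_at (tc d) \<xi> (\<lambda>i. \<zeta> (tx d i))"
    using T.smooth_curve_curve_at[OF C \<xi>(1) mem(1)] T.smooth_curve_curve_at[OF D \<xi>(1) mem(2)] \<xi>(3) by simp_all
  have der: "((\<lambda>t. tx c i (\<xi> t)) has_real_derivative \<zeta> (tx c i)) (at 0)" if "i \<in> idx M <+> idx M" for i
    using cu that unfolding T.curve_at_def by (simp add: idx_tangent_bundle)
  have der': "((\<lambda>t. tx d i (\<xi> t)) has_real_derivative \<zeta> (tx d i)) (at 0)" if "i \<in> idx M <+> idx M" for i
    using cu' that unfolding T.curve_at_def by (simp add: idx_tangent_bundle)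
  have ev: "\<forall>\<^sub>F t in nhds 0. \<xi> t \<in> fst (tc c)" "\<forall>\<^sub>F t in nhds 0. \<xi> t \<in> fst (tc d)"
    using cu cu' by (simp_all add: T.curve_at_def)
  let ?x = "\<lambda>t. snd c (fst (\<xi> t))"
  have derx: "((\<lambda>t. ?x t i) has_real_derivative \<zeta> (tx c (Inl i))) (at 0)" if "i \<in> idx M" for i
    using der[of "Inl i"] that by (simp add: tx_Inl)
  let ?B = "snd c ` (fst c \<inter> fst d)"
  have xB: "?x 0 \<in> ?B" using u \<xi>(2) by auto
  have xcs: "\<forall>\<^sub>F t in nhds 0. ?x t \<in> coord_space (idx M)"
    using ev(1) by eventually_elim (use coords_in[OF c] tc_mem in blast)
  have chain: "((\<lambda>t. g (?x t)) has_real_derivative (\<Sum>i\<in>idx M. pderiv_at i g (?x 0) * \<zeta> (tx c (Inl i)))) (at 0)"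
    if "smooth_on (idx M) ?B g" for g
    by (rule chain_rule[OF finite_idx overlap_open[OF c d] smooth_on_imp_Ck[OF that], where g = "?x" and ?t0.0 = "0"])
       (rule xB, rule xcs, rule derx)
  have x0: "?x 0 = snd c (fst u)" using \<xi>(2) by simp
  have "\<forall>\<^sub>F t in nhds 0. snd d (chart_inv c (?x t)) j = tx d (Inl j) (\<xi> t)"
    using ev(1) by eventually_elim (simp add: tx_Inl tc_mem chart_inv_left[OF c])
  from DERIV_cong_ev[OF refl this refl] chain[OF overlap_smooth[OF c d j]]
  have "((\<lambda>t. tx d (Inl j) (\<xi> t)) has_real_derivative (\<Sum>i\<in>idx M. jac c d (fst u) i j * \<zeta> (tx c (Inl i)))) (at 0)"
    unfolding jac_def x0 by blast
  from DERIV_unique[OF der'[of "Inl j"] this] j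
  show "\<zeta> (tx d (Inl j)) = (\<Sum>i\<in>idx M. \<zeta> (tx c (Inl i)) * jac c d (fst u) i j)" by (simp add: mult.commute)
  let ?G = "\<lambda>k. pderiv_at k (\<lambda>u. snd d (chart_inv c u) j)"
  have dG: "((\<lambda>t. ?G k (?x t)) has_real_derivative (\<Sum>i\<in>idx M. hess c d (fst u) i k j * \<zeta> (tx c (Inl i)))) (at 0)"
    if "k \<in> idx M" for k
    using chain[OF smooth_on_pderiv[OF overlap_smooth[OF c d j] that]] unfolding hess_def x0 .
  have "((\<lambda>t. \<Sum>k\<in>idx M. tx c (Inr k) (\<xi> t) * ?G k (?x t)) has_real_derivative
     (\<Sum>k\<in>idx M. \<zeta> (tx c (Inr k)) * ?G k (?x 0) + (\<Sum>i\<in>idx M. hess c d (fst u) i k j * \<zeta> (tx c (Inl i))) * tx c (Inr k) (\<xi> 0))) (at 0)"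
    by (intro DERIV_sum DERIV_mult der dG) auto
  moreover have "\<forall>\<^sub>F t in nhds 0. (\<Sum>k\<in>idx M. tx c (Inr k) (\<xi> t) * ?G k (?x t)) = tx d (Inr j) (\<xi> t)"
    using ev
  proof eventually_elim
    case (elim t)
    then have "snd (\<xi> t) (\<lambda>q. snd d q j) = (\<Sum>i\<in>idx M. snd (\<xi> t) (\<lambda>q. snd c q i) * jac c d (fst (\<xi> t)) i j)"
      by (intro tangent_change[OF c d]) (simp_all add: tc_mem)
    then show ?case using j by (simp add: tx_Inr jac_def)
  qed
  ultimately have "((\<lambda>t. tx d (Inr j) (\<xi> t)) has_real_derivative
     (\<Sum>k\<in>idx M. \<zeta> (tx c (Inr k)) * ?G k (?x 0) + (\<Sum>i\<in>idx M. hess c d (fst u) i k j * \<zeta> (tx c (Inl i))) * tx c (Inr k) (\<xi> 0))) (at 0)"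
    by (rule DERIV_cong_ev[OF refl _ refl, THEN iffD1, rotated])
  from DERIV_unique[OF der'[of "Inr j"] this] j
  have "\<zeta> (tx d (Inr j)) = (\<Sum>k\<in>idx M. \<zeta> (tx c (Inr k)) * ?G k (?x 0) + (\<Sum>i\<in>idx M. hess c d (fst u) i k j * \<zeta> (tx c (Inl i))) * tx c (Inr k) (\<xi> 0))" by simp
  also have "\<dots> = (\<Sum>k\<in>idx M. \<zeta> (tx c (Inr k)) * jac c d (fst u) k j + (\<Sum>i\<in>idx M. snd u (\<lambda>q. snd c q k) * \<zeta> (tx c (Inl i)) * hess c d (fst u) i k j))"
    unfolding x0 \<xi>(2) by (intro sum.cong refl) (simp add: jac_def tx_Inr sum_distrib_left ac_simps)
  finally show "\<zeta> (tx d (Inr j)) = (\<Sum>k\<in>idx M. \<zeta> (tx c (Inr k)) * jac c d (fst u) k j) +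
      (\<Sum>k\<in>idx M. \<Sum>i\<in>idx M. snd u (\<lambda>q. snd c q k) * \<zeta> (tx c (Inl i)) * hess c d (fst u) i k j)"
    by (simp add: sum.distrib)
qed

abbreviation ttc :: "('m, 'i) chart \<Rightarrow> (('m \<times> 'm tvec) \<times> ('m \<times> 'm tvec) tvec, ('i + 'i) + ('i + 'i)) chart" where
  "ttc c \<equiv> tangent_chart (tangent_bundle M) (tc c)"

lemma ttc_atlas: "c \<in> atlas M \<Longrightarrow> ttc c \<in> atlas (tangent_bundle (tangent_bundle M))"
  using tangent_chart_atlas[of c] by (simp add: tangent_bundle_def)

lemma ttc_mem: "(u, \<zeta>) \<in> fst (ttc c) \<longleftrightarrow> fst u \<in> fst c \<and> snd u \<in> tangent_space M (fst u) \<and> \<zeta> \<in> tangent_space (tangent_bundle M) u"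
proof -
  have "(u, \<zeta>) \<in> fst (ttc c) \<longleftrightarrow> u \<in> fst (tc c) \<and> \<zeta> \<in> tangent_space (tangent_bundle M) u"
    by (simp add: tangent_chart_def[of "tangent_bundle M"])
  then show ?thesis by (simp add: tc_mem)
qed

lemma ttc_coords: "snd (ttc c) (u, \<zeta>) = case_sum (snd (tc c) u) (\<lambda>i. if i \<in> idx M <+> idx M then \<zeta> (tx c i) else 0)"
  by (simp add: tangent_chart_def[of "tangent_bundle M"] idx_tangent_bundle)

lemma tc_coords: "snd (tc c) u = case_sum (snd c (fst u)) (\<lambda>i. if i \<in> idx M then snd u (\<lambda>q. snd c q i) else 0)"
  by (simp add: tangent_chart_def split_beta)

lemma ttc_Inl: "snd (ttc c) (u, \<zeta>) (Inl j) = tx c j u"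
  by (simp add: ttc_coords)

lemma ttc_Inr: "snd (ttc c) (u, \<zeta>) (Inr (Inl i)) = (if i \<in> idx M then \<zeta> (tx c (Inl i)) else 0)"
  "snd (ttc c) (u, \<zeta>) (Inr (Inr i)) = (if i \<in> idx M then \<zeta> (tx c (Inr i)) else 0)"
  by (simp_all add: ttc_coords)

lemma swap_coords_simps:
  "swap_coords w (Inl (Inl i)) = w (Inl (Inl i))" "swap_coords w (Inl (Inr i)) = w (Inr (Inl i))"
  "swap_coords w (Inr (Inl i)) = w (Inl (Inr i))" "swap_coords w (Inr (Inr i)) = w (Inr (Inr i))"
  by (simp_all add: swap_coords_def)

text \<open>Symmetry of the second derivatives makes the coordinate flip independent of the chart.\<close>

lemma flip_exists:
  assumes c: "c \<in> atlas M" and p: "p \<in> fst c" and v: "v \<in> tangent_space M p" and \<zeta>: "\<zeta> \<in> tangent_space (tangent_bundle M) (p, v)"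
  shows "\<exists>z'. \<forall>d\<in>charts_at M p. z' \<in> fst (ttc d) \<and> snd (ttc d) z' = swap_coords (snd (ttc d) ((p, v), \<zeta>))"
proof -
  \<comment> \<open>The candidate is built in the chart \<open>c\<close> by exchanging the
    components of \<open>v\<close> with the base components of \<zeta>; what remains is that the
    same exchange is seen in every other chart \<open>d\<close>.\<close>
  define v' where "v' = (\<lambda>f. \<Sum>i\<in>idx M. \<zeta> (tx c (Inl i)) * coord_vec M c p i f)"
  have v': "v' \<in> tangent_space M p" unfolding v'_def by (rule tangent_comb[OF c p])
  have v'c: "v' (\<lambda>q. snd c q i) = \<zeta> (tx c (Inl i))" if "i \<in> idx M" for i
    unfolding v'_def by (rule tangent_coord_comb[OF c p that])
  have u': "(p, v') \<in> fst (tc c)" using p v' by (simp add: tc_mem)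
  define b where "b = case_sum (\<lambda>i. v (\<lambda>q. snd c q i)) (\<lambda>i. \<zeta> (tx c (Inr i)))"
  define \<zeta>' where "\<zeta>' = (\<lambda>f. \<Sum>i\<in>idx (tangent_bundle M). b i * coord_vec (tangent_bundle M) (tc c) (p, v') i f)"
  have \<zeta>': "\<zeta>' \<in> tangent_space (tangent_bundle M) (p, v')"
    unfolding \<zeta>'_def by (rule T.tangent_comb[OF tangent_chart_atlas[OF c] u'])
  have \<zeta>'c: "\<zeta>' (tx c i) = b i" if "i \<in> idx M <+> idx M" for i
    unfolding \<zeta>'_def by (rule T.tangent_coord_comb[OF tangent_chart_atlas[OF c] u']) (use that in \<open>simp add: idx_tangent_bundle\<close>)
  show ?thesis
  proof (intro exI[of _ "((p, v'), \<zeta>')"] ballI conjI)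
    fix d assume "d \<in> charts_at M p"
    then have d: "d \<in> atlas M" "p \<in> fst d" by (auto simp: charts_at_def)
    show "((p, v'), \<zeta>') \<in> fst (ttc d)" using d v' \<zeta>' by (simp add: ttc_mem)
    have 1: "v' (\<lambda>q. snd d q j) = \<zeta> (tx d (Inl j))" if "j \<in> idx M" for j
      using tangent_change[OF c d(1) p d(2) v', of j] second_tangent_change(1)[OF c d(1), of "(p, v)" \<zeta> j] p d v \<zeta> that v'c by simp
    have 2: "\<zeta>' (tx d (Inl j)) = v (\<lambda>q. snd d q j)" if "j \<in> idx M" for j
      using tangent_change[OF c d(1) p d(2) v, of j] second_tangent_change(1)[OF c d(1), of "(p, v')" \<zeta>' j] p d v' \<zeta>' that \<zeta>'c
      by (simp add: b_def)
    have 3: "\<zeta>' (tx d (Inr j)) = \<zeta> (tx d (Inr j))" if j: "j \<in> idx M" for j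
    proof -
      have "\<zeta>' (tx d (Inr j)) = (\<Sum>k\<in>idx M. \<zeta> (tx c (Inr k)) * jac c d p k j) +
        (\<Sum>k\<in>idx M. \<Sum>i\<in>idx M. \<zeta> (tx c (Inl k)) * v (\<lambda>q. snd c q i) * hess c d p i k j)"
        using second_tangent_change(2)[OF c d(1), of "(p, v')" \<zeta>' j] p d v' \<zeta>' that \<zeta>'c v'c by (simp add: b_def)
      also have "(\<Sum>k\<in>idx M. \<Sum>i\<in>idx M. \<zeta> (tx c (Inl k)) * v (\<lambda>q. snd c q i) * hess c d p i k j)
        = (\<Sum>i\<in>idx M. \<Sum>k\<in>idx M. \<zeta> (tx c (Inl k)) * v (\<lambda>q. snd c q i) * hess c d p i k j)" by (rule sum.swap)
      \<comment> \<open>The exchange swaps the two arguments of the Hessian term, which is harmless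
        because the Hessian is symmetric.\<close>
      also have "\<dots> = (\<Sum>k\<in>idx M. \<Sum>i\<in>idx M. v (\<lambda>q. snd c q k) * \<zeta> (tx c (Inl i)) * hess c d p i k j)"
        using hess_commute[OF c d(1) p d(2) _ _ j] by (intro sum.cong refl) (simp add: mult.commute)
      finally show ?thesis
        using second_tangent_change(2)[OF c d(1), of "(p, v)" \<zeta> j] p d v \<zeta> that by simp
    qed
    have 0: "snd d p i = 0" if "i \<notin> idx M" for i using coords_in[OF d] that by (simp add: coord_space_def)
    show "snd (ttc d) ((p, v'), \<zeta>') = swap_coords (snd (ttc d) ((p, v), \<zeta>))"
    proof
      fix k
      show "snd (ttc d) ((p, v'), \<zeta>') k = swap_coords (snd (ttc d) ((p, v), \<zeta>)) k"
      proof (cases k)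
        case (Inl a)
        show ?thesis
        proof (cases a)
          case (Inr i)
          then show ?thesis using 1[of i] Inl by (simp only: swap_coords_simps ttc_Inl ttc_Inr tc_coords[of d "(p, v')"] sum.case snd_conv cong: if_cong)
        qed (simp only: swap_coords_simps ttc_Inl Inl tx_Inl fst_conv)
      next
        case (Inr a)
        show ?thesis
        proof (cases a)
          case (Inl i)
          then show ?thesis using 2[of i] Inr by (simp only: swap_coords_simps ttc_Inl ttc_Inr tc_coords[of d "(p, v)"] sum.case snd_conv cong: if_cong)
        next
          fix i assume "a = Inr i"
          then show ?thesis using 3[of i] Inr by (simp only: swap_coords_simps ttc_Inr cong: if_cong)
        qed
      qed
    qed
  qed
qed

text \<open>Uniqueness follows from injectivity of the chart of the second tangent bundle; the base
  point is preserved because the flip fixes its coordinates.\<close>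

lemma flip_eq:
  assumes c: "c \<in> atlas M" and p: "p \<in> fst c" and v: "v \<in> tangent_space M p" and \<zeta>: "\<zeta> \<in> tangent_space (tangent_bundle M) (p, v)"
  shows "\<exists>v' \<zeta>'. flip M ((p, v), \<zeta>) = ((p, v'), \<zeta>') \<and> v' \<in> tangent_space M p \<and> \<zeta>' \<in> tangent_space (tangent_bundle M) (p, v') \<and>
    (\<forall>i\<in>idx M. v' (\<lambda>q. snd c q i) = \<zeta> (tx c (Inl i)) \<and> \<zeta>' (tx c (Inl i)) = v (\<lambda>q. snd c q i) \<and> \<zeta>' (tx c (Inr i)) = \<zeta> (tx c (Inr i)))"
proof -
  obtain z where z: "\<forall>d\<in>charts_at M p. z \<in> fst (ttc d) \<and> snd (ttc d) z = swap_coords (snd (ttc d) ((p, v), \<zeta>))"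
    using flip_exists[OF assms] by blast
  have cp: "c \<in> charts_at M p" using c p by (simp add: charts_at_def)
  have fl: "flip M ((p, v), \<zeta>) = z" unfolding flip_def fst_conv
  proof (rule the_equality)
    show "\<forall>d\<in>charts_at M p. z \<in> fst (ttc d) \<and> snd (ttc d) z = swap_coords (snd (ttc d) ((p, v), \<zeta>))" by (rule z)
    fix z' assume "\<forall>d\<in>charts_at M p. z' \<in> fst (ttc d) \<and> snd (ttc d) z' = swap_coords (snd (ttc d) ((p, v), \<zeta>))"
    then show "z' = z" using z cp TT.chart_inj[OF ttc_atlas[OF c]] by (metis inj_onD)
  qed
  obtain q v' \<zeta>' where zz: "z = ((q, v'), \<zeta>')" by (metis surj_pair)
  have mem: "q \<in> fst c" "v' \<in> tangent_space M q" "\<zeta>' \<in> tangent_space (tangent_bundle M) (q, v')"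
    using z cp zz by (auto simp: ttc_mem)
  have eq: "snd (ttc c) ((q, v'), \<zeta>') = swap_coords (snd (ttc c) ((p, v), \<zeta>))" using z cp zz by blast
  have "snd c q i = snd c p i" for i using fun_cong[OF eq, of "Inl (Inl i)"] by (simp add: ttc_coords tc_coords swap_coords_def)
  then have qp: "q = p" using inj_onD[OF chart_inj[OF c] _ mem(1) p] by blast
  have "v' (\<lambda>q. snd c q i) = \<zeta> (tx c (Inl i)) \<and> \<zeta>' (tx c (Inl i)) = v (\<lambda>q. snd c q i) \<and> \<zeta>' (tx c (Inr i)) = \<zeta> (tx c (Inr i))" if "i \<in> idx M" for i
    using fun_cong[OF eq, of "Inl (Inr i)"] fun_cong[OF eq, of "Inr (Inl i)"] fun_cong[OF eq, of "Inr (Inr i)"] that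
    by (simp add: ttc_coords tc_coords swap_coords_def)
  then show ?thesis using fl zz mem qp by auto
qed

end


section \<open>The isomorphism of the iterated bundles\<close>

lemma (in charted) velocity_chart_line:
  assumes c: "c \<in> atlas M" and p: "p \<in> fst c" and v: "v \<in> tangent_space M p"
  shows "velocity M (chart_line c p (tangent_fibre c p v)) = (p, v)"
proof -
  have a: "tangent_fibre c p v \<in> coord_space (idx M)" by (simp add: coord_space_def)
  have "velocity M (chart_line c p (tangent_fibre c p v)) = (p, \<lambda>f. \<Sum>i\<in>idx M. v (\<lambda>q. snd c q i) * coord_vec M c p i f)"
    using velocity_curve_at[OF c chart_line_curve_at[OF c p a]] by (simp add: chart_line_0[OF c p])
  then show ?thesis using tangent_expand[OF c p v] by simp
qed

lemma (in charted) tangent_fibre_coord_space: "tangent_fibre c p v \<in> coord_space (idx M)"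
  by (simp add: coord_space_def)

context charted_ord
begin

text \<open>Over a common base point the pairing is the sum of products of natural fibre
  coordinates, so the product rule expresses the derivative by the two velocities.\<close>

lemma tangent_pairing_deriv:
  assumes c: "c \<in> atlas M" and p: "p \<in> fst c"
    and \<xi>: "smooth_curve (tangent_bundle M) \<xi>" "velocity (tangent_bundle M) \<xi> = ((p, v), \<zeta>)"
    and \<alpha>: "smooth_curve (cotangent_bundle M) \<alpha>" "velocity (cotangent_bundle M) \<alpha> = ((p, a), \<omega>)"
    and v: "v \<in> tangent_space M p" and a: "a \<in> cotangent_space M p"
    and base: "\<forall>\<^sub>F t in nhds 0. fst (\<xi> t) = fst (\<alpha> t)"
  shows "deriv (\<lambda>t. snd (\<alpha> t) (snd (\<xi> t))) 0 =
    (\<Sum>i\<in>idx M. \<zeta> (tx c (Inr i)) * a (coord_vec M c p i) + v (\<lambda>q. snd c q i) * \<omega> (kx c (Inr i)))"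
proof -
  have 0: "\<xi> 0 = (p, v)" "\<alpha> 0 = (p, a)" using \<xi>(2) \<alpha>(2) by (simp_all add: velocity_def)
  have mem: "\<xi> 0 \<in> fst (tc c)" "\<alpha> 0 \<in> fst (kc c)" using p v a by (simp_all add: 0 tc_mem kc_mem)
  have c1: "T.curve_at (tc c) \<xi> (\<lambda>i. \<zeta> (tx c i))" using T.smooth_curve_curve_at[OF tangent_chart_atlas[OF c] \<xi>(1) mem(1)] \<xi>(2) by simp
  have c2: "K.curve_at (kc c) \<alpha> (\<lambda>i. \<omega> (kx c i))" using K.smooth_curve_curve_at[OF cotangent_chart_atlas[OF c] \<alpha>(1) mem(2)] \<alpha>(2) by simp
  have ev: "\<forall>\<^sub>F t in nhds 0. \<xi> t \<in> fst (tc c)" "\<forall>\<^sub>F t in nhds 0. \<alpha> t \<in> fst (kc c)"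
    using c1 c2 by (simp_all add: T.curve_at_def K.curve_at_def)
  have d1: "((\<lambda>t. tx c (Inr i) (\<xi> t)) has_real_derivative \<zeta> (tx c (Inr i))) (at 0)" if "i \<in> idx M" for i
  proof -
    have "Inr i \<in> idx (tangent_bundle M)" using that by (simp add: idx_tangent_bundle)
    then show ?thesis using c1 unfolding T.curve_at_def by blast
  qed
  have d2: "((\<lambda>t. kx c (Inr i) (\<alpha> t)) has_real_derivative \<omega> (kx c (Inr i))) (at 0)" if "i \<in> idx M" for i
  proof -
    have "Inr i \<in> idx (cotangent_bundle M)" using that by (simp add: idx_cotangent_bundle)
    then show ?thesis using c2 unfolding K.curve_at_def by blast
  qed
  have "((\<lambda>t. \<Sum>i\<in>idx M. tx c (Inr i) (\<xi> t) * kx c (Inr i) (\<alpha> t)) has_real_derivative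
    (\<Sum>i\<in>idx M. \<zeta> (tx c (Inr i)) * kx c (Inr i) (\<alpha> 0) + \<omega> (kx c (Inr i)) * tx c (Inr i) (\<xi> 0))) (at 0)"
    by (intro DERIV_sum DERIV_mult d1 d2)
  moreover have "\<forall>\<^sub>F t in nhds 0. (\<Sum>i\<in>idx M. tx c (Inr i) (\<xi> t) * kx c (Inr i) (\<alpha> t)) = snd (\<alpha> t) (snd (\<xi> t))"
    using ev base
  proof eventually_elim
    case (elim t)
    then have m: "fst (\<alpha> t) \<in> fst c" "snd (\<alpha> t) \<in> cotangent_space M (fst (\<alpha> t))" "snd (\<xi> t) \<in> tangent_space M (fst (\<alpha> t))"
      by (simp_all add: tc_mem kc_mem)
    show ?case using cotangent_eval[OF c m] by (simp add: tx_Inr kx_Inr)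
  qed
  ultimately have "((\<lambda>t. snd (\<alpha> t) (snd (\<xi> t))) has_real_derivative
    (\<Sum>i\<in>idx M. \<zeta> (tx c (Inr i)) * kx c (Inr i) (\<alpha> 0) + \<omega> (kx c (Inr i)) * tx c (Inr i) (\<xi> 0))) (at 0)"
    by (rule DERIV_cong_ev[OF refl _ refl, THEN iffD1, rotated])
  from DERIV_imp_deriv[OF this] show ?thesis by (simp add: 0 tx_Inr kx_Inr mult.commute)
qed

text \<open>The condition \<open>compat\<close> says that both vectors project to the same vector of
  the base. Affine curves in the two natural charts then lie over one base curve and realise the
  pairing; \<open>tangent_pairing_deriv\<close> gives uniqueness.\<close>

lemma tangent_pairing_eq:
  assumes c: "c \<in> atlas M" and p: "p \<in> fst c" and v: "v \<in> tangent_space M p" and a: "a \<in> cotangent_space M p"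
    and \<zeta>: "\<zeta> \<in> tangent_space (tangent_bundle M) (p, v)" and \<omega>: "\<omega> \<in> tangent_space (cotangent_bundle M) (p, a)"
    and compat: "\<And>i. i \<in> idx M \<Longrightarrow> \<zeta> (tx c (Inl i)) = \<omega> (kx c (Inl i))"
  shows "tangent_pairing M ((p, v), \<zeta>) ((p, a), \<omega>) =
    (\<Sum>i\<in>idx M. \<zeta> (tx c (Inr i)) * a (coord_vec M c p i) + v (\<lambda>q. snd c q i) * \<omega> (kx c (Inr i)))" (is "_ = ?R")
  unfolding tangent_pairing_def
proof (rule the_equality)
  note C = tangent_chart_atlas[OF c] and D = cotangent_chart_atlas[OF c]
  have u: "(p, v) \<in> fst (tc c)" "(p, a) \<in> fst (kc c)" using p v a by (simp_all add: tc_mem kc_mem)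
  define b where "b = T.tangent_fibre (tc c) (p, v) \<zeta>"
  define b' where "b' = K.tangent_fibre (kc c) (p, a) \<omega>"
  define \<xi> where "\<xi> = T.chart_line (tc c) (p, v) b"
  define \<alpha> where "\<alpha> = K.chart_line (kc c) (p, a) b'"
  have bs: "b \<in> coord_space (idx (tangent_bundle M))" "b' \<in> coord_space (idx (cotangent_bundle M))"
    unfolding b_def b'_def by (rule T.tangent_fibre_coord_space, rule K.tangent_fibre_coord_space)
  have \<xi>: "smooth_curve (tangent_bundle M) \<xi>" "velocity (tangent_bundle M) \<xi> = ((p, v), \<zeta>)"
    unfolding \<xi>_def by (rule T.chart_line_smooth[OF C u(1) bs(1)]) (unfold b_def, rule T.velocity_chart_line[OF C u(1) \<zeta>])
  have \<alpha>: "smooth_curve (cotangent_bundle M) \<alpha>" "velocity (cotangent_bundle M) \<alpha> = ((p, a), \<omega>)"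
    unfolding \<alpha>_def by (rule K.chart_line_smooth[OF D u(2) bs(2)]) (unfold b'_def, rule K.velocity_chart_line[OF D u(2) \<omega>])
  have bb: "b (Inl i) = b' (Inl i)" for i
    using compat[of i] by (simp add: b_def b'_def idx_tangent_bundle idx_cotangent_bundle)
  have base: "\<forall>\<^sub>F t in nhds 0. fst (\<xi> t) = fst (\<alpha> t)"
    using T.chart_line_eventually[OF C u(1) bs(1)] K.chart_line_eventually[OF D u(2) bs(2)]
    unfolding \<xi>_def[symmetric] \<alpha>_def[symmetric]
  proof eventually_elim
    case (elim t)
    have "snd c (fst (\<xi> t)) i = snd c (fst (\<alpha> t)) i" for i
      using fun_cong[OF conjunct2[OF elim(1)], of "Inl i"] fun_cong[OF conjunct2[OF elim(2)], of "Inl i"] bb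
      by (simp add: tx_Inl kx_Inl)
    then show ?case using elim inj_onD[OF chart_inj[OF c], of "fst (\<xi> t)" "fst (\<alpha> t)"] by (auto simp: tc_mem kc_mem)
  qed
  show "\<exists>\<xi> \<alpha>. smooth_curve (tangent_bundle M) \<xi> \<and> smooth_curve (cotangent_bundle M) \<alpha> \<and>
     (\<forall>\<^sub>F t in nhds 0. fst (\<xi> t) = fst (\<alpha> t)) \<and>
     velocity (tangent_bundle M) \<xi> = ((p, v), \<zeta>) \<and> velocity (cotangent_bundle M) \<alpha> = ((p, a), \<omega>) \<and>
     ?R = deriv (\<lambda>t. snd (\<alpha> t) (snd (\<xi> t))) 0"
    using \<xi> \<alpha> base tangent_pairing_deriv[OF c p \<xi> \<alpha> v a base] by (intro exI[of _ \<xi>] exI[of _ \<alpha>]) simp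
  fix r
  assume "\<exists>\<xi> \<alpha>. smooth_curve (tangent_bundle M) \<xi> \<and> smooth_curve (cotangent_bundle M) \<alpha> \<and>
     (\<forall>\<^sub>F t in nhds 0. fst (\<xi> t) = fst (\<alpha> t)) \<and>
     velocity (tangent_bundle M) \<xi> = ((p, v), \<zeta>) \<and> velocity (cotangent_bundle M) \<alpha> = ((p, a), \<omega>) \<and>
     r = deriv (\<lambda>t. snd (\<alpha> t) (snd (\<xi> t))) 0"
  then obtain \<xi> \<alpha> where *: "smooth_curve (tangent_bundle M) \<xi>" "smooth_curve (cotangent_bundle M) \<alpha>"
     "\<forall>\<^sub>F t in nhds 0. fst (\<xi> t) = fst (\<alpha> t)"
     "velocity (tangent_bundle M) \<xi> = ((p, v), \<zeta>)" "velocity (cotangent_bundle M) \<alpha> = ((p, a), \<omega>)"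
     "r = deriv (\<lambda>t. snd (\<alpha> t) (snd (\<xi> t))) 0" by blast
  show "r = ?R" unfolding *(6) by (rule tangent_pairing_deriv[OF c p *(1,4) *(2,5) v a *(3)])
qed

lemma smooth_at_cotangent_pullback:
  assumes "smooth_at M p g" "a \<in> cotangent_space M p"
  shows "smooth_at (cotangent_bundle M) (p, a) (\<lambda>q. g (fst q))"
proof -
  obtain W where "p \<in> W" "smooth_fun_on M W g" using assms(1) by (auto simp: smooth_at_def)
  then show ?thesis using smooth_fun_on_cotangent_pullback[of W g] assms(2)
    unfolding smooth_at_def by (intro exI[of _ "Sigma W (cotangent_space M)"]) simp
qed

lemma tangent_map_fst:
  assumes c: "c \<in> atlas M" and p: "p \<in> fst c" and a: "a \<in> cotangent_space M p"
    and \<omega>: "\<omega> \<in> tangent_space (cotangent_bundle M) (p, a)"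
  shows "tangent_map (cotangent_bundle M) M fst ((p, a), \<omega>) = (p, \<lambda>f. \<Sum>i\<in>idx M. \<omega> (kx c (Inl i)) * coord_vec M c p i f)"
proof -
  obtain \<alpha> where \<alpha>: "smooth_curve (cotangent_bundle M) \<alpha>" "\<alpha> 0 = (p, a)" "\<omega> = snd (velocity (cotangent_bundle M) \<alpha>)"
    using \<omega> by (auto simp: tangent_space_def)
  have "\<alpha> 0 \<in> fst (kc c)" using \<alpha>(2) p a by (simp add: kc_mem)
  from K.smooth_curve_curve_at[OF cotangent_chart_atlas[OF c] \<alpha>(1) this]
  have cu: "K.curve_at (kc c) \<alpha> (\<lambda>i. \<omega> (kx c i))" using \<alpha>(3) by simp
  have "curve_at c (\<lambda>t. fst (\<alpha> t)) (\<lambda>i. \<omega> (kx c (Inl i)))"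
    unfolding curve_at_def
  proof (intro conjI ballI)
    have "\<forall>\<^sub>F t in nhds 0. \<alpha> t \<in> fst (kc c)" using cu by (simp add: K.curve_at_def)
    then show "\<forall>\<^sub>F t in nhds 0. fst (\<alpha> t) \<in> fst c" by eventually_elim (simp add: kc_mem)
    fix i assume "i \<in> idx M"
    then have "((\<lambda>t. kx c (Inl i) (\<alpha> t)) has_real_derivative \<omega> (kx c (Inl i))) (at 0)"
      using cu unfolding K.curve_at_def idx_cotangent_bundle by blast
    then show "((\<lambda>t. snd c (fst (\<alpha> t)) i) has_real_derivative \<omega> (kx c (Inl i))) (at 0)" by (simp add: kx_Inl)
  qed
  from velocity_curve_at[OF c this]
  have V: "snd (velocity M (\<lambda>t. fst (\<alpha> t))) = (\<lambda>f. \<Sum>i\<in>idx M. \<omega> (kx c (Inl i)) * coord_vec M c p i f)"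
    using \<alpha>(2) by simp
  have "(if smooth_at M p g then \<omega> (\<lambda>q. g (fst q)) else 0) = snd (velocity M (\<lambda>t. fst (\<alpha> t))) g" for g
    using smooth_at_cotangent_pullback[OF _ a, of g] \<alpha> by (simp add: velocity_def)
  then have "(\<lambda>g. if smooth_at M p g then \<omega> (\<lambda>q. g (fst q)) else 0) = snd (velocity M (\<lambda>t. fst (\<alpha> t)))" by (rule ext)
  then show ?thesis unfolding tangent_map_def fst_conv snd_conv V[symmetric] by simp
qed

text \<open>The flip turns the base components of \<zeta> into those of \<open>w\<close>, so that
  the tangent pairing applies. In coordinates this is \<alpha>(x, p, x', p') = (x, x', p', p): p' is
  conjugate to x, and p is conjugate to the fibre coordinate.\<close>

lemma alpha_eq:
  assumes c: "c \<in> atlas M" and p: "p \<in> fst c" and a: "a \<in> cotangent_space M p"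
    and \<omega>: "\<omega> \<in> tangent_space (cotangent_bundle M) (p, a)"
  defines "v \<equiv> \<lambda>f. \<Sum>i\<in>idx M. \<omega> (kx c (Inl i)) * coord_vec M c p i f"
  shows "alpha M ((p, a), \<omega>) = ((p, v), \<lambda>\<zeta>. if \<zeta> \<in> tangent_space (tangent_bundle M) (p, v)
     then \<Sum>i\<in>idx M. \<zeta> (tx c (Inr i)) * a (coord_vec M c p i) + \<zeta> (tx c (Inl i)) * \<omega> (kx c (Inr i)) else 0)"
proof -
  have v: "v \<in> tangent_space M p" unfolding v_def by (rule tangent_comb[OF c p])
  have vc: "v (\<lambda>q. snd c q i) = \<omega> (kx c (Inl i))" if "i \<in> idx M" for i
    unfolding v_def by (rule tangent_coord_comb[OF c p that])
  have "tangent_pairing M (flip M ((p, v), \<zeta>)) ((p, a), \<omega>)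
     = (\<Sum>i\<in>idx M. \<zeta> (tx c (Inr i)) * a (coord_vec M c p i) + \<zeta> (tx c (Inl i)) * \<omega> (kx c (Inr i)))"
    if \<zeta>: "\<zeta> \<in> tangent_space (tangent_bundle M) (p, v)" for \<zeta>
  proof -
    obtain v' \<zeta>' where f: "flip M ((p, v), \<zeta>) = ((p, v'), \<zeta>')" "v' \<in> tangent_space M p" "\<zeta>' \<in> tangent_space (tangent_bundle M) (p, v')"
      "\<And>i. i \<in> idx M \<Longrightarrow> v' (\<lambda>q. snd c q i) = \<zeta> (tx c (Inl i))" "\<And>i. i \<in> idx M \<Longrightarrow> \<zeta>' (tx c (Inl i)) = v (\<lambda>q. snd c q i)"
      "\<And>i. i \<in> idx M \<Longrightarrow> \<zeta>' (tx c (Inr i)) = \<zeta> (tx c (Inr i))"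
      using flip_eq[OF c p v \<zeta>] by blast
    have "\<zeta>' (tx c (Inl i)) = \<omega> (kx c (Inl i))" if "i \<in> idx M" for i using f(5)[OF that] vc[OF that] by simp
    from tangent_pairing_eq[OF c p f(2) a f(3) \<omega> this] show ?thesis unfolding f(1) using f(4,6) by simp
  qed
  then show ?thesis unfolding alpha_def tangent_map_fst[OF c p a \<omega>, folded v_def] Let_def by auto
qed

text \<open>The coordinate form of \<alpha> read backwards: position A(\<partial>/\<partial>v^i),
  velocity A(\<partial>/\<partial>x^i).\<close>

definition lift_covec :: "('m, 'i) chart \<Rightarrow> 'm \<times> 'm tvec \<Rightarrow> ('m \<times> 'm tvec) covec \<Rightarrow> real \<Rightarrow> 'i \<Rightarrow> real" where
  "lift_covec c u A t i = A (coord_vec (tangent_bundle M) (tc c) u (Inr i)) + t * A (coord_vec (tangent_bundle M) (tc c) u (Inl i))"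

definition base_curve :: "('m, 'i) chart \<Rightarrow> 'm \<times> 'm tvec \<Rightarrow> real \<Rightarrow> 'm" where
  "base_curve c u = chart_line c (fst u) (tangent_fibre c (fst u) (snd u))"

text \<open>A curve of covectors with velocity \<open>\<epsilon>\<^sub>M(A)\<close>, over a base curve that depends only on \<open>u\<close>.\<close>

definition covec_curve :: "('m, 'i) chart \<Rightarrow> 'm \<times> 'm tvec \<Rightarrow> ('m \<times> 'm tvec) covec \<Rightarrow> real \<Rightarrow> 'm covec" where
  "covec_curve c u A t = (\<lambda>w. \<Sum>i\<in>idx M. lift_covec c u A t i * coord_covec M c (base_curve c u t) i w)"

text \<open>The same curve as an affine line of the natural cotangent chart, so that smoothness and
  velocity come from the general facts on \<open>chart_line\<close>.
  \<open>epsilon_curve_eventually\<close> identifies it near 0 with the explicit form.\<close>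

definition epsilon_curve :: "('m, 'i) chart \<Rightarrow> 'm \<times> 'm tvec \<Rightarrow> ('m \<times> 'm tvec) covec \<Rightarrow> real \<Rightarrow> 'm \<times> 'm covec" where
  "epsilon_curve c u A = K.chart_line (kc c) (fst u, covec_curve c u A 0)
     (case_sum (tangent_fibre c (fst u) (snd u)) (\<lambda>i. if i \<in> idx M then A (coord_vec (tangent_bundle M) (tc c) u (Inl i)) else 0))"

context
  fixes c p v
  assumes c: "c \<in> atlas M" and p: "p \<in> fst c" and v: "v \<in> tangent_space M p"
begin

lemma base_curve_0: "base_curve c (p, v) 0 = p"
  unfolding base_curve_def using chart_line_0[OF c p] by simp

lemma base_curve_eventually:
  "\<forall>\<^sub>F t in nhds 0. base_curve c (p, v) t \<in> fst c \<and> snd c (base_curve c (p, v) t) = (\<lambda>i. snd c p i + t * tangent_fibre c p v i)"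
  unfolding base_curve_def fst_conv snd_conv by (rule chart_line_eventually[OF c p tangent_fibre_coord_space])

lemma base_curve_velocity:
  assumes "smooth_at M p f"
  shows "((\<lambda>t. f (base_curve c (p, v) t)) has_real_derivative v f) (at 0)"
proof -
  have cu: "curve_at c (base_curve c (p, v)) (tangent_fibre c p v)"
    unfolding base_curve_def fst_conv snd_conv by (rule chart_line_curve_at[OF c p tangent_fibre_coord_space])
  have "velocity M (base_curve c (p, v)) = (p, v)"
    unfolding base_curve_def fst_conv snd_conv by (rule velocity_chart_line[OF c p v])
  then show ?thesis using curve_at_deriv_velocity[OF c cu, of f] assms base_curve_0 by simp
qed

lemma epsilon_coords_space:
  "case_sum (tangent_fibre c p v) (\<lambda>i. if i \<in> idx M then A i else 0) \<in> coord_space (idx (cotangent_bundle M))"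
  by (auto simp: coord_space_def idx_cotangent_bundle split: sum.split)

lemma covec_curve_0_mem: "covec_curve c (p, v) A 0 \<in> cotangent_space M p"
  unfolding covec_curve_def base_curve_0 by (rule cotangent_comb[OF c p])

lemma covec_curve_0_coord: "i \<in> idx M \<Longrightarrow> covec_curve c (p, v) A 0 (coord_vec M c p i) = A (coord_vec (tangent_bundle M) (tc c) (p, v) (Inr i))"
  unfolding covec_curve_def base_curve_0 using cotangent_coord_comb[OF c p, of i "lift_covec c (p, v) A 0"] by (simp add: lift_covec_def)

text \<open>Both curves have the same natural coordinates near 0. The explicit form is needed
  because it exhibits one base curve, independent of \<open>A\<close>, and linearity in
  \<open>A\<close>.\<close>

lemma epsilon_curve_eventually:
  "\<forall>\<^sub>F t in nhds 0. epsilon_curve c (p, v) A t = (base_curve c (p, v) t, covec_curve c (p, v) A t)"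
proof -
  have m: "(p, covec_curve c (p, v) A 0) \<in> fst (kc c)" using p covec_curve_0_mem by (simp add: kc_mem)
  show ?thesis
    using base_curve_eventually
      K.chart_line_eventually[OF cotangent_chart_atlas[OF c] m epsilon_coords_space[of "\<lambda>i. A (coord_vec (tangent_bundle M) (tc c) (p, v) (Inl i))"]]
  proof eventually_elim
    case (elim t)
    define q a where "q = fst (epsilon_curve c (p, v) A t)" and "a = snd (epsilon_curve c (p, v) A t)"
    have eq: "epsilon_curve c (p, v) A t = (q, a)" by (simp add: q_def a_def)
    have E: "(q, a) \<in> fst (kc c)" and X: "snd (kc c) (q, a) = (\<lambda>i. snd (kc c) (p, covec_curve c (p, v) A 0) i + t * (case_sum (tangent_fibre c p v) (\<lambda>i. if i \<in> idx M then A (coord_vec (tangent_bundle M) (tc c) (p, v) (Inl i)) else 0)) i)"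
      using elim(2) unfolding eq[symmetric] epsilon_curve_def fst_conv snd_conv by blast+
    have q: "q \<in> fst c" "a \<in> cotangent_space M q" using E by (simp_all add: kc_mem)
    have "snd c q = snd c (base_curve c (p, v) t)"
    proof
      fix i
      show "snd c q i = snd c (base_curve c (p, v) t) i"
        using fun_cong[OF X, of "Inl i"] elim(1) by (simp add: kx_Inl)
    qed
    then have qb: "q = base_curve c (p, v) t" using inj_onD[OF chart_inj[OF c] _ q(1)] elim(1) by blast
    have "a = covec_curve c (p, v) A t"
    proof (rule cotangent_eqI[OF c q])
      show "covec_curve c (p, v) A t \<in> cotangent_space M q" unfolding covec_curve_def qb[symmetric] by (rule cotangent_comb[OF c q(1)])
      fix i assume i: "i \<in> idx M"
      show "a (coord_vec M c q i) = covec_curve c (p, v) A t (coord_vec M c q i)"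
        using fun_cong[OF X, of "Inr i"] i cotangent_coord_comb[OF c q(1) i, of "lift_covec c (p, v) A t"]
        by (simp add: kx_Inr covec_curve_0_coord covec_curve_def[of c "(p, v)" A t] qb[symmetric] lift_covec_def)
    qed
    then show ?case using eq qb by simp
  qed
qed

lemma epsilon_curve_smooth: "smooth_curve (cotangent_bundle M) (epsilon_curve c (p, v) A)"
  unfolding epsilon_curve_def fst_conv snd_conv
  by (rule K.chart_line_smooth[OF cotangent_chart_atlas[OF c] _ epsilon_coords_space]) (use p covec_curve_0_mem in \<open>simp add: kc_mem\<close>)

lemma epsilon_curve_0: "epsilon_curve c (p, v) A 0 = (p, covec_curve c (p, v) A 0)"
  unfolding epsilon_curve_def fst_conv snd_conv
  by (rule K.chart_line_0[OF cotangent_chart_atlas[OF c]]) (use p covec_curve_0_mem in \<open>simp add: kc_mem\<close>)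

text \<open>Provides a preimage of \<open>A\<close> under \<alpha>: by construction its components
  are the ones that \<open>alpha_eq\<close> reads off.\<close>

lemma alpha_epsilon_curve:
  assumes A: "A \<in> cotangent_space (tangent_bundle M) (p, v)"
  shows "alpha M (velocity (cotangent_bundle M) (epsilon_curve c (p, v) A)) = ((p, v), A)"
    and "velocity (cotangent_bundle M) (epsilon_curve c (p, v) A) \<in> pts (tangent_bundle (cotangent_bundle M))"
proof -
  note D = cotangent_chart_atlas[OF c] and C = tangent_chart_atlas[OF c]
  let ?a = "covec_curve c (p, v) A 0"
  let ?b = "case_sum (tangent_fibre c p v) (\<lambda>i. if i \<in> idx M then A (coord_vec (tangent_bundle M) (tc c) (p, v) (Inl i)) else 0)"
  have m: "(p, ?a) \<in> fst (kc c)" using p covec_curve_0_mem by (simp add: kc_mem)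
  define \<omega> where "\<omega> = (\<lambda>f. \<Sum>i\<in>idx (cotangent_bundle M). ?b i * coord_vec (cotangent_bundle M) (kc c) (p, ?a) i f)"
  have V: "velocity (cotangent_bundle M) (epsilon_curve c (p, v) A) = ((p, ?a), \<omega>)"
    unfolding epsilon_curve_def fst_conv snd_conv \<omega>_def
    using K.velocity_curve_at[OF D K.chart_line_curve_at[OF D m epsilon_coords_space]] by (simp add: K.chart_line_0[OF D m])
  have \<omega>: "\<omega> \<in> tangent_space (cotangent_bundle M) (p, ?a)" unfolding \<omega>_def by (rule K.tangent_comb[OF D m])
  have \<omega>c: "\<omega> (kx c i) = ?b i" if "i \<in> idx M <+> idx M" for i
    unfolding \<omega>_def by (rule K.tangent_coord_comb[OF D m]) (use that in \<open>simp add: idx_cotangent_bundle\<close>)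
  show "velocity (cotangent_bundle M) (epsilon_curve c (p, v) A) \<in> pts (tangent_bundle (cotangent_bundle M))"
    unfolding V using \<omega> m K.chart_sub[OF D] by (auto simp: tangent_bundle_def)
  have vv: "(\<lambda>f. \<Sum>i\<in>idx M. \<omega> (kx c (Inl i)) * coord_vec M c p i f) = v"
  proof -
    have "(\<lambda>f. \<Sum>i\<in>idx M. \<omega> (kx c (Inl i)) * coord_vec M c p i f) = (\<lambda>f. \<Sum>i\<in>idx M. v (\<lambda>q. snd c q i) * coord_vec M c p i f)"
      using \<omega>c by (intro ext sum.cong refl) simp
    then show ?thesis using tangent_expand[OF c p v] by simp
  qed
  have u: "(p, v) \<in> fst (tc c)" using p v by (simp add: tc_mem)
  have "(\<lambda>\<zeta>. if \<zeta> \<in> tangent_space (tangent_bundle M) (p, v)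
     then \<Sum>i\<in>idx M. \<zeta> (tx c (Inr i)) * ?a (coord_vec M c p i) + \<zeta> (tx c (Inl i)) * \<omega> (kx c (Inr i)) else 0) = A"
  proof
    fix \<zeta>
    show "(if \<zeta> \<in> tangent_space (tangent_bundle M) (p, v)
     then \<Sum>i\<in>idx M. \<zeta> (tx c (Inr i)) * ?a (coord_vec M c p i) + \<zeta> (tx c (Inl i)) * \<omega> (kx c (Inr i)) else 0) = A \<zeta>"
    proof (cases "\<zeta> \<in> tangent_space (tangent_bundle M) (p, v)")
      case True
      have "A \<zeta> = (\<Sum>i\<in>idx M. \<zeta> (tx c (Inl i)) * A (coord_vec (tangent_bundle M) (tc c) (p, v) (Inl i))) +
         (\<Sum>i\<in>idx M. \<zeta> (tx c (Inr i)) * A (coord_vec (tangent_bundle M) (tc c) (p, v) (Inr i)))"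
        using T.cotangent_eval[OF C u A True] by (simp only: sum_idx_T)
      also have "\<dots> = (\<Sum>i\<in>idx M. \<zeta> (tx c (Inr i)) * ?a (coord_vec M c p i) + \<zeta> (tx c (Inl i)) * \<omega> (kx c (Inr i)))"
        unfolding sum.distrib[symmetric] using \<omega>c covec_curve_0_coord by (intro sum.cong refl) simp
      finally show ?thesis using True by simp
    next
      case False
      then show ?thesis using A by (simp add: cotangent_space_def)
    qed
  qed
  then show "alpha M (velocity (cotangent_bundle M) (epsilon_curve c (p, v) A)) = ((p, v), A)"
    unfolding V alpha_eq[OF c p covec_curve_0_mem \<omega>] vv by simp
qed

end

text \<open>Every natural coordinate of a vector tangent to the cotangent bundle can be recovered
  from its image under \<alpha>, by evaluation on coordinate vectors. Injectivity follows.\<close>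

lemma alpha_coords:
  assumes c: "c \<in> atlas M" and p: "p \<in> fst c" and a: "a \<in> cotangent_space M p"
    and \<omega>: "\<omega> \<in> tangent_space (cotangent_bundle M) (p, a)" and i: "i \<in> idx M"
  shows "fst (fst (alpha M ((p, a), \<omega>))) = p"
    and "snd (fst (alpha M ((p, a), \<omega>))) (\<lambda>q. snd c q i) = \<omega> (kx c (Inl i))"
    and "snd (alpha M ((p, a), \<omega>)) (coord_vec (tangent_bundle M) (tc c) (fst (alpha M ((p, a), \<omega>))) (Inr i)) = a (coord_vec M c p i)"
    and "snd (alpha M ((p, a), \<omega>)) (coord_vec (tangent_bundle M) (tc c) (fst (alpha M ((p, a), \<omega>))) (Inl i)) = \<omega> (kx c (Inr i))"
proof -
  define v where "v = (\<lambda>f. \<Sum>i\<in>idx M. \<omega> (kx c (Inl i)) * coord_vec M c p i f)"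
  have v: "v \<in> tangent_space M p" unfolding v_def by (rule tangent_comb[OF c p])
  have u: "(p, v) \<in> fst (tc c)" using p v by (simp add: tc_mem)
  note C = tangent_chart_atlas[OF c]
  note al = alpha_eq[OF c p a \<omega>, folded v_def]
  show "fst (fst (alpha M ((p, a), \<omega>))) = p" unfolding al by simp
  show "snd (fst (alpha M ((p, a), \<omega>))) (\<lambda>q. snd c q i) = \<omega> (kx c (Inl i))"
    unfolding al fst_conv snd_conv v_def by (rule tangent_coord_comb[OF c p i])
  let ?e = "\<lambda>k. coord_vec (tangent_bundle M) (tc c) (p, v) k"
  have e: "?e k (tx c j) = (if k = j then 1 else 0)" "?e k \<in> tangent_space (tangent_bundle M) (p, v)" if "k \<in> idx M <+> idx M" for k j
    using T.coord_vec_coord[OF C u, of k j] T.coord_vec_tangent[OF C u, of k] that by (simp_all add: idx_tangent_bundle)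
  have "snd (alpha M ((p, a), \<omega>)) (?e (Inr i)) = (\<Sum>j\<in>idx M. if j = i then a (coord_vec M c p j) else 0)"
    unfolding al snd_conv using e[of "Inr i"] i by (simp only: Inr_in_Plus if_True) (intro sum.cong, auto)
  then show "snd (alpha M ((p, a), \<omega>)) (coord_vec (tangent_bundle M) (tc c) (fst (alpha M ((p, a), \<omega>))) (Inr i)) = a (coord_vec M c p i)"
    unfolding al fst_conv using i finite_idx by (simp add: sum.delta)
  have "snd (alpha M ((p, a), \<omega>)) (?e (Inl i)) = (\<Sum>j\<in>idx M. if j = i then \<omega> (kx c (Inr j)) else 0)"
    unfolding al snd_conv using e[of "Inl i"] i by (simp only: Inl_in_Plus if_True) (intro sum.cong, auto)
  then show "snd (alpha M ((p, a), \<omega>)) (coord_vec (tangent_bundle M) (tc c) (fst (alpha M ((p, a), \<omega>))) (Inl i)) = \<omega> (kx c (Inr i))"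
    unfolding al fst_conv using i finite_idx by (simp add: sum.delta)
qed

text \<open>Needed since \<open>epsilon\<close> is an \<open>inv_into\<close>, which inverts
  \<alpha> on the left only where \<alpha> is injective.\<close>

lemma alpha_inj: "inj_on (alpha M) (pts (tangent_bundle (cotangent_bundle M)))"
proof (rule inj_onI)
  fix x y assume x: "x \<in> pts (tangent_bundle (cotangent_bundle M))" and y: "y \<in> pts (tangent_bundle (cotangent_bundle M))"
    and eq: "alpha M x = alpha M y"
  obtain p a \<omega> where x': "x = ((p, a), \<omega>)" by (metis surj_pair)
  obtain q b \<eta> where y': "y = ((q, b), \<eta>)" by (metis surj_pair)
  have px: "p \<in> pts M" "a \<in> cotangent_space M p" "\<omega> \<in> tangent_space (cotangent_bundle M) (p, a)"
    and qy: "q \<in> pts M" "b \<in> cotangent_space M q" "\<eta> \<in> tangent_space (cotangent_bundle M) (q, b)"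
    using x y unfolding x' y' by (auto simp: tangent_bundle_def cotangent_bundle_def)
  obtain c where c: "c \<in> atlas M" "p \<in> fst c" using chart_at_exists[OF px(1)] by blast
  obtain d where d: "d \<in> atlas M" "q \<in> fst d" using chart_at_exists[OF qy(1)] by blast
  have "fst (fst (alpha M x)) = p" "fst (fst (alpha M y)) = q"
    unfolding x' y' alpha_eq[OF c px(2,3)] alpha_eq[OF d qy(2,3)] by simp_all
  then have pq: "q = p" using eq by simp
  note qy = qy[unfolded pq]
  have ab: "a = b"
    by (rule cotangent_eqI[OF c px(2) qy(2)])
       (use alpha_coords(3)[OF c px(2,3)] alpha_coords(3)[OF c qy(2,3)] eq[unfolded x' y' pq] in metis)
  have "\<omega> = \<eta>"
  proof (rule K.tangent_eqI[OF cotangent_chart_atlas[OF c(1)] _ px(3)])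
    show "(p, a) \<in> fst (kc c)" using c px by (simp add: kc_mem)
    show "\<eta> \<in> tangent_space (cotangent_bundle M) (p, a)" using qy ab by simp
    fix k assume "k \<in> idx (cotangent_bundle M)"
    then consider i where "i \<in> idx M" "k = Inl i" | i where "i \<in> idx M" "k = Inr i" by (auto simp: idx_cotangent_bundle)
    then show "\<omega> (kx c k) = \<eta> (kx c k)"
    proof cases
      case 1
      then show ?thesis using alpha_coords(2)[OF c px(2,3)] alpha_coords(2)[OF c qy(2,3)] eq[unfolded x' y' pq] by metis
    next
      case 2
      then show ?thesis using alpha_coords(4)[OF c px(2,3)] alpha_coords(4)[OF c qy(2,3)] eq[unfolded x' y' pq] by metis
    qed
  qed
  then show "x = y" using x' y' pq ab by simp
qed

lemma epsilon_eq:
  assumes "c \<in> atlas M" "p \<in> fst c" "v \<in> tangent_space M p" "A \<in> cotangent_space (tangent_bundle M) (p, v)"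
  shows "epsilon M ((p, v), A) = velocity (cotangent_bundle M) (epsilon_curve c (p, v) A)"
  unfolding epsilon_def alpha_epsilon_curve(1)[OF assms, symmetric]
  by (rule inv_into_f_f[OF alpha_inj alpha_epsilon_curve(2)[OF assms]])

text \<open>The working description of the lift, on which the later arguments rest. In degree 0 the
  separate clause of the definition fits in: a function is differentiated along the base curve,
  whose velocity is \<open>v\<close>.\<close>

lemma d_T_hom_deriv:
  assumes c: "c \<in> atlas M" and p: "p \<in> fst c" and v: "v \<in> tangent_space M p" and X: "X \<in> mv_fields M r"
    and As: "length As = r" "set As \<subseteq> cotangent_space (tangent_bundle M) (p, v)"
  shows "((\<lambda>t. X (base_curve c (p, v) t) (map (\<lambda>A. covec_curve c (p, v) A t) As)) has_real_derivative d_T_hom M r X (p, v) As) (at 0)"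
proof -
  have pp: "p \<in> pts M" using c p chart_sub by blast
  have u: "(p, v) \<in> pts (tangent_bundle M)" using pp v by (simp add: tangent_bundle_def)
  show ?thesis
  proof (cases "r = 0")
    case True
    have "smooth_at M p (\<lambda>q. X q [])"
      using mv_fields_smoothD[OF X c, of "[]"] True p unfolding smooth_at_def by auto
    from base_curve_velocity[OF c p v this] show ?thesis
      using True As u v by (simp add: d_T_hom_def differential_def)
  next
    case False
    let ?\<gamma>s = "map (epsilon_curve c (p, v)) As"
    have ne: "As \<noteq> []" using False As by auto
    have ev: "\<forall>\<^sub>F t in nhds 0. \<forall>A\<in>set As. epsilon_curve c (p, v) A t = (base_curve c (p, v) t, covec_curve c (p, v) A t)"
      using epsilon_curve_eventually[OF c p v] by (intro eventually_ball_finite) auto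
    have cc: "covec_curves p ?\<gamma>s" unfolding covec_curves_def
    proof (intro conjI)
      show "?\<gamma>s \<noteq> []" using ne by simp
      show "\<forall>\<gamma>\<in>set ?\<gamma>s. smooth_curve (cotangent_bundle M) \<gamma> \<and> fst (\<gamma> 0) = p"
        using epsilon_curve_smooth[OF c p v] epsilon_curve_0[OF c p v] by auto
      show "\<forall>\<^sub>F t in nhds 0. \<forall>\<gamma>\<in>set ?\<gamma>s. \<forall>\<delta>\<in>set ?\<gamma>s. fst (\<gamma> t) = fst (\<delta> t)"
        using ev by eventually_elim auto
    qed
    have eps: "map (\<lambda>A. epsilon M ((p, v), A)) As = map (velocity (cotangent_bundle M)) ?\<gamma>s"
      using As(2) epsilon_eq[OF c p v] by auto
    have e1: "d_T_hom M r X (p, v) As = (let W = tangent_wedge M r (map (velocity (cotangent_bundle M)) ?\<gamma>s)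
        in differential (ext_bundle M r) (mv_function M r X) (fst W) (snd W))"
      unfolding d_T_hom_def eps using u As False by simp
    have e2: "((\<lambda>t. X (fst (hd ?\<gamma>s t)) (map (\<lambda>\<gamma>. snd (\<gamma> t)) ?\<gamma>s)) has_real_derivative
       (let W = tangent_wedge M r (map (velocity (cotangent_bundle M)) ?\<gamma>s)
        in differential (ext_bundle M r) (mv_function M r X) (fst W) (snd W))) (at 0)"
      unfolding Let_def by (rule tangent_wedge_differential[OF pp cc _ X]) (use As in simp)
    have e3: "\<forall>\<^sub>F t in nhds 0. X (fst (hd ?\<gamma>s t)) (map (\<lambda>\<gamma>. snd (\<gamma> t)) ?\<gamma>s) = X (base_curve c (p, v) t) (map (\<lambda>A. covec_curve c (p, v) A t) As)"
      using ev
    proof eventually_elim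
      case (elim t)
      have "map (\<lambda>\<gamma>. snd (\<gamma> t)) ?\<gamma>s = map (\<lambda>A. covec_curve c (p, v) A t) As" using elim by auto
      moreover have "fst (hd ?\<gamma>s t) = base_curve c (p, v) t" using elim ne by (simp add: hd_map)
      ultimately show ?case by (simp only:)
    qed
    from e2 show ?thesis unfolding e1 DERIV_cong_ev[OF refl e3 refl] .
  qed
qed

end


section \<open>Multivector fields and bump functions\<close>

context charted
begin

lemma smooth_fun_onD_open: "smooth_fun_on M W f \<Longrightarrow> c \<in> atlas M \<Longrightarrow> coord_open (idx M) (snd c ` (fst c \<inter> W))"
  by (simp add: smooth_fun_on_def openin_mtopology)

lemma smooth_fun_on_cong:
  assumes f: "smooth_fun_on M W f" and eq: "\<And>q. q \<in> W \<Longrightarrow> g q = f q"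
  shows "smooth_fun_on M W g"
  unfolding smooth_fun_on_def
proof (intro conjI ballI)
  show "openin (mtopology M) W" using f by (simp add: smooth_fun_on_def)
  fix c assume c: "c \<in> atlas M"
  show "smooth_on (idx M) (snd c ` (fst c \<inter> W)) (\<lambda>u. g (chart_inv c u))"
  proof (rule smooth_on_congI[OF finite_idx smooth_fun_onD_open[OF f c]])
    show "smooth_on (idx M) (snd c ` (fst c \<inter> W)) (\<lambda>u. f (chart_inv c u))" using f c by (simp add: smooth_fun_on_def)
    fix u assume "u \<in> snd c ` (fst c \<inter> W)"
    then show "g (chart_inv c u) = f (chart_inv c u)" using eq chart_inv_left[OF c] by auto
  qed
qed

lemma smooth_fun_on_subset:
  assumes f: "smooth_fun_on M W f" and V: "openin (mtopology M) V" "V \<subseteq> W"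
  shows "smooth_fun_on M V f"
  unfolding smooth_fun_on_def
proof (intro conjI ballI V(1))
  fix c assume c: "c \<in> atlas M"
  show "smooth_on (idx M) (snd c ` (fst c \<inter> V)) (\<lambda>u. f (chart_inv c u))"
    by (rule smooth_on_subset[of _ "snd c ` (fst c \<inter> W)"]) (use f c V in \<open>auto simp: smooth_fun_on_def\<close>)
qed

lemma smooth_fun_on_const: "openin (mtopology M) W \<Longrightarrow> smooth_fun_on M W (\<lambda>_. k)"
  by (simp add: smooth_fun_on_def smooth_on_const)

lemma smooth_fun_on_mult:
  assumes "smooth_fun_on M W f" "smooth_fun_on M W g" shows "smooth_fun_on M W (\<lambda>q. f q * g q)"
  using assms smooth_on_mult[OF finite_idx smooth_fun_onD_open[OF assms(1)]] by (simp add: smooth_fun_on_def)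

lemma smooth_fun_on_add:
  assumes "smooth_fun_on M W f" "smooth_fun_on M W g" shows "smooth_fun_on M W (\<lambda>q. f q + g q)"
  using assms smooth_on_add[OF finite_idx smooth_fun_onD_open[OF assms(1)]] by (simp add: smooth_fun_on_def)

lemma smooth_fun_on_sum:
  assumes W: "openin (mtopology M) W" and f: "\<And>j. j \<in> J \<Longrightarrow> smooth_fun_on M W (f j)"
  shows "smooth_fun_on M W (\<lambda>q. \<Sum>j\<in>J. f j q)"
  using f
proof (induction J rule: infinite_finite_induct)
  case (insert j J)
  then show ?case using smooth_fun_on_add[of W "f j" "\<lambda>q. \<Sum>j\<in>J. f j q"] by simp
qed (use smooth_fun_on_const[OF W] in simp_all)

lemma smooth_fun_on_power:
  assumes "smooth_fun_on M W f" shows "smooth_fun_on M W (\<lambda>q. f q ^ n)"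
proof (induction n)
  case 0 then show ?case using smooth_fun_on_const[of W] assms by (simp add: smooth_fun_on_def)
next
  case (Suc n) then show ?case using smooth_fun_on_mult[OF assms] by simp
qed

lemma smooth_fun_on_local:
  assumes W: "openin (mtopology M) W" and l: "\<And>q. q \<in> W \<Longrightarrow> \<exists>V. q \<in> V \<and> smooth_fun_on M V f"
  shows "smooth_fun_on M W f"
  unfolding smooth_fun_on_def
proof (intro conjI ballI W)
  fix c assume c: "c \<in> atlas M"
  show "smooth_on (idx M) (snd c ` (fst c \<inter> W)) (\<lambda>u. f (chart_inv c u))"
  proof (rule smooth_on_local[OF finite_idx])
    show "snd c ` (fst c \<inter> W) \<subseteq> coord_space (idx M)" using coords_in[OF c] by auto
    fix u assume "u \<in> snd c ` (fst c \<inter> W)"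
    then obtain q where q: "q \<in> fst c" "q \<in> W" "u = snd c q" by blast
    obtain V where V: "q \<in> V" "smooth_fun_on M V f" using l[OF q(2)] by blast
    show "\<exists>B. coord_open (idx M) B \<and> u \<in> B \<and> smooth_on (idx M) B (\<lambda>u. f (chart_inv c u))"
      by (rule exI[of _ "snd c ` (fst c \<inter> V)"]) (use V q c smooth_fun_onD_open[OF V(2) c] in \<open>auto simp: smooth_fun_on_def\<close>)
  qed
qed

lemma smooth_fun_on_coord_vec:
  assumes c: "c \<in> atlas M" and k: "k \<in> idx M" and W: "W \<subseteq> fst c" and f: "smooth_fun_on M W f"
  shows "smooth_fun_on M W (\<lambda>q. coord_vec M c q k f)"
proof -
  have oW: "openin (mtopology M) W" using f by (simp add: smooth_fun_on_def)
  have cW: "fst c \<inter> W = W" using W by blast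
  have S: "smooth_on (idx M) (snd c ` W) (\<lambda>u. coord_vec M c (chart_inv c u) k f)"
  proof (rule smooth_coord_vec[OF c k oW W])
    show "smooth_on (idx M) (snd c ` W) (\<lambda>u. f (chart_inv c u))"
      using f c cW unfolding smooth_fun_on_def by metis
    show "smooth_at M p f" if "p \<in> W" for p using that f unfolding smooth_at_def by blast
  qed
  show ?thesis unfolding smooth_fun_on_def
  proof (intro conjI ballI oW)
    fix d assume d: "d \<in> atlas M"
    have "fst d \<inter> fst c \<inter> W = fst d \<inter> W" using W by blast
    then show "smooth_on (idx M) (snd d ` (fst d \<inter> W)) (\<lambda>u. coord_vec M c (chart_inv d u) k f)"
      using smooth_on_change_chart[OF c d, of W "\<lambda>q. coord_vec M c q k f"] S oW cW by simp
  qed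
qed

section \<open>The graded algebra of multivector fields\<close>

lemma mv_fieldsI:
  assumes "\<And>p. p \<in> pts M \<Longrightarrow> X p \<in> alt_forms r (cotangent_space M p)" "\<And>p. p \<notin> pts M \<Longrightarrow> X p = (\<lambda>_. 0)"
    "\<And>c js. c \<in> atlas M \<Longrightarrow> length js = r \<Longrightarrow> set js \<subseteq> idx M \<Longrightarrow> smooth_fun_on M (fst c) (\<lambda>p. X p (map (coord_covec M c p) js))"
  shows "X \<in> mv_fields M r"
  using assms by (simp add: mv_fields_def)

lemma mv_fields_outside: "X \<in> mv_fields M r \<Longrightarrow> p \<notin> pts M \<Longrightarrow> X p = (\<lambda>_. 0)"
  by (simp add: mv_fields_def)

lemma mv_fields_zero_arg:
  assumes "X \<in> mv_fields M r" "\<not> (p \<in> pts M \<and> length as = r \<and> set as \<subseteq> cotangent_space M p)" shows "X p as = 0"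
proof (cases "p \<in> pts M")
  case True
  then show ?thesis using alt_forms_zero[OF mv_fields_altD[OF assms(1) True], of as] assms(2) by blast
qed (use mv_fields_outside[OF assms(1)] in simp)

lemma mv_fields_comb:
  assumes X: "X \<in> mv_fields M r" and Y: "Y \<in> mv_fields M r" shows "mv_comb a X b Y \<in> mv_fields M r"
proof (rule mv_fieldsI)
  fix p assume "p \<in> pts M"
  then show "mv_comb a X b Y p \<in> alt_forms r (cotangent_space M p)"
    unfolding mv_comb_def by (intro alt_forms_comb mv_fields_altD[OF X] mv_fields_altD[OF Y])
next
  fix c js assume c: "c \<in> atlas M" "length js = r" "set js \<subseteq> idx M"
  show "smooth_fun_on M (fst c) (\<lambda>p. mv_comb a X b Y p (map (coord_covec M c p) js))"
    unfolding mv_comb_def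
    by (intro smooth_fun_on_add smooth_fun_on_mult smooth_fun_on_const openin_chart mv_fields_smoothD[OF X] mv_fields_smoothD[OF Y] c)
qed (use mv_fields_outside[OF X] mv_fields_outside[OF Y] in \<open>simp add: mv_comb_def\<close>)

lemma mv_fields_0: "(\<lambda>_ _. 0) \<in> mv_fields M r"
  by (rule mv_fieldsI) (auto simp: alt_forms_zero_mem smooth_fun_on_const openin_chart)

lemma mv_part_mv_fields: "X \<in> mv_fields M r \<Longrightarrow> mv_part k X = (if k = r then X else (\<lambda>_ _. 0))"
  by (intro ext) (auto simp: mv_part_def mv_fields_zero_arg)

lemma mv_fields_algebra: "X \<in> mv_fields M r \<Longrightarrow> X \<in> mv_algebra M"
  unfolding mv_algebra_def
  by (auto simp: mv_part_mv_fields mv_fields_0 intro: finite_subset[of _ "{r}"])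

lemma mv_algebra_part: "X \<in> mv_algebra M \<Longrightarrow> mv_part r X \<in> mv_fields M r"
  by (simp add: mv_algebra_def)

lemma mv_part_apply: "mv_part (length as) X p as = X p as"
  by (simp add: mv_part_def)

lemma mv_algebra_comb:
  assumes X: "X \<in> mv_algebra M" and Y: "Y \<in> mv_algebra M" shows "mv_comb a X b Y \<in> mv_algebra M"
proof -
  have P: "mv_part r (mv_comb a X b Y) = mv_comb a (mv_part r X) b (mv_part r Y)" for r
    by (intro ext) (simp add: mv_part_def mv_comb_def)
  have "{r. mv_part r (mv_comb a X b Y) \<noteq> (\<lambda>_ _. 0)} \<subseteq> {r. mv_part r X \<noteq> (\<lambda>_ _. 0)} \<union> {r. mv_part r Y \<noteq> (\<lambda>_ _. 0)}"
    unfolding P by (auto simp: mv_comb_def)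
  then have "finite {r. mv_part r (mv_comb a X b Y) \<noteq> (\<lambda>_ _. 0)}"
    using X Y by (auto simp: mv_algebra_def intro: finite_subset)
  then show ?thesis using mv_fields_comb X Y unfolding mv_algebra_def by (simp add: P)
qed

lemma mv_fields_wedge:
  assumes X: "X \<in> mv_fields M a" and Y: "Y \<in> mv_fields M b" shows "mv_wedge X Y \<in> mv_fields M (a + b)"
proof (rule mv_fieldsI)
  fix p assume p: "p \<in> pts M"
  show "mv_wedge X Y p \<in> alt_forms (a + b) (cotangent_space M p)"
    unfolding mv_wedge_def by (rule wedge_alt_forms[OF cotangent_lin_closed[OF p] mv_fields_altD[OF X p] mv_fields_altD[OF Y p]])
next
  fix p assume "p \<notin> pts M"
  then show "mv_wedge X Y p = (\<lambda>_. 0)" by (simp add: mv_wedge_def mv_fields_outside[OF X] wedge_def fun_eq_iff)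
next
  fix c js assume c: "c \<in> atlas M" and js: "length js = a + b" "set js \<subseteq> idx M"
  have "smooth_fun_on M (fst c) (\<lambda>p. X p (map (coord_covec M c p) (nths js S)) * Y p (map (coord_covec M c p) (nths js (- S))))" for S
  proof (cases "length (nths js S) = a")
    case True
    then have "length (nths js (- S)) = b" using length_nths_compl[of js S] js by simp
    then show ?thesis using True js set_nths_subset[of js S] set_nths_subset[of js "- S"]
      by (intro smooth_fun_on_mult mv_fields_smoothD[OF X c] mv_fields_smoothD[OF Y c]) auto
  next
    case False
    then have "X p (map (coord_covec M c p) (nths js S)) = 0" for p by (intro mv_fields_zero_arg[OF X]) simp
    then show ?thesis using smooth_fun_on_const[OF openin_chart[OF c], of 0] by simp
  qed
  then have "smooth_fun_on M (fst c) (\<lambda>p. \<Sum>S\<in>Pow {..<a + b}. shuffle_sign (a + b) S *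
     (X p (map (coord_covec M c p) (nths js S)) * Y p (map (coord_covec M c p) (nths js (- S)))))"
    by (intro smooth_fun_on_sum openin_chart c smooth_fun_on_mult[OF smooth_fun_on_const])
  then show "smooth_fun_on M (fst c) (\<lambda>p. mv_wedge X Y p (map (coord_covec M c p) js))"
    using js by (simp add: mv_wedge_def wedge_def nths_map mult.assoc)
qed

lemma mv_fields_sum:
  assumes "\<And>j. j \<in> J \<Longrightarrow> Z j \<in> mv_fields M r" shows "(\<lambda>p as. \<Sum>j\<in>J. Z j p as) \<in> mv_fields M r"
  using assms
proof (induction J rule: infinite_finite_induct)
  case (insert j J)
  then show ?case using mv_fields_comb[of "Z j" r "\<lambda>p as. \<Sum>j\<in>J. Z j p as" 1 1] by (simp add: mv_comb_def)
qed (simp_all add: mv_fields_0)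

text \<open>In the term of the shuffle \<open>S\<close> only the component of \<open>X\<close> of
  degree \<open>length (nths as S)\<close> is evaluated, so sorting the shuffles by this number
  gives the sum over \<open>k\<close>.\<close>

lemma mv_part_wedge:
  "mv_part r (mv_wedge X Y) = (\<lambda>p as. \<Sum>k\<le>r. mv_wedge (mv_part k X) (mv_part (r - k) Y) p as)"
proof (intro ext)
  fix p as
  show "mv_part r (mv_wedge X Y) p as = (\<Sum>k\<le>r. mv_wedge (mv_part k X) (mv_part (r - k) Y) p as)"
  proof (cases "length as = r")
    case True
    have "X p (nths as S) * Y p (nths as (- S)) = (\<Sum>k\<le>r. mv_part k X p (nths as S) * mv_part (r - k) Y p (nths as (- S)))" for S
    proof -
      have l: "length (nths as S) \<le> r" "r - length (nths as S) = length (nths as (- S))" using length_nths_compl[of as S] True by auto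
      have "(\<Sum>k\<le>r. mv_part k X p (nths as S) * mv_part (r - k) Y p (nths as (- S)))
        = (\<Sum>k\<le>r. if k = length (nths as S) then X p (nths as S) * Y p (nths as (- S)) else 0)"
        using l by (intro sum.cong) (auto simp: mv_part_def)
      then show ?thesis using l(1) by simp
    qed
    then have "mv_wedge X Y p as = (\<Sum>S\<in>Pow {..<length as}. \<Sum>k\<le>r. shuffle_sign (length as) S * mv_part k X p (nths as S) * mv_part (r - k) Y p (nths as (- S)))"
      unfolding mv_wedge_def wedge_def by (simp add: mult.assoc sum_distrib_left)
    also have "\<dots> = (\<Sum>k\<le>r. mv_wedge (mv_part k X) (mv_part (r - k) Y) p as)"
      unfolding mv_wedge_def wedge_def by (rule sum.swap)
    finally show ?thesis using True by (simp add: mv_part_def)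
  next
    case False
    have "mv_part k X p (nths as S) * mv_part (r - k) Y p (nths as (- S)) = 0" if "k \<le> r" for k S
      using length_nths_compl[of as S] False that by (auto simp: mv_part_def)
    then have "mv_wedge (mv_part k X) (mv_part (r - k) Y) p as = 0" if "k \<le> r" for k
      unfolding mv_wedge_def wedge_def using that by (intro sum.neutral) (simp add: mult.assoc)
    then show ?thesis using False by (simp add: mv_part_def)
  qed
qed

lemma mv_algebra_wedge:
  assumes X: "X \<in> mv_algebra M" and Y: "Y \<in> mv_algebra M" shows "mv_wedge X Y \<in> mv_algebra M"
proof -
  have "mv_part r (mv_wedge X Y) \<in> mv_fields M r" for r
    unfolding mv_part_wedge
  proof (rule mv_fields_sum)
    fix k assume "k \<in> {..r}"
    then show "mv_wedge (mv_part k X) (mv_part (r - k) Y) \<in> mv_fields M r"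
      using mv_fields_wedge[OF mv_algebra_part[OF X, of k] mv_algebra_part[OF Y, of "r - k"]] by simp
  qed
  moreover have "{r. mv_part r (mv_wedge X Y) \<noteq> (\<lambda>_ _. 0)} \<subseteq>
    (\<lambda>(a, b). a + b) ` ({r. mv_part r X \<noteq> (\<lambda>_ _. 0)} \<times> {r. mv_part r Y \<noteq> (\<lambda>_ _. 0)})" (is "?L \<subseteq> ?R")
  proof
    fix r assume "r \<in> ?L"
    then obtain p as where "mv_part r (mv_wedge X Y) p as \<noteq> 0" by (auto simp: fun_eq_iff)
    then obtain k where k: "k \<le> r" "mv_wedge (mv_part k X) (mv_part (r - k) Y) p as \<noteq> 0"
      unfolding mv_part_wedge by (meson atMost_iff sum.neutral)
    then have "mv_part k X \<noteq> (\<lambda>_ _. 0)" "mv_part (r - k) Y \<noteq> (\<lambda>_ _. 0)" by (auto simp: mv_wedge_def wedge_def)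
    then show "r \<in> ?R" using k(1) by (intro image_eqI[of _ _ "(k, r - k)"]) auto
  qed
  then have "finite ?L" by (rule finite_subset) (use X Y in \<open>simp add: mv_algebra_def\<close>)
  ultimately show ?thesis by (simp add: mv_algebra_def)
qed

lemma mv_algebra_sum:
  assumes "\<And>j. j \<in> J \<Longrightarrow> Z j \<in> mv_algebra M" shows "(\<lambda>p as. \<Sum>j\<in>J. Z j p as) \<in> mv_algebra M"
  using assms
proof (induction J rule: infinite_finite_induct)
  case (insert j J)
  then show ?case using mv_algebra_comb[of "Z j" "\<lambda>p as. \<Sum>j\<in>J. Z j p as" 1 1] by (simp add: mv_comb_def)
qed (simp_all add: mv_fields_algebra[OF mv_fields_0])

lemma mv_algebra_decompose:
  assumes X: "X \<in> mv_algebra M"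
  shows "X = (\<lambda>p as. \<Sum>r\<in>{r. mv_part r X \<noteq> (\<lambda>_ _. 0)}. mv_part r X p as)"
proof (intro ext)
  fix p as
  let ?R = "{r. mv_part r X \<noteq> (\<lambda>_ _. 0)}"
  have fin: "finite ?R" using X by (simp add: mv_algebra_def)
  have "(\<Sum>r\<in>?R. mv_part r X p as) = (\<Sum>r\<in>?R. if r = length as then X p as else 0)"
    by (rule sum.cong) (auto simp: mv_part_def)
  also have "\<dots> = X p as"
  proof (cases "length as \<in> ?R")
    case True then show ?thesis using fin by simp
  next
    case False
    then have "mv_part (length as) X p as = 0" by (auto dest: fun_cong)
    then show ?thesis using fin False by (simp add: mv_part_apply)
  qed
  finally show "X p as = (\<Sum>r\<in>?R. mv_part r X p as)" by simp
qed

lemma fun_field_mv_fields: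
  assumes f: "smooth_fun_on M (pts M) f" shows "fun_field M f \<in> mv_fields M 0"
proof (rule mv_fieldsI)
  show "fun_field M f p \<in> alt_forms 0 (cotangent_space M p)" if "p \<in> pts M" for p
    by (rule alt_formsI) (auto simp: fun_field_def multilinear_at_def)
  fix c js assume c: "c \<in> atlas M" "length js = 0" "set js \<subseteq> idx M"
  have "smooth_fun_on M (fst c) f" by (rule smooth_fun_on_subset[OF f openin_chart[OF c(1)] chart_sub[OF c(1)]])
  then show "smooth_fun_on M (fst c) (\<lambda>p. fun_field M f p (map (coord_covec M c p) js))"
    by (rule smooth_fun_on_cong) (use c chart_sub[OF c(1)] in \<open>auto simp: fun_field_def\<close>)
qed (simp add: fun_field_def)

lemma vec_field_one_form:
  "p \<in> pts M \<Longrightarrow> vec_field M Y p = one_form (\<lambda>a. if a \<in> cotangent_space M p then a (Y p) else 0)"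
  by (intro ext) (simp add: vec_field_def one_form_def split: list.split)

text \<open>At each point the field is evaluation at a vector, a 1-form on covectors, so it is a
  wedge list with one factor.\<close>

lemma vec_field_mv_fields:
  assumes Y: "smooth_vector_field M Y" shows "vec_field M Y \<in> mv_fields M 1"
proof (rule mv_fieldsI)
  fix p assume p: "p \<in> pts M"
  let ?e = "\<lambda>a. if a \<in> cotangent_space M p then a (Y p) else 0"
  have "linear_form (cotangent_space M p) ?e"
    using lin_closed_comb[OF cotangent_lin_closed[OF p]] by (auto simp: linear_form_def)
  then have "wedge_list [?e] \<in> alt_forms 1 (cotangent_space M p)" using wedge_list_alt[of "[?e]"] by simp
  moreover have "wedge_list [?e] = one_form ?e"
    by (intro ext) (simp add: wedge_list_def wedge_one_form unit_form_def one_form_def split: list.split)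
  ultimately show "vec_field M Y p \<in> alt_forms 1 (cotangent_space M p)" using vec_field_one_form[OF p, of Y] by simp
next
  fix c js assume c: "c \<in> atlas M" and js: "length js = 1" "set js \<subseteq> idx M"
  obtain i where i: "js = [i]" "i \<in> idx M" using js by (cases js) auto
  have "smooth_fun_on M (fst c) (\<lambda>p. Y p (\<lambda>q. snd c q i))" using Y c i by (simp add: smooth_vector_field_def)
  then show "smooth_fun_on M (fst c) (\<lambda>p. vec_field M Y p (map (coord_covec M c p) js))"
  proof (rule smooth_fun_on_cong)
    fix q assume "q \<in> fst c"
    then have q: "q \<in> pts M" using chart_sub[OF c] by blast
    then have "Y q \<in> tangent_space M q" using Y by (simp add: smooth_vector_field_def)
    then show "vec_field M Y q (map (coord_covec M c q) js) = Y q (\<lambda>q. snd c q i)"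
      using i q coord_covec_cotangent[OF q, of c i] by (simp add: vec_field_def coord_covec_eval)
  qed
qed (simp add: vec_field_def)

end

section \<open>Products with functions, and bump functions\<close>

lemma wedge_0_form: 
  assumes "\<And>as. as \<noteq> [] \<Longrightarrow> \<mu> as = 0" shows "wedge \<mu> \<nu> as = \<mu> [] * \<nu> as"
proof -
  have "wedge \<mu> \<nu> as = (\<Sum>S\<in>{{}}. shuffle_sign (length as) S * \<mu> (nths as S) * \<nu> (nths as (- S)))"
    unfolding wedge_def
  proof (rule sum.mono_neutral_right)
    show "\<forall>S\<in>Pow {..<length as} - {{}}. shuffle_sign (length as) S * \<mu> (nths as S) * \<nu> (nths as (- S)) = 0"
    proof
      fix S assume S: "S \<in> Pow {..<length as} - {{}}"
      then obtain i where "i \<in> S" "i < length as" by auto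
      then have "nths as S \<noteq> []" by (auto simp: set_nths simp flip: set_empty)
      then show "shuffle_sign (length as) S * \<mu> (nths as S) * \<nu> (nths as (- S)) = 0" using assms by simp
    qed
  qed auto
  then show ?thesis by (simp add: shuffle_sign_def nths_all)
qed

lemma wedge_list_scale:
  "wedge_list (map (\<lambda>i z. k * e i z) xs) vs = k ^ length xs * wedge_list (map e xs) vs"
proof (induction xs arbitrary: vs)
  case (Cons x xs)
  have "wedge_list (map (\<lambda>i z. k * e i z) (x # xs)) vs
    = (\<Sum>j<length vs. (- 1) ^ j * (k * e x (vs ! j)) * wedge_list (map (\<lambda>i z. k * e i z) xs) (take j vs @ drop (Suc j) vs))"
    using wedge_one_form[of "\<lambda>z. k * e x z" "wedge_list (map (\<lambda>i z. k * e i z) xs)"] by (simp add: wedge_list_def)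
  also have "\<dots> = k ^ length (x # xs) * (\<Sum>j<length vs. (- 1) ^ j * e x (vs ! j) * wedge_list (map e xs) (take j vs @ drop (Suc j) vs))"
    unfolding Cons.IH by (simp add: sum_distrib_left ac_simps)
  also have "\<dots> = k ^ length (x # xs) * wedge_list (map e (x # xs)) vs"
    using wedge_one_form[of "e x" "wedge_list (map e xs)"] by (simp add: wedge_list_def)
  finally show ?case .
qed simp

text \<open>A product of compact intervals and of singletons for the labels outside
  \<open>I\<close>; Tychonoff's theorem applies.\<close>

lemma compact_closed_box:
  assumes "finite I"
  shows "compact {w \<in> coord_space I. \<forall>i\<in>I. \<bar>w i - x i\<bar> \<le> (e::real)}"
proof -
  have "{w \<in> coord_space I. \<forall>i\<in>I. \<bar>w i - x i\<bar> \<le> e} = PiE UNIV (\<lambda>i. if i \<in> I then {x i - e..x i + e} else {0})"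
    by (auto simp: coord_space_def PiE_def Pi_def abs_le_iff split: if_splits)
  moreover have "compactin (product_topology (\<lambda>i. euclidean) UNIV) (PiE UNIV (\<lambda>i. if i \<in> I then {x i - e..x i + e} else {0}))"
    unfolding compactin_PiE by (auto simp: compactin_euclidean_iff)
  ultimately show ?thesis by (simp add: euclidean_product_topology compactin_euclidean_iff)
qed

text \<open>A normalised product of \<open>flat\<close> functions, vanishing outside the preimage
  \<open>K\<close> of a closed box. \<open>K\<close> is compact, hence closed in a Hausdorff space,
  so extension by 0 is smooth. The last clause is the form in which it is applied: data known only
  on the chart become global after multiplication by \<open>h\<close>.\<close>

lemma (in charted) bump:
  assumes H: "Hausdorff_space (mtopology M)" and c: "c \<in> atlas M" and p: "p \<in> fst c"
  obtains h where "smooth_fun_on M (pts M) h" "h p = 1" "\<And>q. q \<notin> fst c \<Longrightarrow> h q = 0"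
    "\<And>W g. openin (mtopology M) W \<Longrightarrow> smooth_fun_on M (fst c \<inter> W) g \<Longrightarrow> smooth_fun_on M W (\<lambda>q. if q \<in> fst c then h q * g q else 0)"
proof -
  let ?x = "snd c p"
  have "?x \<in> snd c ` fst c" using p by blast
  then obtain d where d: "d > 0" "coord_box (idx M) ?x d \<subseteq> snd c ` fst c"
    using chart_img[OF c] coord_open_iff[OF finite_idx] by metis
  \<comment> \<open>Half the radius, so that the closed box still lies in the image of the
    chart.\<close>
  define e where "e = d / 2"
  have e: "e > 0" "e < d" using d by (simp_all add: e_def)
  define B where "B = {w \<in> coord_space (idx M). \<forall>i\<in>idx M. \<bar>w i - ?x i\<bar> \<le> e}"
  have B: "B \<subseteq> snd c ` fst c" using d(2) e unfolding B_def coord_box_def by force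
  define K where "K = chart_inv c ` B"
  have Kc: "K \<subseteq> fst c" unfolding K_def using B by (auto intro!: chart_inv_right(2))
  \<comment> \<open>Continuity of the inverse chart transports compactness of the box to the
    manifold topology.\<close>
  have "continuous_map (top_of_set B) (mtopology M) (chart_inv c)"
    unfolding continuous_map_def
  proof (intro conjI allI impI)
    show "chart_inv c \<in> topspace (top_of_set B) \<rightarrow> topspace (mtopology M)"
      using Kc chart_sub[OF c] openin_subset[OF openin_pts] unfolding K_def by auto
    fix U assume U: "openin (mtopology M) U"
    have "coord_open (idx M) (snd c ` (fst c \<inter> U))" using U c by (simp add: openin_mtopology)
    then obtain T where T: "open T" "snd c ` (fst c \<inter> U) = coord_space (idx M) \<inter> T" by (auto simp: coord_open_def openin_open)
    have "{x \<in> topspace (top_of_set B). chart_inv c x \<in> U} = B \<inter> T"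
    proof (intro equalityI subsetI)
      fix w assume w: "w \<in> {x \<in> topspace (top_of_set B). chart_inv c x \<in> U}"
      then have "w = snd c (chart_inv c w)" "chart_inv c w \<in> fst c" using B chart_inv_right[of w c] by auto
      then have "w \<in> snd c ` (fst c \<inter> U)" using w by blast
      then show "w \<in> B \<inter> T" using w T(2) by auto
    next
      fix w assume w: "w \<in> B \<inter> T"
      then have "w \<in> snd c ` (fst c \<inter> U)" using T(2) by (auto simp: B_def)
      then show "w \<in> {x \<in> topspace (top_of_set B). chart_inv c x \<in> U}" using w chart_inv_left[OF c] by auto
    qed
    then show "openin (top_of_set B) {x \<in> topspace (top_of_set B). chart_inv c x \<in> U}" using T(1) by (auto simp: openin_open)
  qed
  moreover have "compactin (top_of_set B) B"
    using compact_closed_box[OF finite_idx, of ?x e] unfolding B_def[symmetric] by (simp add: compactin_subtopology compactin_euclidean_iff)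
  ultimately have "compactin (mtopology M) K" unfolding K_def by (intro image_compactin)
  then have clK: "closedin (mtopology M) K" by (rule compactin_imp_closedin[OF H])
  have top: "topspace (mtopology M) = pts M"
    using openin_pts openin_topspace[of "mtopology M"] unfolding openin_mtopology by (metis openin_mtopology openin_pts openin_subset subset_antisym)
  have oK: "openin (mtopology M) (pts M - K)" using clK unfolding closedin_def top by blast
  \<comment> \<open>Each factor is positive exactly where the coordinate differs from that of
    \<open>p\<close> by less than \<open>e\<close>; division by \<open>flat 0 (e * e)\<close> makes
    it 1 at \<open>p\<close>.\<close>
  define h where "h q = (if q \<in> fst c then \<Prod>i\<in>idx M. flat 0 (e * e - (snd c q i - ?x i) * (snd c q i - ?x i)) * inverse (flat 0 (e * e)) else 0)" for q
  have h0: "h q = 0" if "q \<notin> K" for q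
  proof (cases "q \<in> fst c")
    case True
    have "snd c q \<notin> B"
    proof
      assume "snd c q \<in> B"
      then have "chart_inv c (snd c q) \<in> K" unfolding K_def by blast
      then show False using that chart_inv_left[OF c True] by simp
    qed
    then obtain i where i: "i \<in> idx M" "\<bar>snd c q i - ?x i\<bar> > e" using coords_in[OF c True] by (auto simp: B_def)
    have "e * e < (snd c q i - ?x i) * (snd c q i - ?x i)"
      using mult_strict_mono[OF i(2) i(2)] e(1) i(2) by (cases "snd c q i = ?x i") (simp_all flip: abs_mult)
    then have "flat 0 (e * e - (snd c q i - ?x i) * (snd c q i - ?x i)) = 0" by (simp add: flat_def)
    then show ?thesis using i(1) finite_idx True unfolding h_def by (auto intro!: prod_zero)
  qed (simp add: h_def)
  have hp: "h p = 1" using p e(1) by (simp add: h_def flat_def)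
  have smh: "smooth_fun_on M (fst c) h"
  proof (rule smooth_fun_on_chartI[OF c])
    let ?A = "snd c ` fst c"
    note oA = chart_img[OF c]
    have "smooth_on (idx M) ?A (\<lambda>u. \<Prod>i\<in>idx M. flat 0 (e * e + (- 1) * ((u i + (- ?x i)) * (u i + (- ?x i)))) * inverse (flat 0 (e * e)))"
      by (intro smooth_on_prod smooth_on_mult smooth_on_flat smooth_on_add smooth_on_const smooth_on_coord finite_idx oA)
    then show "smooth_on (idx M) ?A (\<lambda>u. h (chart_inv c u))"
      by (rule smooth_on_congI[OF finite_idx oA]) (simp add: h_def chart_inv_right)
  qed
  \<comment> \<open>\<open>W\<close> is covered by the chart domain, where the function is a product
    of smooth functions, and by the complement of \<open>K\<close>, where it is 0.\<close>
  have ext: "smooth_fun_on M W (\<lambda>q. if q \<in> fst c then h q * g q else 0)"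
    if W: "openin (mtopology M) W" and g: "smooth_fun_on M (fst c \<inter> W) g" for W g
  proof (rule smooth_fun_on_local[OF W])
    fix q assume q: "q \<in> W"
    have ocW: "openin (mtopology M) (fst c \<inter> W)" using openin_chart[OF c] W by (rule openin_Int)
    show "\<exists>V. q \<in> V \<and> smooth_fun_on M V (\<lambda>q. if q \<in> fst c then h q * g q else 0)"
    proof (cases "q \<in> fst c")
      case True
      have "smooth_fun_on M (fst c \<inter> W) (\<lambda>q. h q * g q)"
        by (rule smooth_fun_on_mult[OF smooth_fun_on_subset[OF smh ocW] g]) simp
      then have "smooth_fun_on M (fst c \<inter> W) (\<lambda>q. if q \<in> fst c then h q * g q else 0)"
        by (rule smooth_fun_on_cong) simp
      then show ?thesis using True q by blast
    next
      case False
      have "smooth_fun_on M (pts M - K) (\<lambda>q. if q \<in> fst c then h q * g q else 0)"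
        by (rule smooth_fun_on_cong[OF smooth_fun_on_const[OF oK, of 0]]) (simp add: h0)
      moreover have "q \<in> pts M - K" using False Kc q W openin_mtopology by blast
      ultimately show ?thesis by blast
    qed
  qed
  have smM: "smooth_fun_on M (pts M) h"
  proof -
    have "fst c \<inter> pts M = fst c" using chart_sub[OF c] by blast
    then have "smooth_fun_on M (fst c \<inter> pts M) (\<lambda>_. 1)" using smooth_fun_on_const[OF openin_chart[OF c], of 1] by simp
    from ext[OF openin_pts this] show ?thesis
      by (rule smooth_fun_on_cong) (simp add: h_def)
  qed
  show thesis by (rule that[of h]) (use smM hp ext in \<open>auto simp: h_def\<close>)
qed


section \<open>The vertical lift of multivector fields\<close>

lemma mv_linearD:
  "mv_linear M N \<rho> \<Longrightarrow> X \<in> mv_algebra M \<Longrightarrow> Y \<in> mv_algebra M \<Longrightarrow> \<rho> (mv_comb c X d Y) = mv_comb c (\<rho> X) d (\<rho> Y)"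
  by (simp add: mv_linear_def)

lemma mv_linear_sum:
  assumes M: "charted M" and \<rho>: "mv_linear M N \<rho>" and J: "finite J" "\<And>j. j \<in> J \<Longrightarrow> Z j \<in> mv_algebra M"
  shows "\<rho> (\<lambda>p as. \<Sum>j\<in>J. Z j p as) = (\<lambda>p as. \<Sum>j\<in>J. \<rho> (Z j) p as)"
  using J
proof (induction J)
  case empty
  interpret charted M by (rule M)
  have z: "(\<lambda>_ _. 0) \<in> mv_algebra M" by (rule mv_fields_algebra[OF mv_fields_0])
  then have "\<rho> (mv_comb 0 (\<lambda>_ _. 0) 0 (\<lambda>_ _. 0)) = mv_comb 0 (\<rho> (\<lambda>_ _. 0)) 0 (\<rho> (\<lambda>_ _. 0))"
    using mv_linearD[OF \<rho> z z] by blast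
  then show ?case by (simp add: mv_comb_def)
next
  case (insert j J)
  interpret charted M by (rule M)
  have "(\<lambda>p as. \<Sum>j\<in>J. Z j p as) \<in> mv_algebra M" by (rule mv_algebra_sum) (use insert in auto)
  moreover have "Z j \<in> mv_algebra M" using insert by simp
  ultimately have "\<rho> (mv_comb 1 (Z j) 1 (\<lambda>p as. \<Sum>j\<in>J. Z j p as)) = mv_comb 1 (\<rho> (Z j)) 1 (\<rho> (\<lambda>p as. \<Sum>j\<in>J. Z j p as))"
    using mv_linearD[OF \<rho>] by blast
  then show ?case using insert by (simp add: mv_comb_def)
qed

context charted_ord
begin

lemma pts_tangent_bundle: "u \<in> pts (tangent_bundle M) \<longleftrightarrow> fst u \<in> pts M \<and> snd u \<in> tangent_space M (fst u)"
  by (cases u) (simp add: tangent_bundle_def)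

lemma tangent_bundle_chart:
  assumes "u \<in> pts (tangent_bundle M)"
  obtains c where "c \<in> atlas M" "fst u \<in> fst c" "snd u \<in> tangent_space M (fst u)" "u \<in> fst (tc c)"
proof -
  obtain c where "c \<in> atlas M" "fst u \<in> fst c" using assms chart_at_exists[of "fst u"] by (auto simp: pts_tangent_bundle)
  then show thesis using assms by (intro that[of c]) (simp_all add: pts_tangent_bundle tc_mem)
qed

text \<open>\<open>vertical_lift M Y u\<close> depends on \<open>Y\<close> only through its value at
  \<open>fst u\<close>; isolating the map on single vectors gives something that can be
  transposed.\<close>

definition vlift :: "'m \<times> 'm tvec \<Rightarrow> 'm tvec \<Rightarrow> ('m \<times> 'm tvec) tvec" where
  "vlift u w = snd (velocity (tangent_bundle M) (\<lambda>t. (fst u, \<lambda>f. snd u f + t * w f)))"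

text \<open>The transpose of the vertical lift; \<open>v\<^sub>T\<close> is the pullback of multivectors along it.\<close>

definition vres :: "'m \<times> 'm tvec \<Rightarrow> ('m \<times> 'm tvec) covec \<Rightarrow> 'm covec" where
  "vres u A = (\<lambda>w. if w \<in> tangent_space M (fst u) then A (vlift u w) else 0)"

lemma vlift_eq:
  assumes c: "c \<in> atlas M" and p: "p \<in> fst c" and v: "v \<in> tangent_space M p" and w: "w \<in> tangent_space M p"
  shows "vlift (p, v) w = (\<lambda>f. \<Sum>i\<in>idx M. w (\<lambda>q. snd c q i) * coord_vec (tangent_bundle M) (tc c) (p, v) (Inr i) f)"
proof -
  let ?\<gamma> = "\<lambda>t. (p, \<lambda>f. v f + t * w f)"
  have pp: "p \<in> pts M" using c p chart_sub by blast
  have cu: "T.curve_at (tc c) ?\<gamma> (case_sum (\<lambda>_. 0) (\<lambda>i. w (\<lambda>q. snd c q i)))"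
    unfolding T.curve_at_def
  proof (intro conjI ballI)
    have "(\<lambda>f. v f + t * w f) \<in> tangent_space M p" for t
      using lin_closed_comb[OF tangent_lin_closed[OF pp] v w, of 1 t] by simp
    then show "\<forall>\<^sub>F t in nhds 0. ?\<gamma> t \<in> fst (tc c)" using p by (simp add: tc_mem)
    fix j assume "j \<in> idx (tangent_bundle M)"
    then show "((\<lambda>t. tx c j (?\<gamma> t)) has_real_derivative case_sum (\<lambda>_. 0) (\<lambda>i. w (\<lambda>q. snd c q i)) j) (at 0)"
      by (cases j) (auto simp: tx_Inl tx_Inr idx_tangent_bundle intro!: derivative_eq_intros)
  qed
  show ?thesis
    unfolding vlift_def fst_conv snd_conv T.velocity_curve_at[OF tangent_chart_atlas[OF c] cu] sum_idx_T by simp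
qed

text \<open>Both sides have the components A(\<partial>/\<partial>v^i). This links the invariantly
  defined pullback with the starting points of the curves.\<close>

lemma vres_covec_curve:
  assumes c: "c \<in> atlas M" and p: "p \<in> fst c" and v: "v \<in> tangent_space M p" and A: "A \<in> cotangent_space (tangent_bundle M) (p, v)"
  shows "vres (p, v) A = covec_curve c (p, v) A 0"
proof
  fix w
  have u: "(p, v) \<in> fst (tc c)" using p v by (simp add: tc_mem)
  then have up: "(p, v) \<in> pts (tangent_bundle M)" using T.chart_sub[OF tangent_chart_atlas[OF c]] by blast
  show "vres (p, v) A w = covec_curve c (p, v) A 0 w"
  proof (cases "w \<in> tangent_space M p")
    case True
    have "A (vlift (p, v) w) = (\<Sum>i\<in>idx M. w (\<lambda>q. snd c q i) * A (coord_vec (tangent_bundle M) (tc c) (p, v) (Inr i)))"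
      unfolding vlift_eq[OF c p v True]
      by (rule T.cotangent_comb_eval[OF up A finite_idx]) (rule T.coord_vec_tangent[OF tangent_chart_atlas[OF c] u], simp add: idx_tangent_bundle)
    also have "\<dots> = covec_curve c (p, v) A 0 w"
      unfolding covec_curve_def base_curve_0[OF c p v] using True by (simp add: lift_covec_def coord_covec_eval mult.commute)
    finally show ?thesis using True by (simp add: vres_def)
  next
    case False
    then show ?thesis using covec_curve_0_mem[OF c p v, of A] by (simp add: vres_def cotangent_space_def)
  qed
qed

lemma vres_cotangent:
  assumes u: "u \<in> pts (tangent_bundle M)" and A: "A \<in> cotangent_space (tangent_bundle M) u"
  shows "vres u A \<in> cotangent_space M (fst u)"
proof -
  obtain c where c: "c \<in> atlas M" "fst u \<in> fst c" "snd u \<in> tangent_space M (fst u)" "u \<in> fst (tc c)" using u by (rule tangent_bundle_chart)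
  show ?thesis using vres_covec_curve[OF c(1-3)] A covec_curve_0_mem[OF c(1-3), of A] by simp
qed

definition vpull :: "'m mvfield \<Rightarrow> ('m \<times> 'm tvec) mvfield" where
  "vpull X u As = (if u \<in> pts (tangent_bundle M) \<and> set As \<subseteq> cotangent_space (tangent_bundle M) u then X (fst u) (map (vres u) As) else 0)"

lemma vres_comb:
  "(\<lambda>z. a * vres u A z + b * vres u B z) = vres u (\<lambda>z. a * A z + b * B z)"
  by (auto simp: vres_def fun_eq_iff)

lemma vpull_inside: "u \<in> pts (tangent_bundle M) \<and> set As \<subseteq> cotangent_space (tangent_bundle M) u \<Longrightarrow> vpull X u As = X (fst u) (map (vres u) As)"
  by (simp add: vpull_def)

lemma vpull_outside: "\<not> (u \<in> pts (tangent_bundle M) \<and> set As \<subseteq> cotangent_space (tangent_bundle M) u) \<Longrightarrow> vpull X u As = 0"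
  by (simp only: vpull_def if_False)

lemma vpull_wedge: "vpull (mv_wedge X Y) = mv_wedge (vpull X) (vpull Y)"
proof (intro ext)
  fix u As
  let ?W = "cotangent_space (tangent_bundle M) u"
  show "vpull (mv_wedge X Y) u As = mv_wedge (vpull X) (vpull Y) u As"
  proof (cases "u \<in> pts (tangent_bundle M) \<and> set As \<subseteq> ?W")
    case True
    then have "set (nths As S) \<subseteq> ?W" for S using set_nths_subset[of As S] by blast
    then show ?thesis using True by (simp add: vpull_def mv_wedge_def wedge_def nths_map)
  next
    case False
    \<comment> \<open>If some member of \<open>As\<close> is not a covector at \<open>u\<close>, it
      ends up in one of the two sublists and kills the corresponding factor.\<close>
    have "vpull X u (nths As S) * vpull Y u (nths As (- S)) = 0" for S
    proof (rule ccontr)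
      assume "vpull X u (nths As S) * vpull Y u (nths As (- S)) \<noteq> 0"
      then have "u \<in> pts (tangent_bundle M)" "set (nths As S) \<subseteq> ?W" "set (nths As (- S)) \<subseteq> ?W"
        unfolding vpull_def by (auto split: if_splits)
      moreover have "set As \<subseteq> set (nths As S) \<union> set (nths As (- S))"
      proof
        fix x assume "x \<in> set As"
        then obtain i where "i < length As" "x = As ! i" by (auto simp: in_set_conv_nth)
        then show "x \<in> set (nths As S) \<union> set (nths As (- S))" unfolding set_nths by blast
      qed
      ultimately show False using False by blast
    qed
    then have "shuffle_sign (length As) S * vpull X u (nths As S) * vpull Y u (nths As (- S)) = 0" for S by (simp only: mult.assoc mult_zero_right)
    then have "mv_wedge (vpull X) (vpull Y) u As = 0" unfolding mv_wedge_def wedge_def by (rule sum.neutral[OF ballI])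
    then show ?thesis using vpull_outside[OF False] by simp
  qed
qed

lemma vpull_part: "mv_part r (vpull X) = vpull (mv_part r X)"
  by (intro ext) (simp add: mv_part_def vpull_def)

lemma vpull_comb: "vpull (mv_comb a X b Y) = mv_comb a (vpull X) b (vpull Y)"
  by (intro ext) (simp add: mv_comb_def vpull_def)

lemma vpull_fun_field: "vpull (fun_field M f) = fun_field (tangent_bundle M) (\<lambda>u. f (fst u))"
  by (intro ext) (auto simp: vpull_def fun_field_def pts_tangent_bundle)

lemma vpull_vec_field: 
  assumes Y: "smooth_vector_field M Y"
  shows "vpull (vec_field M Y) = vec_field (tangent_bundle M) (vertical_lift M Y)"
proof (intro ext)
  fix u As
  show "vpull (vec_field M Y) u As = vec_field (tangent_bundle M) (vertical_lift M Y) u As"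
  proof (cases "u \<in> pts (tangent_bundle M) \<and> (\<exists>A. As = [A] \<and> A \<in> cotangent_space (tangent_bundle M) u)")
    case True
    then obtain A where A: "As = [A]" "A \<in> cotangent_space (tangent_bundle M) u" and u: "u \<in> pts (tangent_bundle M)" by blast
    have p: "fst u \<in> pts M" using u by (simp add: pts_tangent_bundle)
    then have "Y (fst u) \<in> tangent_space M (fst u)" using Y by (simp add: smooth_vector_field_def)
    then show ?thesis using A u p vres_cotangent[OF u A(2)]
      by (simp add: vpull_def vec_field_def vres_def vertical_lift_def vlift_def)
  next
    case False
    then show ?thesis
      by (cases As) (auto simp: vpull_def vec_field_def split: list.split)
  qed
qed

lemma alt_forms_pull:
  fixes h :: "('c \<Rightarrow> real) \<Rightarrow> 'd \<Rightarrow> real"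
  assumes \<omega>: "\<omega> \<in> alt_forms r W" and W': "lin_closed W'" and h: "\<And>A. A \<in> W' \<Longrightarrow> h A \<in> W"
    and lin: "\<And>A B a b. h (\<lambda>z. a * A z + b * B z) = (\<lambda>z. a * h A z + b * h B z)"
  shows "(\<lambda>As :: ('c \<Rightarrow> real) list. if set As \<subseteq> W' then \<omega> (map h As) else 0) \<in> alt_forms r W'" (is "?f \<in> _")
proof (rule alt_formsI)
  show "?f As = 0" if "\<not> (length As = r \<and> set As \<subseteq> W')" for As
    using that alt_forms_zero[OF \<omega>, of "map h As"] by auto
  show "multilinear_at r W' ?f" unfolding multilinear_at_def
  proof (intro allI impI)
    fix vs :: "('c \<Rightarrow> real) list" and k v w and c d :: real
    assume H: "length vs = r \<and> set vs \<subseteq> W' \<and> k < r \<and> v \<in> W' \<and> w \<in> W'"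
    have l: "length (map h vs) = r" "set (map h vs) \<subseteq> W" "k < r" "h v \<in> W" "h w \<in> W" using H h by auto
    have sub: "set (vs[k := x]) \<subseteq> W'" if "x \<in> W'" for x
      by (rule set_update_subsetI) (use H that in auto)
    have "(\<lambda>z. c * v z + d * w z) \<in> W'" using lin_closed_comb[OF W'] H by blast
    then show "?f (vs[k := \<lambda>z. c * v z + d * w z]) = c * ?f (vs[k := v]) + d * ?f (vs[k := w])"
      using multilinear_atD[OF alt_forms_lin[OF \<omega>] l, of c d] H by (simp add: sub lin map_update)
  qed
  fix vs :: "('c \<Rightarrow> real) list" and i j assume "length vs = r" "i < j" "j < r" "vs ! i = vs ! j"
  then show "?f vs = 0" using alt_forms_alt[OF \<omega>, of "map h vs" i j] by simp
qed

lemma alt_forms_scale: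
  assumes \<omega>: "\<omega> \<in> alt_forms r W" and W: "lin_closed W" and js: "length js = r" "\<And>j. j \<in> set js \<Longrightarrow> d j \<in> W"
  shows "\<omega> (map (\<lambda>j z. k j * d j z) js) = prod_list (map k js) * \<omega> (map d js)"
proof -
  have sc: "(\<lambda>z. k j * d j z) \<in> W" if "j \<in> set js" for j
    using lin_closed_comb[OF W js(2)[OF that] js(2)[OF that], of "k j" 0] by simp
  have "\<omega> (map d xs @ map (\<lambda>j z. k j * d j z) ys) = prod_list (map k ys) * \<omega> (map d xs @ map d ys)" if "js = xs @ ys" for xs ys
    using that
  proof (induction ys arbitrary: xs)
    case (Cons y ys)
    let ?l = "map d xs @ d y # map (\<lambda>j z. k j * d j z) ys"
    have y: "d y \<in> W" using js(2)[of y] Cons.prems by simp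
    have l: "length ?l = r" "set ?l \<subseteq> W" using js sc Cons.prems by auto
    have "\<omega> (map d xs @ map (\<lambda>j z. k j * d j z) (y # ys)) = \<omega> (?l[length xs := (\<lambda>z. k y * d y z + 0 * d y z)])"
      by (simp add: list_update_append)
    also have "\<dots> = k y * \<omega> (?l[length xs := d y]) + 0 * \<omega> (?l[length xs := d y])"
      by (rule multilinear_atD[OF alt_forms_lin[OF \<omega>] l _ y y]) (use js Cons.prems in simp)
    also have "\<dots> = k y * \<omega> (map d (xs @ [y]) @ map (\<lambda>j z. k j * d j z) ys)" by (simp add: list_update_append)
    also have "\<dots> = k y * (prod_list (map k ys) * \<omega> (map d (xs @ [y]) @ map d ys))"
      using Cons.IH[of "xs @ [y]"] Cons.prems by simp
    finally show ?case by simp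
  qed simp
  from this[of "[]" js] show ?thesis by simp
qed

text \<open>The differential of the fibre coordinate v^i gives the constant component field dx^i,
  the differential of the base coordinate x^i gives t dx^i.\<close>

lemma covec_curve_coord:
  assumes c: "c \<in> atlas M" and u: "u \<in> fst (tc c)" and j: "j \<in> idx M <+> idx M"
  shows "covec_curve c u (coord_covec (tangent_bundle M) (tc c) u j) t =
    (\<lambda>w. (if isl j then t else 1) * coord_covec M c (base_curve c u t) (case_sum id id j) w)"
proof
  fix w
  note D = T.coord_covec_dual[OF tangent_chart_atlas[OF c] u]
  have "covec_curve c u (coord_covec (tangent_bundle M) (tc c) u j) t w =
    (\<Sum>i\<in>idx M. if i = case_sum id id j then (if isl j then t else 1) * coord_covec M c (base_curve c u t) i w else 0)"
    unfolding covec_curve_def lift_covec_def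
    by (intro sum.cong refl) (cases j; auto simp: D idx_tangent_bundle)
  also have "\<dots> = (if isl j then t else 1) * coord_covec M c (base_curve c u t) (case_sum id id j) w"
    using j finite_idx by (cases j) (auto simp: sum.delta)
  finally show "covec_curve c u (coord_covec (tangent_bundle M) (tc c) u j) t w =
    (if isl j then t else 1) * coord_covec M c (base_curve c u t) (case_sum id id j) w" .
qed

text \<open>Each base label contributes a factor \<open>t\<close>. The value at \<open>t = 0\<close>
  yields the components of the vertical lift, and the derivative at 0 those of the tangent
  lift.\<close>

lemma covec_curve_components:
  assumes c: "c \<in> atlas M" and u: "u \<in> fst (tc c)" and X: "X \<in> mv_fields M r"
    and js: "length js = r" "set js \<subseteq> idx M <+> idx M" and b: "base_curve c u t \<in> fst c"
  shows "X (base_curve c u t) (map (\<lambda>A. covec_curve c u A t) (map (coord_covec (tangent_bundle M) (tc c) u) js)) =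
    t ^ length (filter isl js) * X (base_curve c u t) (map (coord_covec M c (base_curve c u t)) (map (case_sum id id) js))"
proof -
  have q: "base_curve c u t \<in> pts M" using b chart_sub[OF c] by blast
  let ?d = "\<lambda>j. coord_covec M c (base_curve c u t) (case_sum id id j)"
  have "map (\<lambda>A. covec_curve c u A t) (map (coord_covec (tangent_bundle M) (tc c) u) js) = map (\<lambda>j z. (if isl j then t else 1) * ?d j z) js"
    using js(2) covec_curve_coord[OF c u] by auto
  also have "X (base_curve c u t) \<dots> = prod_list (map (\<lambda>j. if isl j then t else 1) js) * X (base_curve c u t) (map ?d js)"
    by (rule alt_forms_scale[OF mv_fields_altD[OF X q] cotangent_lin_closed[OF q] js(1)]) (rule coord_covec_cotangent[OF q])
  also have "prod_list (map (\<lambda>j. if isl j then t else 1) js) = t ^ length (filter isl js)" by (induction js) auto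
  finally show ?thesis by (simp add: o_def)
qed

lemma Sigma_tc: "Sigma (fst c) (tangent_space M) = fst (tc c)"
  by (simp add: tangent_chart_def)

lemma case_sum_idx:
  assumes "set js \<subseteq> idx M <+> idx M" shows "set (map (case_sum id id) js) \<subseteq> idx M"
proof
  fix i assume "i \<in> set (map (case_sum id id) js)"
  then obtain j where "j \<in> set js" "i = case_sum id id j" by auto
  then show "i \<in> idx M" using assms by (cases j) auto
qed

lemma vpull_eq_covec_curve:
  assumes c: "c \<in> atlas M" and p: "p \<in> fst c" and v: "v \<in> tangent_space M p" and As: "set As \<subseteq> cotangent_space (tangent_bundle M) (p, v)"
  shows "vpull X (p, v) As = X p (map (\<lambda>A. covec_curve c (p, v) A 0) As)"
proof -
  have pp: "p \<in> pts M" using c p chart_sub by blast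
  have "map (vres (p, v)) As = map (\<lambda>A. covec_curve c (p, v) A 0) As" using vres_covec_curve[OF c p v] As by auto
  moreover have "vpull X (p, v) As = X p (map (vres (p, v)) As)" using As v pp by (simp add: vpull_def pts_tangent_bundle)
  ultimately show ?thesis by (simp only:)
qed

lemma vpull_mv_fields:
  assumes X: "X \<in> mv_fields M r" shows "vpull X \<in> mv_fields (tangent_bundle M) r"
proof (rule T.mv_fieldsI)
  fix u assume u: "u \<in> pts (tangent_bundle M)"
  have p: "fst u \<in> pts M" using u by (simp add: pts_tangent_bundle)
  have "vpull X u = (\<lambda>As. if set As \<subseteq> cotangent_space (tangent_bundle M) u then X (fst u) (map (vres u) As) else 0)"
    using u by (intro ext) (simp add: vpull_def)
  also have "\<dots> \<in> alt_forms r (cotangent_space (tangent_bundle M) u)"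
    by (rule alt_forms_pull[OF mv_fields_altD[OF X p] T.cotangent_lin_closed[OF u] vres_cotangent[OF u]])
       (auto simp: vres_comb)
  finally show "vpull X u \<in> alt_forms r (cotangent_space (tangent_bundle M) u)" .
next
  fix C js assume "C \<in> atlas (tangent_bundle M)" and js: "length js = r" "set js \<subseteq> idx (tangent_bundle M)"
  then obtain c where c: "c \<in> atlas M" "C = tc c" by (auto simp: tangent_bundle_def)
  have js': "set js \<subseteq> idx M <+> idx M" using js by (simp add: idx_tangent_bundle)
  let ?F = "\<lambda>q. X q (map (coord_covec M c q) (map (case_sum id id) js))"
  have "smooth_fun_on M (fst c) ?F"
    by (rule mv_fields_smoothD[OF X c(1) _ case_sum_idx[OF js']]) (use js in simp)
  from smooth_fun_on_tangent_pullback[OF this]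
  \<comment> \<open>With \<open>0 ^ 0 = 1\<close>, the power selects the index lists without base
    labels; the other components of the vertical lift vanish.\<close>
  have S: "smooth_fun_on (tangent_bundle M) (fst (tc c)) (\<lambda>u. 0 ^ length (filter isl js) * ?F (fst u))"
    unfolding Sigma_tc by (intro T.smooth_fun_on_mult T.smooth_fun_on_const T.openin_chart tangent_chart_atlas c)
  show "smooth_fun_on (tangent_bundle M) (fst C) (\<lambda>u. vpull X u (map (coord_covec (tangent_bundle M) C u) js))"
    unfolding c(2)
  proof (rule T.smooth_fun_on_cong[OF S])
    fix u assume u: "u \<in> fst (tc c)"
    obtain p v where pv: "u = (p, v)" by (cases u)
    have p: "p \<in> fst c" "v \<in> tangent_space M p" using u pv by (simp_all add: tc_mem)
    have up: "u \<in> pts (tangent_bundle M)" using u T.chart_sub[OF tangent_chart_atlas[OF c(1)]] by blast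
    have "set (map (coord_covec (tangent_bundle M) (tc c) u) js) \<subseteq> cotangent_space (tangent_bundle M) (p, v)"
      using T.coord_covec_cotangent[OF up, of "tc c"] pv by auto
    from vpull_eq_covec_curve[OF c(1) p this, of X]
    show "vpull X u (map (coord_covec (tangent_bundle M) (tc c) u) js) = 0 ^ length (filter isl js) * ?F (fst u)"
      using covec_curve_components[OF c(1) u X js(1) js', of 0] pv p(1) base_curve_0[OF c(1) p] by simp
  qed
qed (simp add: vpull_def fun_eq_iff)

lemma vpull_algebra:
  assumes X: "X \<in> mv_algebra M" shows "vpull X \<in> mv_algebra (tangent_bundle M)"
proof -
  have "{r. mv_part r (vpull X) \<noteq> (\<lambda>_ _. 0)} \<subseteq> {r. mv_part r X \<noteq> (\<lambda>_ _. 0)}"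
    unfolding vpull_part by (auto simp: vpull_def fun_eq_iff split: if_splits)
  then have "finite {r. mv_part r (vpull X) \<noteq> (\<lambda>_ _. 0)}" by (rule finite_subset) (use X in \<open>simp add: mv_algebra_def\<close>)
  then show ?thesis using vpull_mv_fields[OF mv_algebra_part[OF X]] by (simp add: mv_algebra_def vpull_part)
qed

lemma unit_field: "fun_field M (\<lambda>_. 1) \<in> mv_algebra M"
  by (rule mv_fields_algebra[OF fun_field_mv_fields[OF smooth_fun_on_const[OF openin_pts]]])

lemma vpull_graded_hom: "graded_hom M (tangent_bundle M) (restrict vpull (mv_algebra M))"
  unfolding graded_hom_def mv_linear_def
proof (intro conjI ballI allI)
  show "restrict vpull (mv_algebra M) ` mv_algebra M \<subseteq> mv_algebra (tangent_bundle M)" using vpull_algebra by auto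
  show "restrict vpull (mv_algebra M) ` mv_fields M r \<subseteq> mv_fields (tangent_bundle M) r" for r
    using vpull_mv_fields mv_fields_algebra by auto
  show "restrict vpull (mv_algebra M) (fun_field M (\<lambda>_. 1)) = fun_field (tangent_bundle M) (\<lambda>_. 1)"
    using unit_field vpull_fun_field by simp
  fix X Y assume XY: "X \<in> mv_algebra M" "Y \<in> mv_algebra M"
  then show "restrict vpull (mv_algebra M) (mv_comb a X b Y) = mv_comb a (restrict vpull (mv_algebra M) X) b (restrict vpull (mv_algebra M) Y)" for a b
    by (simp add: mv_algebra_comb vpull_comb)
  show "restrict vpull (mv_algebra M) (mv_wedge X Y) = mv_wedge (restrict vpull (mv_algebra M) X) (restrict vpull (mv_algebra M) Y)"
    using XY by (simp add: mv_algebra_wedge vpull_wedge)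
qed

text \<open>Multiplying by a power of a bump function \<open>h\<close> with \<open>h p = 1\<close> makes the expansion of a multivector
  field in a chart a global identity between products of functions and vector fields.\<close>

lemma graded_hom_eq_vpull:
  assumes H: "Hausdorff_space (mtopology M)" and \<rho>: "graded_hom M (tangent_bundle M) \<rho>"
    and fn: "\<And>f. smooth_fun_on M (pts M) f \<Longrightarrow> \<rho> (fun_field M f) = fun_field (tangent_bundle M) (\<lambda>u. f (fst u))"
    and vf: "\<And>Y. smooth_vector_field M Y \<Longrightarrow> \<rho> (vec_field M Y) = vec_field (tangent_bundle M) (vertical_lift M Y)"
    and X: "X \<in> mv_fields M r"
  shows "\<rho> X = vpull X"
proof (intro ext)
  fix u As
  have wd: "\<rho> (mv_wedge Z Z') = mv_wedge (\<rho> Z) (\<rho> Z')" if "Z \<in> mv_algebra M" "Z' \<in> mv_algebra M" for Z Z'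
    using \<rho> that by (simp add: graded_hom_def)
  have lin: "mv_linear M (tangent_bundle M) \<rho>" using \<rho> by (simp add: graded_hom_def)
  have \<rho>X: "\<rho> X \<in> mv_fields (tangent_bundle M) r" using \<rho> X by (auto simp: graded_hom_def)
  \<comment> \<open>The fields on which \<rho> is the pullback: closed under products and finite
    sums, and containing all functions and vector fields.\<close>
  define G where "G = {Z \<in> mv_algebra M. \<rho> Z = vpull Z}"
  have G_wedge: "mv_wedge Z Z' \<in> G" if "Z \<in> G" "Z' \<in> G" for Z Z'
    using that wd by (simp add: G_def mv_algebra_wedge vpull_wedge)
  have G_fun: "fun_field M f \<in> G" if "smooth_fun_on M (pts M) f" for f
    using fn[OF that] mv_fields_algebra[OF fun_field_mv_fields[OF that]] by (simp add: G_def vpull_fun_field)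
  have G_vec: "vec_field M Y \<in> G" if "smooth_vector_field M Y" for Y
    using vf[OF that] mv_fields_algebra[OF vec_field_mv_fields[OF that]] by (simp add: G_def vpull_vec_field[OF that])
  have G_sum: "(\<lambda>p as. \<Sum>j\<in>J. Z j p as) \<in> G" if J: "finite J" "\<And>j. j \<in> J \<Longrightarrow> Z j \<in> G" for J :: "'i set set" and Z
  proof -
    have Z: "Z j \<in> mv_algebra M" "\<rho> (Z j) = vpull (Z j)" if "j \<in> J" for j using J(2)[OF that] by (simp_all add: G_def)
    have "\<rho> (\<lambda>p as. \<Sum>j\<in>J. Z j p as) = (\<lambda>p as. \<Sum>j\<in>J. \<rho> (Z j) p as)"
      by (rule mv_linear_sum[OF charted_M lin J(1) Z(1)])
    also have "\<dots> = vpull (\<lambda>p as. \<Sum>j\<in>J. Z j p as)" 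
    proof (intro ext)
      fix u As
      show "(\<Sum>j\<in>J. \<rho> (Z j) u As) = vpull (\<lambda>p as. \<Sum>j\<in>J. Z j p as) u As"
        using Z(2) by (cases "u \<in> pts (tangent_bundle M) \<and> set As \<subseteq> cotangent_space (tangent_bundle M) u")
          (simp_all add: vpull_inside vpull_outside del: de_Morgan_conj)
    qed
    finally show ?thesis using mv_algebra_sum[of J Z] Z(1) by (simp add: G_def)
  qed
  show "\<rho> X u As = vpull X u As"
  proof (cases "u \<in> pts (tangent_bundle M)")
    case False
    then show ?thesis using T.mv_fields_outside[OF \<rho>X False] T.mv_fields_outside[OF vpull_mv_fields[OF X] False] by simp
  next
    case True
    obtain c where c: "c \<in> atlas M" "fst u \<in> fst c" using True by (rule tangent_bundle_chart)
    obtain h where h: "smooth_fun_on M (pts M) h" "h (fst u) = 1" "\<And>q. q \<notin> fst c \<Longrightarrow> h q = 0"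
      "\<And>W g. openin (mtopology M) W \<Longrightarrow> smooth_fun_on M (fst c \<inter> W) g \<Longrightarrow> smooth_fun_on M W (\<lambda>q. if q \<in> fst c then h q * g q else 0)"
    proof (rule bump[OF H c])
      fix h assume "smooth_fun_on M (pts M) h" "h (fst u) = 1" "\<And>q. q \<notin> fst c \<Longrightarrow> h q = 0"
        "\<And>W g. openin (mtopology M) W \<Longrightarrow> smooth_fun_on M (fst c \<inter> W) g \<Longrightarrow> smooth_fun_on M W (\<lambda>q. if q \<in> fst c then h q * g q else 0)"
      then show thesis by (rule that)
    qed
    \<comment> \<open>Coordinate vector fields damped by the bump function, so as to be global
      vector fields.\<close>
    define Y where "Y i q = (\<lambda>f. if q \<in> fst c then h q * coord_vec M c q i f else 0)" for i q
    have Y: "smooth_vector_field M (Y i)" if i: "i \<in> idx M" for i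
      unfolding smooth_vector_field_def
    proof (intro conjI ballI)
      fix q assume q: "q \<in> pts M"
      show "Y i q \<in> tangent_space M q"
      proof (cases "q \<in> fst c")
        case True
        have e: "coord_vec M c q i \<in> tangent_space M q" by (rule coord_vec_tangent[OF c(1) True i])
        show ?thesis using lin_closed_comb[OF tangent_lin_closed[OF q] e e, of "h q" 0] True by (simp add: Y_def)
      next
        case False
        then show ?thesis using tangent_lin_closed[OF q] by (simp add: Y_def lin_closed_def)
      qed
    next
      fix d j assume d: "d \<in> atlas M" and j: "j \<in> idx M"
      have o: "openin (mtopology M) (fst c \<inter> fst d)" using openin_chart[OF c(1)] openin_chart[OF d] by (rule openin_Int)
      have "smooth_fun_on M (fst c \<inter> fst d) (\<lambda>q. snd d q j)"
        by (rule smooth_fun_on_subset[OF smooth_coord[OF d] o]) simp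
      then have "smooth_fun_on M (fst c \<inter> fst d) (\<lambda>q. coord_vec M c q i (\<lambda>q. snd d q j))"
        by (intro smooth_fun_on_coord_vec[OF c(1) i]) auto
      from h(4)[OF openin_chart[OF d] this]
      show "smooth_fun_on M (fst d) (\<lambda>p. Y i p (\<lambda>q. snd d q j))" by (simp add: Y_def)
    qed
    define P where "P xs = foldr (\<lambda>i. mv_wedge (vec_field M (Y i))) xs (fun_field M (\<lambda>_. 1))" for xs
    have GP: "P xs \<in> G" if "set xs \<subseteq> idx M" for xs
      using that
    proof (induction xs)
      case Nil then show ?case using G_fun[OF smooth_fun_on_const[OF openin_pts]] by (simp add: P_def)
    next
      case (Cons i xs) then show ?case using G_wedge[OF G_vec[OF Y]] by (simp add: P_def)
    qed
    have P_eval: "P xs q = wedge_list (map (\<lambda>i a. if a \<in> cotangent_space M q then a (Y i q) else 0) xs)" if "q \<in> pts M" for xs q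
    proof (induction xs)
      case Nil show ?case using that by (intro ext) (simp add: P_def wedge_list_def unit_form_def fun_field_def)
    next
      case (Cons i xs)
      then show ?case by (simp add: P_def wedge_list_def mv_wedge_def vec_field_one_form[OF that])
    qed
    let ?Ss = "subsets_of_card (idx M) r"
    have fS: "finite ?Ss" by (rule finite_subsets_of_card[OF finite_idx])
    have Ss: "set (sorted_list_of_set S) \<subseteq> idx M" "length (sorted_list_of_set S) = r" if "S \<in> ?Ss" for S
      using that finite_subset[OF _ finite_idx] by (auto simp: subsets_of_card_def)
    define g where "g S q = (if q \<in> fst c then h q * X q (basis_covecs c q S) else 0)" for S q
    have g: "smooth_fun_on M (pts M) (g S)" if S: "S \<in> ?Ss" for S
    proof -
      have "fst c \<inter> pts M = fst c" using chart_sub[OF c(1)] by blast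
      then have "smooth_fun_on M (fst c \<inter> pts M) (\<lambda>q. X q (basis_covecs c q S))"
        using mv_fields_smoothD[OF X c(1) Ss(2)[OF S] Ss(1)[OF S]] by simp
      from h(4)[OF openin_pts this] show ?thesis unfolding g_def .
    qed
    \<comment> \<open>The exponent counts one factor \<open>h\<close> from the coefficient
      \<open>g S\<close> and \<open>r\<close> factors from the product of damped coordinate
      fields.\<close>
    have id: "mv_wedge (fun_field M (\<lambda>q. h q ^ Suc r)) X = (\<lambda>q as. \<Sum>S\<in>?Ss. mv_wedge (fun_field M (g S)) (P (sorted_list_of_set S)) q as)"
    proof (intro ext)
      fix q as
      have w0: "mv_wedge (fun_field M f) Z q as = fun_field M f q [] * Z q as" for f and Z :: "'m mvfield"
        unfolding mv_wedge_def by (rule wedge_0_form) (simp add: fun_field_def)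
      show "mv_wedge (fun_field M (\<lambda>q. h q ^ Suc r)) X q as = (\<Sum>S\<in>?Ss. mv_wedge (fun_field M (g S)) (P (sorted_list_of_set S)) q as)"
      proof (cases "q \<in> fst c")
        case False
        then show ?thesis unfolding w0 by (simp add: fun_field_def h(3) g_def)
      next
        case q: True
        then have qp: "q \<in> pts M" using chart_sub[OF c(1)] by blast
        let ?ev = "\<lambda>i a. if a \<in> cotangent_space M q then a (coord_vec M c q i) else 0"
        have ev: "(\<lambda>i a. if a \<in> cotangent_space M q then a (Y i q) else 0) i = (\<lambda>a. h q * ?ev i a)" if i: "i \<in> idx M" for i
        proof
          fix a
          have e: "coord_vec M c q i \<in> tangent_space M q" by (rule coord_vec_tangent[OF c(1) q i])
          show "(if a \<in> cotangent_space M q then a (Y i q) else 0) = h q * ?ev i a"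
            using linear_formD[of "tangent_space M q" a, OF _ e e, of "h q" 0] q
            by (simp add: Y_def cotangent_iff)
        qed
        have PS: "P (sorted_list_of_set S) q as = h q ^ r * wedge_list (map ?ev (sorted_list_of_set S)) as" if S: "S \<in> ?Ss" for S
        proof -
          have m: "map (\<lambda>i a. if a \<in> cotangent_space M q then a (Y i q) else 0) (sorted_list_of_set S) = map (\<lambda>i a. h q * ?ev i a) (sorted_list_of_set S)"
            using ev Ss(1)[OF S] by (intro map_cong refl) blast
          show ?thesis unfolding P_eval[OF qp] m using wedge_list_scale[of "h q" ?ev "sorted_list_of_set S" as] Ss(2)[OF S] by simp
        qed
        have lf: "linear_form (cotangent_space M q) (?ev i)" for i
          using lin_closed_comb[OF cotangent_lin_closed[OF qp]] by (auto simp: linear_form_def)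
        have du: "?ev i (coord_covec M c q j) = (if i = j then 1 else 0)" if "i \<in> idx M" "j \<in> idx M" for i j
          using coord_covec_dual[OF c(1) q that(1), of j] coord_covec_cotangent[OF qp] by auto
        have "X q as = (\<Sum>S\<in>?Ss. X q (basis_covecs c q S) * wedge_list (map ?ev (sorted_list_of_set S)) as)"
          using fun_cong[OF alt_form_expansion[where d = ?ev and e = "coord_covec M c q", OF spans_cotangent[OF c(1) q] lf du mv_fields_altD[OF X qp]], of as] .
        then have "h q ^ Suc r * X q as = (\<Sum>S\<in>?Ss. h q * X q (basis_covecs c q S) * (h q ^ r * wedge_list (map ?ev (sorted_list_of_set S)) as))"
          by (simp add: sum_distrib_left ac_simps)
        also have "\<dots> = (\<Sum>S\<in>?Ss. mv_wedge (fun_field M (g S)) (P (sorted_list_of_set S)) q as)"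
          unfolding w0 using qp q PS by (intro sum.cong refl) (simp add: fun_field_def g_def)
        finally show ?thesis unfolding w0 using qp by (simp add: fun_field_def)
      qed
    qed
    have F: "fun_field M (\<lambda>q. h q ^ Suc r) \<in> G" by (rule G_fun[OF smooth_fun_on_power[OF h(1)]])
    have "mv_wedge (fun_field M (\<lambda>q. h q ^ Suc r)) X \<in> G" unfolding id
      by (rule G_sum[OF fS]) (intro G_wedge G_fun g GP Ss)
    then have "mv_wedge (\<rho> (fun_field M (\<lambda>q. h q ^ Suc r))) (\<rho> X) = mv_wedge (vpull (fun_field M (\<lambda>q. h q ^ Suc r))) (vpull X)"
      using wd[of "fun_field M (\<lambda>q. h q ^ Suc r)" X] F mv_fields_algebra[OF X] by (simp add: G_def vpull_wedge)
    then have E: "mv_wedge (vpull (fun_field M (\<lambda>q. h q ^ Suc r))) (\<rho> X) u As = mv_wedge (vpull (fun_field M (\<lambda>q. h q ^ Suc r))) (vpull X) u As"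
      using F by (simp add: G_def)
    \<comment> \<open>The bump function is 1 at the base point of \<open>u\<close>, so
      multiplication by its power does not change values at \<open>u\<close> and can be removed from
      both sides.\<close>
    have w1: "mv_wedge (vpull (fun_field M (\<lambda>q. h q ^ Suc r))) Z u As = Z u As" for Z
    proof -
      have "mv_wedge (vpull (fun_field M (\<lambda>q. h q ^ Suc r))) Z u As = vpull (fun_field M (\<lambda>q. h q ^ Suc r)) u [] * Z u As"
        unfolding mv_wedge_def vpull_fun_field by (rule wedge_0_form) (simp add: fun_field_def)
      moreover have "vpull (fun_field M (\<lambda>q. h q ^ Suc r)) u [] = 1"
        unfolding vpull_fun_field using True h(2) by (simp add: fun_field_def)
      ultimately show ?thesis by simp
    qed
    show ?thesis using E unfolding w1 .
  qed
qed

text \<open>On the algebra a homomorphism is settled degree by degree through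
  \<open>graded_hom_eq_vpull\<close>. Outside it the description fixes the default value of
  extensional functions, whence the \<open>restrict\<close>.\<close>

lemma v_T_eq:
  assumes H: "Hausdorff_space (mtopology M)"
  shows "v_T M = restrict vpull (mv_algebra M)"
  unfolding v_T_def
proof (rule the_equality)
  show "restrict vpull (mv_algebra M) \<in> mv_algebra M \<rightarrow>\<^sub>E mv_algebra (tangent_bundle M) \<and>
     graded_hom M (tangent_bundle M) (restrict vpull (mv_algebra M)) \<and>
     (\<forall>f. smooth_fun_on M (pts M) f \<longrightarrow> restrict vpull (mv_algebra M) (fun_field M f) = fun_field (tangent_bundle M) (\<lambda>u. f (fst u))) \<and>
     (\<forall>Y. smooth_vector_field M Y \<longrightarrow> restrict vpull (mv_algebra M) (vec_field M Y) = vec_field (tangent_bundle M) (vertical_lift M Y))"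
    using vpull_graded_hom vpull_algebra mv_fields_algebra[OF fun_field_mv_fields] mv_fields_algebra[OF vec_field_mv_fields] vpull_fun_field vpull_vec_field
    by auto
  fix \<rho>
  assume "\<rho> \<in> mv_algebra M \<rightarrow>\<^sub>E mv_algebra (tangent_bundle M) \<and> graded_hom M (tangent_bundle M) \<rho> \<and>
     (\<forall>f. smooth_fun_on M (pts M) f \<longrightarrow> \<rho> (fun_field M f) = fun_field (tangent_bundle M) (\<lambda>u. f (fst u))) \<and>
     (\<forall>Y. smooth_vector_field M Y \<longrightarrow> \<rho> (vec_field M Y) = vec_field (tangent_bundle M) (vertical_lift M Y))"
  then have e: "\<rho> \<in> mv_algebra M \<rightarrow>\<^sub>E mv_algebra (tangent_bundle M)" and gh: "graded_hom M (tangent_bundle M) \<rho>"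
    and fn: "\<And>f. smooth_fun_on M (pts M) f \<Longrightarrow> \<rho> (fun_field M f) = fun_field (tangent_bundle M) (\<lambda>u. f (fst u))"
    and vf: "\<And>Y. smooth_vector_field M Y \<Longrightarrow> \<rho> (vec_field M Y) = vec_field (tangent_bundle M) (vertical_lift M Y)" by blast+
  have lin: "mv_linear M (tangent_bundle M) \<rho>" using gh by (simp add: graded_hom_def)
  have "\<rho> X = vpull X" if X: "X \<in> mv_algebra M" for X
  proof -
    let ?R = "{r. mv_part r X \<noteq> (\<lambda>_ _. 0)}"
    have fin: "finite ?R" using X by (simp add: mv_algebra_def)
    have part: "mv_part r X \<in> mv_algebra M" for r by (rule mv_fields_algebra[OF mv_algebra_part[OF X]])
    have "\<rho> X = \<rho> (\<lambda>p as. \<Sum>r\<in>?R. mv_part r X p as)" by (rule arg_cong[OF mv_algebra_decompose[OF X]])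
    also have "\<dots> = (\<lambda>p as. \<Sum>r\<in>?R. \<rho> (mv_part r X) p as)" by (rule mv_linear_sum[OF charted_M lin fin part])
    also have "\<dots> = (\<lambda>p as. \<Sum>r\<in>?R. vpull (mv_part r X) p as)"
      using graded_hom_eq_vpull[OF H gh fn vf mv_algebra_part[OF X]] by simp
    also have "\<dots> = (\<lambda>p as. \<Sum>r\<in>?R. mv_part r (vpull X) p as)" unfolding vpull_part ..
    also have "\<dots> = vpull X"
    proof (intro ext)
      fix u as
      have "(\<Sum>r\<in>?R. mv_part r (vpull X) u as) = (\<Sum>r\<in>?R. if r = length as then vpull X u as else 0)"
        by (rule sum.cong) (auto simp: mv_part_def)
      also have "\<dots> = vpull X u as"
      proof (cases "length as \<in> ?R")
        case True then show ?thesis using fin by simp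
      next
        case False
        then have "mv_part (length as) (vpull X) u as = 0" unfolding vpull_part by (simp add: vpull_def)
        then show ?thesis using fin False by (simp add: mv_part_def)
      qed
      finally show "(\<Sum>r\<in>?R. mv_part r (vpull X) u as) = vpull X u as" .
    qed
    finally show ?thesis .
  qed
  then show "\<rho> = restrict vpull (mv_algebra M)" using e by (intro extensionalityI[of _ "mv_algebra M"]) (auto simp: PiE_def)
qed

end


section \<open>The tangent lift of multivector fields\<close>

context charted_ord
begin

lemma d_T_outside:
  "\<not> (u \<in> pts (tangent_bundle M) \<and> set As \<subseteq> cotangent_space (tangent_bundle M) u) \<Longrightarrow> d_T M X u As = 0"
  unfolding d_T_def d_T_hom_def by (rule if_not_P) blast

lemma d_T_deriv:
  assumes c: "c \<in> atlas M" and u: "u \<in> fst (tc c)" and X: "X \<in> mv_algebra M"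
    and As: "set As \<subseteq> cotangent_space (tangent_bundle M) u"
  shows "((\<lambda>t. X (base_curve c u t) (map (\<lambda>A. covec_curve c u A t) As)) has_real_derivative d_T M X u As) (at 0)"
proof -
  obtain p v where pv: "u = (p, v)" by (cases u)
  have m: "p \<in> fst c" "v \<in> tangent_space M p" using u pv by (simp_all add: tc_mem)
  from d_T_hom_deriv[OF c m mv_algebra_part[OF X] refl As[unfolded pv]]
  show ?thesis by (simp add: pv d_T_def mv_part_def)
qed

lemma base_curve_eventually_chart:
  assumes c: "c \<in> atlas M" and u: "u \<in> fst (tc c)"
  shows "\<forall>\<^sub>F t in nhds 0. base_curve c u t \<in> fst c"
proof -
  obtain p v where pv: "u = (p, v)" by (cases u)
  have m: "p \<in> fst c" "v \<in> tangent_space M p" using u pv by (simp_all add: tc_mem)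
  show ?thesis using base_curve_eventually[OF c m] unfolding pv by eventually_elim simp
qed

lemma covec_curve_mem:
  assumes c: "c \<in> atlas M" and b: "base_curve c u t \<in> fst c"
  shows "covec_curve c u A t \<in> cotangent_space M (base_curve c u t)"
  unfolding covec_curve_def by (rule cotangent_comb[OF c b])

lemma covec_curve_comb:
  "covec_curve c u (\<lambda>z. a * A z + b * B z) t = (\<lambda>w. a * covec_curve c u A t w + b * covec_curve c u B t w)"
  by (intro ext) (simp add: covec_curve_def lift_covec_def sum_distrib_left sum.distrib[symmetric] algebra_simps)

lemma vpull_covec_curve:
  assumes c: "c \<in> atlas M" and u: "u \<in> fst (tc c)" and As: "set As \<subseteq> cotangent_space (tangent_bundle M) u"
  shows "X (base_curve c u 0) (map (\<lambda>A. covec_curve c u A 0) As) = vpull X u As"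
proof -
  obtain p v where pv: "u = (p, v)" by (cases u)
  have m: "p \<in> fst c" "v \<in> tangent_space M p" using u pv by (simp_all add: tc_mem)
  show ?thesis using vpull_eq_covec_curve[OF c m, of As X] As base_curve_0[OF c m] by (simp add: pv)
qed

lemma tangent_bundle_chart_mem:
  assumes "u \<in> pts (tangent_bundle M)"
  obtains c where "c \<in> atlas M" "u \<in> fst (tc c)"
  using assms by (rule tangent_bundle_chart)

text \<open>For each small t the function under the derivative is alternating and multilinear in the
  covectors, because \<open>covec_curve\<close> is linear in its covector; both properties survive
  differentiation at 0.\<close>

lemma d_T_alt:
  assumes X: "X \<in> mv_fields M r" and u: "u \<in> pts (tangent_bundle M)"
  shows "d_T M X u \<in> alt_forms r (cotangent_space (tangent_bundle M) u)"
proof (rule alt_formsI)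
  obtain c where c: "c \<in> atlas M" "u \<in> fst (tc c)" using u by (rule tangent_bundle_chart_mem)
  let ?W = "cotangent_space (tangent_bundle M) u"
  let ?f = "\<lambda>As t. X (base_curve c u t) (map (\<lambda>A. covec_curve c u A t) As)"
  note D = d_T_deriv[OF c mv_fields_algebra[OF X]]
  note ev = base_curve_eventually_chart[OF c]
  fix As assume As: "\<not> (length As = r \<and> set As \<subseteq> ?W)"
  show "d_T M X u As = 0"
  proof (cases "set As \<subseteq> ?W")
    case True
    then have "?f As t = 0" for t using As by (intro mv_fields_zero_arg[OF X]) simp
    then have "(?f As has_real_derivative 0) (at 0)" by simp
    from DERIV_unique[OF D[OF True] this] show ?thesis .
  qed (simp add: d_T_outside)
next
  obtain c where c: "c \<in> atlas M" "u \<in> fst (tc c)" using u by (rule tangent_bundle_chart_mem)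
  let ?W = "cotangent_space (tangent_bundle M) u"
  let ?f = "\<lambda>As t. X (base_curve c u t) (map (\<lambda>A. covec_curve c u A t) As)"
  note D = d_T_deriv[OF c mv_fields_algebra[OF X]]
  note ev = base_curve_eventually_chart[OF c]
  show "multilinear_at r ?W (d_T M X u)" unfolding multilinear_at_def
  proof (intro allI impI)
    fix vs :: "('m \<times> 'm tvec) covec list" and k A B and a b :: real
    assume H: "length vs = r \<and> set vs \<subseteq> ?W \<and> k < r \<and> A \<in> ?W \<and> B \<in> ?W"
    have sub: "set (vs[k := Z]) \<subseteq> ?W" if "Z \<in> ?W" for Z by (rule set_update_subsetI) (use H that in auto)
    have AB: "(\<lambda>z. a * A z + b * B z) \<in> ?W" using lin_closed_comb[OF T.cotangent_lin_closed[OF u]] H by blast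
    have e: "\<forall>\<^sub>F t in nhds 0. ?f (vs[k := \<lambda>z. a * A z + b * B z]) t = a * ?f (vs[k := A]) t + b * ?f (vs[k := B]) t"
      using ev
    proof eventually_elim
      case (elim t)
      have q: "base_curve c u t \<in> pts M" using elim chart_sub[OF c(1)] by blast
      have "set (map (\<lambda>A. covec_curve c u A t) vs) \<subseteq> cotangent_space M (base_curve c u t)"
        using covec_curve_mem[OF c(1) elim] by auto
      from multilinear_atD[OF alt_forms_lin[OF mv_fields_altD[OF X q]] _ this _ covec_curve_mem[OF c(1) elim] covec_curve_mem[OF c(1) elim], of k a A b B]
      show ?case using H by (simp add: map_update covec_curve_comb)
    qed
    have "((\<lambda>t. a * ?f (vs[k := A]) t + b * ?f (vs[k := B]) t) has_real_derivative a * d_T M X u (vs[k := A]) + b * d_T M X u (vs[k := B])) (at 0)"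
      using H by (intro DERIV_add DERIV_cmult D sub) auto
    then have "(?f (vs[k := \<lambda>z. a * A z + b * B z]) has_real_derivative a * d_T M X u (vs[k := A]) + b * d_T M X u (vs[k := B])) (at 0)"
      unfolding DERIV_cong_ev[OF refl e refl] .
    from DERIV_unique[OF D[OF sub[OF AB]] this]
    show "d_T M X u (vs[k := \<lambda>z. a * A z + b * B z]) = a * d_T M X u (vs[k := A]) + b * d_T M X u (vs[k := B])" .
  qed
  fix vs :: "('m \<times> 'm tvec) covec list" and i j
  assume H: "length vs = r" "set vs \<subseteq> ?W" "i < j" "j < r" "vs ! i = vs ! j"
  have e: "\<forall>\<^sub>F t in nhds 0. ?f vs t = 0"
    using ev
  proof eventually_elim
    case (elim t)
    have q: "base_curve c u t \<in> pts M" using elim chart_sub[OF c(1)] by blast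
    show ?case by (rule alt_forms_alt[OF mv_fields_altD[OF X q], of _ i j]) (use H in auto)
  qed
  have "(?f vs has_real_derivative 0) (at 0)" unfolding DERIV_cong_ev[OF refl e refl] by (rule DERIV_const)
  from DERIV_unique[OF D[OF H(2)] this] show "d_T M X u vs = 0" .
qed

text \<open>By \<open>covec_curve_components\<close> a component is the derivative at 0 of t^n
  F(b(t)), where n counts the base labels and b is the base curve. The product rule leaves F, its
  derivative along the fibre vector, or 0, all smooth on the tangent bundle.\<close>

lemma d_T_mv_fields:
  assumes X: "X \<in> mv_fields M r" shows "d_T M X \<in> mv_fields (tangent_bundle M) r"
proof (rule T.mv_fieldsI)
  show "d_T M X u \<in> alt_forms r (cotangent_space (tangent_bundle M) u)" if "u \<in> pts (tangent_bundle M)" for u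
    by (rule d_T_alt[OF X that])
  show "d_T M X u = (\<lambda>_. 0)" if "u \<notin> pts (tangent_bundle M)" for u
    by (intro ext d_T_outside) (use that in blast)
  fix C js assume "C \<in> atlas (tangent_bundle M)" and js: "length js = r" "set js \<subseteq> idx (tangent_bundle M)"
  then obtain c where c: "c \<in> atlas M" "C = tc c" by (auto simp: tangent_bundle_def)
  have js': "set js \<subseteq> idx M <+> idx M" using js by (simp add: idx_tangent_bundle)
  let ?F = "\<lambda>q. X q (map (coord_covec M c q) (map (case_sum id id) js))"
  let ?n = "length (filter isl js)"
  note C = tangent_chart_atlas[OF c(1)]
  have smF: "smooth_fun_on M (fst c) ?F"
    by (rule mv_fields_smoothD[OF X c(1) _ case_sum_idx[OF js']]) (use js in simp)
  have oC: "openin (mtopology (tangent_bundle M)) (fst (tc c))" by (rule T.openin_chart[OF C])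
  \<comment> \<open>For \<open>n = 0\<close> the factor \<open>real n\<close> removes the first
    summand, whose exponent is truncated to 0; for \<open>n = 1\<close> only the first summand
    remains, for larger \<open>n\<close> none.\<close>
  have S: "smooth_fun_on (tangent_bundle M) (fst (tc c)) (\<lambda>u. real ?n * 0 ^ (?n - 1) * ?F (fst u) +
     0 ^ ?n * (\<Sum>k\<in>idx M. tx c (Inr k) u * coord_vec M c (fst u) k ?F))"
  proof (intro T.smooth_fun_on_add T.smooth_fun_on_mult T.smooth_fun_on_sum T.smooth_fun_on_const oC T.smooth_coord[OF C])
    show "smooth_fun_on (tangent_bundle M) (fst (tc c)) (\<lambda>u. ?F (fst u))"
      using smooth_fun_on_tangent_pullback[OF smF] unfolding Sigma_tc .
    show "smooth_fun_on (tangent_bundle M) (fst (tc c)) (\<lambda>u. coord_vec M c (fst u) k ?F)" if "k \<in> idx M" for k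
      using smooth_fun_on_tangent_pullback[OF smooth_fun_on_coord_vec[OF c(1) that order_refl smF]] unfolding Sigma_tc .
  qed
  show "smooth_fun_on (tangent_bundle M) (fst C) (\<lambda>u. d_T M X u (map (coord_covec (tangent_bundle M) C u) js))"
    unfolding c(2)
  proof (rule T.smooth_fun_on_cong[OF S])
    fix u assume u: "u \<in> fst (tc c)"
    obtain p v where pv: "u = (p, v)" by (cases u)
    have p: "p \<in> fst c" "v \<in> tangent_space M p" using u pv by (simp_all add: tc_mem)
    have up: "u \<in> pts (tangent_bundle M)" using u T.chart_sub[OF C] by blast
    let ?As = "map (coord_covec (tangent_bundle M) (tc c) u) js"
    have As: "set ?As \<subseteq> cotangent_space (tangent_bundle M) u" using T.coord_covec_cotangent[OF up, of "tc c"] by auto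
    have "smooth_at M p ?F" using smF p(1) unfolding smooth_at_def by blast
    from base_curve_velocity[OF c(1) p this]
    have dF: "((\<lambda>t. ?F (base_curve c u t)) has_real_derivative v ?F) (at 0)" unfolding pv .
    have b0: "base_curve c u 0 = p" using base_curve_0[OF c(1) p] pv by simp
    have "((\<lambda>t. t ^ ?n * ?F (base_curve c u t)) has_real_derivative
       (real ?n * 0 ^ (?n - 1)) * ?F (base_curve c u 0) + v ?F * 0 ^ ?n) (at 0)"
      by (rule DERIV_mult[OF _ dF]) (use DERIV_pow[of ?n "0::real"] in simp)
    moreover have e: "\<forall>\<^sub>F t in nhds 0. X (base_curve c u t) (map (\<lambda>A. covec_curve c u A t) ?As) = t ^ ?n * ?F (base_curve c u t)"
      using base_curve_eventually_chart[OF c(1) u] by eventually_elim (rule covec_curve_components[OF c(1) u X js(1) js'])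
    ultimately have "((\<lambda>t. X (base_curve c u t) (map (\<lambda>A. covec_curve c u A t) ?As)) has_real_derivative
       (real ?n * 0 ^ (?n - 1)) * ?F (base_curve c u 0) + v ?F * 0 ^ ?n) (at 0)"
      unfolding DERIV_cong_ev[OF refl e refl] by simp
    from DERIV_unique[OF d_T_deriv[OF c(1) u mv_fields_algebra[OF X] As] this]
    have "d_T M X u ?As = (real ?n * 0 ^ (?n - 1)) * ?F p + v ?F * 0 ^ ?n" unfolding b0 .
    moreover have "v ?F = (\<Sum>k\<in>idx M. tx c (Inr k) u * coord_vec M c (fst u) k ?F)"
      using fun_cong[OF tangent_expand[OF c(1) p], of ?F] by (simp add: tx_Inr pv)
    ultimately show "d_T M X u ?As = real ?n * 0 ^ (?n - 1) * ?F (fst u) +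
       0 ^ ?n * (\<Sum>k\<in>idx M. tx c (Inr k) u * coord_vec M c (fst u) k ?F)"
      by (simp only: pv fst_conv mult.commute[of "0 ^ ?n"])
  qed
qed

lemma d_T_zero: "d_T M (\<lambda>_ _. 0) = (\<lambda>_ _. 0)"
proof (intro ext)
  fix u :: "'m \<times> 'm tvec" and As
  show "d_T M (\<lambda>_ _. 0) u As = 0"
  proof (cases "u \<in> pts (tangent_bundle M)")
    case u: True
    have z: "(\<lambda>_ _. 0) \<in> mv_fields M k" for k by (rule mv_fields_0)
    \<comment> \<open>The zero field belongs to every degree; regarded as a field of degree one more
      than the length of \<open>As\<close>, its lift vanishes on \<open>As\<close>.\<close>
    show ?thesis by (rule alt_forms_zero[OF d_T_alt[OF z[of "Suc (length As)"] u]]) simp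
  qed (use d_T_outside in blast)
qed

lemma d_T_part: "mv_part r (d_T M X) = d_T M (mv_part r X)"
proof (intro ext)
  fix u As
  show "mv_part r (d_T M X) u As = d_T M (mv_part r X) u As"
  proof (cases "length As = r")
    case True
    have "mv_part r (mv_part r X) = mv_part r X" by (intro ext) (simp add: mv_part_def)
    then show ?thesis using True by (simp add: mv_part_def[of r "d_T M X"] d_T_def)
  next
    case False
    have "mv_part (length As) (mv_part r X) = (\<lambda>_ _. 0)" using False by (intro ext) (simp add: mv_part_def)
    then have "d_T M (mv_part r X) u As = d_T M (\<lambda>_ _. 0) u As" by (simp add: d_T_def mv_part_def[of _ "\<lambda>_ _. 0"])
    then show ?thesis using False by (simp add: d_T_zero mv_part_def)
  qed
qed

lemma d_T_algebra:
  assumes X: "X \<in> mv_algebra M" shows "d_T M X \<in> mv_algebra (tangent_bundle M)"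
proof -
  have "{r. mv_part r (d_T M X) \<noteq> (\<lambda>_ _. 0)} \<subseteq> {r. mv_part r X \<noteq> (\<lambda>_ _. 0)}"
    unfolding d_T_part using d_T_zero by auto
  then have "finite {r. mv_part r (d_T M X) \<noteq> (\<lambda>_ _. 0)}" by (rule finite_subset) (use X in \<open>simp add: mv_algebra_def\<close>)
  then show ?thesis using d_T_mv_fields[OF mv_algebra_part[OF X]] by (simp add: mv_algebra_def d_T_part)
qed

lemma d_T_comb:
  assumes X: "X \<in> mv_algebra M" and Y: "Y \<in> mv_algebra M"
  shows "d_T M (mv_comb a X b Y) = mv_comb a (d_T M X) b (d_T M Y)"
proof (intro ext)
  fix u As
  show "d_T M (mv_comb a X b Y) u As = mv_comb a (d_T M X) b (d_T M Y) u As"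
  proof (cases "u \<in> pts (tangent_bundle M) \<and> set As \<subseteq> cotangent_space (tangent_bundle M) u")
    case True
    then have As: "set As \<subseteq> cotangent_space (tangent_bundle M) u" by blast
    obtain c where c: "c \<in> atlas M" "u \<in> fst (tc c)" using True tangent_bundle_chart_mem by blast
    have "((\<lambda>t. mv_comb a X b Y (base_curve c u t) (map (\<lambda>A. covec_curve c u A t) As)) has_real_derivative a * d_T M X u As + b * d_T M Y u As) (at 0)"
      unfolding mv_comb_def by (intro DERIV_add DERIV_cmult d_T_deriv c X Y As)
    from DERIV_unique[OF d_T_deriv[OF c mv_algebra_comb[OF X Y] As] this] show ?thesis by (simp add: mv_comb_def)
  next
    case False
    then show ?thesis unfolding mv_comb_def[of a "d_T M X"] using d_T_outside[OF False] by simp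
  qed
qed

lemma d_T_wedge:
  assumes X: "X \<in> mv_algebra M" and Y: "Y \<in> mv_algebra M"
  shows "d_T M (mv_wedge X Y) = mv_comb 1 (mv_wedge (d_T M X) (vpull Y)) 1 (mv_wedge (vpull X) (d_T M Y))"
proof (intro ext)
  fix u As
  let ?W = "cotangent_space (tangent_bundle M) u"
  show "d_T M (mv_wedge X Y) u As = mv_comb 1 (mv_wedge (d_T M X) (vpull Y)) 1 (mv_wedge (vpull X) (d_T M Y)) u As"
  proof (cases "u \<in> pts (tangent_bundle M) \<and> set As \<subseteq> ?W")
    case True
    then have As: "set As \<subseteq> ?W" by blast
    have sub: "set (nths As S) \<subseteq> ?W" for S using As set_nths_subset[of As S] by blast
    obtain c where c: "c \<in> atlas M" "u \<in> fst (tc c)" using True tangent_bundle_chart_mem by blast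
    let ?f = "\<lambda>X As t. X (base_curve c u t) (map (\<lambda>A. covec_curve c u A t) As)"
    have "((\<lambda>t. \<Sum>S\<in>Pow {..<length As}. shuffle_sign (length As) S * (?f X (nths As S) t * ?f Y (nths As (- S)) t)) has_real_derivative
       (\<Sum>S\<in>Pow {..<length As}. shuffle_sign (length As) S * (d_T M X u (nths As S) * ?f Y (nths As (- S)) 0 + d_T M Y u (nths As (- S)) * ?f X (nths As S) 0))) (at 0)"
      by (intro DERIV_sum DERIV_cmult DERIV_mult d_T_deriv c X Y sub)
    moreover have "mv_wedge X Y (base_curve c u t) (map (\<lambda>A. covec_curve c u A t) As) =
       (\<Sum>S\<in>Pow {..<length As}. shuffle_sign (length As) S * (?f X (nths As S) t * ?f Y (nths As (- S)) t))" for t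
      by (simp add: mv_wedge_def wedge_def nths_map mult.assoc)
    ultimately have "((\<lambda>t. mv_wedge X Y (base_curve c u t) (map (\<lambda>A. covec_curve c u A t) As)) has_real_derivative
       (\<Sum>S\<in>Pow {..<length As}. shuffle_sign (length As) S * (d_T M X u (nths As S) * ?f Y (nths As (- S)) 0 + d_T M Y u (nths As (- S)) * ?f X (nths As S) 0))) (at 0)"
      by (simp only:)
    from DERIV_unique[OF d_T_deriv[OF c mv_algebra_wedge[OF X Y] As] this]
    \<comment> \<open>The undifferentiated factor in each term of the product rule is taken at time
      0, where it is the pullback.\<close>
    show ?thesis unfolding vpull_covec_curve[OF c sub]
      by (simp add: mv_comb_def mv_wedge_def wedge_def sum.distrib[symmetric] algebra_simps)
  next
    case False
    have z: "mv_wedge P Q u As = 0" if P: "\<And>Bs. \<not> (u \<in> pts (tangent_bundle M) \<and> set Bs \<subseteq> ?W) \<Longrightarrow> P u Bs = 0"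
      and Q: "\<And>Bs. \<not> (u \<in> pts (tangent_bundle M) \<and> set Bs \<subseteq> ?W) \<Longrightarrow> Q u Bs = 0" for P Q
    proof -
      have "P u (nths As S) * Q u (nths As (- S)) = 0" for S
      proof (rule ccontr)
        assume "P u (nths As S) * Q u (nths As (- S)) \<noteq> 0"
        then have "u \<in> pts (tangent_bundle M)" "set (nths As S) \<subseteq> ?W" "set (nths As (- S)) \<subseteq> ?W"
          using P[of "nths As S"] Q[of "nths As (- S)"] by auto
        moreover have "set As \<subseteq> set (nths As S) \<union> set (nths As (- S))"
        proof
          fix x assume "x \<in> set As"
          then obtain i where "i < length As" "x = As ! i" by (auto simp: in_set_conv_nth)
          then show "x \<in> set (nths As S) \<union> set (nths As (- S))" unfolding set_nths by blast
        qed
        ultimately show False using False by blast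
      qed
      then have "shuffle_sign (length As) S * P u (nths As S) * Q u (nths As (- S)) = 0" for S by (simp only: mult.assoc mult_zero_right)
      then show ?thesis unfolding mv_wedge_def wedge_def by (rule sum.neutral[OF ballI])
    qed
    show ?thesis unfolding mv_comb_def using d_T_outside[OF False] z[OF d_T_outside vpull_outside] z[OF vpull_outside d_T_outside] by simp
  qed
qed

lemma d_T_derivation:
  assumes H: "Hausdorff_space (mtopology M)"
  shows "derivation_along M (tangent_bundle M) (v_T M) 0 (d_T M)"
  unfolding derivation_along_def
proof (intro conjI allI ballI)
  show "graded_hom M (tangent_bundle M) (v_T M)" unfolding v_T_eq[OF H] by (rule vpull_graded_hom)
  show "mv_linear M (tangent_bundle M) (d_T M)"
    unfolding mv_linear_def using d_T_algebra d_T_comb by blast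
  show "d_T M ` mv_fields M q \<subseteq> (if int q + 0 \<ge> 0 then mv_fields (tangent_bundle M) (nat (int q + 0)) else {\<lambda>_ _. 0})" for q
    using d_T_mv_fields by auto
  fix q \<mu> \<nu> assume "\<mu> \<in> mv_fields M q" and \<nu>: "\<nu> \<in> mv_algebra M"
  then have \<mu>: "\<mu> \<in> mv_algebra M" by (intro mv_fields_algebra)
  show "d_T M (mv_wedge \<mu> \<nu>) = mv_comb 1 (mv_wedge (d_T M \<mu>) (v_T M \<nu>)) (if even (int q * 0) then 1 else - 1) (mv_wedge (v_T M \<mu>) (d_T M \<nu>))"
    unfolding v_T_eq[OF H] using d_T_wedge[OF \<mu> \<nu>] \<mu> \<nu> by simp
qed

lemma smooth_vector_field_component:
  "smooth_vector_field M Y \<Longrightarrow> c \<in> atlas M \<Longrightarrow> i \<in> idx M \<Longrightarrow> smooth_fun_on M (fst c) (\<lambda>p. Y p (\<lambda>q. snd c q i))"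
  by (simp add: smooth_vector_field_def)

text \<open>The right-hand side in the description of \<open>complete_lift\<close>, for one
  chart.\<close>

definition chart_complete_lift :: "('m, 'i) chart \<Rightarrow> ('m \<Rightarrow> 'm tvec) \<Rightarrow> 'm \<times> 'm tvec \<Rightarrow> ('m \<times> 'm tvec) tvec" where
  "chart_complete_lift c Y u = (\<lambda>f.
       (\<Sum>i\<in>idx M. Y (fst u) (\<lambda>q. snd c q i) * coord_vec (tangent_bundle M) (tangent_chart M c) u (Inl i) f) +
       (\<Sum>i\<in>idx M. (\<Sum>k\<in>idx M. coord_vec M c (fst u) k (\<lambda>p. Y p (\<lambda>q. snd c q i)) * snd u (\<lambda>q. snd c q k)) *
          coord_vec (tangent_bundle M) (tangent_chart M c) u (Inr i) f))"

lemma chart_complete_lift_sum: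
  "chart_complete_lift c Y u = (\<lambda>f. \<Sum>j\<in>idx (tangent_bundle M). case_sum (\<lambda>i. Y (fst u) (\<lambda>q. snd c q i))
     (\<lambda>i. \<Sum>k\<in>idx M. coord_vec M c (fst u) k (\<lambda>p. Y p (\<lambda>q. snd c q i)) * snd u (\<lambda>q. snd c q k)) j *
       coord_vec (tangent_bundle M) (tangent_chart M c) u j f)"
  unfolding chart_complete_lift_def sum_idx_T by simp

lemma chart_complete_lift_tangent:
  assumes c: "c \<in> atlas M" and u: "u \<in> fst (tc c)"
  shows "chart_complete_lift c Y u \<in> tangent_space (tangent_bundle M) u"
  unfolding chart_complete_lift_sum by (rule T.tangent_comb[OF tangent_chart_atlas[OF c] u])

text \<open>In the chart the pairing of \<open>Y\<close> with the curve is the sum of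
  \<open>lift_covec\<close> times the components Y^i. Its derivative is the sum over i of Y^i
  A(\<partial>/\<partial>x^i) + v(Y^i) A(\<partial>/\<partial>v^i), where v(Y^i) is expanded in
  partial derivatives.\<close>

lemma d_T_vec_field_chart:
  assumes Y: "smooth_vector_field M Y" and c: "c \<in> atlas M" and u: "u \<in> fst (tc c)" and A: "A \<in> cotangent_space (tangent_bundle M) u"
  shows "d_T M (vec_field M Y) u [A] = A (chart_complete_lift c Y u)"
proof -
  obtain p v where pv: "u = (p, v)" by (cases u)
  have p: "p \<in> fst c" "v \<in> tangent_space M p" using u pv by (simp_all add: tc_mem)
  have up: "u \<in> pts (tangent_bundle M)" using u T.chart_sub[OF tangent_chart_atlas[OF c]] by blast
  have b0: "base_curve c u 0 = p" using base_curve_0[OF c p] pv by simp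
  let ?Y = "\<lambda>i p. Y p (\<lambda>q. snd c q i)"
  let ?e = "coord_vec (tangent_bundle M) (tc c) u"
  have dY: "((\<lambda>t. ?Y i (base_curve c u t)) has_real_derivative v (?Y i)) (at 0)" if "i \<in> idx M" for i
  proof -
    have "smooth_at M p (?Y i)" using smooth_vector_field_component[OF Y c that] p(1) unfolding smooth_at_def by blast
    from base_curve_velocity[OF c p this] show ?thesis unfolding pv .
  qed
  have dl: "((\<lambda>t. lift_covec c u A t i) has_real_derivative A (?e (Inl i))) (at 0)" for i
    unfolding lift_covec_def by (auto intro!: derivative_eq_intros)
  have "((\<lambda>t. \<Sum>i\<in>idx M. lift_covec c u A t i * ?Y i (base_curve c u t)) has_real_derivative
     (\<Sum>i\<in>idx M. A (?e (Inl i)) * ?Y i (base_curve c u 0) + v (?Y i) * lift_covec c u A 0 i)) (at 0)"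
    by (intro DERIV_sum DERIV_mult dl dY)
  moreover have e: "\<forall>\<^sub>F t in nhds 0. vec_field M Y (base_curve c u t) (map (\<lambda>A. covec_curve c u A t) [A]) =
     (\<Sum>i\<in>idx M. lift_covec c u A t i * ?Y i (base_curve c u t))"
    using base_curve_eventually_chart[OF c u]
  proof eventually_elim
    case (elim t)
    have q: "base_curve c u t \<in> pts M" using elim chart_sub[OF c] by blast
    have "Y (base_curve c u t) \<in> tangent_space M (base_curve c u t)" using Y q by (simp add: smooth_vector_field_def)
    then show ?case using q covec_curve_mem[OF c elim, of A] by (simp add: vec_field_def) (simp add: covec_curve_def coord_covec_eval)
  qed
  ultimately have D: "((\<lambda>t. vec_field M Y (base_curve c u t) (map (\<lambda>A. covec_curve c u A t) [A])) has_real_derivative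
     (\<Sum>i\<in>idx M. A (?e (Inl i)) * ?Y i (base_curve c u 0) + v (?Y i) * lift_covec c u A 0 i)) (at 0)"
    unfolding DERIV_cong_ev[OF refl e refl] by simp
  have "set [A] \<subseteq> cotangent_space (tangent_bundle M) u" using A by simp
  from DERIV_unique[OF d_T_deriv[OF c u mv_fields_algebra[OF vec_field_mv_fields[OF Y]] this] D]
  have "d_T M (vec_field M Y) u [A] = (\<Sum>i\<in>idx M. A (?e (Inl i)) * ?Y i p + v (?Y i) * A (?e (Inr i)))"
    unfolding b0 by (simp add: lift_covec_def)
  also have "\<dots> = (\<Sum>i\<in>idx M. ?Y i p * A (?e (Inl i))) +
      (\<Sum>i\<in>idx M. (\<Sum>k\<in>idx M. coord_vec M c p k (?Y i) * v (\<lambda>q. snd c q k)) * A (?e (Inr i)))"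
  proof -
    have "v (?Y i) = (\<Sum>k\<in>idx M. coord_vec M c p k (?Y i) * v (\<lambda>q. snd c q k))" for i
      using fun_cong[OF tangent_expand[OF c p], of "?Y i"] by (simp add: mult.commute)
    then show ?thesis by (simp only: sum.distrib mult.commute[of _ "?Y _ p"])
  qed
  also have "\<dots> = A (chart_complete_lift c Y u)"
  proof -
    have "A (chart_complete_lift c Y u) = (\<Sum>j\<in>idx (tangent_bundle M). case_sum (\<lambda>i. Y (fst u) (\<lambda>q. snd c q i))
     (\<lambda>i. \<Sum>k\<in>idx M. coord_vec M c (fst u) k (?Y i) * snd u (\<lambda>q. snd c q k)) j * A (?e j))"
      unfolding chart_complete_lift_sum
      by (rule T.cotangent_comb_eval[OF up A T.finite_idx T.coord_vec_tangent[OF tangent_chart_atlas[OF c] u]])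
    then show ?thesis unfolding sum_idx_T by (simp add: pv)
  qed
  finally show ?thesis .
qed

text \<open>By \<open>d_T_vec_field_chart\<close> the chart formulas of any two charts pair equally
  with every covector, since \<open>d_T\<close> refers to no chart; coordinate covectors separate
  tangent vectors.\<close>

lemma complete_lift_eq:
  assumes Y: "smooth_vector_field M Y" and c: "c \<in> atlas M" and u: "u \<in> fst (tc c)"
  shows "complete_lift M Y u = chart_complete_lift c Y u"
  unfolding complete_lift_def chart_complete_lift_def[symmetric]
proof (rule the_equality)
  have cu: "c \<in> charts_at M (fst u)" using c u by (simp add: charts_at_def tc_mem)
  show "\<forall>d\<in>charts_at M (fst u). chart_complete_lift c Y u = chart_complete_lift d Y u"
  proof
    fix d assume "d \<in> charts_at M (fst u)"
    then have d: "d \<in> atlas M" "u \<in> fst (tc d)" using u by (simp_all add: charts_at_def tc_mem)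
    have up: "u \<in> pts (tangent_bundle M)" using u T.chart_sub[OF tangent_chart_atlas[OF c]] by blast
    show "chart_complete_lift c Y u = chart_complete_lift d Y u"
    proof (rule T.tangent_eqI[OF tangent_chart_atlas[OF c] u chart_complete_lift_tangent[OF c u] chart_complete_lift_tangent[OF d]])
      fix j
      have A: "coord_covec (tangent_bundle M) (tc c) u j \<in> cotangent_space (tangent_bundle M) u" by (rule T.coord_covec_cotangent[OF up])
      show "chart_complete_lift c Y u (tx c j) = chart_complete_lift d Y u (tx c j)"
        using d_T_vec_field_chart[OF Y c u A] d_T_vec_field_chart[OF Y d A]
          T.coord_covec_eval[OF chart_complete_lift_tangent[OF c u]] T.coord_covec_eval[OF chart_complete_lift_tangent[OF d]]
        by metis
    qed
  qed
  fix \<xi> assume "\<forall>d\<in>charts_at M (fst u). \<xi> = chart_complete_lift d Y u"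
  then show "\<xi> = chart_complete_lift c Y u" using cu by blast
qed

lemma d_T_vec_field:
  assumes Y: "smooth_vector_field M Y"
  shows "d_T M (vec_field M Y) = vec_field (tangent_bundle M) (complete_lift M Y)"
proof (intro ext)
  fix u As
  show "d_T M (vec_field M Y) u As = vec_field (tangent_bundle M) (complete_lift M Y) u As"
  proof (cases "u \<in> pts (tangent_bundle M) \<and> (\<exists>A. As = [A] \<and> A \<in> cotangent_space (tangent_bundle M) u)")
    case True
    then obtain A where A: "As = [A]" "A \<in> cotangent_space (tangent_bundle M) u" and u: "u \<in> pts (tangent_bundle M)" by blast
    obtain c where c: "c \<in> atlas M" "u \<in> fst (tc c)" using u by (rule tangent_bundle_chart_mem)
    show ?thesis using d_T_vec_field_chart[OF Y c A(2)] complete_lift_eq[OF Y c] A u by (simp add: vec_field_def)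
  next
    case False
    have "d_T M (vec_field M Y) u As = 0"
    proof (rule T.mv_fields_zero_arg[OF d_T_mv_fields[OF vec_field_mv_fields[OF Y]]])
      show "\<not> (u \<in> pts (tangent_bundle M) \<and> length As = 1 \<and> set As \<subseteq> cotangent_space (tangent_bundle M) u)"
        using False by (auto simp: length_Suc_conv)
    qed
    moreover have "vec_field (tangent_bundle M) (complete_lift M Y) u As = 0"
      using False by (auto simp: vec_field_def split: list.split)
    ultimately show ?thesis by simp
  qed
qed

end

theorem theorem2p3:
  fixes M :: "('m, nat) manifold" and n :: nat
  assumes "smooth_manifold M" and "idx M = {..<n}"
  shows "derivation_along M (tangent_bundle M) (v_T M) 0 (d_T M) \<and>
         (\<forall>Y. smooth_vector_field M Y \<longrightarrow>
            d_T M (vec_field M Y) = vec_field (tangent_bundle M) (complete_lift M Y))"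
proof -
  interpret charted_ord M
    using smooth_manifold_charted[OF assms(1)] by (simp add: charted_ord_def)
  have "Hausdorff_space (mtopology M)" using assms(1) by (simp add: smooth_manifold_def)
  then show ?thesis using d_T_derivation d_T_vec_field by blast
qed


end
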